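(* Let $K$ be a simplicial complex on the vertex set $[m]$ and let $(\underline{U},\underline{V})=(\underline{B\vee C},\underline{B\vee E})$ be a wedge decomposable family of pairs, i.e. $(U_i,V_i)=(B_i\vee C_i,\,B_i\vee E_i)$ for $i=1,\dots,m$, where each $E_i\hookrightarrow C_i$ is a null homotopic inclusion. Then there is a homotopy equivalence $$\widehat{Z}\big(K;(\underline{U},\underline{V})\big)\longrightarrow \bigvee_{I\subseteq [m]}\Big(\big(\bigvee_{\sigma\in K_I}|\mathrm{lk}_\sigma(K_I)|\ast\widehat{D}^{I}_{\underline{C},\underline{E}}(\sigma)\big)\wedge \widehat{Z}\big(K_{[m]-I};(\underline{B},\underline{B})_{[m]-I}\big)\Big).$$
   Context: $[m]=\{1,\dots,m\}$. A simplicial complex $K$ on $[m]$ contains the empty simplex. For a family $(\underline{X},\underline{A})=\{(X_i,A_i)\}_{i=1}^m$ of pointed CW pairs, the polyhedral smash product is $\widehat{Z}(K;(\underline{X},\underline{A}))=\bigcup_{\sigma\in K}\widehat{D}(\sigma)\subseteq X_1\wedge\cdots\wedge X_m$, $\widehat{D}(\sigma)=\bigwedge_{i=1}^m W_i$, with $W_i=X_i$ if $i\in\sigma$ and $W_i=A_i$ if $i\notin\sigma$. For $I\subseteq[m]$, $K_I=\{\sigma\in K:\sigma\subseteq I\}$ and $(\underline{X},\underline{A})_I=\{(X_i,A_i)\}_{i\in I}$; $\widehat{Z}(K_I;(\underline{X},\underline{A})_I)\subseteq\bigwedge_{i\in I}X_i$. In particular $\widehat{Z}(K_{[m]-I};(\underline{B},\underline{B})_{[m]-I})=\bigwedge_{j\in[m]-I}B_j$.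 For $\sigma\in K_I$, $\widehat{D}^{I}_{\underline{C},\underline{E}}(\sigma)=\bigwedge_{i\in I}W_i$ with $W_i=C_i$ if $i\in\sigma$ and $W_i=E_i$ if $i\in I-\sigma$. Smash products over the empty index set are $S^0$. $\mathrm{lk}_\sigma(K_I)=\{\tau\in K_I:\tau\cap\sigma=\varnothing,\ \tau\cup\sigma\in K_I\}$ is the link, $|\cdot|$ is geometric realization, $\ast$ is the join, $|\{\varnothing\}|=\varnothing$ and $\varnothing\ast Y=Y$ (equivalently $|\mathrm{lk}|\ast Y\simeq\Sigma|\mathrm{lk}|\wedge Y$ with $\Sigma\varnothing=S^0$). All $B_i,C_i,E_i$ are pointed CW complexes. *)

theory Defs
  imports "HOL-Analysis.Analysis"
begin

section \<open>Pointed spaces and homotopy equivalences\<close>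

type_synonym 'a pspace = "'a topology \<times> 'a"

abbreviation space_of :: "'a pspace \<Rightarrow> 'a topology" where "space_of \<equiv> fst"
abbreviation basept :: "'a pspace \<Rightarrow> 'a" where "basept \<equiv> snd"
abbreviation points :: "'a pspace \<Rightarrow> 'a set" where "points X \<equiv> topspace (space_of X)"

definition subpspace :: "'a pspace \<Rightarrow> 'a set \<Rightarrow> 'a pspace" where
  "subpspace X S = (subtopology (space_of X) S, basept X)"

definition pointed_map :: "'a pspace \<Rightarrow> 'b pspace \<Rightarrow> ('a \<Rightarrow> 'b) \<Rightarrow> bool" where
  "pointed_map X Y f \<longleftrightarrow>
     continuous_map (space_of X) (space_of Y) f \<and> f (basept X) = basept Y"

definition pointed_homotopic ::
    "'a pspace \<Rightarrow> 'b pspace \<Rightarrow> ('a \<Rightarrow> 'b) \<Rightarrow> ('a \<Rightarrow> 'b) \<Rightarrow> bool" where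
  "pointed_homotopic X Y =
     homotopic_with (\<lambda>h. h (basept X) = basept Y) (space_of X) (space_of Y)"

definition pointed_homotopy_equivalence ::
    "'a pspace \<Rightarrow> 'b pspace \<Rightarrow> ('a \<Rightarrow> 'b) \<Rightarrow> bool" where
  "pointed_homotopy_equivalence X Y f \<longleftrightarrow> pointed_map X Y f \<and>
     (\<exists>g. pointed_map Y X g \<and>
          pointed_homotopic X X (g \<circ> f) id \<and> pointed_homotopic Y Y (f \<circ> g) id)"

lemma pointed_homotopy_equivalence_imp_homotopy_equivalent_space:
  assumes "pointed_homotopy_equivalence X Y f"
  shows "space_of X homotopy_equivalent_space space_of Y"
proof -
  have free: "homotopic_with (\<lambda>_. True) (space_of X) (space_of Y) f g"
    if "pointed_homotopic X Y f g" for X :: "'c pspace" and Y :: "'d pspace" and f g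
    using that unfolding pointed_homotopic_def by (rule homotopic_with_mono) simp
  obtain g where "pointed_map X Y f" "pointed_map Y X g"
      "pointed_homotopic X X (g \<circ> f) id" "pointed_homotopic Y Y (f \<circ> g) id"
    using assms unfolding pointed_homotopy_equivalence_def by blast
  then have "continuous_map (space_of X) (space_of Y) f \<and>
      continuous_map (space_of Y) (space_of X) g \<and>
      homotopic_with (\<lambda>_. True) (space_of X) (space_of X) (g \<circ> f) id \<and>
      homotopic_with (\<lambda>_. True) (space_of Y) (space_of Y) (f \<circ> g) id"
    by (simp add: pointed_map_def free)
  then show ?thesis
    unfolding homotopy_equivalent_space_def by (intro exI)
qed


section \<open>CW complexes\<close>

text \<open>\<^const>\<open>Euclidean_space\<close> consists of the real sequences vanishing from index \<open>n\<close> on, so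
  for \<open>n = 0\<close> the disc is a single point with empty boundary sphere.\<close>

definition disc_set :: "nat \<Rightarrow> (nat \<Rightarrow> real) set" where
  "disc_set n = {x \<in> topspace (Euclidean_space n). (\<Sum>i<n. (x i)\<^sup>2) \<le> 1}"

definition open_disc_set :: "nat \<Rightarrow> (nat \<Rightarrow> real) set" where
  "open_disc_set n = {x \<in> topspace (Euclidean_space n). (\<Sum>i<n. (x i)\<^sup>2) < 1}"

definition disc :: "nat \<Rightarrow> (nat \<Rightarrow> real) topology" where
  "disc n = subtopology (Euclidean_space n) (disc_set n)"

definition open_disc :: "nat \<Rightarrow> (nat \<Rightarrow> real) topology" where
  "open_disc n = subtopology (Euclidean_space n) (open_disc_set n)"

text \<open>A cell is given by its dimension and a characteristic map.\<close>

type_synonym 'a cell = "nat \<times> ((nat \<Rightarrow> real) \<Rightarrow> 'a)"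

definition open_cell :: "'a cell \<Rightarrow> 'a set" where
  "open_cell c = snd c ` open_disc_set (fst c)"

definition closed_cell :: "'a cell \<Rightarrow> 'a set" where
  "closed_cell c = snd c ` disc_set (fst c)"

definition cell_frontier :: "'a cell \<Rightarrow> 'a set" where
  "cell_frontier c = snd c ` (disc_set (fst c) - open_disc_set (fst c))"

definition cw_structure :: "'a topology \<Rightarrow> 'a cell set \<Rightarrow> bool" where
  "cw_structure X \<Phi> \<longleftrightarrow>
     Hausdorff_space X \<and>
     (\<forall>c\<in>\<Phi>. continuous_map (disc (fst c)) X (snd c) \<and>
             embedding_map (open_disc (fst c)) X (snd c)) \<and>
     disjoint_family_on open_cell \<Phi> \<and>
     (\<Union>c\<in>\<Phi>. open_cell c) = topspace X \<and>
     (\<forall>c\<in>\<Phi>. \<exists>\<F>\<subseteq>\<Phi>. finite \<F> \<and> (\<forall>d\<in>\<F>. fst d < fst c) \<and>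
             cell_frontier c \<subseteq> (\<Union>d\<in>\<F>. open_cell d)) \<and>
     (\<forall>S\<subseteq>topspace X. (\<forall>c\<in>\<Phi>. closedin X (S \<inter> closed_cell c)) \<longrightarrow> closedin X S)"

definition cw_subcomplex :: "'a cell set \<Rightarrow> 'a set \<Rightarrow> bool" where
  "cw_subcomplex \<Phi> A \<longleftrightarrow>
     (\<exists>\<Psi>\<subseteq>\<Phi>. A = (\<Union>c\<in>\<Psi>. open_cell c) \<and> (\<forall>c\<in>\<Psi>. closed_cell c \<subseteq> A))"

text \<open>As usual, the base point of a CW complex is a vertex (0-cell).\<close>

definition pointed_cw_pair :: "'a pspace \<Rightarrow> 'a set \<Rightarrow> bool" where
  "pointed_cw_pair X A \<longleftrightarrow>
     (\<exists>\<Phi>. cw_structure (space_of X) \<Phi> \<and> cw_subcomplex \<Phi> A \<and>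
          basept X \<in> A \<and> (\<exists>c\<in>\<Phi>. fst c = 0 \<and> open_cell c = {basept X}))"

definition pointed_cw_complex :: "'a pspace \<Rightarrow> bool" where
  "pointed_cw_complex X \<longleftrightarrow> pointed_cw_pair X (points X)"

text \<open>Null homotopic in the free sense: the constant is not required to be the base point and
  the homotopy is not required to be pointed.\<close>

definition null_homotopic_inclusion :: "'a pspace \<Rightarrow> 'a set \<Rightarrow> bool" where
  "null_homotopic_inclusion X A \<longleftrightarrow>
     (\<exists>c. homotopic_with (\<lambda>_. True) (subtopology (space_of X) A) (space_of X) id (\<lambda>_. c))"


section \<open>Quotients by a subspace, wedges and smash products\<close>

text \<open>The pointed quotient \<open>X / S\<close>: all points of \<open>S\<close> are identified to the base point
  \<^term>\<open>None\<close>. For \<open>S = {}\<close> this is \<open>X\<close> with a disjoint base point added.\<close>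

definition collapse_map :: "'a set \<Rightarrow> 'a \<Rightarrow> 'a option" where
  "collapse_map S x = (if x \<in> S then None else Some x)"

definition collapse :: "'a topology \<Rightarrow> 'a set \<Rightarrow> 'a option pspace" where
  "collapse X S =
     (topology (\<lambda>U. U \<subseteq> insert None (Some ` (topspace X - S)) \<and>
                    openin X {x \<in> topspace X. collapse_map S x \<in> U}),
      None)"

lemma istopology_collapse:
  "istopology (\<lambda>U. U \<subseteq> insert None (Some ` (topspace X - S)) \<and>
                   openin X {x \<in> topspace X. collapse_map S x \<in> U})"
proof -
  have 1: "{x \<in> topspace X. collapse_map S x \<in> U \<inter> V} =
           {x \<in> topspace X. collapse_map S x \<in> U} \<inter> {x \<in> topspace X. collapse_map S x \<in> V}" for U V
    by auto
  have 2: "{x \<in> topspace X. collapse_map S x \<in> \<Union>\<K>} =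
           (\<Union>K\<in>\<K>. {x \<in> topspace X. collapse_map S x \<in> K})" for \<K>
    by auto
  show ?thesis
    unfolding istopology_def 1 2 by blast
qed

lemma openin_collapse:
  "openin (space_of (collapse X S)) U \<longleftrightarrow>
     U \<subseteq> insert None (Some ` (topspace X - S)) \<and>
     openin X {x \<in> topspace X. collapse_map S x \<in> U}"
  by (simp add: collapse_def topology_inverse'[OF istopology_collapse])

lemma points_collapse: "points (collapse X S) = insert None (Some ` (topspace X - S))"
proof -
  have "{x \<in> topspace X. collapse_map S x \<in> insert None (Some ` (topspace X - S))} = topspace X"
    by (auto simp: collapse_map_def)
  then have "openin (space_of (collapse X S)) (insert None (Some ` (topspace X - S)))"
    by (simp add: openin_collapse)
  then show ?thesis
    by (metis openin_collapse openin_subset openin_topspace subset_antisym)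
qed

lemma quotient_map_collapse:
  assumes "S \<inter> topspace X \<noteq> {}"
  shows "quotient_map X (space_of (collapse X S)) (collapse_map S)"
proof -
  have "collapse_map S ` topspace X = insert None (Some ` (topspace X - S))"
    using assms by (auto simp: collapse_map_def image_iff)
  then show ?thesis
    by (auto simp: quotient_map_def points_collapse openin_collapse)
qed

definition wedge :: "'i set \<Rightarrow> ('i \<Rightarrow> 'a pspace) \<Rightarrow> ('i \<times> 'a) option pspace" where
  "wedge J X = collapse (sum_topology (\<lambda>j. space_of (X j)) J) ((\<lambda>j. (j, basept (X j))) ` J)"

definition wedge2 :: "'a pspace \<Rightarrow> 'a pspace \<Rightarrow> (bool \<times> 'a) option pspace" where
  "wedge2 X Y = wedge UNIV (\<lambda>b. if b then Y else X)"

text \<open>Smash products are quotients of the product in compactly generated spaces, so that those of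
  CW complexes are again CW complexes. For \<open>I = {}\<close> the product is a point and the fat wedge is
  empty, so the smash product is \<open>S\<^sup>0\<close>.\<close>

definition smash :: "'i set \<Rightarrow> ('i \<Rightarrow> 'a pspace) \<Rightarrow> ('i \<Rightarrow> 'a) option pspace" where
  "smash I X = collapse (kification (product_topology (\<lambda>i. space_of (X i)) I))
                        {x. \<exists>i\<in>I. x i = basept (X i)}"

definition smash2 :: "'a pspace \<Rightarrow> 'b pspace \<Rightarrow> ('a \<times> 'b) option pspace" where
  "smash2 X Y = collapse (kification (prod_topology (space_of X) (space_of Y)))
                         {(x, y). x = basept X \<or> y = basept Y}"

lemma points_smash_empty: "points (smash {} X) = {None, Some (\<lambda>_. undefined)}"
  by (simp add: smash_def points_collapse)


section \<open>Simplicial complexes\<close>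

definition simplicial_complex_on :: "'v set \<Rightarrow> 'v set set \<Rightarrow> bool" where
  "simplicial_complex_on V K \<longleftrightarrow>
     {} \<in> K \<and> (\<forall>\<sigma>\<in>K. \<sigma> \<subseteq> V) \<and> (\<forall>\<sigma>\<in>K. \<forall>\<tau>. \<tau> \<subseteq> \<sigma> \<longrightarrow> \<tau> \<in> K)"

definition full_subcomplex :: "'v set set \<Rightarrow> 'v set \<Rightarrow> 'v set set" where
  "full_subcomplex K I = {\<sigma> \<in> K. \<sigma> \<subseteq> I}"

definition link :: "'v set \<Rightarrow> 'v set set \<Rightarrow> 'v set set" where
  "link \<sigma> K = {\<tau> \<in> K. \<tau> \<inter> \<sigma> = {} \<and> \<tau> \<union> \<sigma> \<in> K}"

text \<open>Barycentric coordinates. The product topology is the right one for finite complexes; the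
  realization of \<open>{{}}\<close> is empty.\<close>

definition geometric_realization :: "'v set set \<Rightarrow> ('v \<Rightarrow> real) topology" where
  "geometric_realization L =
     subtopology (powertop_real UNIV)
       {x. (\<forall>v. 0 \<le> x v) \<and> {v. x v \<noteq> 0} \<in> L \<and> (\<Sum>v | x v \<noteq> 0. x v) = 1}"

lemma geometric_realization_empty_simplex:
  "topspace (geometric_realization {{}}) = {}"
  by (auto simp: geometric_realization_def)


section \<open>Joins\<close>

text \<open>The join is the quotient of the disjoint union of \<open>X\<close>, \<open>X \<times> Y \<times> [0,1]\<close> and \<open>Y\<close> that
  identifies \<open>(x, y, 0)\<close> with \<open>x\<close> and \<open>(x, y, 1)\<close> with \<open>y\<close>; in particular the join of the empty
  space with \<open>Y\<close> is \<open>Y\<close>. The base point is that of \<open>Y\<close>. No k-ification is needed when \<open>X\<close> is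
  compact Hausdorff, which is the case for the realization of a finite complex.\<close>

datatype ('a, 'b) join_point = Left_End 'a | Right_End 'b | Between 'a 'b real

definition join_map :: "'a \<times> 'b \<times> real \<Rightarrow> ('a, 'b) join_point" where
  "join_map = (\<lambda>(x, y, t). if t = 0 then Left_End x else if t = 1 then Right_End y
                          else Between x y t)"

definition join_cylinder :: "'a topology \<Rightarrow> 'b topology \<Rightarrow> ('a \<times> 'b \<times> real) topology" where
  "join_cylinder X Y = prod_topology X (prod_topology Y (top_of_set {0..1}))"

definition join_points :: "'a topology \<Rightarrow> 'b topology \<Rightarrow> ('a, 'b) join_point set" where
  "join_points X Y = Left_End ` topspace X \<union> Right_End ` topspace Y \<union>
                     join_map ` topspace (join_cylinder X Y)"

definition join_topology :: "'a topology \<Rightarrow> 'b topology \<Rightarrow> ('a, 'b) join_point topology" where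
  "join_topology X Y =
     topology (\<lambda>U. U \<subseteq> join_points X Y \<and>
                   openin X {x \<in> topspace X. Left_End x \<in> U} \<and>
                   openin Y {y \<in> topspace Y. Right_End y \<in> U} \<and>
                   openin (join_cylinder X Y) {z \<in> topspace (join_cylinder X Y). join_map z \<in> U})"

definition join :: "'a topology \<Rightarrow> 'b pspace \<Rightarrow> ('a, 'b) join_point pspace" where
  "join X Y = (join_topology X (space_of Y), Right_End (basept Y))"

lemma istopology_join:
  "istopology (\<lambda>U. U \<subseteq> join_points X Y \<and>
                   openin X {x \<in> topspace X. Left_End x \<in> U} \<and>
                   openin Y {y \<in> topspace Y. Right_End y \<in> U} \<and>
                   openin (join_cylinder X Y) {z \<in> topspace (join_cylinder X Y). join_map z \<in> U})"
proof -
  have 1: "{x \<in> T. f x \<in> U \<inter> V} = {x \<in> T. f x \<in> U} \<inter> {x \<in> T. f x \<in> V}"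
    for T :: "'c set" and f :: "'c \<Rightarrow> 'd" and U V
    by auto
  have 2: "{x \<in> T. f x \<in> \<Union>\<K>} = (\<Union>K\<in>\<K>. {x \<in> T. f x \<in> K})"
    for T :: "'c set" and f :: "'c \<Rightarrow> 'd" and \<K>
    by auto
  show ?thesis
    unfolding istopology_def 1 2 by blast
qed

lemma openin_join_topology:
  "openin (join_topology X Y) U \<longleftrightarrow>
     U \<subseteq> join_points X Y \<and>
     openin X {x \<in> topspace X. Left_End x \<in> U} \<and>
     openin Y {y \<in> topspace Y. Right_End y \<in> U} \<and>
     openin (join_cylinder X Y) {z \<in> topspace (join_cylinder X Y). join_map z \<in> U}"
  by (simp add: join_topology_def topology_inverse'[OF istopology_join])


section \<open>Polyhedral smash products\<close>

text \<open>A family of pairs is given by \<open>X\<close> and \<open>A\<close> with \<open>A i \<subseteq> points (X i)\<close>. By the encoding of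
  smash products, the points of each \<^term>\<open>Dhat I X A \<sigma>\<close> are points of \<^term>\<open>smash I X\<close>.\<close>

definition Dhat ::
    "'i set \<Rightarrow> ('i \<Rightarrow> 'a pspace) \<Rightarrow> ('i \<Rightarrow> 'a set) \<Rightarrow> 'i set \<Rightarrow> ('i \<Rightarrow> 'a) option pspace" where
  "Dhat I X A \<sigma> = smash I (\<lambda>i. if i \<in> \<sigma> then X i else subpspace (X i) (A i))"

definition Zhat ::
    "'i set \<Rightarrow> 'i set set \<Rightarrow> ('i \<Rightarrow> 'a pspace) \<Rightarrow> ('i \<Rightarrow> 'a set) \<Rightarrow> ('i \<Rightarrow> 'a) option pspace" where
  "Zhat I K X A = subpspace (smash I X) (\<Union>\<sigma>\<in>K. points (Dhat I X A \<sigma>))"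

lemma points_Dhat_subset: "points (Dhat I X A \<sigma>) \<subseteq> points (smash I X)"
  by (force simp: Dhat_def smash_def subpspace_def points_collapse PiE_iff split: if_splits)

end

theory Submission
  imports Defs
begin

text \<open>
Call two pairs equivalent if there are pointed homotopy inverse maps of pairs whose homotopies are
maps of pairs as well. The polyhedral smash product only depends on the equivalence classes of its
pairs, because coordinatewise maps and homotopies respect every \<open>\<sigma>\<close>-block \<open>D(\<sigma>)\<close>
(\<open>Zhat_homotopy_equivalence\<close>). Each pair may therefore be replaced by a convenient one.

Since \<open>E\<close> contracts in \<open>C\<close>, attaching a cone to \<open>E\<close> amounts to wedging one on:
the pair \<open>(B \<or> C, B \<or> E)\<close> is equivalent to \<open>(B \<or> C \<or> cone E, B \<or> E)\<close>, where the second \<open>E\<close> is the base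
of the cone (\<open>pair_homotopy_equivalent_cone_wedge\<close>). In this model \<open>C\<close> meets the subspace only in the
base point. The homotopy extension property needed here comes from an explicit retraction of
\<open>C \<times> [0,1]\<close> onto \<open>C \<times> 0 \<union> E \<times> [0,1]\<close> that pushes points down cell by cell.

A point of the polyhedral smash product of the models, other than the base point, is a tuple whose
entries lie in \<open>B_i\<close>, in \<open>C_i\<close> or in the open cone on \<open>E_i\<close>. Let \<open>I\<close> be the set of indices
without an entry in \<open>B_i\<close>, and \<open>\<sigma> \<subseteq> I\<close> the set of those with an entry in \<open>C_i\<close>. What remains are
an element of the smash product of the \<open>B_j\<close> with \<open>j \<notin> I\<close>,
an element of \<open>D(\<sigma>)\<close> with factors \<open>C_i\<close>, \<open>E_i\<close>, and the
heights in the cones, a vector in the cube over \<open>I - \<sigma>\<close>. The tuple lies in the polyhedral product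
exactly if the indices with positive height together with \<open>\<sigma>\<close> form a simplex of \<open>K\<close>, that is, if the
height vector belongs to the cubical cone on the link of \<open>\<sigma>\<close> in \<open>K_I\<close>. In polar coordinates this cone
is the ordinary cone on \<open>|lk|\<close>, with the apex at height \<open>0\<close>; a height equal to \<open>1\<close> means the base
point. So the summand of \<open>I\<close> and \<open>\<sigma>\<close> is the cone on \<open>|lk|\<close> times \<open>D(\<sigma>)\<close> with its end \<open>|lk| \<times> D(\<sigma>)\<close>
and the cone over the base point collapsed, which is the quotient of \<open>|lk| * D(\<sigma>)\<close> by its
subspace \<open>|lk| * basept\<close>, smashed with that of the \<open>B_j\<close>.

This gives a map \<open>to_model\<close> from the wedge of smash products of joins to the polyhedral smash product
of the models, which is injective away from the base point and collapses the cones \<open>|lk| * basept\<close>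
(\<open>to_model_inj\<close>). It is a quotient map (\<open>quotient_map_to_model\<close>): on each of the finitely many closed
sets of tuples of prescribed type the inverse is continuous, as it only reads off coordinates. Finally,
the collapsed cones can be contracted by a homotopy of the whole wedge of joins (\<open>shrink\<close>), since the
base point of \<open>D(\<sigma>)\<close> has a neighbourhood that contracts to it. Collapsing a subspace that
is contracted by a homotopy of the ambient space is a homotopy equivalence
(\<open>collapse_fibre_homotopy_equivalence\<close>).

All smash products are formed with compactly generated products. For these, products of quotient maps
are quotient maps under mild hypotheses, which yields the continuity of maps defined piecewise on
products with wedges, joins and smash products.
\<close>

section \<open>Compactly generated products and quotient maps\<close>

text \<open>The tube lemma, which gives openness on each compact subset of \<open>A\<close>; as \<open>A\<close> is a k-space this
  is enough.\<close>

lemma compact_slices_openin: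
  assumes V: "openin (kification (prod_topology A Z)) V" and A: "k_space A" and N: "compactin Z N"
  shows "openin A {a \<in> topspace A. \<forall>z\<in>N. (a, z) \<in> V}"
proof -
  let ?S = "{a \<in> topspace A. \<forall>z\<in>N. (a, z) \<in> V}"
  have "openin (subtopology A Q) (Q \<inter> ?S)" if Q: "compactin A Q" for Q
  proof -
    have QN: "compactin (prod_topology A Z) (Q \<times> N)"
      using Q N compactin_Times by blast
    then have op: "openin (subtopology (prod_topology A Z) (Q \<times> N)) ((Q \<times> N) \<inter> V)"
      using V by (simp add: openin_kification)
    have Qs: "Q \<subseteq> topspace A"
      using Q compactin_subset_topspace by auto
    let ?C = "topspace (subtopology A Q)"
    have op': "openin (prod_topology (subtopology A Q) (subtopology Z N)) ((Q \<times> N) \<inter> V)"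
      using op by (simp only: subtopology_Times)
    have cN: "compact_space (subtopology Z N)"
      using N by (simp add: compact_space_subtopology)
    have "\<exists>U. openin (subtopology A Q) U \<and> a \<in> U \<and> U \<subseteq> Q \<inter> ?S" if "a \<in> Q \<inter> ?S" for a
    proof -
      have comp: "compactin (subtopology Z N) N" "compactin (subtopology A Q) {a}"
        using N that Qs by (auto simp: compactin_subtopology)
      have sub: "{a} \<times> N \<subseteq> (Q \<times> N) \<inter> V"
        using that by auto
      obtain U W where "openin (subtopology A Q) U" "openin (subtopology Z N) W"
          "{a} \<subseteq> U" "N \<subseteq> W" "U \<times> W \<subseteq> (Q \<times> N) \<inter> V"
        using Wallace_theorem_prod_topology[OF comp(2,1) op' sub] by blast
      moreover have "U \<subseteq> Q \<inter> ?S"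
      proof
        fix u assume "u \<in> U"
        show "u \<in> Q \<inter> ?S"
        proof (cases "N = {}")
          case True
          then show ?thesis
            using \<open>u \<in> U\<close> \<open>openin (subtopology A Q) U\<close> openin_subset by fastforce
        next
          case False
          then obtain z where "z \<in> N" by blast
          then show ?thesis
            using \<open>u \<in> U\<close> \<open>U \<times> W \<subseteq> _\<close> \<open>N \<subseteq> W\<close> Qs by blast
        qed
      qed
      ultimately show ?thesis by blast
    qed
    then show ?thesis
      using openin_subopen by (metis (no_types, lifting))
  qed
  then show ?thesis
    using A unfolding k_space_alt by (metis (no_types, lifting) mem_Collect_eq subsetI)
qed

text \<open>Openness in a compactly generated product can be tested one factor at a time. A compact set \<open>Q\<close> projects to
  a compact Hausdorff, hence locally compact, subset \<open>M\<close> of \<open>Z\<close>, so a point of \<open>U\<close> has a compact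
  neighbourhood in its slice over \<open>M\<close>, and the last hypothesis spreads it in the direction of \<open>J\<close>.
  The topology of \<open>J\<close> enters only through the sets of \<open>j\<close> whose slice contains a given compact set, and
  openness of these can be tested after pulling back along any maps that determine the topology of \<open>J\<close>;
  this is how products with quotients, joins, wedges and CW complexes are handled below.\<close>

lemma openin_kification_prod_if_compact_slices:
  assumes Z: "Hausdorff_space Z" and U: "U \<subseteq> topspace J \<times> topspace Z"
    and slice: "\<And>j. j \<in> topspace J \<Longrightarrow> openin (kification Z) {z \<in> topspace Z. (j, z) \<in> U}"
    and slices: "\<And>N. compactin Z N \<Longrightarrow> openin J {j \<in> topspace J. \<forall>z\<in>N. (j, z) \<in> U}"
  shows "openin (kification (prod_topology J Z)) U"
  unfolding openin_kification
proof (intro conjI allI impI)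
  show "U \<subseteq> topspace (prod_topology J Z)"
    using U by auto
  fix Q assume Q: "compactin (prod_topology J Z) Q"
  define M where "M = snd ` Q"
  have M: "compactin Z M"
    unfolding M_def using Q continuous_map_snd image_compactin by blast
  have MZ: "compact_space (subtopology Z M)" "Hausdorff_space (subtopology Z M)"
    using M Z by (auto simp: compact_space_subtopology Hausdorff_space_subtopology)
  have Msub: "M \<subseteq> topspace Z"
    using M compactin_subset_topspace by blast
  show "openin (subtopology (prod_topology J Z) Q) (Q \<inter> U)"
  proof (subst openin_subopen, intro ballI)
    fix x assume x: "x \<in> Q \<inter> U"
    obtain j z where jz: "x = (j, z)" by (cases x)
    have j: "j \<in> topspace J" and z: "z \<in> M"
      using x U jz by (auto simp: M_def image_iff intro: rev_bexI)
    have op: "openin (subtopology Z M) (M \<inter> {z \<in> topspace Z. (j, z) \<in> U})"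
      using slice[OF j] M by (simp add: openin_kification)
    have "neighbourhood_base_of (compactin (subtopology Z M)) (subtopology Z M)"
      using MZ compact_imp_locally_compact_space locally_compact_space_neighbourhood_base by blast
    then obtain W N where W: "openin (subtopology Z M) W" and N: "compactin (subtopology Z M) N"
        and WN: "z \<in> W" "W \<subseteq> N" "N \<subseteq> M \<inter> {z \<in> topspace Z. (j, z) \<in> U}"
    proof -
      have "z \<in> M \<inter> {z \<in> topspace Z. (j, z) \<in> U}"
        using x jz z Msub by auto
      then show ?thesis
        using \<open>neighbourhood_base_of _ _\<close> op that unfolding neighbourhood_base_of by meson
    qed
    obtain W' where W': "openin Z W'" "W = W' \<inter> M"
      using W by (auto simp: openin_subtopology)
    have NZ: "compactin Z N"
      using N by (simp add: compactin_subtopology)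
    let ?G = "{j \<in> topspace J. \<forall>z\<in>N. (j, z) \<in> U}"
    have "openin (prod_topology J Z) (?G \<times> W')"
      using slices[OF NZ] W' by (simp add: openin_prod_Times_iff)
    then have "openin (subtopology (prod_topology J Z) Q) (Q \<inter> ?G \<times> W')"
      by (rule openin_subtopology_Int2)
    moreover have "x \<in> Q \<inter> ?G \<times> W'"
      using x jz j WN W' by auto
    moreover have "Q \<inter> ?G \<times> W' \<subseteq> Q \<inter> U"
    proof
      fix y assume y: "y \<in> Q \<inter> ?G \<times> W'"
      obtain j' z' where y': "y = (j', z')" by (cases y)
      have "z' \<in> M" using y y' by (auto simp: M_def image_iff intro: rev_bexI)
      then have "z' \<in> N" using y y' WN W' by auto
      then show "y \<in> Q \<inter> U" using y y' by auto
    qed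
    ultimately show "\<exists>T. openin (subtopology (prod_topology J Z) Q) T \<and> x \<in> T \<and> T \<subseteq> Q \<inter> U"
      by blast
  qed
qed

lemma continuous_map_kification_functor:
  assumes "continuous_map X Y f"
  shows "continuous_map (kification X) (kification Y) f"
  using assms by (simp add: continuous_map_into_kification continuous_map_from_kification)

lemma openin_slice:
  assumes "openin (kification (prod_topology A Z)) V" "a \<in> topspace A"
  shows "openin (kification Z) {z \<in> topspace Z. (a, z) \<in> V}"
proof -
  have "continuous_map Z (prod_topology A Z) (\<lambda>z. (a, z))"
    using assms(2) by (simp add: continuous_map_pairwise o_def)
  then show ?thesis
    using assms(1) openin_continuous_map_preimage[OF continuous_map_kification_functor] by fastforce
qed

text \<open>Preimages of \<open>{w. w \<times> N \<subseteq> U}\<close> under \<open>q\<close> have the same form, so the criterion above descends from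
  \<open>A\<close> to \<open>W\<close>; local compactness of \<open>Z\<close> is replaced by the k-topology.\<close>

lemma quotient_map_kification_prod:
  assumes q: "quotient_map A W q" and A: "k_space A" and Z: "Hausdorff_space Z"
  shows "quotient_map (kification (prod_topology A Z)) (kification (prod_topology W Z))
           (\<lambda>(a, z). (q a, z))"
  unfolding quotient_map_def
proof (intro conjI allI impI)
  have qs: "q ` topspace A = topspace W"
    using q by (simp add: quotient_map_def)
  show "(\<lambda>(a, z). (q a, z)) ` topspace (kification (prod_topology A Z))
          = topspace (kification (prod_topology W Z))"
    using qs by (force simp: image_iff)
  fix U assume U: "U \<subseteq> topspace (kification (prod_topology W Z))"
  let ?P = "{x \<in> topspace (kification (prod_topology A Z)). (case x of (a, z) \<Rightarrow> (q a, z)) \<in> U}"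
  have cont: "continuous_map (prod_topology A Z) (prod_topology W Z) (\<lambda>(a, z). (q a, z))"
    using continuous_map_compose[OF continuous_map_fst quotient_imp_continuous_map[OF q], of Z]
    by (simp add: case_prod_unfold continuous_map_pairwise o_def continuous_map_snd)
  show "openin (kification (prod_topology A Z)) ?P = openin (kification (prod_topology W Z)) U"
  proof
    assume "openin (kification (prod_topology W Z)) U"
    then show "openin (kification (prod_topology A Z)) ?P"
      using openin_continuous_map_preimage[OF continuous_map_kification_functor[OF cont]] by blast
  next
    assume P: "openin (kification (prod_topology A Z)) ?P"
    show "openin (kification (prod_topology W Z)) U"
    proof (rule openin_kification_prod_if_compact_slices[OF Z])
      show "U \<subseteq> topspace W \<times> topspace Z" using U by simp
    next
      fix w assume "w \<in> topspace W"
      then obtain a where a: "a \<in> topspace A" "w = q a" using qs by auto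
      have "{z \<in> topspace Z. (w, z) \<in> U} = {z \<in> topspace Z. (a, z) \<in> ?P}"
        using a by auto
      then show "openin (kification Z) {z \<in> topspace Z. (w, z) \<in> U}"
        using openin_slice[OF P a(1)] by simp
    next
      fix N assume N: "compactin Z N"
      have "N \<subseteq> topspace Z" using N compactin_subset_topspace by blast
      then have "{a \<in> topspace A. q a \<in> {w \<in> topspace W. \<forall>z\<in>N. (w, z) \<in> U}}
            = {a \<in> topspace A. \<forall>z\<in>N. (a, z) \<in> ?P}"
        using qs by auto
      then have "openin A {a \<in> topspace A. q a \<in> {w \<in> topspace W. \<forall>z\<in>N. (w, z) \<in> U}}"
        using compact_slices_openin[OF P A N] by simp
      moreover have "{w \<in> topspace W. \<forall>z\<in>N. (w, z) \<in> U} \<subseteq> topspace W" by blast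
      ultimately show "openin W {w \<in> topspace W. \<forall>z\<in>N. (w, z) \<in> U}"
        using q unfolding quotient_map_def by blast
    qed
  qed
qed

lemma continuous_map_comp:
  assumes "continuous_map X Y f" "continuous_map Y Z g"
  shows "continuous_map X Z (\<lambda>x. g (f x))"
  using continuous_map_compose[OF assms] by (simp add: o_def)

lemma continuous_map_fst_comp:
  "continuous_map Z (prod_topology X Y) f \<Longrightarrow> continuous_map Z X (\<lambda>x. fst (f x))"
  by (rule continuous_map_comp[OF _ continuous_map_fst])

lemma continuous_map_snd_comp:
  "continuous_map Z (prod_topology X Y) f \<Longrightarrow> continuous_map Z Y (\<lambda>x. snd (f x))"
  by (rule continuous_map_comp[OF _ continuous_map_snd])

lemma k_space_openinI:
  assumes "k_space X" "S \<subseteq> topspace X"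
    and "\<And>K. compactin X K \<Longrightarrow> openin (subtopology X K) (K \<inter> S)"
  shows "openin X S"
  using assms unfolding k_space_open by simp

section \<open>Collapsing a subspace\<close>

lemma openin_collapseI:
  assumes "U \<subseteq> points (collapse X S)" "openin X {x \<in> topspace X. collapse_map S x \<in> U}"
  shows "openin (space_of (collapse X S)) U"
  using assms by (simp add: openin_collapse points_collapse)

lemma closedin_collapse:
  "closedin (space_of (collapse X S)) T \<longleftrightarrow>
     T \<subseteq> points (collapse X S) \<and> closedin X {x \<in> topspace X. collapse_map S x \<in> T}"
proof -
  have "{x \<in> topspace X. collapse_map S x \<in> points (collapse X S) - T}
      = topspace X - {x \<in> topspace X. collapse_map S x \<in> T}"
    by (auto simp: points_collapse collapse_map_def)
  then show ?thesis
    by (auto simp: closedin_def openin_collapse points_collapse)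
qed

lemma collapse_map_in_points: "x \<in> topspace X \<Longrightarrow> collapse_map S x \<in> points (collapse X S)"
  by (auto simp: collapse_map_def points_collapse)

lemma continuous_map_collapse_map: "continuous_map X (space_of (collapse X S)) (collapse_map S)"
  by (simp add: continuous_map collapse_map_in_points image_subset_iff openin_collapse)

lemma continuous_map_from_collapse:
  assumes "continuous_map X Z (\<lambda>x. f (collapse_map S x))" and "f None \<in> topspace Z"
  shows "continuous_map (space_of (collapse X S)) Z f"
  unfolding continuous_map
proof (intro conjI allI impI)
  show "f ` points (collapse X S) \<subseteq> topspace Z"
    using assms continuous_map_image_subset_topspace[OF assms(1)]
    by (force simp: points_collapse collapse_map_def image_subset_iff split: if_splits)
  fix U assume "openin Z U"
  then have "openin X {x \<in> topspace X. f (collapse_map S x) \<in> U}"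
    using assms(1) openin_continuous_map_preimage by blast
  moreover have "{x \<in> topspace X. collapse_map S x \<in> {z \<in> points (collapse X S). f z \<in> U}}
      = {x \<in> topspace X. f (collapse_map S x) \<in> U}"
    by (auto simp: collapse_map_in_points)
  ultimately show "openin (space_of (collapse X S)) {z \<in> points (collapse X S). f z \<in> U}"
    by (intro openin_collapseI) auto
qed

definition collapse_lift :: "'b set \<Rightarrow> ('a \<Rightarrow> 'b) \<Rightarrow> 'a option \<Rightarrow> 'b option" where
  "collapse_lift T f z = (case z of None \<Rightarrow> None | Some x \<Rightarrow> collapse_map T (f x))"

lemma collapse_lift_simps [simp]:
  "collapse_lift T f None = None" "collapse_lift T f (Some x) = collapse_map T (f x)"
  by (simp_all add: collapse_lift_def)

lemma None_in_collapse [simp]: "None \<in> points (collapse X S)"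
  by (simp add: points_collapse)

lemma basept_collapse [simp]: "basept (collapse X S) = None"
  by (simp add: collapse_def)

text \<open>Every quotient \<open>X / S\<close> is a quotient of \<open>X\<close> with a disjoint base point. The latter has points of
  the same type, and its topology is that of a sum.\<close>

lemma quotient_map_collapse_from_disjoint_base:
  "quotient_map (space_of (collapse X {})) (space_of (collapse X S)) (collapse_lift S id)"
  unfolding quotient_map_def
proof (intro conjI allI impI)
  show "collapse_lift S id ` points (collapse X {}) = points (collapse X S)"
  proof (intro equalityI subsetI)
    fix z assume "z \<in> points (collapse X S)"
    then have "z = collapse_lift S id z" "z \<in> points (collapse X {})"
      by (auto simp: points_collapse collapse_map_def)
    then show "z \<in> collapse_lift S id ` points (collapse X {})" by blast
  qed (auto simp: points_collapse collapse_map_def split: if_splits)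
  fix U assume U: "U \<subseteq> points (collapse X S)"
  have "{x \<in> topspace X. collapse_map {} x \<in> {z \<in> points (collapse X {}). collapse_lift S id z \<in> U}}
      = {x \<in> topspace X. collapse_map S x \<in> U}"
    by (auto simp: points_collapse collapse_map_def)
  then show "openin (space_of (collapse X {})) {z \<in> points (collapse X {}). collapse_lift S id z \<in> U}
      = openin (space_of (collapse X S)) U"
    using U by (auto simp: openin_collapse points_collapse)
qed

text \<open>Multiplying with a locally compact space preserves quotient maps, so it suffices to treat
  \<open>X\<close> with a disjoint base point, which is covered by two open sets.\<close>

lemma continuous_map_from_prod_collapse:
  assumes I: "locally_compact_space I" "Hausdorff_space I"
    and F: "continuous_map (prod_topology I X) Z (\<lambda>(t, x). f (t, collapse_map S x))"
    and F0: "continuous_map I Z (\<lambda>t. f (t, None))"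
  shows "continuous_map (prod_topology I (space_of (collapse X S))) Z f"
proof -
  let ?q = "\<lambda>(t, z). (t, collapse_lift S id z)"
  let ?C = "space_of (collapse X {})"
  have "quotient_map (prod_topology I ?C) (prod_topology I (space_of (collapse X S))) ?q"
    using quotient_map_prod_right[OF I(1) disjI1[OF I(2)] quotient_map_collapse_from_disjoint_base] .
  moreover have "continuous_map (prod_topology I ?C) Z (f \<circ> ?q)"
  proof (rule pasting_lemma[where I = "{False, True}" and f = "\<lambda>_. f \<circ> ?q" and
        T = "\<lambda>b. topspace I \<times> (if b then {None} else Some ` topspace X)"])
    fix b :: bool
    have "{x \<in> topspace X. collapse_map {} x \<in> Some ` topspace X} = topspace X"
      by (auto simp: collapse_map_def)
    then have o: "openin ?C {None}" "openin ?C (Some ` topspace X)"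
      by (auto simp: openin_collapse collapse_map_def)
    then show "openin (prod_topology I ?C) (topspace I \<times> (if b then {None} else Some ` topspace X))"
      by (simp add: openin_prod_Times_iff)
    show "continuous_map (subtopology (prod_topology I ?C)
           (topspace I \<times> (if b then {None} else Some ` topspace X))) Z (f \<circ> ?q)"
    proof (cases b)
      case True
      have "continuous_map (subtopology (prod_topology I ?C) (topspace I \<times> {None})) Z (\<lambda>z. f (fst z, None))"
        by (rule continuous_map_comp[OF _ F0]) (rule continuous_map_subtopology_fst)
      then have "continuous_map (subtopology (prod_topology I ?C) (topspace I \<times> {None})) Z (f \<circ> ?q)"
        by (rule continuous_map_eq) auto
      then show ?thesis
        using True by simp
    next
      case False
      have "continuous_map (subtopology ?C (Some ` topspace X)) X the"
        unfolding continuous_map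
      proof (intro conjI allI impI)
        fix U assume U: "openin X U"
        have "{z \<in> topspace (subtopology ?C (Some ` topspace X)). the z \<in> U} = Some ` U"
          using openin_subset[OF U] by (auto simp: points_collapse)
        moreover have "{x \<in> topspace X. collapse_map {} x \<in> Some ` U} = U"
          using openin_subset[OF U] by (auto simp: collapse_map_def)
        then have "openin ?C (Some ` U)"
          using U openin_subset[OF U] by (auto simp: openin_collapse)
        moreover have "Some ` U \<subseteq> Some ` topspace X"
          using openin_subset[OF U] by blast
        ultimately show "openin (subtopology ?C (Some ` topspace X))
            {z \<in> topspace (subtopology ?C (Some ` topspace X)). the z \<in> U}"
          by (metis inf.absorb_iff1 openin_subtopology)
      qed auto
      then have "continuous_map (prod_topology I (subtopology ?C (Some ` topspace X))) (prod_topology I X)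
            (\<lambda>z. (fst z, the (snd z)))"
        by (intro continuous_map_pairedI continuous_map_fst continuous_map_comp[OF continuous_map_snd]) simp
      then have "continuous_map (prod_topology I (subtopology ?C (Some ` topspace X))) Z
            (\<lambda>z. f (fst z, collapse_map S (the (snd z))))"
        using continuous_map_comp[OF _ F] by fastforce
      then have "continuous_map (subtopology (prod_topology I ?C) (topspace I \<times> (Some ` topspace X))) Z
            (\<lambda>z. f (fst z, collapse_map S (the (snd z))))"
        by (simp add: subtopology_Times)
      then have "continuous_map (subtopology (prod_topology I ?C) (topspace I \<times> (Some ` topspace X))) Z (f \<circ> ?q)"
        by (rule continuous_map_eq) auto
      then show ?thesis
        using False by simp
    qed
    fix z assume "z \<in> topspace (prod_topology I ?C)"
    then show "\<exists>j. j \<in> {False, True} \<and> z \<in> topspace I \<times> (if j then {None} else Some ` topspace X)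
            \<and> (f \<circ> ?q) z = (f \<circ> ?q) z"
      by (auto simp: points_collapse)
  qed auto
  ultimately show ?thesis
    by (simp add: continuous_compose_quotient_map_eq)
qed

lemma k_space_collapse:
  assumes "k_space X"
  shows "k_space (space_of (collapse X S))"
  unfolding k_space_open
proof (intro allI impI, elim conjE)
  fix U assume U: "U \<subseteq> points (collapse X S)"
    and *: "\<forall>Q. compactin (space_of (collapse X S)) Q \<longrightarrow>
                 openin (subtopology (space_of (collapse X S)) Q) (Q \<inter> U)"
  have "openin (subtopology X Q) (Q \<inter> {x \<in> topspace X. collapse_map S x \<in> U})" if Q: "compactin X Q" for Q
  proof -
    have c: "compactin (space_of (collapse X S)) (collapse_map S ` Q)"
      using Q continuous_map_collapse_map image_compactin by blast
    have "continuous_map (subtopology X Q) (subtopology (space_of (collapse X S)) (collapse_map S ` Q)) (collapse_map S)"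
      by (intro continuous_map_into_subtopology continuous_map_from_subtopology continuous_map_collapse_map) auto
    then have "openin (subtopology X Q) {x \<in> topspace (subtopology X Q). collapse_map S x \<in> collapse_map S ` Q \<inter> U}"
      using * c openin_continuous_map_preimage by fastforce
    moreover have "{x \<in> topspace (subtopology X Q). collapse_map S x \<in> collapse_map S ` Q \<inter> U}
        = Q \<inter> {x \<in> topspace X. collapse_map S x \<in> U}"
      by auto
    ultimately show ?thesis by simp
  qed
  then have "openin X {x \<in> topspace X. collapse_map S x \<in> U}"
    by (intro k_space_openinI[OF assms]) auto
  then show "openin (space_of (collapse X S)) U"
    using U by (simp add: openin_collapse points_collapse)
qed

lemma Hausdorff_space_collapse:
  assumes H: "Hausdorff_space X"
    and sep: "\<And>x. x \<in> topspace X - S \<Longrightarrow>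
        \<exists>U V. openin X U \<and> openin X V \<and> x \<in> U \<and> S \<inter> topspace X \<subseteq> V \<and> disjnt U V"
  shows "Hausdorff_space (space_of (collapse X S))"
proof -
  have op: "openin (space_of (collapse X S)) (Some ` U)" if "openin X U" "U \<inter> S = {}" for U
  proof -
    have U: "U \<subseteq> topspace X - S"
      using that(2) openin_subset[OF that(1)] by auto
    then have "{x \<in> topspace X. collapse_map S x \<in> Some ` U} = U"
      by (auto simp: collapse_map_def)
    then show ?thesis
      using that(1) U by (auto simp: openin_collapse)
  qed
  have op': "openin (space_of (collapse X S)) (insert None (Some ` (V - S)))"
    if "openin X V" "S \<inter> topspace X \<subseteq> V" for V
  proof -
    have "{x \<in> topspace X. collapse_map S x \<in> insert None (Some ` (V - S))} = V"
      using that openin_subset[OF that(1)] by (auto simp: collapse_map_def)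
    then show ?thesis
      using that openin_subset[OF that(1)] by (auto simp: openin_collapse)
  qed
  have out: "\<exists>U V. openin (space_of (collapse X S)) U \<and> openin (space_of (collapse X S)) V
      \<and> Some x \<in> U \<and> None \<in> V \<and> disjnt U V" if x: "x \<in> topspace X - S" for x
  proof -
    obtain U V where UV: "openin X U" "openin X V" "x \<in> U" "S \<inter> topspace X \<subseteq> V" "disjnt U V"
      using sep[OF x] by blast
    then have "U \<inter> S = {}" using openin_subset[OF UV(1)] by (auto simp: disjnt_def)
    then show ?thesis
      using UV by (intro exI[of _ "Some ` U"] exI[of _ "insert None (Some ` (V - S))"] conjI op op')
        (auto simp: disjnt_def)
  qed
  have two: "\<exists>U V. openin (space_of (collapse X S)) U \<and> openin (space_of (collapse X S)) V
      \<and> Some x \<in> U \<and> Some y \<in> V \<and> disjnt U V" if xy: "x \<in> topspace X - S" "y \<in> topspace X - S" "x \<noteq> y" for x y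
  proof -
    have S0: "\<exists>U. openin X U \<and> x \<in> U \<and> U \<inter> S = {}" if x: "x \<in> topspace X - S" for x
    proof -
      obtain U V where "openin X U" "x \<in> U" "S \<inter> topspace X \<subseteq> V" "disjnt U V"
        using sep[OF x] by blast
      then show ?thesis
        using openin_subset[of X U] by (intro exI[of _ U]) (auto simp: disjnt_def)
    qed
    obtain U V where "openin X U" "openin X V" "x \<in> U" "y \<in> V" "disjnt U V"
      using H xy unfolding Hausdorff_space_def by blast
    moreover obtain U' V' where "openin X U'" "x \<in> U'" "U' \<inter> S = {}" "openin X V'" "y \<in> V'" "V' \<inter> S = {}"
      using S0[OF xy(1)] S0[OF xy(2)] by blast
    ultimately show ?thesis
      by (intro exI[of _ "Some ` (U \<inter> U')"] exI[of _ "Some ` (V \<inter> V')"] conjI op openin_Int)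
        (auto simp: disjnt_def)
  qed
  show ?thesis
    unfolding Hausdorff_space_def
  proof (intro allI impI, elim conjE)
    fix p q assume pq: "p \<in> points (collapse X S)" "q \<in> points (collapse X S)" "p \<noteq> q"
    then consider x where "p = Some x" "x \<in> topspace X - S" "q = None"
      | y where "q = Some y" "y \<in> topspace X - S" "p = None"
      | x y where "p = Some x" "x \<in> topspace X - S" "q = Some y" "y \<in> topspace X - S" "x \<noteq> y"
      by (auto simp: points_collapse)
    then show "\<exists>U V. openin (space_of (collapse X S)) U \<and> openin (space_of (collapse X S)) V
        \<and> p \<in> U \<and> q \<in> V \<and> disjnt U V"
    proof cases
      case 1 then show ?thesis using out by blast
    next
      case 2 then show ?thesis using out[OF 2(2)] 2(1,3) unfolding disjnt_def by blast
    next
      case 3 then show ?thesis using two by blast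
    qed
  qed
qed

section \<open>Finite products of quotient maps\<close>

lemma product_topology_cong:
  assumes "\<And>i. i \<in> I \<Longrightarrow> X i = Y i"
  shows "product_topology X I = product_topology Y I"
proof -
  have *: "continuous_map (product_topology X I) (product_topology Y I) (\<lambda>x. x)"
    if "\<And>i. i \<in> I \<Longrightarrow> X i = Y i" for X Y :: "'a \<Rightarrow> 'b topology"
    unfolding continuous_map_componentwise
    using that by (auto simp: PiE_iff continuous_map_product_projection simp flip: that)
  have op: "openin S U \<Longrightarrow> continuous_map T S (\<lambda>x. x) \<Longrightarrow> topspace S = topspace T \<Longrightarrow> openin T U"
    for S T :: "('a \<Rightarrow> 'b) topology" and U
  proof -
    assume a: "openin S U" "continuous_map T S (\<lambda>x. x)" "topspace S = topspace T"
    have "{x \<in> topspace T. x \<in> U} = U"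
      using openin_subset[OF a(1)] a(3) by auto
    then show ?thesis
      using openin_continuous_map_preimage[OF a(2,1)] by simp
  qed
  have ts: "topspace (product_topology X I) = topspace (product_topology Y I)"
    using assms by (auto simp: PiE_iff)
  show ?thesis
    unfolding topology_eq
    using op[OF _ *[of X Y] ts[symmetric]] op[OF _ *[of Y X] ts] assms by metis
qed

text \<open>Split off the coordinate \<open>j\<close> by a homeomorphism and use the result for two factors.\<close>

lemma quotient_map_kification_product_one_coordinate:
  fixes X X' :: "'i \<Rightarrow> 'c topology"
  assumes j: "j \<in> I" and q: "quotient_map (X j) (X' j) q" and k: "k_space (X j)"
    and H: "\<And>i. i \<in> I \<Longrightarrow> i \<noteq> j \<Longrightarrow> Hausdorff_space (X i)"
    and same: "\<And>i. i \<in> I \<Longrightarrow> i \<noteq> j \<Longrightarrow> X' i = X i"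
  shows "quotient_map (kification (product_topology X I)) (kification (product_topology X' I))
           (\<lambda>x. x(j := q (x j)))"
proof -
  let ?R = "product_topology X (I - {j})"
  let ?a = "\<lambda>x. (x j, restrict x (I - {j}))" and ?b = "\<lambda>(y, z). z(j := y)"
  have ac: "continuous_map (product_topology Y I) (prod_topology (Y j) (product_topology Y (I - {j}))) ?a"
    for Y :: "'i \<Rightarrow> 'c topology"
    using j by (intro continuous_map_pairedI continuous_map_product_projection)
      (auto simp: continuous_map_componentwise intro!: continuous_map_product_projection)
  have bc: "continuous_map (prod_topology (Y j) (product_topology Y (I - {j}))) (product_topology Y I) ?b"
    for Y :: "'i \<Rightarrow> 'c topology"
    unfolding continuous_map_componentwise
  proof (intro conjI ballI)
    show "?b ` topspace (prod_topology (Y j) (product_topology Y (I - {j}))) \<subseteq> extensional I"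
      using j by (auto simp: extensional_def PiE_def)
    fix i assume i: "i \<in> I"
    show "continuous_map (prod_topology (Y j) (product_topology Y (I - {j}))) (Y i) (\<lambda>x. ?b x i)"
    proof (cases "i = j")
      case True
      then show ?thesis by (simp add: case_prod_unfold continuous_map_fst)
    next
      case False
      then show ?thesis
        using i by (simp add: case_prod_unfold)
          (rule continuous_map_comp[OF continuous_map_snd], simp add: continuous_map_product_projection)
    qed
  qed
  have homa: "homeomorphic_maps (kification (product_topology Y I))
        (kification (prod_topology (Y j) (product_topology Y (I - {j})))) ?a ?b" for Y :: "'i \<Rightarrow> 'c topology"
    unfolding homeomorphic_maps_def
    using continuous_map_kification_functor[OF ac, of Y] continuous_map_kification_functor[OF bc, of Y] j
    by (force simp: PiE_iff extensional_def fun_eq_iff restrict_def)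
  have R': "product_topology X' (I - {j}) = ?R"
    by (rule product_topology_cong) (simp add: same)
  have HR: "Hausdorff_space ?R"
    using H by (auto simp: Hausdorff_space_product_topology)
  have q1: "quotient_map (kification (product_topology X I)) (kification (prod_topology (X j) ?R)) ?a"
    using homa[of X] by (simp add: homeomorphic_maps_map homeomorphic_map_def)
  have q2: "quotient_map (kification (prod_topology (X j) ?R)) (kification (prod_topology (X' j) ?R)) (\<lambda>(a, z). (q a, z))"
    by (rule quotient_map_kification_prod[OF q k HR])
  have q3: "quotient_map (kification (prod_topology (X' j) ?R)) (kification (product_topology X' I)) ?b"
    using homa[of X'] by (simp add: homeomorphic_maps_map homeomorphic_map_def R')
  have q4: "quotient_map (kification (product_topology X I)) (kification (product_topology X' I))
          (?b \<circ> ((\<lambda>(a, z). (q a, z)) \<circ> ?a))"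
    by (intro quotient_map_compose[OF _ q3] quotient_map_compose[OF q1 q2])
  show ?thesis
    by (rule quotient_map_eq[OF q4]) (use j in \<open>auto simp: fun_eq_iff PiE_iff extensional_def\<close>)
qed

text \<open>One coordinate at a time: in the intermediate products the coordinates in \<open>J\<close> have already been
  replaced.\<close>

lemma quotient_map_kification_product:
  fixes X X' :: "'i \<Rightarrow> 'c topology"
  assumes fin: "finite I"
    and q: "\<And>i. i \<in> I \<Longrightarrow> quotient_map (X i) (X' i) (q i)"
    and k: "\<And>i. i \<in> I \<Longrightarrow> k_space (X i)"
    and H: "\<And>i. i \<in> I \<Longrightarrow> Hausdorff_space (X i)" "\<And>i. i \<in> I \<Longrightarrow> Hausdorff_space (X' i)"
  shows "quotient_map (kification (product_topology X I)) (kification (product_topology X' I))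
           (\<lambda>x. \<lambda>i\<in>I. q i (x i))"
proof -
  let ?X = "\<lambda>J i. if i \<in> J then X' i else X i"
  have "quotient_map (kification (product_topology X I)) (kification (product_topology (?X J) I))
           (\<lambda>x. \<lambda>i\<in>I. if i \<in> J then q i (x i) else x i)" if "J \<subseteq> I" for J
    using finite_subset[OF that fin] that
  proof (induction J rule: finite_induct)
    case empty
    show ?case
    proof (rule quotient_map_eq)
      show "quotient_map (kification (product_topology X I)) (kification (product_topology (?X {}) I)) id"
        by (simp add: quotient_map_def Int_def[symmetric] Int_absorb1 Collect_conj_eq del: topspace_product_topology)
    qed (auto simp: PiE_iff extensional_def fun_eq_iff)
  next
    case (insert j J)
    have "quotient_map (kification (product_topology (?X J) I)) (kification (product_topology (?X (insert j J)) I))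
           (\<lambda>x. x(j := q j (x j)))"
      using insert.hyps insert.prems
      by (intro quotient_map_kification_product_one_coordinate) (auto simp: q k H)
    with insert.IH insert.prems have "quotient_map (kification (product_topology X I)) (kification (product_topology (?X (insert j J)) I))
           ((\<lambda>x. x(j := q j (x j))) \<circ> (\<lambda>x. \<lambda>i\<in>I. if i \<in> J then q i (x i) else x i))"
      using quotient_map_compose by (metis (no_types, lifting) insert_subset)
    then show ?case
      by (rule quotient_map_eq) (use insert.prems insert.hyps in \<open>auto simp: fun_eq_iff\<close>)
  qed
  from this[OF order_refl] have *: "quotient_map (kification (product_topology X I)) (kification (product_topology (?X I) I))
           (\<lambda>x. \<lambda>i\<in>I. if i \<in> I then q i (x i) else x i)" .
  have "product_topology (?X I) I = product_topology X' I"
    by (rule product_topology_cong) simp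
  moreover have "(\<lambda>x. \<lambda>i\<in>I. if i \<in> I then q i (x i) else x i) = (\<lambda>x. \<lambda>i\<in>I. q i (x i))"
    by (simp add: fun_eq_iff restrict_def)
  ultimately show ?thesis
    using * by simp
qed

section \<open>Retractions for CW pairs\<close>

abbreviation unit_interval :: "real topology" where "unit_interval \<equiv> top_of_set {0..1}"

lemma unit_interval_facts:
  "compact_space unit_interval" "Hausdorff_space unit_interval" "locally_compact_space unit_interval"
  by (auto simp: compact_space_subtopology compact_imp_locally_compact_space Hausdorff_space_subtopology)

lemma continuous_map_into_unit_interval:
  "continuous_map X unit_interval f \<longleftrightarrow> continuous_map X euclideanreal f \<and> (\<forall>x\<in>topspace X. 0 \<le> f x \<and> f x \<le> 1)"
  by (auto simp: continuous_map_in_subtopology)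

lemma continuous_map_from_unit_interval:
  "continuous_map X unit_interval f \<Longrightarrow> continuous_map X euclideanreal f"
  by (simp add: continuous_map_in_subtopology)

definition disc_norm :: "nat \<Rightarrow> (nat \<Rightarrow> real) \<Rightarrow> real" where
  "disc_norm n x = sqrt (\<Sum>i<n. (x i)\<^sup>2)"

lemma topspace_disc [simp]: "topspace (disc n) = disc_set n"
  by (auto simp: disc_def disc_set_def)

lemma in_disc_set: "x \<in> disc_set n \<longleftrightarrow> (\<forall>i\<ge>n. x i = 0) \<and> disc_norm n x \<le> 1"
  by (auto simp: disc_set_def topspace_Euclidean_space disc_norm_def)

lemma in_open_disc_set: "x \<in> open_disc_set n \<longleftrightarrow> (\<forall>i\<ge>n. x i = 0) \<and> disc_norm n x < 1"
  by (auto simp: open_disc_set_def topspace_Euclidean_space disc_norm_def)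

lemma disc_norm_scale: "0 \<le> c \<Longrightarrow> disc_norm n (\<lambda>i. x i / c) = disc_norm n x / c"
  by (simp add: disc_norm_def power_divide sum_divide_distrib[symmetric] real_sqrt_divide)

lemma continuous_map_into_disc:
  assumes "\<And>i. continuous_map X euclideanreal (\<lambda>x. f x i)" "\<And>x. x \<in> topspace X \<Longrightarrow> f x \<in> disc_set n"
  shows "continuous_map X (disc n) f"
  using assms unfolding disc_def Euclidean_space_def
  by (auto simp: continuous_map_in_subtopology continuous_map_componentwise_UNIV disc_set_def topspace_Euclidean_space)

lemma continuous_map_disc_coordinate: "continuous_map (disc n) euclideanreal (\<lambda>x. x i)"
  unfolding disc_def Euclidean_space_def
  by (intro continuous_map_from_subtopology continuous_map_product_projection) auto

lemma continuous_map_disc_norm: "continuous_map (disc n) euclideanreal (disc_norm n)"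
  unfolding disc_norm_def
  by (intro continuous_map_sqrt continuous_map_sum continuous_map_real_pow continuous_map_disc_coordinate) auto

lemma compact_space_disc: "compact_space (disc n)"
proof -
  have "compact_space (product_topology (\<lambda>_. top_of_set {-1..1::real}) (UNIV :: nat set))"
    by (simp add: compact_space_product_topology compact_space_subtopology)
  then have c: "compactin (powertop_real UNIV) (\<Pi>\<^sub>E i\<in>UNIV. {-1..1::real})"
    by (simp add: compactin_PiE)
  have "closedin (powertop_real UNIV) (disc_set n)"
  proof -
    have "closedin (powertop_real UNIV) {x \<in> topspace (powertop_real UNIV). (\<Sum>i<n. (x i)\<^sup>2) \<in> {..1}}"
      by (intro closedin_continuous_map_preimage[where Y = euclideanreal] continuous_map_sum
          continuous_map_real_pow continuous_map_product_projection) auto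
    moreover have "disc_set n = topspace (Euclidean_space n) \<inter> {x \<in> topspace (powertop_real UNIV). (\<Sum>i<n. (x i)\<^sup>2) \<in> {..1}}"
      by (auto simp: disc_set_def)
    ultimately show ?thesis
      using closedin_Euclidean_space by (simp add: closedin_Int)
  qed
  moreover have "disc_set n \<subseteq> (\<Pi>\<^sub>E i\<in>UNIV. {-1..1::real})"
  proof
    fix x assume x: "x \<in> disc_set n"
    have "(x i)\<^sup>2 \<le> 1" for i
    proof (cases "i < n")
      case True
      then have "(x i)\<^sup>2 \<le> (\<Sum>i<n. (x i)\<^sup>2)"
        by (intro member_le_sum) auto
      then show ?thesis using x by (auto simp: disc_set_def)
    next
      case False
      then show ?thesis using x by (auto simp: in_disc_set)
    qed
    then have "\<bar>x i\<bar> \<le> 1" for i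
      using abs_square_le_1 by blast
    then show "x \<in> (\<Pi>\<^sub>E i\<in>UNIV. {-1..1::real})"
      by (auto simp: abs_le_iff minus_le_iff)
  qed
  ultimately have "compactin (powertop_real UNIV) (disc_set n)"
    using c closed_compactin by blast
  then show ?thesis
  proof -
    have "{x. \<forall>i\<ge>n. x i = 0} \<inter> disc_set n = disc_set n"
      by (auto simp: in_disc_set)
    then show ?thesis
      using \<open>compactin (powertop_real UNIV) (disc_set n)\<close>
      by (simp add: disc_def Euclidean_space_def subtopology_subtopology compact_space_subtopology)
  qed
qed

text \<open>The radial projection of the cylinder over the disc from the point at height \<open>2\<close> above its
  centre; one division by \<open>max |x| ((2 - t) / 2)\<close> covers the bottom and the side.\<close>

definition disc_push :: "nat \<Rightarrow> (nat \<Rightarrow> real) \<times> real \<Rightarrow> (nat \<Rightarrow> real) \<times> real" where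
  "disc_push n = (\<lambda>(x, t). let m = max (disc_norm n x) ((2 - t) / 2) in (\<lambda>i. x i / m, 2 - (2 - t) / m))"

lemma disc_push_props:
  assumes x: "x \<in> disc_set n" and t: "0 \<le> t" "t \<le> 1"
  shows "fst (disc_push n (x, t)) \<in> disc_set n"
    and "0 \<le> snd (disc_push n (x, t))" "snd (disc_push n (x, t)) \<le> 1"
    and "t = 0 \<Longrightarrow> disc_push n (x, t) = (x, 0)"
    and "x \<notin> open_disc_set n \<Longrightarrow> disc_push n (x, t) = (x, t)"
    and "snd (disc_push n (x, t)) = 0 \<or> fst (disc_push n (x, t)) \<notin> open_disc_set n"
proof -
  define m where "m = max (disc_norm n x) ((2 - t) / 2)"
  have dp: "disc_push n (x, t) = (\<lambda>i. x i / m, 2 - (2 - t) / m)"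
    by (simp add: disc_push_def m_def Let_def)
  have x1: "disc_norm n x \<le> 1" "\<forall>i\<ge>n. x i = 0"
    using x by (auto simp: in_disc_set)
  have m: "m \<ge> disc_norm n x" "m \<ge> (2 - t) / 2" "m \<le> 1" "m > 0"
    using x1 t by (auto simp: m_def less_max_iff_disj)
  have nm: "disc_norm n (\<lambda>i. x i / m) = disc_norm n x / m"
    using m by (simp add: disc_norm_scale)
  show "fst (disc_push n (x, t)) \<in> disc_set n"
    using m x1 by (simp add: dp in_disc_set nm)
  show "0 \<le> snd (disc_push n (x, t))"
    using m by (simp add: dp field_simps)
  show "snd (disc_push n (x, t)) \<le> 1"
    using m t by (simp add: dp field_simps)
  show "disc_push n (x, t) = (x, 0)" if "t = 0"
    using that x1 by (simp add: disc_push_def Let_def max_def)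
  show "disc_push n (x, t) = (x, t)" if "x \<notin> open_disc_set n"
  proof -
    have "disc_norm n x = 1" using that x1 by (auto simp: in_open_disc_set)
    then have "m = 1" using t by (simp add: m_def)
    then show ?thesis by (simp add: dp)
  qed
  show "snd (disc_push n (x, t)) = 0 \<or> fst (disc_push n (x, t)) \<notin> open_disc_set n"
  proof (cases "disc_norm n x \<le> (2 - t) / 2")
    case True
    then have "m = (2 - t) / 2" by (simp add: m_def)
    then have "(2 - t) / m = 2" using t m by (simp add: field_simps)
    then show ?thesis by (simp add: dp)
  next
    case False
    then have "m = disc_norm n x" by (simp add: m_def)
    then have "disc_norm n (\<lambda>i. x i / m) = 1" using m nm by simp
    then show ?thesis by (simp add: dp in_open_disc_set)
  qed
qed

lemma continuous_map_disc_push: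
  "continuous_map (prod_topology (disc n) unit_interval) (prod_topology (disc n) unit_interval) (disc_push n)"
proof -
  let ?B = "prod_topology (disc n) unit_interval"
  have N: "continuous_map ?B euclideanreal (\<lambda>p. disc_norm n (fst p))"
    by (rule continuous_map_comp[OF continuous_map_fst continuous_map_disc_norm])
  have T: "continuous_map ?B euclideanreal snd"
    by (rule continuous_map_from_unit_interval[OF continuous_map_snd])
  have X: "continuous_map ?B euclideanreal (\<lambda>p. fst p i)" for i
    by (rule continuous_map_comp[OF continuous_map_fst continuous_map_disc_coordinate])
  let ?m = "\<lambda>p. max (disc_norm n (fst p)) ((2 - snd p) / 2)"
  have M: "continuous_map ?B euclideanreal ?m"
    by (intro continuous_map_real_max N continuous_map_real_divide continuous_map_diff T) auto
  have M0: "?m p \<noteq> 0" if "p \<in> topspace ?B" for p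
    using that by (auto simp: max_def)
  have eq: "disc_push n = (\<lambda>p. (\<lambda>i. fst p i / ?m p, 2 - (2 - snd p) / ?m p))"
    by (auto simp: disc_push_def Let_def)
  have in_d: "fst (disc_push n p) \<in> disc_set n" "0 \<le> snd (disc_push n p)" "snd (disc_push n p) \<le> 1"
    if "p \<in> topspace ?B" for p
    using that disc_push_props[of "fst p" n "snd p"] by auto
  show ?thesis
    unfolding continuous_map_pairwise
  proof
    show "continuous_map ?B (disc n) (fst \<circ> disc_push n)"
    proof (rule continuous_map_into_disc)
      fix i show "continuous_map ?B euclideanreal (\<lambda>p. (fst \<circ> disc_push n) p i)"
        unfolding eq o_def fst_conv using M0 by (intro continuous_map_real_divide X M) blast
    qed (use in_d in auto)
    have "continuous_map ?B euclideanreal (\<lambda>p. 2 - (2 - snd p) / ?m p)"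
      using M0 by (intro continuous_map_diff continuous_map_real_divide M T) auto
    then show "continuous_map ?B unit_interval (snd \<circ> disc_push n)"
      unfolding continuous_map_into_unit_interval using in_d by (simp add: eq o_def)
  qed
qed

lemma cw_structureD:
  assumes "cw_structure X \<Phi>"
  shows "Hausdorff_space X"
    and "c \<in> \<Phi> \<Longrightarrow> continuous_map (disc (fst c)) X (snd c)"
    and "c \<in> \<Phi> \<Longrightarrow> embedding_map (open_disc (fst c)) X (snd c)"
    and "c \<in> \<Phi> \<Longrightarrow> d \<in> \<Phi> \<Longrightarrow> x \<in> open_cell c \<Longrightarrow> x \<in> open_cell d \<Longrightarrow> c = d"
    and "(\<Union>c\<in>\<Phi>. open_cell c) = topspace X"
    and "c \<in> \<Phi> \<Longrightarrow> \<exists>\<F>\<subseteq>\<Phi>. finite \<F> \<and> (\<forall>d\<in>\<F>. fst d < fst c) \<and> cell_frontier c \<subseteq> (\<Union>d\<in>\<F>. open_cell d)"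
    and "S \<subseteq> topspace X \<Longrightarrow> (\<And>c. c \<in> \<Phi> \<Longrightarrow> closedin X (S \<inter> closed_cell c)) \<Longrightarrow> closedin X S"
  using assms unfolding cw_structure_def disjoint_family_on_def by (simp, simp, simp, blast, simp, simp, simp)

lemma compactin_closed_cell:
  assumes "cw_structure X \<Phi>" "c \<in> \<Phi>"
  shows "compactin X (closed_cell c)"
  using assms image_compactin[of "disc (fst c)" "disc_set (fst c)" X "snd c"] compact_space_disc
  by (auto simp: cw_structure_def closed_cell_def compact_space_def)

text \<open>The weak topology, tested on the closed discs instead of the closed cells; discs are compact, so
  the characteristic maps are closed.\<close>

lemma openin_cw:
  assumes cw: "cw_structure X \<Phi>" and S: "S \<subseteq> topspace X"
    and cells: "\<And>c. c \<in> \<Phi> \<Longrightarrow> openin (disc (fst c)) {y \<in> disc_set (fst c). snd c y \<in> S}"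
  shows "openin X S"
proof -
  have "closedin X ((topspace X - S) \<inter> closed_cell c)" if c: "c \<in> \<Phi>" for c
  proof -
    have chi: "continuous_map (disc (fst c)) X (snd c)"
      using cw c by (auto simp: cw_structure_def)
    have "closedin (disc (fst c)) (disc_set (fst c) - {y \<in> disc_set (fst c). snd c y \<in> S})"
      using cells[OF c] by (simp add: closedin_def double_diff)
    then have "compactin (disc (fst c)) (disc_set (fst c) - {y \<in> disc_set (fst c). snd c y \<in> S})"
      by (simp add: closedin_compact_space compact_space_disc)
    then have "compactin X (snd c ` (disc_set (fst c) - {y \<in> disc_set (fst c). snd c y \<in> S}))"
      using chi image_compactin by blast
    moreover have "snd c ` (disc_set (fst c) - {y \<in> disc_set (fst c). snd c y \<in> S})
        = (topspace X - S) \<inter> closed_cell c"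
      using continuous_map_image_subset_topspace[OF chi] by (auto simp: closed_cell_def)
    ultimately show ?thesis
      using cw compactin_imp_closedin by (fastforce simp: cw_structure_def)
  qed
  then have "closedin X (topspace X - S)"
    using cw_structureD(7)[OF cw, of "topspace X - S"] by auto
  then show ?thesis
    using S by (simp add: openin_closedin_eq)
qed

lemma k_space_cw:
  assumes cw: "cw_structure X \<Phi>"
  shows "k_space X"
  unfolding k_space_open
proof (intro allI impI, elim conjE)
  fix S assume S: "S \<subseteq> topspace X" and *: "\<forall>K. compactin X K \<longrightarrow> openin (subtopology X K) (K \<inter> S)"
  show "openin X S"
  proof (rule openin_cw[OF cw S])
    fix c assume c: "c \<in> \<Phi>"
    then have "continuous_map (disc (fst c)) X (snd c)"
      using cw by (auto simp: cw_structure_def)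
    then have "continuous_map (disc (fst c)) (subtopology X (closed_cell c)) (snd c)"
      by (simp add: continuous_map_in_subtopology closed_cell_def)
    moreover have "openin (subtopology X (closed_cell c)) (closed_cell c \<inter> S)"
      using * compactin_closed_cell[OF cw c] by blast
    ultimately have "openin (disc (fst c)) {y \<in> topspace (disc (fst c)). snd c y \<in> closed_cell c \<inter> S}"
      using openin_continuous_map_preimage by blast
    moreover have "{y \<in> topspace (disc (fst c)). snd c y \<in> closed_cell c \<inter> S} = {y \<in> disc_set (fst c). snd c y \<in> S}"
      by (auto simp: closed_cell_def)
    ultimately show "openin (disc (fst c)) {y \<in> disc_set (fst c). snd c y \<in> S}" by simp
  qed
qed

lemma closed_cell_covered:
  assumes cw: "cw_structure X \<Phi>" and c: "c \<in> \<Phi>"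
  obtains F where "F \<subseteq> \<Phi>" "finite F" "\<forall>d\<in>F. fst d < fst c" "cell_frontier c \<subseteq> (\<Union>d\<in>F. open_cell d)"
  using cw_structureD(6)[OF assms] by blast

lemma open_cell_subset_closed_cell: "open_cell c \<subseteq> closed_cell c"
  by (auto simp: open_cell_def closed_cell_def in_disc_set in_open_disc_set)

lemma closed_cell_eq: "closed_cell c = open_cell c \<union> cell_frontier c"
  by (auto simp: open_cell_def closed_cell_def cell_frontier_def in_disc_set in_open_disc_set)

lemma closedin_cw_subcomplex:
  assumes cw: "cw_structure X \<Phi>" and A: "cw_subcomplex \<Phi> A"
  shows "closedin X A"
proof -
  obtain \<Psi> where \<Psi>: "\<Psi> \<subseteq> \<Phi>" "A = (\<Union>c\<in>\<Psi>. open_cell c)" "\<And>c. c \<in> \<Psi> \<Longrightarrow> closed_cell c \<subseteq> A"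
    using A unfolding cw_subcomplex_def by blast
  have disj: "c = d" if "c \<in> \<Phi>" "d \<in> \<Phi>" "x \<in> open_cell c" "x \<in> open_cell d" for c d x
    using cw_structureD(4)[OF cw] that .
  have clo: "closedin X (closed_cell c)" if "c \<in> \<Phi>" for c
    using cw compactin_closed_cell[OF cw that] compactin_imp_closedin by (auto simp: cw_structure_def)
  have "closedin X (A \<inter> closed_cell c)" if c: "c \<in> \<Phi>" for c
  proof -
    obtain F where F: "F \<subseteq> \<Phi>" "finite F" "cell_frontier c \<subseteq> (\<Union>d\<in>F. open_cell d)"
      using cw_structureD(6)[OF cw c] by blast
    have "A \<inter> closed_cell c = (\<Union>d\<in>insert c F \<inter> \<Psi>. closed_cell d \<inter> closed_cell c)"
    proof (intro equalityI subsetI)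
      fix x assume x: "x \<in> A \<inter> closed_cell c"
      then obtain e where e: "e \<in> \<Psi>" "x \<in> open_cell e" using \<Psi>(2) by auto
      have "x \<in> open_cell c \<or> (\<exists>d\<in>F. x \<in> open_cell d)"
        using x F(3) by (auto simp: closed_cell_eq)
      then have "e \<in> insert c F"
        using disj[of e] e \<Psi>(1) c F(1) by blast
      then show "x \<in> (\<Union>d\<in>insert c F \<inter> \<Psi>. closed_cell d \<inter> closed_cell c)"
        using e x open_cell_subset_closed_cell by fastforce
    qed (use \<Psi>(3) in blast)
    moreover have "closedin X (\<Union>d\<in>insert c F \<inter> \<Psi>. closed_cell d \<inter> closed_cell c)"
    proof (rule closedin_Union)
      show "finite ((\<lambda>d. closed_cell d \<inter> closed_cell c) ` (insert c F \<inter> \<Psi>))" using F by auto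
      show "closedin X S" if "S \<in> (\<lambda>d. closed_cell d \<inter> closed_cell c) ` (insert c F \<inter> \<Psi>)" for S
        using that F(1) c clo closedin_Int by blast
    qed
    ultimately show ?thesis by simp
  qed
  moreover have "A \<subseteq> topspace X"
    using \<Psi>(1,2) cw_structureD(5)[OF cw] by blast
  ultimately show ?thesis
    using cw_structureD(7)[OF cw, of A] by auto
qed

definition cell_of :: "'a cell set \<Rightarrow> 'a \<Rightarrow> 'a cell" where
  "cell_of \<Phi> x = (THE c. c \<in> \<Phi> \<and> x \<in> open_cell c)"

definition cell_coord :: "'a cell \<Rightarrow> 'a \<Rightarrow> nat \<Rightarrow> real" where
  "cell_coord c x = inv_into (open_disc_set (fst c)) (snd c) x"

text \<open>Pushing a point of the cylinder down its cell either stops at the bottom or arrives over the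
  frontier, in cells of lower dimension; \<open>n\<close> bounds the number of steps.\<close>

primrec cw_push :: "'a cell set \<Rightarrow> 'a set \<Rightarrow> nat \<Rightarrow> 'a \<times> real \<Rightarrow> 'a \<times> real" where
  "cw_push \<Phi> A 0 p = p"
| "cw_push \<Phi> A (Suc n) p =
    (if fst p \<in> A \<or> snd p = 0 then p
     else let c = cell_of \<Phi> (fst p); q = disc_push (fst c) (cell_coord c (fst p), snd p)
          in cw_push \<Phi> A n (snd c (fst q), snd q))"

definition cw_retract :: "'a cell set \<Rightarrow> 'a set \<Rightarrow> 'a \<times> real \<Rightarrow> 'a \<times> real" where
  "cw_retract \<Phi> A p = cw_push \<Phi> A (Suc (fst (cell_of \<Phi> (fst p)))) p"

lemma cw_push_bottom: "cw_push \<Phi> A n (x, 0) = (x, 0)"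
  by (cases n) auto

lemma cell_of_eq:
  assumes "cw_structure X \<Phi>" "c \<in> \<Phi>" "x \<in> open_cell c"
  shows "cell_of \<Phi> x = c"
  unfolding cell_of_def using cw_structureD(4)[OF assms(1)] assms(2,3) by (intro the_equality) blast+

lemma topspace_open_disc: "topspace (open_disc n) = open_disc_set n"
  by (auto simp: open_disc_def open_disc_set_def)

lemma cell_coord_eq:
  assumes "cw_structure X \<Phi>" "c \<in> \<Phi>" "y \<in> open_disc_set (fst c)"
  shows "cell_coord c (snd c y) = y"
proof -
  have "inj_on (snd c) (open_disc_set (fst c))"
    using cw_structureD(3)[OF assms(1,2)] by (simp add: embedding_map_def homeomorphic_map_def topspace_open_disc)
  then show ?thesis
    using assms(3) by (simp add: cell_coord_def)
qed

lemma open_disc_subset: "open_disc_set n \<subseteq> disc_set n"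
  by (auto simp: in_disc_set in_open_disc_set)

lemma cw_push_step:
  assumes cw: "cw_structure X \<Phi>" and c: "c \<in> \<Phi>" and y: "y \<in> open_disc_set (fst c)"
    and q: "disc_push (fst c) (y, t) = (y', s)" and n: "snd c y \<notin> A" "t \<noteq> 0"
  shows "cw_push \<Phi> A (Suc k) (snd c y, t) = cw_push \<Phi> A k (snd c y', s)"
proof -
  have "snd c y \<in> open_cell c" using y by (auto simp: open_cell_def)
  then show ?thesis
    using n q cell_of_eq[OF cw c] cell_coord_eq[OF cw c y] by (simp add: Let_def)
qed

lemma frontier_lower_cell:
  assumes cw: "cw_structure X \<Phi>" and c: "c \<in> \<Phi>" and y: "y \<in> disc_set (fst c)" "y \<notin> open_disc_set (fst c)"
  obtains d w where "d \<in> \<Phi>" "fst d < fst c" "w \<in> open_disc_set (fst d)" "snd c y = snd d w"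
proof -
  have "snd c y \<in> cell_frontier c" using y by (auto simp: cell_frontier_def)
  then obtain d where "d \<in> \<Phi>" "fst d < fst c" "snd c y \<in> open_cell d"
    using cw_structureD(6)[OF cw c] by blast
  moreover from this obtain w where "w \<in> open_disc_set (fst d)" "snd c y = snd d w"
    by (auto simp: open_cell_def)
  ultimately show ?thesis
    using that by blast
qed

lemma in_some_cell:
  assumes "cw_structure X \<Phi>" "x \<in> topspace X"
  obtains c y where "c \<in> \<Phi>" "y \<in> open_disc_set (fst c)" "x = snd c y"
  using cw_structureD(5)[OF assms(1)] assms(2) unfolding open_cell_def by blast

text \<open>Induction along the push: every step that leaves the bottom and the subcomplex ends over a cell
  of smaller dimension.\<close>

lemma cw_push_induct [consumes 5, case_names stop bottom side]:
  assumes cw: "cw_structure X \<Phi>" and c: "c \<in> \<Phi>" and y: "y \<in> open_disc_set (fst c)" and t: "0 \<le> t" "t \<le> 1"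
    and stop: "\<And>c y t. c \<in> \<Phi> \<Longrightarrow> y \<in> open_disc_set (fst c) \<Longrightarrow> 0 \<le> t \<Longrightarrow> t \<le> 1 \<Longrightarrow> snd c y \<in> A \<or> t = 0 \<Longrightarrow> P c y t"
    and bottom: "\<And>c y t y'. c \<in> \<Phi> \<Longrightarrow> y \<in> open_disc_set (fst c) \<Longrightarrow> 0 \<le> t \<Longrightarrow> t \<le> 1 \<Longrightarrow> snd c y \<notin> A \<Longrightarrow> t \<noteq> 0 \<Longrightarrow>
       disc_push (fst c) (y, t) = (y', 0) \<Longrightarrow> y' \<in> disc_set (fst c) \<Longrightarrow> P c y t"
    and side: "\<And>c y t d w y' s. c \<in> \<Phi> \<Longrightarrow> y \<in> open_disc_set (fst c) \<Longrightarrow> 0 \<le> t \<Longrightarrow> t \<le> 1 \<Longrightarrow> snd c y \<notin> A \<Longrightarrow> t \<noteq> 0 \<Longrightarrow>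
       disc_push (fst c) (y, t) = (y', s) \<Longrightarrow> y' \<in> disc_set (fst c) \<Longrightarrow> 0 \<le> s \<Longrightarrow> s \<le> 1 \<Longrightarrow>
       d \<in> \<Phi> \<Longrightarrow> fst d < fst c \<Longrightarrow> w \<in> open_disc_set (fst d) \<Longrightarrow> snd c y' = snd d w \<Longrightarrow> P d w s \<Longrightarrow> P c y t"
  shows "P c y t"
  using c y t
proof (induction "fst c" arbitrary: c y t rule: less_induct)
  case less
  show ?case
  proof (cases "snd c y \<in> A \<or> t = 0")
    case True
    then show ?thesis using less.prems stop by blast
  next
    case False
    obtain y' s where q: "disc_push (fst c) (y, t) = (y', s)" by (cases "disc_push (fst c) (y, t)")
    have yd: "y \<in> disc_set (fst c)" using less.prems open_disc_subset by blast
    note pr = disc_push_props[OF yd less.prems(3,4), unfolded q fst_conv snd_conv]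
    show ?thesis
    proof (cases "s = 0")
      case True
      then show ?thesis using bottom less.prems False q pr(1) by blast
    next
      case s: False
      then have "y' \<notin> open_disc_set (fst c)" using pr(6) by blast
      then obtain d w where dw: "d \<in> \<Phi>" "fst d < fst c" "w \<in> open_disc_set (fst d)" "snd c y' = snd d w"
        using frontier_lower_cell[OF cw less.prems(1) pr(1)] by blast
      show ?thesis
        by (rule side[OF less.prems _ _ q pr(1) pr(2) pr(3) dw less.hyps[OF dw(2) dw(1) dw(3) pr(2,3)]])
          (use False in auto)
    qed
  qed
qed

text \<open>Each step ends over a cell of smaller dimension, so after more steps than the dimension the point
  is at rest.\<close>

lemma cw_push_enough:
  assumes cw: "cw_structure X \<Phi>" and c: "c \<in> \<Phi>" and y: "y \<in> open_disc_set (fst c)" and t: "0 \<le> t" "t \<le> 1"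
  shows "\<forall>m n. fst c < m \<longrightarrow> fst c < n \<longrightarrow> cw_push \<Phi> A m (snd c y, t) = cw_push \<Phi> A n (snd c y, t)"
  using cw c y t
proof (induction rule: cw_push_induct[where A = A])
  case (stop c y t)
  then show ?case by (metis cw_push_bottom gr_implies_not_zero not0_implies_Suc cw_push.simps(2) fst_conv snd_conv)
next
  case (bottom c y t y')
  show ?case
  proof (intro allI impI)
    fix m n assume "fst c < m" "fst c < n"
    then obtain m' n' where "m = Suc m'" "n = Suc n'" by (meson less_imp_Suc_add)
    then show "cw_push \<Phi> A m (snd c y, t) = cw_push \<Phi> A n (snd c y, t)"
      using cw_push_step[OF cw bottom(1,2,7,5,6)] by (simp only: cw_push_bottom)
  qed
next
  case (side c y t d w y' s)
  show ?case
  proof (intro allI impI)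
    fix m n assume mn: "fst c < m" "fst c < n"
    then obtain m' n' where "m = Suc m'" "n = Suc n'" by (meson less_imp_Suc_add)
    then show "cw_push \<Phi> A m (snd c y, t) = cw_push \<Phi> A n (snd c y, t)"
      using cw_push_step[OF cw side(1,2,7,5,6)] side(12,14,15) mn by (metis less_Suc_eq_le less_le_trans)
  qed
qed

text \<open>Seen through a characteristic map, the retraction is unchanged by the radial projection.\<close>

lemma cw_retract_disc_push:
  assumes cw: "cw_structure X \<Phi>" and A: "cw_subcomplex \<Phi> A"
    and c: "c \<in> \<Phi>" "\<not> open_cell c \<subseteq> A" and y: "y \<in> disc_set (fst c)" and t: "0 \<le> t" "t \<le> 1"
    and q: "disc_push (fst c) (y, t) = (y', s)"
  shows "cw_retract \<Phi> A (snd c y, t) = cw_retract \<Phi> A (snd c y', s)"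
proof (cases "y \<in> open_disc_set (fst c) \<and> t \<noteq> 0")
  case False
  then have "(y', s) = (y, t)"
    using disc_push_props(4,5)[OF y t] q by auto
  then show ?thesis by simp
next
  case True
  obtain \<Psi> where \<Psi>: "\<Psi> \<subseteq> \<Phi>" "A = (\<Union>c\<in>\<Psi>. open_cell c)"
    using A unfolding cw_subcomplex_def by blast
  have yc: "snd c y \<in> open_cell c" using True by (auto simp: open_cell_def)
  have nA: "snd c y \<notin> A"
  proof
    assume "snd c y \<in> A"
    then obtain d where "d \<in> \<Psi>" "snd c y \<in> open_cell d" using \<Psi> by blast
    then have "c = d" using cw_structureD(4)[OF cw c(1) _ yc] \<Psi> by blast
    then show False using c \<Psi> \<open>d \<in> \<Psi>\<close> by blast
  qed
  have "cw_retract \<Phi> A (snd c y, t) = cw_push \<Phi> A (fst c) (snd c y', s)"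
    unfolding cw_retract_def fst_conv cell_of_eq[OF cw c(1) yc]
    using cw_push_step[OF cw c(1) _ q nA] True by blast
  also have "\<dots> = cw_retract \<Phi> A (snd c y', s)"
  proof (cases "s = 0")
    case True
    then show ?thesis by (simp only: cw_push_bottom cw_retract_def)
  next
    case False
    note pr = disc_push_props[OF y t, unfolded q fst_conv snd_conv]
    obtain d w where dw: "d \<in> \<Phi>" "fst d < fst c" "w \<in> open_disc_set (fst d)" "snd c y' = snd d w"
      using frontier_lower_cell[OF cw c(1) pr(1)] pr(6) False by blast
    have "cell_of \<Phi> (snd c y') = d"
      using cell_of_eq[OF cw dw(1)] dw by (auto simp: open_cell_def)
    then show ?thesis
      unfolding cw_retract_def fst_conv
      using cw_push_enough[OF cw dw(1,3) pr(2,3)] dw by (metis lessI)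
  qed
  finally show ?thesis .
qed

lemma cw_retract_bottom: "cw_retract \<Phi> A (x, 0) = (x, 0)"
  by (simp only: cw_retract_def cw_push_bottom)

lemma cw_retract_on_subcomplex: "x \<in> A \<Longrightarrow> cw_retract \<Phi> A (x, t) = (x, t)"
  by (simp add: cw_retract_def)

lemma cw_retract_props:
  assumes cw: "cw_structure X \<Phi>" and x: "x \<in> topspace X" and t: "0 \<le> t" "t \<le> 1"
  shows "0 \<le> snd (cw_retract \<Phi> A (x, t)) \<and> snd (cw_retract \<Phi> A (x, t)) \<le> 1 \<and>
         (snd (cw_retract \<Phi> A (x, t)) \<noteq> 0 \<longrightarrow> fst (cw_retract \<Phi> A (x, t)) \<in> A) \<and>
         (\<forall>A'. cw_subcomplex \<Phi> A' \<longrightarrow> x \<in> A' \<longrightarrow> fst (cw_retract \<Phi> A (x, t)) \<in> A')"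
proof -
  obtain c y where c: "c \<in> \<Phi>" and y: "y \<in> open_disc_set (fst c)" and xy: "x = snd c y"
    using in_some_cell[OF cw x] .
  have sub: "snd c y' \<in> A'" if as: "cw_subcomplex \<Phi> A'" "snd c y \<in> A'" "y' \<in> disc_set (fst c)" "y \<in> open_disc_set (fst c)" "c \<in> \<Phi>"
    for A' y' y c
  proof -
    obtain \<Psi> where \<Psi>: "\<Psi> \<subseteq> \<Phi>" "A' = (\<Union>c\<in>\<Psi>. open_cell c)" "\<forall>c\<in>\<Psi>. closed_cell c \<subseteq> A'"
      using as(1) unfolding cw_subcomplex_def by blast
    then obtain d where d: "d \<in> \<Psi>" "snd c y \<in> open_cell d" using as(2) by blast
    have "snd c y \<in> open_cell c" using as(4) by (auto simp: open_cell_def)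
    then have "c = d" using cw_structureD(4)[OF cw as(5)] d \<Psi>(1) by blast
    then show ?thesis using d(1) \<Psi>(3) as(3) by (auto simp: closed_cell_def)
  qed
  let ?Q = "\<lambda>x p. 0 \<le> snd p \<and> snd p \<le> (1::real) \<and> (snd p \<noteq> 0 \<longrightarrow> fst p \<in> A) \<and>
         (\<forall>A'. cw_subcomplex \<Phi> A' \<longrightarrow> x \<in> A' \<longrightarrow> fst p \<in> A')"
  have "?Q (snd c y) (cw_push \<Phi> A (Suc (fst c)) (snd c y, t))"
    using cw c y t
  proof (induction rule: cw_push_induct[where A = A])
    case (stop c y t)
    then show ?case by auto
  next
    case (bottom c y t y')
    show ?case
      unfolding cw_push_step[OF cw bottom(1,2,7,5,6)] cw_push_bottom
      using bottom sub by auto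
  next
    case (side c y t d w y' s)
    have "cw_push \<Phi> A (Suc (fst c)) (snd c y, t) = cw_push \<Phi> A (fst c) (snd d w, s)"
      using cw_push_step[OF cw side(1,2,7,5,6)] side(14) by simp
    also have "\<dots> = cw_push \<Phi> A (Suc (fst d)) (snd d w, s)"
      using cw_push_enough[OF cw side(11,13,9,10)] side(12) by blast
    finally show ?case
      using side(15) sub[OF _ _ side(8,2,1)] side(14) by auto
  qed
  moreover have "cell_of \<Phi> x = c"
    using cell_of_eq[OF cw c] y xy by (auto simp: open_cell_def)
  ultimately show ?thesis
    by (simp add: cw_retract_def xy del: cw_push.simps)
qed

text \<open>On a cell outside of the subcomplex the retraction factors through the radial projection, whose
  image consists of the bottom and the cylinder over the boundary sphere. On the bottom the retraction is
  the identity, and over the sphere it is known on finitely many cells of smaller dimension, so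
  continuity on all cylinders over cells follows by induction on the dimension. The topology of \<open>X \<times> [0,1]\<close> is determined by these
  cylinders, by the criterion for compactly generated products.\<close>

lemma continuous_map_cw_retract:
  assumes cw: "cw_structure X \<Phi>" and A: "cw_subcomplex \<Phi> A"
  shows "continuous_map (prod_topology X unit_interval) (prod_topology X unit_interval) (cw_retract \<Phi> A)"
proof -
  let ?XI = "prod_topology X unit_interval" and ?R = "cw_retract \<Phi> A"
  have HX: "Hausdorff_space ?XI"
    using cw_structureD(1)[OF cw] unit_interval_facts by (simp add: Hausdorff_space_prod_topology)
  have AX: "A \<subseteq> topspace X"
    using closedin_cw_subcomplex[OF cw A] closedin_subset by blast
  have cells: "continuous_map (prod_topology (disc (fst c)) unit_interval) ?XI (\<lambda>(y, t). ?R (snd c y, t))"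
    if "c \<in> \<Phi>" for c
    using that
  proof (induction "fst c" arbitrary: c rule: less_induct)
    case (less c)
    let ?B = "prod_topology (disc (fst c)) unit_interval"
    have chi: "continuous_map (disc (fst d)) X (snd d)" if "d \<in> \<Phi>" for d
      using cw_structureD(2)[OF cw that] .
    have chiI: "continuous_map (prod_topology (disc (fst d)) unit_interval) ?XI (\<lambda>(y, t). (snd d y, t))" if "d \<in> \<Phi>" for d
      unfolding case_prod_unfold
      by (intro continuous_map_pairedI continuous_map_snd continuous_map_comp[OF continuous_map_fst chi[OF that]])
    show ?case
    proof (cases "open_cell c \<subseteq> A")
      case True
      obtain \<Psi> where \<Psi>: "\<Psi> \<subseteq> \<Phi>" "A = (\<Union>c\<in>\<Psi>. open_cell c)" "\<forall>c\<in>\<Psi>. closed_cell c \<subseteq> A"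
        using A unfolding cw_subcomplex_def by blast
      have "(\<lambda>i. 0) \<in> open_disc_set (fst c)" by (simp add: in_open_disc_set disc_norm_def)
      then obtain x where x: "x \<in> open_cell c" by (auto simp: open_cell_def)
      then obtain d where "d \<in> \<Psi>" "x \<in> open_cell d" using True \<Psi>(2) by blast
      then have "c \<in> \<Psi>" using cw_structureD(4)[OF cw less.prems _ x] \<Psi>(1) by blast
      then have "snd c y \<in> A" if "y \<in> disc_set (fst c)" for y
        using \<Psi>(3) that by (auto simp: closed_cell_def)
      then show ?thesis
        by (intro continuous_map_eq[OF chiI[OF less.prems]]) (auto simp: cw_retract_on_subcomplex)
    next
      case nA: False
      obtain F where F: "F \<subseteq> \<Phi>" "finite F" "\<forall>d\<in>F. fst d < fst c" "cell_frontier c \<subseteq> (\<Union>d\<in>F. open_cell d)"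
        using closed_cell_covered[OF cw less.prems] .
      let ?Fr = "\<Union>d\<in>F. closed_cell d"
      have clo: "closedin X (closed_cell d)" if "d \<in> \<Phi>" for d
        using compactin_closed_cell[OF cw that] compactin_imp_closedin cw_structureD(1)[OF cw] by blast
      have ccX: "closed_cell d \<subseteq> topspace X" if "d \<in> \<Phi>" for d
        using clo[OF that] closedin_subset by blast
      have one: "continuous_map (subtopology ?XI (closed_cell d \<times> {0..1})) ?XI ?R" if d: "d \<in> F" for d
      proof -
        have d\<Phi>: "d \<in> \<Phi>" "fst d < fst c" using d F by auto
        let ?D = "prod_topology (disc (fst d)) unit_interval"
        let ?S = "subtopology ?XI (closed_cell d \<times> {0..1})"
        have 1: "continuous_map ?D ?S (\<lambda>(y, t). (snd d y, t))"
          using chiI[OF d\<Phi>(1)] by (auto simp: continuous_map_in_subtopology closed_cell_def)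
        have "closed_map ?D ?S (\<lambda>(y, t). (snd d y, t))"
          using 1 HX compact_space_disc unit_interval_facts
          by (intro continuous_imp_closed_map) (auto simp: compact_space_prod_topology Hausdorff_space_subtopology)
        \<comment> \<open>a map from a compact space onto a Hausdorff space is a quotient map\<close>
        moreover have "(\<lambda>(y, t). (snd d y, t)) ` topspace ?D = topspace ?S"
          using ccX[OF d\<Phi>(1)] by (force simp: closed_cell_def image_iff)
        ultimately have "quotient_map ?D ?S (\<lambda>(y, t). (snd d y, t))"
          using 1 continuous_closed_imp_quotient_map by blast
        moreover have "continuous_map ?D ?XI (?R \<circ> (\<lambda>(y, t). (snd d y, t)))"
          using less.hyps[OF d\<Phi>(2,1)] by (simp add: o_def case_prod_unfold)
        ultimately show ?thesis
          by (simp add: continuous_compose_quotient_map_eq)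
      qed
      let ?S = "subtopology ?XI (?Fr \<times> {0..1})"
      have fr: "continuous_map ?S ?XI ?R"
      proof (rule pasting_lemma_closed[where I = F and T = "\<lambda>d. closed_cell d \<times> {0..1}" and f = "\<lambda>_. ?R"])
        show "finite F" by (rule F)
        fix d assume d: "d \<in> F"
        have "closedin ?XI (closed_cell d \<times> {0..1})"
          using clo[of d] d F by (auto simp: closedin_prod_Times_iff)
        then show "closedin ?S (closed_cell d \<times> {0..1})"
          using d by (intro closedin_subset_topspace) auto
        have "?Fr \<times> {0..1} \<inter> closed_cell d \<times> {0..1} = closed_cell d \<times> {0..1::real}"
          using d by blast
        then show "continuous_map (subtopology ?S (closed_cell d \<times> {0..1})) ?XI ?R"
          using one[OF d] by (simp add: subtopology_subtopology)
      qed auto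
      let ?P = "disc_push (fst c)"
      have P: "continuous_map ?B ?B ?P" by (rule continuous_map_disc_push)
      have Pin: "fst (?P p) \<in> disc_set (fst c)" "0 \<le> snd (?P p)" "snd (?P p) \<le> 1"
         "snd (?P p) \<noteq> 0 \<Longrightarrow> fst (?P p) \<notin> open_disc_set (fst c)" if "p \<in> topspace ?B" for p
        using that disc_push_props[of "fst p" "fst c" "snd p"] by auto
      let ?T = "\<lambda>b. if b then {p \<in> topspace ?B. snd (?P p) \<in> {0}}
                         else {p \<in> topspace ?B. disc_norm (fst c) (fst (?P p)) \<in> {1}}"
      have nrm: "disc_norm (fst c) y = 1" if "y \<in> disc_set (fst c)" "y \<notin> open_disc_set (fst c)" for y
        using that by (auto simp: in_disc_set in_open_disc_set)
      let ?g = "\<lambda>p. ?R (snd c (fst (?P p)), snd (?P p))"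
      have "continuous_map ?B ?XI ?g"
      proof (rule pasting_lemma_closed[where I = "{True, False}" and T = ?T and f = "\<lambda>_. ?g"])
        fix b :: bool
        have "continuous_map ?B euclideanreal (\<lambda>p. snd (?P p))"
          by (rule continuous_map_from_unit_interval[OF continuous_map_snd_comp[OF P]])
        moreover have "continuous_map ?B euclideanreal (\<lambda>p. disc_norm (fst c) (fst (?P p)))"
          by (rule continuous_map_comp[OF continuous_map_fst_comp[OF P] continuous_map_disc_norm])
        ultimately show "closedin ?B (?T b)"
          by (cases b) (simp_all only: if_True if_False, (rule closedin_continuous_map_preimage[where Y = euclideanreal]; simp)+)
        have comp: "continuous_map (subtopology ?B (?T b)) ?XI (\<lambda>p. (snd c (fst (?P p)), snd (?P p)))"
          using continuous_map_comp[OF P chiI[OF less.prems]]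
          by (intro continuous_map_from_subtopology) (simp add: case_prod_unfold)
        show "continuous_map (subtopology ?B (?T b)) ?XI ?g"
        proof (cases b)
          case True
          then show ?thesis
            by (intro continuous_map_eq[OF comp]) (auto simp: cw_retract_bottom)
        next
          case False
          have fr_in: "snd c y \<in> ?Fr" if "y \<in> disc_set (fst c)" "disc_norm (fst c) y = 1" for y
          proof -
            have "snd c y \<in> cell_frontier c" using that by (auto simp: cell_frontier_def in_open_disc_set)
            then obtain d where "d \<in> F" "snd c y \<in> open_cell d" using F(4) by auto
            then show ?thesis using open_cell_subset_closed_cell[of d] by auto
          qed
          have "continuous_map (subtopology ?B (?T b)) ?S (\<lambda>p. (snd c (fst (?P p)), snd (?P p)))"
            unfolding continuous_map_in_subtopology
          proof (intro conjI comp image_subset_iff_funcset[THEN iffD1] image_subsetI)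
            fix p assume p: "p \<in> topspace (subtopology ?B (?T b))"
            then have p': "p \<in> topspace ?B" "disc_norm (fst c) (fst (?P p)) = 1" using False by auto
            show "(snd c (fst (?P p)), snd (?P p)) \<in> ?Fr \<times> {0..1}"
              using fr_in[OF Pin(1)[OF p'(1)] p'(2)] Pin(2,3)[OF p'(1)] by auto
          qed
          from continuous_map_comp[OF this fr] show ?thesis by simp
        qed
        fix p assume p: "p \<in> topspace ?B"
        then have "p \<in> ?T (snd (?P p) = 0)"
          using Pin(4)[OF p] nrm[OF Pin(1)[OF p]] by auto
        then show "\<exists>j. j \<in> {True, False} \<and> p \<in> ?T j \<and> ?g p = ?g p" by blast
      qed auto
      moreover have "?g p = (\<lambda>(y, t). ?R (snd c y, t)) p" if "p \<in> topspace ?B" for p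
        using that cw_retract_disc_push[OF cw A less.prems nA, of "fst p" "snd p" "fst (?P p)" "snd (?P p)"]
        by (auto simp: case_prod_unfold)
      ultimately show ?thesis
        by (rule continuous_map_eq)
    qed
  qed
  have in_XI: "?R p \<in> topspace ?XI" if "p \<in> topspace ?XI" for p
  proof -
    obtain x t where p: "p = (x, t)" by (cases p)
    then have xt: "x \<in> topspace X" "0 \<le> t" "t \<le> 1" using that by auto
    obtain c y where cy: "c \<in> \<Phi>" "y \<in> open_disc_set (fst c)" "x = snd c y"
      using in_some_cell[OF cw xt(1)] .
    then have "y \<in> disc_set (fst c)" using open_disc_subset by blast
    with cy show ?thesis
      using continuous_map_image_subset_topspace[OF cells[of c]] xt p by (force simp: image_subset_iff)
  qed
  have kXI: "k_space ?XI"
    using k_space_cw[OF cw] unit_interval_facts by (simp add: k_space_prod_topology_right)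
  show ?thesis
    unfolding continuous_map
  proof (intro conjI allI impI)
    show "?R ` topspace ?XI \<subseteq> topspace ?XI" using in_XI by blast
    fix U assume U: "openin ?XI U"
    let ?V = "{p \<in> topspace ?XI. ?R p \<in> U}"
    have pre: "openin (prod_topology (disc (fst c)) unit_interval) {p. fst p \<in> disc_set (fst c) \<and> snd p \<in> {0..1} \<and> ?R (snd c (fst p), snd p) \<in> U}"
      if "c \<in> \<Phi>" for c
      using openin_continuous_map_preimage[OF cells[OF that] U]
      by (rule back_subst[where P = "openin _"]) auto
    have chiX: "snd c y \<in> topspace X" if "c \<in> \<Phi>" "y \<in> disc_set (fst c)" for c y
      using continuous_map_image_subset_topspace[OF cw_structureD(2)[OF cw that(1)]] that by auto
    have "openin (kification ?XI) ?V"
    proof (rule openin_kification_prod_if_compact_slices)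
      show "?V \<subseteq> topspace X \<times> topspace unit_interval" by auto
      fix x assume x: "x \<in> topspace X"
      obtain c y where cy: "c \<in> \<Phi>" "y \<in> open_disc_set (fst c)" "x = snd c y"
        using in_some_cell[OF cw x] .
      then have c: "c \<in> \<Phi>" "y \<in> disc_set (fst c)" "x = snd c y"
        using open_disc_subset by blast+
      have "continuous_map unit_interval (prod_topology (disc (fst c)) unit_interval) (\<lambda>t. (y, t))"
        using c by (intro continuous_map_pairedI) auto
      from openin_continuous_map_preimage[OF this pre[OF c(1)]]
      have "openin unit_interval {t \<in> topspace unit_interval. (x, t) \<in> ?V}"
        by (rule back_subst[where P = "openin _"]) (use c chiX in auto)
      then show "openin (kification unit_interval) {t \<in> topspace unit_interval. (x, t) \<in> ?V}"
        by (rule openin_kification_finer)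
    next
      fix N assume N: "compactin unit_interval N"
      show "openin X {x \<in> topspace X. \<forall>t\<in>N. (x, t) \<in> ?V}"
      proof (rule openin_cw[OF cw])
        fix c assume c: "c \<in> \<Phi>"
        have "k_space (disc (fst c))" by (simp add: compact_imp_k_space compact_space_disc)
        from compact_slices_openin[OF openin_kification_finer[OF pre[OF c]] this N]
        show "openin (disc (fst c)) {y \<in> disc_set (fst c). snd c y \<in> {x \<in> topspace X. \<forall>t\<in>N. (x, t) \<in> ?V}}"
          by (rule back_subst[where P = "openin _"])
            (use chiX[OF c] compactin_subset_topspace[OF N] in auto)
      qed auto
    qed (rule unit_interval_facts)
    then show "openin ?XI ?V"
      by (simp only: kXI[folded kification_eq_self])
  qed
qed

lemma continuous_map_if_closed:
  assumes "closedin X S" "closedin X T" "topspace X \<subseteq> S \<union> T"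
    and "continuous_map (subtopology X S) Y f" "continuous_map (subtopology X T) Y g"
    and "\<And>x. x \<in> S \<Longrightarrow> x \<in> T \<Longrightarrow> f x = g x"
  shows "continuous_map X Y (\<lambda>x. if x \<in> S then f x else g x)"
proof (rule pasting_lemma_closed[where I = "{True, False}" and T = "\<lambda>b. if b then S else T"
        and f = "\<lambda>b. if b then f else g"])
  fix x assume "x \<in> topspace X"
  then show "\<exists>j. j \<in> {True, False} \<and> x \<in> (if j then S else T) \<and>
      (if x \<in> S then f x else g x) = (if j then f else g) x"
    using assms(3) by (cases "x \<in> S") auto
qed (use assms in auto)

lemma continuous_map_if_le:
  assumes u: "continuous_map X euclideanreal u" and v: "continuous_map X euclideanreal v"
    and "continuous_map (subtopology X {x. u x \<le> v x}) Y f"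
    and "continuous_map (subtopology X {x. v x \<le> u x}) Y g"
    and "\<And>x. x \<in> topspace X \<Longrightarrow> u x = v x \<Longrightarrow> f x = g x"
  shows "continuous_map X Y (\<lambda>x. if u x \<le> v x then f x else g x)"
proof -
  have c: "continuous_map X euclideanreal (\<lambda>x. v x - u x)"
    by (intro continuous_map_diff u v)
  have 1: "closedin X {x \<in> topspace X. v x - u x \<in> {0..}}" "closedin X {x \<in> topspace X. v x - u x \<in> {..0}}"
    by (rule closedin_continuous_map_preimage[OF c]; simp)+
  have "topspace X \<inter> {x. u x \<le> v x} = {x \<in> topspace X. v x - u x \<in> {0..}}"
    "topspace X \<inter> {x. v x \<le> u x} = {x \<in> topspace X. v x - u x \<in> {..0}}"
    by auto
  then have 2: "subtopology X {x. u x \<le> v x} = subtopology X {x \<in> topspace X. v x - u x \<in> {0..}}"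
    "subtopology X {x. v x \<le> u x} = subtopology X {x \<in> topspace X. v x - u x \<in> {..0}}"
    using subtopology_restrict[of X] by metis+
  have "continuous_map X Y (\<lambda>x. if x \<in> {x \<in> topspace X. v x - u x \<in> {0..}} then f x else g x)"
    using assms(3,4,5) unfolding 2 by (intro continuous_map_if_closed[OF 1]) auto
  then show ?thesis
    by (rule continuous_map_eq) auto
qed

lemmas real_continuous_intros = continuous_map_diff continuous_map_add continuous_map_real_mult
  continuous_map_real_max continuous_map_real_min continuous_map_real_abs continuous_map_const[THEN iffD2]

text \<open>What the CW structure of a pair \<open>(C, E)\<close> with null homotopic inclusion is used for: \<open>R\<close> is a
  retraction of \<open>C \<times> [0,1]\<close> onto \<open>C \<times> 0 \<union> E \<times> [0,1]\<close>; \<open>h\<close> is a pointed homotopy of the identity to a map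
  that is constant on \<open>E\<close>; \<open>k\<close> is a pointed homotopy, preserving \<open>E\<close>, from the identity to a map that is
  constant where the distance-like function \<open>d\<close> is less than \<open>1\<close>.\<close>

definition null_pair_data ::
  "'a pspace \<Rightarrow> 'a set \<Rightarrow> ('a \<times> real \<Rightarrow> 'a \<times> real) \<Rightarrow> ('a \<times> real \<Rightarrow> 'a) \<Rightarrow> ('a \<times> real \<Rightarrow> 'a) \<Rightarrow> ('a \<Rightarrow> real) \<Rightarrow> bool" where
  "null_pair_data C E R h k d \<longleftrightarrow>
     Hausdorff_space (space_of C) \<and> k_space (space_of C) \<and> closedin (space_of C) E \<and> basept C \<in> E \<and>
     continuous_map (prod_topology (space_of C) unit_interval) (prod_topology (space_of C) unit_interval) R \<and>
     (\<forall>x. R (x, 0) = (x, 0)) \<and> (\<forall>x\<in>E. \<forall>t. R (x, t) = (x, t)) \<and>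
     (\<forall>x\<in>points C. \<forall>t\<in>{0..1}. snd (R (x, t)) \<noteq> 0 \<longrightarrow> fst (R (x, t)) \<in> E) \<and>
     continuous_map (prod_topology (space_of C) unit_interval) (space_of C) h \<and>
     (\<forall>x\<in>points C. h (x, 0) = x) \<and> (\<forall>x\<in>E. h (x, 1) = basept C) \<and> (\<forall>t\<in>{0..1}. h (basept C, t) = basept C) \<and>
     continuous_map (prod_topology (space_of C) unit_interval) (space_of C) k \<and>
     (\<forall>x\<in>points C. k (x, 0) = x) \<and> (\<forall>t\<in>{0..1}. k (basept C, t) = basept C) \<and>
     (\<forall>x\<in>E. \<forall>t\<in>{0..1}. k (x, t) \<in> E) \<and>
     continuous_map (space_of C) unit_interval d \<and> d (basept C) = 0 \<and>
     (\<forall>x\<in>points C. d x < 1 \<longrightarrow> k (x, 1) = basept C)"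

lemma cw_subcomplex_basept:
  assumes "c \<in> \<Phi>" "fst c = 0" "open_cell c = {p}"
  shows "cw_subcomplex \<Phi> {p}"
proof -
  have "disc_set 0 = open_disc_set 0"
    by (auto simp: disc_set_def open_disc_set_def)
  then have "closed_cell c = {p}"
    using assms by (simp add: closed_cell_def open_cell_def)
  then show ?thesis
    using assms unfolding cw_subcomplex_def by (intro exI[of _ "{c}"]) auto
qed

text \<open>\<open>R\<close> and \<open>Q\<close> are the retractions belonging to the subcomplexes \<open>A\<close> and \<open>{basept}\<close>. A point of
  the cylinder that \<open>Q\<close> moves to positive height lies over the base point; so the first component of
  \<open>Q\<close> is a homotopy \<open>k\<close> contracting the neighbourhood \<open>d < 1\<close>, with \<open>d\<close> one minus the final height.
  This allows to turn the free null homotopy \<open>H\<close> of \<open>A\<close> into a pointed one \<open>g\<close>, see below; by homotopy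
  extension along \<open>R\<close> it becomes the homotopy \<open>h\<close> of the identity of \<open>X\<close>.\<close>

lemma pointed_cw_pair_null_pair_data:
  fixes X :: "'a pspace"
  assumes pair: "pointed_cw_pair X A" and null: "null_homotopic_inclusion X A"
  shows "\<exists>R h k d. null_pair_data X A R h k d"
proof -
  obtain \<Phi> c0 where cw: "cw_structure (space_of X) \<Phi>" and A: "cw_subcomplex \<Phi> A" and b: "basept X \<in> A"
    and c0: "c0 \<in> \<Phi>" "fst c0 = 0" "open_cell c0 = {basept X}"
    using pair unfolding pointed_cw_pair_def by blast
  let ?C = "space_of X" and ?p = "basept X"
  let ?CI = "prod_topology ?C unit_interval"
  have Acl: "closedin ?C A"
    by (rule closedin_cw_subcomplex[OF cw A])
  have AC: "A \<subseteq> topspace ?C" using Acl closedin_subset by blast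
  have pC: "?p \<in> topspace ?C" using b AC by blast
  define R where "R = cw_retract \<Phi> A"
  define Q where "Q = cw_retract \<Phi> {?p}"
  have R: "continuous_map ?CI ?CI R" and Q: "continuous_map ?CI ?CI Q"
    unfolding R_def Q_def
    by (intro continuous_map_cw_retract cw A cw_subcomplex_basept[OF c0])+
  have Rp: "0 \<le> snd (R (x, t))" "snd (R (x, t)) \<le> 1" "snd (R (x, t)) \<noteq> 0 \<Longrightarrow> fst (R (x, t)) \<in> A"
    if "x \<in> topspace ?C" "t \<in> {0..1}" for x t
    using cw_retract_props[OF cw that(1), of t A] that unfolding R_def by auto
  have Qp: "0 \<le> snd (Q (x, t))" "snd (Q (x, t)) \<le> 1" "snd (Q (x, t)) \<noteq> 0 \<Longrightarrow> fst (Q (x, t)) = ?p"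
      "x \<in> A \<Longrightarrow> fst (Q (x, t)) \<in> A"
    if "x \<in> topspace ?C" "t \<in> {0..1}" for x t
    using cw_retract_props[OF cw that(1), of t "{?p}"] that A unfolding Q_def by auto
  have R0: "R (x, 0) = (x, 0)" and Q0: "Q (x, 0) = (x, 0)" for x
    unfolding R_def Q_def by (rule cw_retract_bottom)+
  have RA: "x \<in> A \<Longrightarrow> R (x, t) = (x, t)" and Qb: "Q (?p, t) = (?p, t)" for x t
    unfolding R_def Q_def by (rule cw_retract_on_subcomplex; simp)+
  define k where "k = (\<lambda>z. fst (Q z))"
  define d where "d = (\<lambda>x. 1 - snd (Q (x, 1)))"
  have k: "continuous_map ?CI ?C k"
    unfolding k_def by (rule continuous_map_fst_comp[OF Q])
  have "continuous_map ?C ?CI (\<lambda>x. (x, 1))"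
    by (intro continuous_map_pairedI) auto
  from continuous_map_from_unit_interval[OF continuous_map_snd_comp[OF continuous_map_comp[OF this Q]]]
  have d: "continuous_map ?C unit_interval d"
    unfolding d_def continuous_map_into_unit_interval
    using Qp by (auto intro!: real_continuous_intros)
  have dp: "d ?p = 0" by (simp add: d_def Qb)
  have d1: "k (x, 1) = ?p" if "x \<in> topspace ?C" "d x < 1" for x
    using Qp(3)[of x 1] that by (simp add: d_def k_def)
  have d01: "0 \<le> d x" "d x \<le> 1" if "x \<in> topspace ?C" for x
    using d that by (auto simp: continuous_map_into_unit_interval)
  obtain c where "homotopic_with (\<lambda>_. True) (subtopology ?C A) ?C id (\<lambda>_. c)"
    using null unfolding null_homotopic_inclusion_def by blast
  then obtain H where H: "continuous_map (prod_topology unit_interval (subtopology ?C A)) ?C H"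
    and H0: "\<And>x. H (0, x) = x" and H1: "\<And>x. H (1, x) = c"
    unfolding homotopic_with_def by auto
  let ?AI = "prod_topology (subtopology ?C A) unit_interval"
  \<comment> \<open>First contract along \<open>k\<close>, then follow \<open>H\<close>, then return along the track of the base point under
    \<open>H\<close>; \<open>H\<close> is only followed up to time \<open>d\<close>, so the base point, where \<open>d = 0\<close>, rests. The last two
    parts agree where they meet because either \<open>H\<close> has arrived at its constant end (\<open>d = 1\<close>) or \<open>k\<close>
    has arrived at the base point (\<open>d < 1\<close>).\<close>
  define g where "g = (\<lambda>z. if snd z \<le> 2/3
      then H (min (max 0 (3 * snd z - 1)) (d (fst z)), k (fst z, min 1 (3 * snd z)))
      else H (min (3 - 3 * snd z) (d (fst z)), ?p))"
  have AIC: "continuous_map ?AI ?C fst"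
    by (rule continuous_map_into_fulltopology[OF continuous_map_fst])
  have sn: "continuous_map ?AI euclideanreal snd"
    by (rule continuous_map_from_unit_interval[OF continuous_map_snd])
  have dn: "continuous_map ?AI euclideanreal (\<lambda>z. d (fst z))"
    by (rule continuous_map_comp[OF AIC continuous_map_from_unit_interval[OF d]])
  have g: "continuous_map ?AI ?C g"
    unfolding g_def
  proof (rule continuous_map_if_le)
    show "continuous_map (subtopology ?AI {x. snd x \<le> 2/3}) ?C
        (\<lambda>z. H (min (max 0 (3 * snd z - 1)) (d (fst z)), k (fst z, min 1 (3 * snd z))))"
    proof (rule continuous_map_from_subtopology[OF continuous_map_comp[OF _ H]])
      have "continuous_map ?AI ?C (\<lambda>z. k (fst z, min 1 (3 * snd z)))"
        by (intro continuous_map_comp[OF _ k] continuous_map_pairedI AIC)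
          (auto simp: continuous_map_into_unit_interval intro!: real_continuous_intros sn)
      moreover have "k (fst z, min 1 (3 * snd z)) \<in> A" if "z \<in> topspace ?AI" for z
        using that Qp(4)[of "fst z" "min 1 (3 * snd z)"] AC by (auto simp: k_def)
      ultimately have 1: "continuous_map ?AI (subtopology ?C A) (\<lambda>z. k (fst z, min 1 (3 * snd z)))"
        by (auto simp: continuous_map_in_subtopology)
      have "continuous_map ?AI unit_interval (\<lambda>z. min (max 0 (3 * snd z - 1)) (d (fst z)))"
        using d01 AC by (auto simp: continuous_map_into_unit_interval min_le_iff_disj intro!: real_continuous_intros sn dn)
      then show "continuous_map ?AI (prod_topology unit_interval (subtopology ?C A))
          (\<lambda>z. (min (max 0 (3 * snd z - 1)) (d (fst z)), k (fst z, min 1 (3 * snd z))))"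
        by (intro continuous_map_pairedI 1)
    qed
    have "continuous_map ?AI unit_interval (\<lambda>z. min (3 - 3 * snd z) (d (fst z)))"
      using d01 AC by (auto simp: continuous_map_into_unit_interval min_le_iff_disj intro!: real_continuous_intros sn dn)
    then show "continuous_map (subtopology ?AI {x. 2/3 \<le> snd x}) ?C (\<lambda>z. H (min (3 - 3 * snd z) (d (fst z)), ?p))"
      using b pC by (intro continuous_map_from_subtopology[OF continuous_map_comp[OF _ H]] continuous_map_pairedI) auto
    fix z assume z: "z \<in> topspace ?AI" "snd z = 2/3"
    show "H (min (max 0 (3 * snd z - 1)) (d (fst z)), k (fst z, min 1 (3 * snd z))) = H (min (3 - 3 * snd z) (d (fst z)), ?p)"
    proof (cases "d (fst z) < 1")
      case True
      then show ?thesis using z d1 by auto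
    next
      case False
      then have "d (fst z) = 1" using z d01[of "fst z"] by auto
      then have "min (max 0 (3 * snd z - 1)) (d (fst z)) = 1" "min (3 - 3 * snd z) (d (fst z)) = 1"
        using z by auto
      then show ?thesis by (simp only: H1)
    qed
  qed (auto intro: sn)
  have g0: "g (x, 0) = x" if "x \<in> A" for x
    using d01[of x] AC that Q0 by (auto simp: g_def k_def H0 subset_iff)
  have g1: "g (x, 1) = ?p" if "x \<in> A" for x
    using d01[of x] AC that by (auto simp: g_def H0 subset_iff)
  have gp: "g (?p, t) = ?p" if "t \<in> {0..1}" for t
    using that by (auto simp: g_def dp k_def Qb H0 min_def)
  define h where "h = (\<lambda>z. if z \<in> {z \<in> topspace ?CI. fst (R z) \<in> A} then g (R z) else fst (R z))"
  have h: "continuous_map ?CI ?C h"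
    unfolding h_def
  proof (rule continuous_map_if_closed)
    show "closedin ?CI {z \<in> topspace ?CI. fst (R z) \<in> A}"
      by (rule closedin_continuous_map_preimage[OF continuous_map_fst_comp[OF R] Acl])
    show "closedin ?CI {z \<in> topspace ?CI. snd (R z) \<in> {0}}"
      by (rule closedin_continuous_map_preimage[OF continuous_map_from_unit_interval[OF continuous_map_snd_comp[OF R]]]) simp
    show "topspace ?CI \<subseteq> {z \<in> topspace ?CI. fst (R z) \<in> A} \<union> {z \<in> topspace ?CI. snd (R z) \<in> {0}}"
      using Rp by auto
    have "continuous_map (subtopology ?CI {z \<in> topspace ?CI. fst (R z) \<in> A}) ?AI R"
      using continuous_map_from_subtopology[OF R, of "{z \<in> topspace ?CI. fst (R z) \<in> A}"]
      by (auto simp: continuous_map_pairwise continuous_map_in_subtopology)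
    from continuous_map_comp[OF this g]
    show "continuous_map (subtopology ?CI {z \<in> topspace ?CI. fst (R z) \<in> A}) ?C (\<lambda>z. g (R z))" .
    show "continuous_map (subtopology ?CI {z \<in> topspace ?CI. snd (R z) \<in> {0}}) ?C (\<lambda>z. fst (R z))"
      by (rule continuous_map_from_subtopology[OF continuous_map_fst_comp[OF R]])
    fix z assume "z \<in> {z \<in> topspace ?CI. fst (R z) \<in> A}" "z \<in> {z \<in> topspace ?CI. snd (R z) \<in> {0}}"
    then show "g (R z) = fst (R z)"
      using g0[of "fst (R z)"] by (cases "R z") auto
  qed
  have "null_pair_data X A R h k d"
    unfolding null_pair_data_def
  proof (intro conjI ballI allI impI)
    show "Hausdorff_space ?C" "k_space ?C" using cw_structureD(1)[OF cw] k_space_cw[OF cw] .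
    show "h (x, 0) = x" if "x \<in> topspace ?C" for x
      using that by (auto simp: h_def R0 g0)
    show "h (x, 1) = ?p" if "x \<in> A" for x
      using that AC by (auto simp: h_def RA g1)
    show "h (?p, t) = ?p" if "t \<in> {0..1}" for t
      using that b pC by (auto simp: h_def RA gp)
    show "k (x, 0) = x" for x by (simp add: k_def Q0)
    show "k (?p, t) = ?p" for t by (simp add: k_def Qb)
    show "k (x, t) \<in> A" if "x \<in> A" "t \<in> {0..1}" for x t
      using Qp(4) that AC by (auto simp: k_def)
  qed (use Acl b R R0 RA Rp h k d dp d1 in auto)
  then show ?thesis by blast
qed

section \<open>Pairs with a null homotopic inclusion split off a cone\<close>

definition pair_preserving :: "'a pspace \<Rightarrow> 'a set \<Rightarrow> 'b pspace \<Rightarrow> 'b set \<Rightarrow> ('a \<Rightarrow> 'b) \<Rightarrow> bool" where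
  "pair_preserving X A Y B h \<longleftrightarrow> h (basept X) = basept Y \<and> h ` A \<subseteq> B"

definition pair_homotopy_equivalent :: "'a pspace \<Rightarrow> 'a set \<Rightarrow> 'b pspace \<Rightarrow> 'b set \<Rightarrow> bool" where
  "pair_homotopy_equivalent X A Y B \<longleftrightarrow> (\<exists>f g.
     continuous_map (space_of X) (space_of Y) f \<and> pair_preserving X A Y B f \<and>
     continuous_map (space_of Y) (space_of X) g \<and> pair_preserving Y B X A g \<and>
     homotopic_with (pair_preserving X A X A) (space_of X) (space_of X) (g \<circ> f) id \<and>
     homotopic_with (pair_preserving Y B Y B) (space_of Y) (space_of Y) (f \<circ> g) id)"

lemma homotopic_with_pairI:
  assumes "continuous_map (prod_topology unit_interval (space_of X)) (space_of Y) H"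
    and "\<And>x. x \<in> points X \<Longrightarrow> H (0, x) = f x" "\<And>x. x \<in> points X \<Longrightarrow> H (1, x) = g x"
    and "\<And>t. t \<in> {0..1} \<Longrightarrow> H (t, basept X) = basept Y"
    and "\<And>t x. t \<in> {0..1} \<Longrightarrow> x \<in> A \<Longrightarrow> H (t, x) \<in> B"
    and "basept X \<in> points X" "A \<subseteq> points X"
  shows "homotopic_with (pair_preserving X A Y B) (space_of X) (space_of Y) f g"
proof (subst homotopic_with)
  show "pair_preserving X A Y B h = pair_preserving X A Y B k"
    if "\<And>x. x \<in> points X \<Longrightarrow> h x = k x" for h k
    using that assms(6,7) by (auto simp: pair_preserving_def image_subset_iff subset_iff)
qed (use assms in \<open>auto simp: pair_preserving_def\<close>)

lemma continuous_map_from_sum: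
  assumes "\<And>j. j \<in> J \<Longrightarrow> continuous_map (X j) Z (\<lambda>x. f (j, x))"
  shows "continuous_map (sum_topology X J) Z f"
  unfolding continuous_map
proof (intro conjI allI impI)
  show "f ` topspace (sum_topology X J) \<subseteq> topspace Z"
    using continuous_map_image_subset_topspace[OF assms] by fastforce
  fix U assume U: "openin Z U"
  have eq: "{x. (j, x) \<in> {p \<in> topspace (sum_topology X J). f p \<in> U}} = {x \<in> topspace (X j). f (j, x) \<in> U}"
    if "j \<in> J" for j
    using that by auto
  show "openin (sum_topology X J) {p \<in> topspace (sum_topology X J). f p \<in> U}"
    unfolding openin_sum_topology using openin_continuous_map_preimage[OF assms U] eq by auto
qed

lemma continuous_map_sum_inject: "j \<in> J \<Longrightarrow> continuous_map (X j) (sum_topology X J) (\<lambda>x. (j, x))"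
  by (simp add: continuous_map_component_injection)

lemma continuous_map_from_prod_sum:
  assumes "\<And>j. j \<in> J \<Longrightarrow> continuous_map (prod_topology I (X j)) Z (\<lambda>(t, x). f (t, (j, x)))"
  shows "continuous_map (prod_topology I (sum_topology X J)) Z f"
proof (rule pasting_lemma[where I = J and f = "\<lambda>_. f" and T = "\<lambda>j. topspace I \<times> ({j} \<times> topspace (X j))"])
  fix j assume j: "j \<in> J"
  have op: "openin (sum_topology X J) ({j} \<times> U)" if "openin (X j) U" for U
    unfolding openin_sum_topology
  proof (intro conjI ballI)
    show "{j} \<times> U \<subseteq> Sigma J (topspace \<circ> X)"
      using j openin_subset[OF that] by auto
    fix i
    show "openin (X i) {x. (i, x) \<in> {j} \<times> U}"
      using that by (cases "i = j") auto
  qed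
  show "openin (prod_topology I (sum_topology X J)) (topspace I \<times> ({j} \<times> topspace (X j)))"
    using op[of "topspace (X j)"] by (simp add: openin_prod_Times_iff)
  have "continuous_map (subtopology (sum_topology X J) ({j} \<times> topspace (X j))) (X j) snd"
    unfolding continuous_map
  proof (intro conjI allI impI)
    fix U assume U: "openin (X j) U"
    have "{p \<in> topspace (subtopology (sum_topology X J) ({j} \<times> topspace (X j))). snd p \<in> U}
        = ({j} \<times> U) \<inter> ({j} \<times> topspace (X j))"
      using j openin_subset[OF U] by auto
    then show "openin (subtopology (sum_topology X J) ({j} \<times> topspace (X j)))
        {p \<in> topspace (subtopology (sum_topology X J) ({j} \<times> topspace (X j))). snd p \<in> U}"
      using op[OF U] openin_subtopology by blast
  qed auto
  then have "continuous_map (prod_topology I (subtopology (sum_topology X J) ({j} \<times> topspace (X j))))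
      (prod_topology I (X j)) (\<lambda>z. (fst z, snd (snd z)))"
    by (intro continuous_map_pairedI continuous_map_fst continuous_map_comp[OF continuous_map_snd])
  from continuous_map_comp[OF this assms[OF j]]
  have "continuous_map (subtopology (prod_topology I (sum_topology X J)) (topspace I \<times> ({j} \<times> topspace (X j))))
      Z (\<lambda>z. f (fst z, (j, snd (snd z))))"
    by (simp add: subtopology_Times)
  then show "continuous_map (subtopology (prod_topology I (sum_topology X J)) (topspace I \<times> ({j} \<times> topspace (X j)))) Z f"
    by (rule continuous_map_eq) auto
qed (auto simp: topspace_sum_topology)

lemma continuous_map_case_collapse:
  assumes "continuous_map X Z F" "\<And>x. x \<in> topspace X \<Longrightarrow> x \<in> S \<Longrightarrow> F x = z0" "z0 \<in> topspace Z"
  shows "continuous_map (space_of (collapse X S)) Z (case_option z0 F)"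
proof (rule continuous_map_from_collapse)
  show "continuous_map X Z (\<lambda>x. case_option z0 F (collapse_map S x))"
    by (rule continuous_map_eq[OF assms(1)]) (auto simp: collapse_map_def assms(2))
qed (simp add: assms(3))

lemma continuous_map_case_prod_collapse:
  assumes F: "continuous_map (prod_topology unit_interval X) Z F"
    and "\<And>t x. t \<in> {0..1} \<Longrightarrow> x \<in> topspace X \<Longrightarrow> x \<in> S \<Longrightarrow> F (t, x) = z0" "z0 \<in> topspace Z"
  shows "continuous_map (prod_topology unit_interval (space_of (collapse X S))) Z
           (\<lambda>(t, z). case z of None \<Rightarrow> z0 | Some x \<Rightarrow> F (t, x))"
proof (rule continuous_map_from_prod_collapse)
  show "continuous_map (prod_topology unit_interval X) Z
     (\<lambda>(t, x). (\<lambda>(t, z). case z of None \<Rightarrow> z0 | Some x \<Rightarrow> F (t, x)) (t, collapse_map S x))"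
    by (rule continuous_map_eq[OF F]) (auto simp: collapse_map_def assms(2))
qed (simp_all add: assms(3) unit_interval_facts)

definition cone_piece :: "'a pspace \<Rightarrow> 'a pspace \<Rightarrow> 'a set \<Rightarrow> nat \<Rightarrow> ('a \<times> real) topology" where
  "cone_piece B C E n = prod_topology
     (if n = 0 then space_of B else if n = 1 then space_of C else subtopology (space_of C) E)
     (top_of_set (if n = 2 then {0..1} else {0}))"

definition cone_sum :: "'a pspace \<Rightarrow> 'a pspace \<Rightarrow> 'a set \<Rightarrow> (nat \<times> 'a \<times> real) topology" where
  "cone_sum B C E = sum_topology (cone_piece B C E) {0, 1, 2}"

definition cone_base :: "'a pspace \<Rightarrow> 'a pspace \<Rightarrow> (nat \<times> 'a \<times> real) set" where
  "cone_base B C = {(n, x, t). x = basept (if n = 0 then B else C) \<or> n = 2 \<and> t = 1}"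

text \<open>The wedge of \<open>B\<close>, \<open>C\<close> and the reduced cone on \<open>E\<close>; the summands carry the tags \<open>0\<close>, \<open>1\<close> and
  \<open>2\<close>, and the cone has its base at height \<open>0\<close> and its apex, the base point, at height \<open>1\<close>.\<close>

definition cone_wedge :: "'a pspace \<Rightarrow> 'a pspace \<Rightarrow> 'a set \<Rightarrow> (nat \<times> 'a \<times> real) option pspace" where
  "cone_wedge B C E = collapse (cone_sum B C E) (cone_base B C)"

definition cone_wedge_sub :: "'a pspace \<Rightarrow> 'a pspace \<Rightarrow> 'a set \<Rightarrow> (nat \<times> 'a \<times> real) option set" where
  "cone_wedge_sub B C E = {z \<in> points (cone_wedge B C E). \<forall>n x t. z = Some (n, x, t) \<longrightarrow> n \<noteq> 1 \<and> t = 0}"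

locale cone_model =
  fixes B C :: "'a pspace" and E :: "'a set" and R h k d
  assumes data: "null_pair_data C E R h k d" and BB: "basept B \<in> points B"
begin

lemma
  shows HC: "Hausdorff_space (space_of C)"
    and Ecl: "closedin (space_of C) E" and bE: "basept C \<in> E"
    and R: "continuous_map (prod_topology (space_of C) unit_interval) (prod_topology (space_of C) unit_interval) R"
    and R0: "R (x, 0) = (x, 0)" and RE: "x \<in> E \<Longrightarrow> R (x, t) = (x, t)"
    and Rin: "x \<in> points C \<Longrightarrow> t \<in> {0..1} \<Longrightarrow> snd (R (x, t)) \<noteq> 0 \<Longrightarrow> fst (R (x, t)) \<in> E"
    and h: "continuous_map (prod_topology (space_of C) unit_interval) (space_of C) h"
    and h0: "x \<in> points C \<Longrightarrow> h (x, 0) = x" and h1: "x \<in> E \<Longrightarrow> h (x, 1) = basept C"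
    and hb: "t \<in> {0..1} \<Longrightarrow> h (basept C, t) = basept C"
  using data unfolding null_pair_data_def by (simp_all only: simp_thms)

lemma EC: "E \<subseteq> points C"
  using Ecl closedin_subset by blast

lemma bC: "basept C \<in> points C"
  using bE EC by blast

abbreviation "P \<equiv> space_of (cone_wedge B C E)"
abbreviation "CI \<equiv> prod_topology (space_of C) unit_interval"
abbreviation "EI \<equiv> prod_topology (subtopology (space_of C) E) unit_interval"

definition inB :: "'a \<Rightarrow> (nat \<times> 'a \<times> real) option" where "inB x = collapse_map (cone_base B C) (0, x, 0)"
definition inC :: "'a \<Rightarrow> (nat \<times> 'a \<times> real) option" where "inC x = collapse_map (cone_base B C) (1, x, 0)"
definition inE :: "'a \<times> real \<Rightarrow> (nat \<times> 'a \<times> real) option" where "inE p = collapse_map (cone_base B C) (2, p)"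

lemma in_base [simp]: "inB (basept B) = None" "inC (basept C) = None" "inE (basept C, t) = None" "inE (x, 1) = None"
  by (auto simp: inB_def inC_def inE_def cone_base_def collapse_map_def)

lemma cont_inB: "continuous_map (space_of B) P inB"
proof -
  have "continuous_map (space_of B) (cone_piece B C E 0) (\<lambda>x. (x, 0))"
    by (simp add: cone_piece_def continuous_map_pairedI)
  from continuous_map_comp[OF this continuous_map_sum_inject[of 0 "{0,1,2}" "cone_piece B C E"]]
  show ?thesis
    unfolding cone_wedge_def inB_def cone_sum_def by (intro continuous_map_comp[OF _ continuous_map_collapse_map]) auto
qed

lemma cont_inC: "continuous_map (space_of C) P inC"
proof -
  have "continuous_map (space_of C) (cone_piece B C E 1) (\<lambda>x. (x, 0))"
    by (simp add: cone_piece_def continuous_map_pairedI)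
  from continuous_map_comp[OF this continuous_map_sum_inject[of 1 "{0,1,2}" "cone_piece B C E"]]
  show ?thesis
    unfolding cone_wedge_def inC_def cone_sum_def by (intro continuous_map_comp[OF _ continuous_map_collapse_map]) auto
qed

lemma cont_inE: "continuous_map EI P inE"
proof -
  have "cone_piece B C E 2 = EI"
    by (simp add: cone_piece_def)
  with continuous_map_sum_inject[of 2 "{0,1,2}" "cone_piece B C E"]
  have "continuous_map EI (cone_sum B C E) (\<lambda>p. (2, p))" by (simp add: cone_sum_def)
  then show ?thesis
    unfolding cone_wedge_def inE_def by (intro continuous_map_comp[OF _ continuous_map_collapse_map])
qed

lemma points_P:
  "points (cone_wedge B C E) = {None} \<union> inB ` points B \<union> inC ` points C \<union> inE ` (E \<times> {0..1})"
proof -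
  have "topspace (cone_sum B C E) = (\<lambda>x. (0, x, 0)) ` points B \<union> (\<lambda>x. (1, x, 0)) ` points C \<union> (\<lambda>p. (2, p)) ` (E \<times> {0..1})"
    using EC by (auto simp: cone_sum_def topspace_sum_topology cone_piece_def)
  moreover have "points (cone_wedge B C E) = {None} \<union> collapse_map (cone_base B C) ` topspace (cone_sum B C E)"
  proof (intro equalityI subsetI)
    fix z assume "z \<in> points (cone_wedge B C E)"
    then show "z \<in> {None} \<union> collapse_map (cone_base B C) ` topspace (cone_sum B C E)"
      by (cases z) (auto simp: cone_wedge_def points_collapse collapse_map_def image_iff intro!: bexI)
  qed (auto simp: cone_wedge_def points_collapse collapse_map_def)
  ultimately show ?thesis
    by (simp only: image_Un image_image inB_def[symmetric] inC_def[symmetric] inE_def[symmetric] Un_assoc)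
qed

text \<open>On \<open>C \<times> 0 \<union> E \<times> [0,1]\<close>: over a point of \<open>E\<close> the path from \<open>C\<close> along the null homotopy to the base
  point and then down the cone to its base. So \<open>theta\<close> is a homotopy from the inclusion of \<open>E\<close> in \<open>C\<close> to
  the inclusion as the base of the cone.\<close>

definition theta :: "'a \<times> real \<Rightarrow> (nat \<times> 'a \<times> real) option" where
  "theta p = (if snd p \<le> 1/2 then inC (h (fst p, 2 * snd p)) else inE (fst p, 2 - 2 * snd p))"

lemma cont_theta:
  assumes u: "continuous_map Z CI u" and uE: "\<And>z. z \<in> topspace Z \<Longrightarrow> snd (u z) \<noteq> 0 \<Longrightarrow> fst (u z) \<in> E"
  shows "continuous_map Z P (\<lambda>z. theta (u z))"
  unfolding theta_def
proof (rule continuous_map_if_le)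
  have sn: "continuous_map Z euclideanreal (\<lambda>z. snd (u z))"
    by (rule continuous_map_from_unit_interval[OF continuous_map_snd_comp[OF u]])
  show "continuous_map Z euclideanreal (\<lambda>z. snd (u z))" by (rule sn)
  have s01: "0 \<le> snd (u z)" "snd (u z) \<le> 1" if "z \<in> topspace Z" for z
    using continuous_map_image_subset_topspace[OF u] that by auto
  have "continuous_map Z (space_of C) (\<lambda>z. h (fst (u z), min 1 (2 * snd (u z))))"
    using s01 by (intro continuous_map_comp[OF _ h] continuous_map_pairedI continuous_map_fst_comp[OF u])
      (auto simp: continuous_map_into_unit_interval intro!: real_continuous_intros sn)
  from continuous_map_from_subtopology[OF continuous_map_comp[OF this cont_inC]]
  show "continuous_map (subtopology Z {x. snd (u x) \<le> 1/2}) P (\<lambda>z. inC (h (fst (u z), 2 * snd (u z))))"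
    by (rule continuous_map_eq) (simp add: min.absorb2)
  let ?S = "{x. 1/2 \<le> snd (u x)}"
  have "continuous_map (subtopology Z ?S) (subtopology (space_of C) E) (\<lambda>z. fst (u z))"
    using continuous_map_from_subtopology[OF continuous_map_fst_comp[OF u]] uE by (force simp: continuous_map_in_subtopology)
  moreover have "continuous_map (subtopology Z ?S) unit_interval (\<lambda>z. 2 - 2 * snd (u z))"
    using s01 by (auto simp: continuous_map_into_unit_interval intro!: real_continuous_intros continuous_map_from_subtopology[OF sn])
  ultimately have "continuous_map (subtopology Z ?S) EI (\<lambda>z. (fst (u z), 2 - 2 * snd (u z)))"
    by (rule continuous_map_pairedI)
  from continuous_map_comp[OF this cont_inE]
  show "continuous_map (subtopology Z ?S) P (\<lambda>z. inE (fst (u z), 2 - 2 * snd (u z)))" .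
  fix z assume z: "z \<in> topspace Z" "snd (u z) = 1/2"
  then have "fst (u z) \<in> E" using uE by auto
  moreover have "2 * snd (u z) = 1" "2 - 2 * snd (u z) = 1" using z by auto
  ultimately show "inC (h (fst (u z), 2 * snd (u z))) = inE (fst (u z), 2 - 2 * snd (u z))"
    using h1 by (simp only: in_base)
qed simp

lemma theta_simps [simp]:
  "x \<in> points C \<Longrightarrow> theta (x, 0) = inC x" "theta (x, 1) = inE (x, 0)"
  "t \<in> {0..1} \<Longrightarrow> theta (basept C, t) = None"
  by (auto simp: theta_def h0 hb)

end

lemma insert_None_image_collapse_map:
  "insert None (Some ` (T - S)) = insert None (collapse_map S ` T)"
proof (rule set_eqI)
  fix z show "z \<in> insert None (Some ` (T - S)) \<longleftrightarrow> z \<in> insert None (collapse_map S ` T)"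
    by (cases z) (auto simp: collapse_map_def image_iff split: if_splits)
qed

context cone_model
begin

definition "wedge2_base = (\<lambda>j. (j, basept (if j then C else B))) ` UNIV"
definition "jB x = collapse_map wedge2_base (False, x)"
definition "jC x = collapse_map wedge2_base (True, x)"

abbreviation "WU \<equiv> space_of (wedge2 B C)"

lemma wedge2_base_eq: "wedge2_base = {(False, basept B), (True, basept C)}"
proof -
  show ?thesis unfolding wedge2_base_def UNIV_bool by simp
qed

lemma wedge2_eq: "wedge2 B C = collapse (sum_topology (\<lambda>b. space_of (if b then C else B)) UNIV) wedge2_base"
proof -
  show ?thesis unfolding wedge2_def wedge_def wedge2_base_def ..
qed

lemma j_base [simp]:
  shows "jB (basept B) = None" and "jC (basept C) = None"
proof -
  show "jB (basept B) = None" unfolding jB_def wedge2_base_eq collapse_map_def by simp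
  show "jC (basept C) = None" unfolding jC_def wedge2_base_eq collapse_map_def by simp
qed

lemma cont_j:
  shows "continuous_map (space_of B) WU jB" and "continuous_map (space_of C) WU jC"
proof -
  let ?X = "\<lambda>b. space_of (if b then C else B)"
  have *: "continuous_map (?X b) WU (\<lambda>x. collapse_map wedge2_base (b, x))" for b
    unfolding wedge2_eq
    by (rule continuous_map_comp[OF continuous_map_sum_inject[of b UNIV ?X] continuous_map_collapse_map]) simp
  show "continuous_map (space_of B) WU jB" "continuous_map (space_of C) WU jC"
    using *[of False] *[of True] by (simp_all add: jB_def[abs_def] jC_def[abs_def])
qed

lemma points_WU: "points (wedge2 B C) = {None} \<union> jB ` points B \<union> jC ` points C"
proof (intro equalityI subsetI)
  fix z assume "z \<in> points (wedge2 B C)"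
  then consider "z = None" | b x where "z = Some (b, x)" "x \<in> points (if b then C else B)" "(b, x) \<notin> wedge2_base"
    unfolding wedge2_eq points_collapse by auto
  then show "z \<in> {None} \<union> jB ` points B \<union> jC ` points C"
  proof cases
    case (2 b x)
    then show ?thesis by (cases b) (auto simp: jB_def jC_def collapse_map_def intro!: image_eqI)
  qed simp
next
  fix z assume "z \<in> {None} \<union> jB ` points B \<union> jC ` points C"
  then show "z \<in> points (wedge2 B C)"
    using continuous_map_image_subset_topspace[OF cont_j(1)] continuous_map_image_subset_topspace[OF cont_j(2)]
    by (auto simp: wedge2_eq)
qed

lemma points_WV: "points (wedge2 B (subpspace C E)) = {None} \<union> jB ` points B \<union> jC ` E"
proof -
  have "points (wedge2 B (subpspace C E)) = insert None (Some ` ({False} \<times> points B \<union> {True} \<times> E - wedge2_base))"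
  proof -
    have "topspace (sum_topology (\<lambda>b. space_of (if b then subpspace C E else B)) UNIV) = {False} \<times> points B \<union> {True} \<times> E"
      using EC by (auto simp: subpspace_def topspace_sum_topology split: if_splits)
    moreover have "(\<lambda>b. (b, basept (if b then subpspace C E else B))) ` UNIV = wedge2_base"
      unfolding wedge2_base_def by (rule image_cong) (auto simp: subpspace_def)
    ultimately show ?thesis
      by (simp only: wedge2_def wedge_def points_collapse)
  qed
  also have "\<dots> = insert None (collapse_map wedge2_base ` (Pair False ` points B \<union> Pair True ` E))"
  proof -
    have "{False} \<times> points B \<union> {True} \<times> E = Pair False ` points B \<union> Pair True ` E" by auto
    then show ?thesis by (simp only: insert_None_image_collapse_map)
  qed
  also have "\<dots> = {None} \<union> jB ` points B \<union> jC ` E"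
    by (simp only: image_Un image_image jB_def[symmetric] jC_def[symmetric]) blast
  finally show ?thesis .
qed

lemma wedge_homotopy:
  assumes FB: "continuous_map (prod_topology unit_interval (space_of B)) Z FB"
    and FC: "continuous_map (prod_topology unit_interval (space_of C)) Z FC"
    and b: "\<And>t. t \<in> {0..1} \<Longrightarrow> FB (t, basept B) = zb" "\<And>t. t \<in> {0..1} \<Longrightarrow> FC (t, basept C) = zb"
  obtains H where "continuous_map (prod_topology unit_interval WU) Z H"
    and "\<And>t. H (t, None) = zb"
    and "\<And>t x. t \<in> {0..1} \<Longrightarrow> H (t, jB x) = FB (t, x)" "\<And>t x. t \<in> {0..1} \<Longrightarrow> H (t, jC x) = FC (t, x)"
proof
  define F where "F = (\<lambda>(t, b, x). if b then FC (t, x) else FB (t, x))"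
  define H where "H = (\<lambda>(t, z). case z of None \<Rightarrow> zb | Some x \<Rightarrow> F (t, x))"
  have zb: "zb \<in> topspace Z"
    using continuous_map_image_subset_topspace[OF FB] b(1)[of 0] BB by (fastforce simp: image_subset_iff)
  show "continuous_map (prod_topology unit_interval WU) Z H"
    unfolding H_def wedge2_eq
  proof (rule continuous_map_case_prod_collapse[OF _ _ zb])
    show "continuous_map (prod_topology unit_interval (sum_topology (\<lambda>b. space_of (if b then C else B)) UNIV)) Z F"
    proof (rule continuous_map_from_prod_sum)
      fix c :: bool
      show "continuous_map (prod_topology unit_interval (space_of (if c then C else B))) Z (\<lambda>(t, x). F (t, c, x))"
        using FB FC by (cases c) (simp_all add: F_def case_prod_eta)
    qed
  qed (auto simp: F_def wedge2_base_def b)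
  show "H (t, None) = zb" for t by (simp add: H_def)
  show "H (t, jB x) = FB (t, x)" "H (t, jC x) = FC (t, x)" if "t \<in> {0..1}" for t x
    using that b by (auto simp: H_def jB_def jC_def F_def collapse_map_def wedge2_base_def)
qed

lemma cone_wedge_homotopy:
  assumes FB: "continuous_map (prod_topology unit_interval (space_of B)) Z FB"
    and FC: "continuous_map (prod_topology unit_interval (space_of C)) Z FC"
    and FE: "continuous_map (prod_topology unit_interval EI) Z FE"
    and b: "\<And>t. t \<in> {0..1} \<Longrightarrow> FB (t, basept B) = zb" "\<And>t. t \<in> {0..1} \<Longrightarrow> FC (t, basept C) = zb"
      "\<And>t s. t \<in> {0..1} \<Longrightarrow> s \<in> {0..1} \<Longrightarrow> FE (t, basept C, s) = zb"
      "\<And>t x. t \<in> {0..1} \<Longrightarrow> x \<in> E \<Longrightarrow> FE (t, x, 1) = zb"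
  obtains H where "continuous_map (prod_topology unit_interval P) Z H"
    and "\<And>t. H (t, None) = zb"
    and "\<And>t x. t \<in> {0..1} \<Longrightarrow> H (t, inB x) = FB (t, x)" "\<And>t x. t \<in> {0..1} \<Longrightarrow> H (t, inC x) = FC (t, x)"
    and "\<And>t x s. t \<in> {0..1} \<Longrightarrow> x \<in> E \<Longrightarrow> s \<in> {0..1} \<Longrightarrow> H (t, inE (x, s)) = FE (t, x, s)"
proof
  define F where "F = (\<lambda>(t, n::nat, x, s::real). if n = 0 then FB (t, x) else if n = 1 then FC (t, x) else FE (t, x, s))"
  define H where "H = (\<lambda>(t, z). case z of None \<Rightarrow> zb | Some x \<Rightarrow> F (t, x))"
  have zb: "zb \<in> topspace Z"
    using continuous_map_image_subset_topspace[OF FB] b(1)[of 0] BB by (fastforce simp: image_subset_iff)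
  show "continuous_map (prod_topology unit_interval P) Z H"
    unfolding H_def cone_wedge_def
  proof (rule continuous_map_case_prod_collapse[OF _ _ zb])
    show "continuous_map (prod_topology unit_interval (cone_sum B C E)) Z F"
      unfolding cone_sum_def
    proof (rule continuous_map_from_prod_sum)
      have *: "continuous_map (prod_topology unit_interval (prod_topology Y T)) Z (\<lambda>(t, x). G (t, fst x))"
        if "continuous_map (prod_topology unit_interval Y) Z G" for Y :: "'a topology" and T :: "real topology" and G
        unfolding case_prod_unfold
        by (rule continuous_map_comp[OF _ that]) (intro continuous_map_pairedI continuous_map_fst continuous_map_fst_comp[OF continuous_map_snd])
      fix n :: nat assume "n \<in> {0, 1, 2}"
      then consider "n = 0" | "n = 1" | "n = 2" by auto
      then show "continuous_map (prod_topology unit_interval (cone_piece B C E n)) Z (\<lambda>(t, x). F (t, n, x))"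
      proof cases
        case 1
        then show ?thesis using *[OF FB, of "top_of_set {0}"] by (simp add: cone_piece_def F_def case_prod_unfold)
      next
        case 2
        then show ?thesis using *[OF FC, of "top_of_set {0}"] by (simp add: cone_piece_def F_def case_prod_unfold)
      next
        case 3
        then show ?thesis using FE by (simp add: cone_piece_def F_def case_prod_unfold)
      qed
    qed
  next
    fix t :: real and p assume tp: "t \<in> {0..1}" "p \<in> topspace (cone_sum B C E)" "p \<in> cone_base B C"
    obtain n x s where p: "p = (n, x, s)" by (cases p)
    then consider "n = 0" | "n = 1" | "n = 2" "x \<in> E" "s \<in> {0..1}"
      using tp(2) by (auto simp: cone_sum_def topspace_sum_topology cone_piece_def)
    then show "F (t, p) = zb"
      using tp b p by cases (auto simp: F_def cone_base_def)
  qed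
  show "H (t, None) = zb" for t by (simp add: H_def)
  show "H (t, inB x) = FB (t, x)" "H (t, inC x) = FC (t, x)" if "t \<in> {0..1}" for t x
    using that b by (auto simp: H_def inB_def inC_def F_def collapse_map_def cone_base_def)
  show "H (t, inE (x, s)) = FE (t, x, s)" if "t \<in> {0..1}" "x \<in> E" "s \<in> {0..1}" for t x s
    using that b by (auto simp: H_def inE_def F_def collapse_map_def cone_base_def)
qed

lemma sub_eq: "cone_wedge_sub B C E = {None} \<union> inB ` points B \<union> inE ` (E \<times> {0})"
proof (intro equalityI subsetI)
  fix z assume z: "z \<in> cone_wedge_sub B C E"
  then have "z \<in> {None} \<union> inB ` points B \<union> inC ` points C \<union> inE ` (E \<times> {0..1})"
    unfolding cone_wedge_sub_def points_P by blast
  then consider "z = None" | "z \<in> inB ` points B" | x where "x \<in> points C" "z = inC x" | x s where "x \<in> E" "z = inE (x, s)" "z \<noteq> None"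
    by blast
  then show "z \<in> {None} \<union> inB ` points B \<union> inE ` (E \<times> {0})"
  proof cases
    case (3 x)
    then show ?thesis using z by (auto simp: cone_wedge_sub_def inC_def collapse_map_def split: if_splits)
  next
    case (4 x s)
    then have "s = 0" using z by (auto simp: cone_wedge_sub_def inE_def collapse_map_def split: if_splits)
    then show ?thesis using 4 by auto
  qed auto
next
  fix z assume z: "z \<in> {None} \<union> inB ` points B \<union> inE ` (E \<times> {0})"
  moreover have "(0::real) \<in> {0..1}" by simp
  ultimately have "z \<in> points (cone_wedge B C E)" unfolding points_P by blast
  then show "z \<in> cone_wedge_sub B C E"
    using z by (auto simp: cone_wedge_sub_def inB_def inE_def collapse_map_def split: if_splits)
qed

lemma IX:
  shows "continuous_map (prod_topology unit_interval X) X snd"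
    and "continuous_map (prod_topology unit_interval X) unit_interval fst"
    and "continuous_map (prod_topology unit_interval X) euclideanreal fst"
proof -
  show "continuous_map (prod_topology unit_interval X) X snd" by (rule continuous_map_snd)
  show "continuous_map (prod_topology unit_interval X) unit_interval fst" by (rule continuous_map_fst)
  then show "continuous_map (prod_topology unit_interval X) euclideanreal fst"
    by (rule continuous_map_from_unit_interval)
qed

lemma EI_cont:
  shows "continuous_map (prod_topology unit_interval EI) (space_of C) (\<lambda>z. fst (snd z))"
    and "continuous_map (prod_topology unit_interval EI) (subtopology (space_of C) E) (\<lambda>z. fst (snd z))"
    and "continuous_map (prod_topology unit_interval EI) euclideanreal (\<lambda>z. snd (snd z))"
proof -
  show 1: "continuous_map (prod_topology unit_interval EI) (subtopology (space_of C) E) (\<lambda>z. fst (snd z))"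
    by (rule continuous_map_fst_comp[OF continuous_map_snd])
  show "continuous_map (prod_topology unit_interval EI) (space_of C) (\<lambda>z. fst (snd z))"
    by (rule continuous_map_into_fulltopology[OF 1])
  show "continuous_map (prod_topology unit_interval EI) euclideanreal (\<lambda>z. snd (snd z))"
    by (rule continuous_map_from_unit_interval[OF continuous_map_snd_comp[OF continuous_map_snd]])
qed

lemma h_in:
  assumes "x \<in> points C" "t \<in> {0..1}"
  shows "h (x, t) \<in> points C"
proof -
  have "(x, t) \<in> topspace CI" using assms by simp
  then show ?thesis using continuous_map_image_subset_topspace[OF h] by blast
qed

lemma R_in:
  assumes "x \<in> points C" "t \<in> {0..1}"
  shows "fst (R (x, t)) \<in> points C \<and> snd (R (x, t)) \<in> {0..1}"
proof -
  have "(x, t) \<in> topspace CI" using assms by simp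
  then have "R (x, t) \<in> topspace CI" using continuous_map_image_subset_topspace[OF R] by blast
  then show ?thesis by (auto simp: mem_Times_iff)
qed

lemma const_homotopies:
  shows "continuous_map (prod_topology unit_interval (space_of B)) P (\<lambda>z. inB (snd z))"
    and "continuous_map (prod_topology unit_interval (space_of B)) WU (\<lambda>z. jB (snd z))"
    and "continuous_map (prod_topology unit_interval (space_of C)) P (\<lambda>z. inC (snd z))"
    and "continuous_map (prod_topology unit_interval (space_of C)) WU (\<lambda>z. jC (snd z))"
proof -
  show "continuous_map (prod_topology unit_interval (space_of B)) P (\<lambda>z. inB (snd z))"
    by (rule continuous_map_comp[OF continuous_map_snd cont_inB])
  show "continuous_map (prod_topology unit_interval (space_of B)) WU (\<lambda>z. jB (snd z))"
    by (rule continuous_map_comp[OF continuous_map_snd cont_j(1)])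
  show "continuous_map (prod_topology unit_interval (space_of C)) P (\<lambda>z. inC (snd z))"
    by (rule continuous_map_comp[OF continuous_map_snd cont_inC])
  show "continuous_map (prod_topology unit_interval (space_of C)) WU (\<lambda>z. jC (snd z))"
    by (rule continuous_map_comp[OF continuous_map_snd cont_j(2)])
qed

lemma cont_theta_R:
  assumes u: "continuous_map Z CI u"
  shows "continuous_map Z P (\<lambda>z. theta (R (u z)))"
proof (rule cont_theta)
  show "continuous_map Z CI (\<lambda>z. R (u z))" by (rule continuous_map_comp[OF u R])
  show "fst (R (u z)) \<in> E" if "z \<in> topspace Z" "snd (R (u z)) \<noteq> 0" for z
  proof -
    have "u z \<in> topspace CI" using continuous_map_image_subset_topspace[OF u] that by blast
    then show ?thesis using Rin[of "fst (u z)" "snd (u z)"] that by auto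
  qed
qed

lemma RbE: "R (basept C, t) = (basept C, t)"
proof -
  show ?thesis by (rule RE[OF bE])
qed

lemma WVU: "points (wedge2 B (subpspace C E)) \<subseteq> points (wedge2 B C)"
proof -
  have "jC ` E \<subseteq> jC ` points C" using EC by (rule image_mono)
  then show ?thesis unfolding points_WV points_WU by simp blast
qed

lemma bases: "basept (wedge2 B C) = None" "basept (cone_wedge B C E) = None"
proof -
  show "basept (wedge2 B C) = None" unfolding wedge2_eq by simp
  show "basept (cone_wedge B C E) = None" unfolding cone_wedge_def by simp
qed

text \<open>The equivalence extends the homotopy \<open>theta\<close> of the inclusion of \<open>E\<close> over \<open>C\<close> and takes its end, which
  moves \<open>E\<close> to the base of the cone. Its inverse contracts the cone by the null homotopy \<open>h\<close>.\<close>

definition to_cone :: "((bool \<times> 'a) option \<Rightarrow> (nat \<times> 'a \<times> real) option) \<Rightarrow> bool" where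
  "to_cone \<phi> \<longleftrightarrow> continuous_map WU P \<phi> \<and> \<phi> None = None \<and> (\<forall>x. \<phi> (jB x) = inB x) \<and> (\<forall>x. \<phi> (jC x) = theta (R (x, 1)))"

definition from_cone :: "((nat \<times> 'a \<times> real) option \<Rightarrow> (bool \<times> 'a) option) \<Rightarrow> bool" where
  "from_cone \<psi> \<longleftrightarrow> continuous_map P WU \<psi> \<and> \<psi> None = None \<and> (\<forall>x. \<psi> (inB x) = jB x) \<and> (\<forall>x. \<psi> (inC x) = jC x) \<and>
     (\<forall>x\<in>E. \<forall>s\<in>{0..1}. \<psi> (inE (x, s)) = jC (h (x, s)))"

lemma ex_to_cone: "\<exists>\<phi>. to_cone \<phi>"
proof -
  have "continuous_map (prod_topology unit_interval (space_of C)) P (\<lambda>z. theta (R (snd z, 1)))"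
    by (rule cont_theta_R) (intro continuous_map_pairedI IX continuous_map_const[THEN iffD2]; simp)
  then obtain \<Phi> where \<Phi>: "continuous_map (prod_topology unit_interval WU) P \<Phi>" "\<And>t. \<Phi> (t, None) = None"
      "\<And>t x. t \<in> {0..1} \<Longrightarrow> \<Phi> (t, jB x) = inB x" "\<And>t x. t \<in> {0..1} \<Longrightarrow> \<Phi> (t, jC x) = theta (R (x, 1))"
    by (rule wedge_homotopy[OF const_homotopies(1), where zb = None]) (use RbE in auto)
  define \<phi> where "\<phi> z = \<Phi> (0, z)" for z
  have \<phi>: "continuous_map WU P \<phi>" "\<phi> None = None" "\<And>x. \<phi> (jB x) = inB x" "\<And>x. \<phi> (jC x) = theta (R (x, 1))"
    unfolding \<phi>_def using \<Phi>(2-4) zero_le_one by (auto intro!: continuous_map_comp[OF _ \<Phi>(1)] continuous_map_pairedI)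
  then show ?thesis unfolding to_cone_def by blast
qed

lemma ex_from_cone: "\<exists>\<psi>. from_cone \<psi>"
proof -
  have "continuous_map (prod_topology unit_interval EI) WU (\<lambda>z. jC (h (snd z)))"
  proof (rule continuous_map_comp[OF continuous_map_comp[OF _ h] cont_j(2)])
    have "continuous_map EI CI (\<lambda>z. (fst z, snd z))"
      by (intro continuous_map_pairedI continuous_map_snd continuous_map_into_fulltopology[OF continuous_map_fst])
    then show "continuous_map (prod_topology unit_interval EI) CI snd"
      using continuous_map_comp[OF continuous_map_snd[of unit_interval EI], of CI "\<lambda>z. z"] by simp
  qed
  then obtain \<Psi> where \<Psi>: "continuous_map (prod_topology unit_interval P) WU \<Psi>" "\<And>t. \<Psi> (t, None) = None"
      "\<And>t x. t \<in> {0..1} \<Longrightarrow> \<Psi> (t, inB x) = jB x" "\<And>t x. t \<in> {0..1} \<Longrightarrow> \<Psi> (t, inC x) = jC x"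
      "\<And>t x s. t \<in> {0..1} \<Longrightarrow> x \<in> E \<Longrightarrow> s \<in> {0..1} \<Longrightarrow> \<Psi> (t, inE (x, s)) = jC (h (x, s))"
    by (rule cone_wedge_homotopy[OF const_homotopies(2) const_homotopies(4), where zb = None]) (use hb h1 in auto)
  define \<psi> where "\<psi> z = \<Psi> (0, z)" for z
  have \<psi>: "continuous_map P WU \<psi>" "\<psi> None = None" "\<And>x. \<psi> (inB x) = jB x" "\<And>x. \<psi> (inC x) = jC x"
      "\<And>x s. x \<in> E \<Longrightarrow> s \<in> {0..1} \<Longrightarrow> \<psi> (inE (x, s)) = jC (h (x, s))"
    unfolding \<psi>_def using \<Psi>(2-5) zero_le_one by (auto intro!: continuous_map_comp[OF _ \<Psi>(1)] continuous_map_pairedI)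
  then show ?thesis unfolding from_cone_def by blast
qed

text \<open>The inverse maps the path of \<open>theta\<close> over a point of \<open>E\<close> to its track under \<open>h\<close>, run forth and
  back, which is what the tent function \<open>?m\<close> parametrises. In the first half of the homotopy the tent is
  flattened, in the second the homotopy extension is undone. Over \<open>E\<close> nothing moves: \<open>R\<close> fixes \<open>E \<times> 1\<close>
  and the tent vanishes at \<open>1\<close>.\<close>

lemma from_cone_to_cone:
  assumes "to_cone \<phi>" "from_cone \<psi>"
  shows "homotopic_with (pair_preserving (wedge2 B C) (points (wedge2 B (subpspace C E))) (wedge2 B C) (points (wedge2 B (subpspace C E))))
         WU WU (\<psi> \<circ> \<phi>) id"
proof -
  have \<phi>: "continuous_map WU P \<phi>" "\<phi> None = None" "\<And>x. \<phi> (jB x) = inB x" "\<And>x. \<phi> (jC x) = theta (R (x, 1))"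
    using assms(1) unfolding to_cone_def by auto
  have \<psi>: "continuous_map P WU \<psi>" "\<psi> None = None" "\<And>x. \<psi> (inB x) = jB x" "\<And>x. \<psi> (inC x) = jC x"
      "\<And>x s. x \<in> E \<Longrightarrow> s \<in> {0..1} \<Longrightarrow> \<psi> (inE (x, s)) = jC (h (x, s))"
    using assms(2) unfolding from_cone_def by auto
  let ?m = "\<lambda>s. min (2 * s) (2 - 2 * s) :: real"
  have \<psi>\<theta>: "\<psi> (theta (x, s)) = jC (h (x, ?m s))" if "x \<in> points C" "s \<in> {0..1}" "s \<noteq> 0 \<Longrightarrow> x \<in> E" for x s
    using that \<psi> by (auto simp: theta_def min_def)
  let ?u = "\<lambda>z. R (snd z, min 1 (2 - 2 * fst z))" and ?f = "\<lambda>z. max 0 (1 - 2 * fst z)"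
  let ?IC = "prod_topology unit_interval (space_of C)"
  have u: "continuous_map ?IC CI ?u"
    by (intro continuous_map_comp[OF _ R] continuous_map_pairedI IX)
      (auto simp: continuous_map_into_unit_interval intro!: real_continuous_intros IX)
  have us: "continuous_map ?IC euclideanreal (\<lambda>z. snd (?u z))"
    by (rule continuous_map_from_unit_interval[OF continuous_map_snd_comp[OF u]])
  have u01: "0 \<le> snd (?u z)" "snd (?u z) \<le> 1" if "z \<in> topspace ?IC" for z
    using continuous_map_image_subset_topspace[OF u] that by fastforce+
  have mr: "0 \<le> ?f z * ?m (snd (?u z)) \<and> ?f z * ?m (snd (?u z)) \<le> 1" if "z \<in> topspace ?IC" for z
    using u01[OF that] that by (auto intro!: mult_nonneg_nonneg mult_le_one)
  have "continuous_map ?IC (space_of C) (\<lambda>z. h (fst (?u z), ?f z * ?m (snd (?u z))))"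
    by (intro continuous_map_comp[OF _ h] continuous_map_pairedI continuous_map_fst_comp[OF u])
      (use mr in \<open>auto simp: continuous_map_into_unit_interval intro!: real_continuous_intros IX us\<close>)
  from continuous_map_comp[OF this cont_j(2)]
  obtain H where H: "continuous_map (prod_topology unit_interval WU) WU H" "\<And>t. H (t, None) = None"
    "\<And>t x. t \<in> {0..1} \<Longrightarrow> H (t, jB x) = jB x"
    "\<And>t x. t \<in> {0..1} \<Longrightarrow> H (t, jC x) = jC (h (fst (?u (t, x)), ?f (t, x) * ?m (snd (?u (t, x)))))"
  proof (rule wedge_homotopy[OF const_homotopies(2), where zb = None])
    show "jC (h (fst (?u (t, basept C)), ?f (t, basept C) * ?m (snd (?u (t, basept C))))) = None" if "t \<in> {0..1}" for t
    proof -
      have "?f (t, basept C) * ?m (snd (?u (t, basept C))) \<in> {0..1}"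
        using mr[of "(t, basept C)"] that bC by simp
      from hb[OF this] show ?thesis by (simp only: snd_conv fst_conv RbE j_base)
    qed
  qed (auto simp del: fst_conv)
  show ?thesis
  proof (rule homotopic_with_pairI[OF H(1)])
    fix z assume z: "z \<in> points (wedge2 B C)"
    then consider "z = None" | x where "z = jB x" | x where "x \<in> points C" "z = jC x"
      unfolding points_WU by auto
    then show "H (0, z) = (\<psi> \<circ> \<phi>) z"
    proof cases
      case (3 x)
      have "\<psi> (theta (R (x, 1))) = jC (h (fst (R (x, 1)), ?m (snd (R (x, 1)))))"
        using \<psi>\<theta>[of "fst (R (x, 1))" "snd (R (x, 1))"] R_in[of x 1] Rin[of x 1] 3 by auto
      then show ?thesis using 3 H(4)[of 0 x] \<phi>(4) by simp
    qed (use H \<phi> \<psi> in auto)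
    show "H (1, z) = id z"
      using z unfolding points_WU using H(2) H(3)[of 1] H(4)[of 1] R0 h0 by auto
  next
    show "H (t, z) \<in> points (wedge2 B (subpspace C E))"
      if t: "t \<in> {0..1}" and z: "z \<in> points (wedge2 B (subpspace C E))" for t z
    proof -
      have hjc: "H (t, jC x) = jC x" if "x \<in> E" for x
      proof -
        have "?f (t, x) * ?m (snd (?u (t, x))) = 0"
          using that t by (cases "t \<le> 1/2") (auto simp: RE min_def max_def)
        then show ?thesis using H(4)[OF t] that RE h0 EC by auto
      qed
      consider "z = None" | x where "x \<in> points B" "z = jB x" | x where "x \<in> E" "z = jC x"
        using z unfolding points_WV by auto
      then have "H (t, z) = z" using H(2) H(3)[OF t] hjc by cases simp_all
      then show ?thesis using z by simp
    qed
  qed (use WVU H(2) in \<open>auto simp: bases points_WU\<close>)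
qed

text \<open>The homotopy has three steps. The first undoes the homotopy extension on \<open>C\<close>. This moves the
  start of the image of each cone line along the path \<open>theta\<close>; as the base of the cone has to stay where
  it is, that part of the path is inserted at the beginning of the line. At the end a cone line is
  mapped to the cone line, followed by the track of \<open>h\<close> run backwards and forwards (\<open>?f1\<close>). The second step
  contracts this detour, and the third reparametrises the cone lines.\<close>

lemma to_cone_from_cone:
  assumes "to_cone \<phi>" "from_cone \<psi>"
  shows "homotopic_with (pair_preserving (cone_wedge B C E) (cone_wedge_sub B C E) (cone_wedge B C E) (cone_wedge_sub B C E))
         P P (\<phi> \<circ> \<psi>) id"
proof -
  have \<phi>: "\<phi> None = None" "\<And>x. \<phi> (jB x) = inB x" "\<And>x. \<phi> (jC x) = theta (R (x, 1))"
    using assms(1) unfolding to_cone_def by auto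
  have \<psi>: "\<psi> None = None" "\<And>x. \<psi> (inB x) = jB x" "\<And>x. \<psi> (inC x) = jC x"
      "\<And>x s. x \<in> E \<Longrightarrow> s \<in> {0..1} \<Longrightarrow> \<psi> (inE (x, s)) = jC (h (x, s))"
    using assms(2) unfolding from_cone_def by auto
  let ?IC = "prod_topology unit_interval (space_of C)" and ?IE = "prod_topology unit_interval EI"
  let ?pp = "pair_preserving (cone_wedge B C E) (cone_wedge_sub B C E) (cone_wedge B C E) (cone_wedge_sub B C E)"
  have i01: "(0::real) \<in> {0..1}" "(1::real) \<in> {0..1}" by auto
  have AP: "cone_wedge_sub B C E \<subseteq> points (cone_wedge B C E)"
    by (auto simp: cone_wedge_sub_def)
  \<comment> \<open>A homotopy that fixes \<open>B\<close> and the base of the cone preserves the pair.\<close>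
  have hom: "homotopic_with ?pp P P f g"
    if H: "continuous_map (prod_topology unit_interval P) P H" "\<And>t. H (t, None) = None"
      "\<And>t x. t \<in> {0..1} \<Longrightarrow> H (t, inB x) = inB x"
      "\<And>t x. t \<in> {0..1} \<Longrightarrow> x \<in> E \<Longrightarrow> H (t, inE (x, 0)) = inE (x, 0)"
    and f: "f None = None" "\<And>x. f (inB x) = inB x" "\<And>x. x \<in> points C \<Longrightarrow> H (0, inC x) = f (inC x)"
      "\<And>x s. x \<in> E \<Longrightarrow> s \<in> {0..1} \<Longrightarrow> H (0, inE (x, s)) = f (inE (x, s))"
    and g: "g None = None" "\<And>x. g (inB x) = inB x" "\<And>x. x \<in> points C \<Longrightarrow> H (1, inC x) = g (inC x)"
      "\<And>x s. x \<in> E \<Longrightarrow> s \<in> {0..1} \<Longrightarrow> H (1, inE (x, s)) = g (inE (x, s))"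
    for H f g
  proof (rule homotopic_with_pairI[OF H(1)])
    show "H (0, z) = f z" if "z \<in> points (cone_wedge B C E)" for z
      using that H(2,3) f unfolding points_P by auto
    show "H (1, z) = g z" if "z \<in> points (cone_wedge B C E)" for z
      using that H(2,3) g unfolding points_P by auto
    show "H (t, z) \<in> cone_wedge_sub B C E" if t: "t \<in> {0..1}" and z: "z \<in> cone_wedge_sub B C E" for t z
    proof -
      consider "z = None" | x where "x \<in> points B" "z = inB x" | x where "x \<in> E" "z = inE (x, 0)"
        using z unfolding sub_eq by auto
      then have "H (t, z) = z" using H(2) H(3)[OF t] H(4)[OF t] by cases simp_all
      then show ?thesis using z by simp
    qed
  qed (use AP H(2) in \<open>auto simp: bases points_P\<close>)
  let ?FC1 = "\<lambda>z. theta (R (snd z, 1 - fst z))"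
  let ?u = "\<lambda>z. R (h (fst (snd z), (snd (snd z) - fst z / 2) / (1 - fst z / 2)), 1 - fst z)"
  let ?FE1 = "\<lambda>z. if snd (snd z) \<le> fst z / 2 then theta (fst (snd z), 1 - 2 * snd (snd z)) else theta (?u z)"
  let ?F1 = "\<lambda>z. if fst z = (0::real) then (\<phi> \<circ> \<psi>) (snd z) else snd z"
  let ?f1 = "\<lambda>t x. if t \<le> 1/4 then inE (x, 4 * t) else inC (h (x, max (2 - 4 * t) (2 * t - 1)))"
  have FC1: "continuous_map ?IC P ?FC1"
    by (intro cont_theta_R continuous_map_pairedI IX)
      (auto simp: continuous_map_into_unit_interval intro!: real_continuous_intros IX)
  have FE1: "continuous_map ?IE P ?FE1"
  proof (rule continuous_map_if_le)
    let ?S = "{x. snd (snd x) \<le> fst x / 2}" and ?T = "{x. fst x / 2 \<le> snd (snd x)}"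
    show c: "continuous_map ?IE euclideanreal (\<lambda>z. snd (snd z))" "continuous_map ?IE euclideanreal (\<lambda>z. fst z / 2)"
      by (rule EI_cont(3)) (intro continuous_map_real_divide IX(3) continuous_map_const[THEN iffD2]; simp)
    show "continuous_map (subtopology ?IE ?S) P (\<lambda>z. theta (fst (snd z), 1 - 2 * snd (snd z)))"
    proof (rule cont_theta)
      show "continuous_map (subtopology ?IE ?S) CI (\<lambda>z. (fst (snd z), 1 - 2 * snd (snd z)))"
        by (intro continuous_map_pairedI continuous_map_from_subtopology[OF EI_cont(1)])
          (auto simp: continuous_map_into_unit_interval intro!: real_continuous_intros continuous_map_from_subtopology[OF c(1)])
    qed auto
    show "continuous_map (subtopology ?IE ?T) P (\<lambda>z. theta (?u z))"
    proof (intro cont_theta_R continuous_map_pairedI continuous_map_comp[OF _ h] continuous_map_from_subtopology[OF EI_cont(1)])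
      have "continuous_map ?IE euclideanreal (\<lambda>z. (snd (snd z) - fst z / 2) / (1 - fst z / 2))"
        by (intro continuous_map_real_divide continuous_map_diff c) auto
      then show "continuous_map (subtopology ?IE ?T) unit_interval (\<lambda>z. (snd (snd z) - fst z / 2) / (1 - fst z / 2))"
        unfolding continuous_map_into_unit_interval
        by (intro conjI continuous_map_from_subtopology) (auto simp: field_simps)
      have "continuous_map ?IE unit_interval (\<lambda>z. 1 - fst z)"
        by (auto simp: continuous_map_into_unit_interval intro!: real_continuous_intros IX)
      then show "continuous_map (subtopology ?IE ?T) unit_interval (\<lambda>z. 1 - fst z)"
        by (rule continuous_map_from_subtopology)
    qed
    fix z assume z: "z \<in> topspace ?IE" "snd (snd z) = fst z / 2"
    then have "fst (snd z) \<in> E" by auto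
    then have "R (h (fst (snd z), 0), 1 - fst z) = (fst (snd z), 1 - fst z)"
      using h0 EC RE by auto
    then show "theta (fst (snd z), 1 - 2 * snd (snd z)) = theta (?u z)"
      by (simp add: z(2))
  qed
  have FE1_eq: "?FE1 (t, x, s) = (if s \<le> t / 2 then theta (x, 1 - 2 * s) else theta (R (h (x, (s - t / 2) / (1 - t / 2)), 1 - t)))" for t x s
    by (simp only: fst_conv snd_conv)
  obtain H1 where H1: "continuous_map (prod_topology unit_interval P) P H1" "\<And>t. H1 (t, None) = None"
      "\<And>t x. t \<in> {0..1} \<Longrightarrow> H1 (t, inB x) = inB x" "\<And>t x. t \<in> {0..1} \<Longrightarrow> H1 (t, inC x) = ?FC1 (t, x)"
      "\<And>t x s. t \<in> {0..1} \<Longrightarrow> x \<in> E \<Longrightarrow> s \<in> {0..1} \<Longrightarrow> H1 (t, inE (x, s)) = ?FE1 (t, x, s)"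
  proof (rule cone_wedge_homotopy[OF const_homotopies(1) FC1 FE1, where zb = None])
    show "?FE1 (t, basept C, s) = None" if "t \<in> {0..1}" "s \<in> {0..1}" for t s
    proof (cases "s \<le> t / 2")
      case True
      then show ?thesis using that unfolding FE1_eq by simp
    next
      case False
      then have "(s - t / 2) / (1 - t / 2) \<in> {0..1}" using that by (auto simp: field_simps)
      then show ?thesis using that False unfolding FE1_eq by (simp add: hb RbE)
    qed
    show "?FE1 (t, x, 1) = None" if "t \<in> {0..1}" "x \<in> E" for t x
    proof -
      have "\<not> 1 \<le> t / 2" "(1 - t / 2) / (1 - t / 2) = 1" using that by auto
      then show ?thesis using that unfolding FE1_eq by (simp add: h1 RbE)
    qed
  qed (auto simp: RbE)
  have H1e: "H1 (t, inE (x, s)) = (if s \<le> t / 2 then theta (x, 1 - 2 * s) else theta (R (h (x, (s - t / 2) / (1 - t / 2)), 1 - t)))"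
    if "t \<in> {0..1}" "x \<in> E" "s \<in> {0..1}" for t x s
    using H1(5)[OF that] by (simp only: fst_conv snd_conv)
  let ?g1 = "\<lambda>z. H1 (1, z)"
  have H1E: "H1 (1, inE (x, s)) = ?f1 s x" if "x \<in> E" "s \<in> {0..1}" for x s
  proof -
    have x: "x \<in> points C" using that EC by blast
    have e: "H1 (1, inE (x, s)) = (if s \<le> 1 / 2 then theta (x, 1 - 2 * s) else theta (R (h (x, (s - 1 / 2) / (1 - 1 / 2)), 1 - 1)))"
      using H1e[OF i01(2) that] .
    consider "s = 1/4" | "s < 1/4" | "1/4 < s" "s \<le> 1/2" | "1/2 < s" by linarith
    then show ?thesis
    proof cases
      case 1
      show ?thesis unfolding e unfolding 1 using that h1 by (simp add: theta_def)
    next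
      case 2
      then have "\<not> 1 - 2 * s \<le> 1/2" by simp
      then show ?thesis using 2 unfolding e by (simp add: theta_def)
    next
      case 3
      then have "1 - 2 * s \<le> 1/2" "max (2 - 4 * s) (2 * s - 1) = 2 - 4 * s" "\<not> s \<le> 1/4" "2 * (1 - 2 * s) = 2 - 4 * s" by auto
      then show ?thesis using 3 unfolding e by (simp only: theta_def if_True if_False fst_conv snd_conv)
    next
      case 4
      have "(s - 1/2) / (1 - 1/2) = 2 * s - 1" by (simp add: field_simps)
      moreover have "h (x, 2 * s - 1) \<in> points C" using h_in[OF x] 4 that by auto
      moreover have "\<not> s \<le> 1/2" "\<not> s \<le> 1/4" "max (2 - 4 * s) (2 * s - 1) = 2 * s - 1" using 4 by auto
      ultimately show ?thesis
        unfolding e by (simp only: if_False diff_self R0 theta_simps)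
    qed
  qed
  have step1: "homotopic_with ?pp P P (\<phi> \<circ> \<psi>) ?g1"
  proof (rule hom[OF H1(1,2,3)])
    show "H1 (t, inE (x, 0)) = inE (x, 0)" if "t \<in> {0..1}" "x \<in> E" for t x
      using H1e[OF that i01(1)] that by simp
    show "H1 (0, inC x) = (\<phi> \<circ> \<psi>) (inC x)" if "x \<in> points C" for x
      using H1(4)[OF i01(1)] by (simp add: \<phi> \<psi>)
    show "H1 (0, inE (x, s)) = (\<phi> \<circ> \<psi>) (inE (x, s))" if "x \<in> E" "s \<in> {0..1}" for x s
    proof (cases "s = 0")
      case True
      then show ?thesis using H1e[OF i01(1) that] that EC h0 RE by (auto simp: \<phi> \<psi>)
    next
      case False
      then have "\<not> s \<le> 0 / 2" "(s - 0 / 2) / (1 - 0 / 2) = s" using that by auto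
      then show ?thesis using H1e[OF i01(1) that] that by (simp add: \<phi> \<psi>)
    qed
  qed (use H1 i01 in \<open>simp_all add: \<phi> \<psi>\<close>)
  let ?FE2 = "\<lambda>z. if snd (snd z) \<le> 1/4 then inE (fst (snd z), 4 * snd (snd z))
      else inC (h (fst (snd z), max (max (2 - 4 * snd (snd z)) (2 * snd (snd z) - 1)) (fst z)))"
  have FE2: "continuous_map ?IE P ?FE2"
  proof (rule continuous_map_if_le)
    show "continuous_map (subtopology ?IE {x. snd (snd x) \<le> 1/4}) P (\<lambda>z. inE (fst (snd z), 4 * snd (snd z)))"
      by (intro continuous_map_comp[OF _ cont_inE] continuous_map_pairedI continuous_map_from_subtopology[OF EI_cont(2)])
        (auto simp: continuous_map_into_unit_interval intro!: real_continuous_intros continuous_map_from_subtopology[OF EI_cont(3)])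
    show "continuous_map (subtopology ?IE {x. 1/4 \<le> snd (snd x)}) P
        (\<lambda>z. inC (h (fst (snd z), max (max (2 - 4 * snd (snd z)) (2 * snd (snd z) - 1)) (fst z))))"
      by (intro continuous_map_comp[OF _ cont_inC] continuous_map_comp[OF _ h] continuous_map_pairedI continuous_map_from_subtopology[OF EI_cont(1)])
        (auto simp: continuous_map_into_unit_interval intro!: real_continuous_intros continuous_map_from_subtopology[OF EI_cont(3)] continuous_map_from_subtopology[OF IX(3)])
    fix z assume z: "z \<in> topspace ?IE" "snd (snd z) = 1/4"
    then have "max (max (2 - 4 * snd (snd z)) (2 * snd (snd z) - 1)) (fst z) = 1" "4 * snd (snd z) = 1" "fst (snd z) \<in> E" by auto
    then show "inE (fst (snd z), 4 * snd (snd z)) = inC (h (fst (snd z), max (max (2 - 4 * snd (snd z)) (2 * snd (snd z) - 1)) (fst z)))"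
      using h1 by (simp only: in_base)
  qed (auto intro: EI_cont)
  obtain H2 where H2: "continuous_map (prod_topology unit_interval P) P H2" "\<And>t. H2 (t, None) = None"
      "\<And>t x. t \<in> {0..1} \<Longrightarrow> H2 (t, inB x) = inB x" "\<And>t x. t \<in> {0..1} \<Longrightarrow> H2 (t, inC x) = inC x"
      "\<And>t x s. t \<in> {0..1} \<Longrightarrow> x \<in> E \<Longrightarrow> s \<in> {0..1} \<Longrightarrow> H2 (t, inE (x, s)) = ?FE2 (t, x, s)"
  proof (rule cone_wedge_homotopy[OF const_homotopies(1,3) FE2, where zb = None])
    show "?FE2 (t, basept C, s) = None" if "t \<in> {0..1}" "s \<in> {0..1}" for t s
    proof (cases "s \<le> 1/4")
      case False
      then have "max (max (2 - 4 * s) (2 * s - 1)) t \<in> {0..1}" using that by auto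
      then show ?thesis using False hb by simp
    qed auto
  qed (auto simp: h1)
  have H2e: "H2 (t, inE (x, s)) = (if s \<le> 1/4 then inE (x, 4 * s) else inC (h (x, max (max (2 - 4 * s) (2 * s - 1)) t)))"
    if "t \<in> {0..1}" "x \<in> E" "s \<in> {0..1}" for t x s
    using H2(5)[OF that] by (simp only: fst_conv snd_conv)
  let ?g2 = "\<lambda>z. H2 (1, z)"
  have step2: "homotopic_with ?pp P P ?g1 ?g2"
  proof (rule hom[OF H2(1,2,3)])
    show "H2 (0, inE (x, s)) = ?g1 (inE (x, s))" if "x \<in> E" "s \<in> {0..1}" for x s
    proof -
      have "max (max (2 - 4 * s) (2 * s - 1)) 0 = max (2 - 4 * s) (2 * s - 1)" by auto
      then show ?thesis using H2e[OF i01(1) that] H1E[OF that] by simp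
    qed
    show "H2 (t, inE (x, 0)) = inE (x, 0)" if "t \<in> {0..1}" "x \<in> E" for t x
      using H2e[OF that i01(1)] by simp
    show "H2 (0, inC x) = ?g1 (inC x)" if "x \<in> points C" for x
      using H2(4)[OF i01(1)] H1(4)[OF i01(2)] that by (simp add: R0)
    show "H2 (1, inE (x, s)) = ?g2 (inE (x, s))" for x s ..
  qed (use H1(2) H1(3)[OF i01(2)] H2(2) H2(3)[OF i01(2)] in simp_all)
  let ?FE3 = "\<lambda>z. inE (fst (snd z), min 1 ((4 - 3 * fst z) * snd (snd z)))"
  have FE3: "continuous_map ?IE P ?FE3"
    by (intro continuous_map_comp[OF _ cont_inE] continuous_map_pairedI EI_cont(2))
      (auto simp: continuous_map_into_unit_interval intro!: real_continuous_intros EI_cont(3) IX mult_nonneg_nonneg)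
  obtain H3 where H3: "continuous_map (prod_topology unit_interval P) P H3" "\<And>t. H3 (t, None) = None"
      "\<And>t x. t \<in> {0..1} \<Longrightarrow> H3 (t, inB x) = inB x" "\<And>t x. t \<in> {0..1} \<Longrightarrow> H3 (t, inC x) = inC x"
      "\<And>t x s. t \<in> {0..1} \<Longrightarrow> x \<in> E \<Longrightarrow> s \<in> {0..1} \<Longrightarrow> H3 (t, inE (x, s)) = ?FE3 (t, x, s)"
  proof (rule cone_wedge_homotopy[OF const_homotopies(1,3) FE3, where zb = None])
    show "?FE3 (t, x, 1) = None" if "t \<in> {0..1}" for t x
    proof -
      have "min 1 ((4 - 3 * t) * 1) = 1" using that by auto
      then show ?thesis by (simp only: fst_conv snd_conv in_base)
    qed
  qed simp_all
  have H3e: "H3 (t, inE (x, s)) = inE (x, min 1 ((4 - 3 * t) * s))"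
    if "t \<in> {0..1}" "x \<in> E" "s \<in> {0..1}" for t x s
    using H3(5)[OF that] by (simp only: fst_conv snd_conv)
  have step3: "homotopic_with ?pp P P ?g2 id"
  proof (rule hom[OF H3(1,2,3)])
    show "H3 (0, inE (x, s)) = ?g2 (inE (x, s))" if "x \<in> E" "s \<in> {0..1}" for x s
    proof (cases "s \<le> 1/4")
      case True
      then have "min 1 ((4 - 3 * 0) * s) = 4 * s" by simp
      then show ?thesis using True H3e[OF i01(1) that] H2e[OF i01(2) that] by (simp only: if_True)
    next
      case False
      then have "max (max (2 - 4 * s) (2 * s - 1)) 1 = 1" using that by auto
      then show ?thesis using False H3e[OF i01(1) that] H2e[OF i01(2) that] that h1 by (simp add: min_def)
    qed
    show "H3 (1, inE (x, s)) = id (inE (x, s))" if "x \<in> E" "s \<in> {0..1}" for x s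
    proof -
      have "min 1 ((4 - 3 * 1) * s) = s" using that by simp
      then show ?thesis using H3e[OF i01(2) that] by (simp only: id_apply)
    qed
    show "H3 (t, inE (x, 0)) = inE (x, 0)" if "t \<in> {0..1}" "x \<in> E" for t x
      using H3e[OF that i01(1)] by simp
  qed (use H2(2) H2(3,4)[OF i01(2)] H3(2) H3(4) i01 in simp_all)
  show ?thesis
    using homotopic_with_trans[OF homotopic_with_trans[OF step1 step2] step3] .
qed

lemma pair_homotopy_equivalent_cone_wedge:
  "pair_homotopy_equivalent (wedge2 B C) (points (wedge2 B (subpspace C E))) (cone_wedge B C E) (cone_wedge_sub B C E)"
proof -
  obtain \<phi> \<psi> where \<phi>\<psi>: "to_cone \<phi>" "from_cone \<psi>" using ex_to_cone ex_from_cone by blast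
  have "\<psi> (inE (x, 0)) = jC x" if "x \<in> E" for x
    using \<phi>\<psi>(2) that h0 EC by (auto simp: from_cone_def)
  then have "\<psi> z \<in> {None} \<union> jB ` points B \<union> jC ` E" if z: "z \<in> {None} \<union> inB ` points B \<union> inE ` (E \<times> {0})" for z
  proof -
    consider "z = None" | x where "x \<in> points B" "z = inB x" | x where "x \<in> E" "z = inE (x, 0)"
      using z by auto
    then show ?thesis
    proof cases
      case (3 x)
      then have "\<psi> z = jC x" using \<open>\<And>x. x \<in> E \<Longrightarrow> \<psi> (inE (x, 0)) = jC x\<close> by simp
      then show ?thesis using 3 by blast
    qed (use \<phi>\<psi>(2) in \<open>auto simp: from_cone_def\<close>)
  qed
  then have \<psi>A: "pair_preserving (cone_wedge B C E) (cone_wedge_sub B C E) (wedge2 B C) (points (wedge2 B (subpspace C E))) \<psi>"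
    using \<phi>\<psi>(2) unfolding pair_preserving_def points_WV sub_eq bases from_cone_def by (simp add: image_subset_iff)
  have "\<phi> (jC x) = inE (x, 0)" if "x \<in> E" for x
    using \<phi>\<psi>(1) that RE by (auto simp: to_cone_def)
  then have \<phi>A: "pair_preserving (wedge2 B C) (points (wedge2 B (subpspace C E))) (cone_wedge B C E) (cone_wedge_sub B C E) \<phi>"
    using \<phi>\<psi>(1) unfolding pair_preserving_def points_WV sub_eq bases to_cone_def by (auto simp: image_subset_iff)
  show ?thesis
    unfolding pair_homotopy_equivalent_def
    using \<phi>A \<psi>A from_cone_to_cone[OF \<phi>\<psi>] to_cone_from_cone[OF \<phi>\<psi>] \<phi>\<psi>
    unfolding to_cone_def from_cone_def by blast
qed

end

section \<open>Homotopy invariance of the polyhedral smash product\<close>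

definition fat_wedge :: "'i set \<Rightarrow> ('i \<Rightarrow> 'a pspace) \<Rightarrow> ('i \<Rightarrow> 'a) set" where
  "fat_wedge I X = {x. \<exists>i\<in>I. x i = basept (X i)}"

definition smash_map :: "'i set \<Rightarrow> ('i \<Rightarrow> 'b pspace) \<Rightarrow> ('i \<Rightarrow> 'a \<Rightarrow> 'b) \<Rightarrow> ('i \<Rightarrow> 'a) option \<Rightarrow> ('i \<Rightarrow> 'b) option" where
  "smash_map I Y f z = (case z of None \<Rightarrow> None | Some x \<Rightarrow> collapse_map (fat_wedge I Y) (\<lambda>i\<in>I. f i (x i)))"

lemma smash_eq: "smash I X = collapse (kification (product_topology (\<lambda>i. space_of (X i)) I)) (fat_wedge I X)"
  by (simp add: smash_def fat_wedge_def)

lemma points_smash: "points (smash I X) = insert None (Some ` ((\<Pi>\<^sub>E i\<in>I. points (X i)) - fat_wedge I X))"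
  by (simp add: smash_eq points_collapse)

lemma points_Dhat:
  "points (Dhat I X A \<sigma>) = insert None (Some ` ((\<Pi>\<^sub>E i\<in>I. if i \<in> \<sigma> then points (X i) else points (X i) \<inter> A i) - fat_wedge I X))"
proof -
  let ?W = "\<lambda>i. if i \<in> \<sigma> then X i else subpspace (X i) (A i)"
  have "basept (?W i) = basept (X i)" for i by (simp add: subpspace_def)
  then have "fat_wedge I ?W = fat_wedge I X" by (simp add: fat_wedge_def)
  moreover have "points (?W i) = (if i \<in> \<sigma> then points (X i) else points (X i) \<inter> A i)" for i
    by (simp add: subpspace_def)
  ultimately show ?thesis
    unfolding Dhat_def points_smash by simp
qed

definition Zset :: "'i set \<Rightarrow> 'i set set \<Rightarrow> ('i \<Rightarrow> 'a pspace) \<Rightarrow> ('i \<Rightarrow> 'a set) \<Rightarrow> ('i \<Rightarrow> 'a) option set" where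
  "Zset I K X A = (\<Union>\<sigma>\<in>K. points (Dhat I X A \<sigma>))"

lemma Zhat_eq: "Zhat I K X A = subpspace (smash I X) (Zset I K X A)"
  by (simp add: Zhat_def Zset_def)

lemma Some_in_Zset:
  "Some x \<in> Zset I K X A \<longleftrightarrow> x \<in> (\<Pi>\<^sub>E i\<in>I. points (X i)) \<and> (\<forall>i\<in>I. x i \<noteq> basept (X i)) \<and> (\<exists>\<sigma>\<in>K. \<forall>i\<in>I - \<sigma>. x i \<in> A i)"
proof -
  have "x \<in> (\<Pi>\<^sub>E i\<in>I. if i \<in> \<sigma> then points (X i) else points (X i) \<inter> A i) \<longleftrightarrow>
      x \<in> (\<Pi>\<^sub>E i\<in>I. points (X i)) \<and> (\<forall>i\<in>I - \<sigma>. x i \<in> A i)" for \<sigma>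
    by (auto simp: PiE_iff split: if_splits)
  note eq = this
  have "Some x \<in> points (Dhat I X A \<sigma>) \<longleftrightarrow>
      x \<in> (\<Pi>\<^sub>E i\<in>I. points (X i)) \<and> (\<forall>i\<in>I - \<sigma>. x i \<in> A i) \<and> (\<forall>i\<in>I. x i \<noteq> basept (X i))" for \<sigma>
    unfolding points_Dhat using eq[of \<sigma>] by (simp add: inj_image_mem_iff fat_wedge_def)
  then show ?thesis
    by (auto simp only: Zset_def UN_iff)
qed

lemma None_in_Zset: "K \<noteq> {} \<Longrightarrow> None \<in> Zset I K X A"
  by (auto simp: Zset_def points_Dhat)

lemma Zset_subset: "Zset I K X A \<subseteq> points (smash I X)"
  unfolding Zset_def using points_Dhat_subset by blast

lemma points_Zhat: "points (Zhat I K X A) = Zset I K X A"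
  using Zset_subset[of I K X A] by (simp add: Zhat_eq subpspace_def Int_absorb1)

lemma basept_Zhat [simp]: "basept (Zhat I K X A) = None"
  by (simp add: Zhat_eq subpspace_def smash_eq)

lemma space_Zhat: "space_of (Zhat I K X A) = subtopology (space_of (smash I X)) (Zset I K X A)"
  by (simp add: Zhat_eq subpspace_def)

text \<open>The product of the unit interval with a k-space is again a k-space, so a coordinatewise homotopy
  is continuous into the compactly generated product, and it descends to the collapsed fat wedges.\<close>

lemma continuous_map_smash_homotopy:
  assumes F: "\<And>i. i \<in> I \<Longrightarrow> continuous_map (prod_topology unit_interval (space_of (X i))) (space_of (Y i)) (F i)"
    and b: "\<And>i t. i \<in> I \<Longrightarrow> t \<in> {0..1} \<Longrightarrow> F i (t, basept (X i)) = basept (Y i)"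
  shows "continuous_map (prod_topology unit_interval (space_of (smash I X))) (space_of (smash I Y))
           (\<lambda>(t, z). smash_map I Y (\<lambda>i x. F i (t, x)) z)"
proof -
  let ?PX = "kification (product_topology (\<lambda>i. space_of (X i)) I)" and ?PY = "product_topology (\<lambda>i. space_of (Y i)) I"
  let ?G = "\<lambda>(t, x). collapse_map (fat_wedge I Y) (\<lambda>i\<in>I. F i (t, x i))"
  have k: "k_space (prod_topology unit_interval ?PX)"
    by (intro k_space_prod_topology_left) (simp_all add: unit_interval_facts)
  have "continuous_map (prod_topology unit_interval ?PX) ?PY (\<lambda>(t, x). \<lambda>i\<in>I. F i (t, x i))"
    unfolding continuous_map_componentwise
  proof (intro conjI ballI)
    fix i assume i: "i \<in> I"
    have "continuous_map ?PX (space_of (X i)) (\<lambda>x. x i)"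
      by (rule continuous_map_from_kification[OF continuous_map_product_projection[OF i]])
    then have "continuous_map (prod_topology unit_interval ?PX) (prod_topology unit_interval (space_of (X i))) (\<lambda>z. (fst z, snd z i))"
      by (intro continuous_map_pairedI continuous_map_fst continuous_map_comp[OF continuous_map_snd])
    from continuous_map_comp[OF this F[OF i]] i
    show "continuous_map (prod_topology unit_interval ?PX) (space_of (Y i)) (\<lambda>z. (case z of (t, x) \<Rightarrow> \<lambda>i\<in>I. F i (t, x i)) i)"
      by (simp add: case_prod_unfold)
  qed (auto simp: extensional_def)
  then have "continuous_map (prod_topology unit_interval ?PX) (kification ?PY) (\<lambda>(t, x). \<lambda>i\<in>I. F i (t, x i))"
    using k by (simp add: continuous_map_into_kification)
  from continuous_map_comp[OF this continuous_map_collapse_map]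
  have G: "continuous_map (prod_topology unit_interval ?PX) (space_of (smash I Y)) ?G"
    by (simp add: smash_eq case_prod_unfold)
  have "continuous_map (prod_topology unit_interval (space_of (smash I X))) (space_of (smash I Y))
           (\<lambda>(t, z). case z of None \<Rightarrow> None | Some x \<Rightarrow> ?G (t, x))"
    unfolding smash_eq[of I X]
  proof (rule continuous_map_case_prod_collapse[OF G])
    show "?G (t, x) = None" if t: "t \<in> {0..1}" and x: "x \<in> fat_wedge I X" for t x
    proof -
      obtain i where i: "i \<in> I" "x i = basept (X i)" using x by (auto simp: fat_wedge_def)
      then have "(\<lambda>i\<in>I. F i (t, x i)) \<in> fat_wedge I Y"
        using b[OF i(1) t] by (auto simp: fat_wedge_def intro!: bexI[of _ i])
      then show ?thesis by (simp add: collapse_map_def)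
    qed
  qed (simp add: smash_eq)
  then show ?thesis
    by (simp add: smash_map_def case_prod_unfold)
qed

lemma smash_map_Zset:
  assumes f: "\<And>i. i \<in> I \<Longrightarrow> continuous_map (space_of (X i)) (space_of (Y i)) (f i)"
    and p: "\<And>i. i \<in> I \<Longrightarrow> pair_preserving (X i) (A i) (Y i) (B i) (f i)"
    and K: "K \<noteq> {}" and z: "z \<in> Zset I K X A"
  shows "smash_map I Y f z \<in> Zset I K Y B"
proof (cases "smash_map I Y f z")
  case None
  then show ?thesis using K by (simp add: None_in_Zset)
next
  case (Some y)
  then obtain x where x: "z = Some x" by (auto simp: smash_map_def split: option.splits)
  have y: "y = (\<lambda>i\<in>I. f i (x i))" "y \<notin> fat_wedge I Y"
    using Some x by (auto simp: smash_map_def collapse_map_def split: if_splits)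
  obtain \<sigma> where \<sigma>: "\<sigma> \<in> K" "\<forall>i\<in>I - \<sigma>. x i \<in> A i" and xP: "x \<in> (\<Pi>\<^sub>E i\<in>I. points (X i))"
    using z unfolding x Some_in_Zset by blast
  have "f i (x i) \<in> points (Y i)" if "i \<in> I" for i
    using continuous_map_image_subset_topspace[OF f[OF that]] xP that by (auto simp: PiE_iff)
  moreover have "f i (x i) \<in> B i" if "i \<in> I - \<sigma>" for i
    using p[of i] \<sigma>(2) that by (auto simp: pair_preserving_def)
  ultimately show ?thesis
    unfolding Some Some_in_Zset using y \<sigma>(1) by (auto simp: fat_wedge_def intro!: bexI[of _ \<sigma>])
qed

lemma pointed_homotopic_Zhat:
  assumes h: "\<And>i. i \<in> I \<Longrightarrow> homotopic_with (pair_preserving (X i) (A i) (Y i) (B i)) (space_of (X i)) (space_of (Y i)) (f i) (g i)"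
    and K: "K \<noteq> {}"
  shows "pointed_homotopic (Zhat I K X A) (Zhat I K Y B) (smash_map I Y f) (smash_map I Y g)"
proof -
  have "\<exists>F. continuous_map (prod_topology unit_interval (space_of (X i))) (space_of (Y i)) F \<and>
      (\<forall>x. F (0, x) = f i x) \<and> (\<forall>x. F (1, x) = g i x) \<and>
      (\<forall>t\<in>{0..1}. pair_preserving (X i) (A i) (Y i) (B i) (\<lambda>x. F (t, x)))" if "i \<in> I" for i
    using h[OF that] unfolding homotopic_with_def by blast
  then obtain F where F: "\<And>i. i \<in> I \<Longrightarrow> continuous_map (prod_topology unit_interval (space_of (X i))) (space_of (Y i)) (F i)"
      "\<And>i x. i \<in> I \<Longrightarrow> F i (0, x) = f i x" "\<And>i x. i \<in> I \<Longrightarrow> F i (1, x) = g i x"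
      "\<And>i t. i \<in> I \<Longrightarrow> t \<in> {0..1} \<Longrightarrow> pair_preserving (X i) (A i) (Y i) (B i) (\<lambda>x. F i (t, x))"
    by metis
  define H where "H = (\<lambda>(t, z). smash_map I Y (\<lambda>i x. F i (t, x)) z)"
  have H: "continuous_map (prod_topology unit_interval (space_of (smash I X))) (space_of (smash I Y)) H"
    unfolding H_def using F(4) by (intro continuous_map_smash_homotopy F(1)) (auto simp: pair_preserving_def)
  have slice: "continuous_map (space_of (X i)) (space_of (Y i)) (\<lambda>x. F i (t, x))" if "i \<in> I" "t \<in> {0..1}" for i t
    using that by (intro continuous_map_comp[OF _ F(1)] continuous_map_pairedI) auto
  have HZ: "H (t, z) \<in> Zset I K Y B" if "t \<in> {0..1}" "z \<in> Zset I K X A" for t z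
    unfolding H_def using that F(4) by (auto intro!: smash_map_Zset slice K)
  have "continuous_map (prod_topology unit_interval (space_of (Zhat I K X A))) (space_of (Zhat I K Y B)) H"
    unfolding space_Zhat continuous_map_in_subtopology
  proof (intro conjI)
    have "prod_topology unit_interval (subtopology (space_of (smash I X)) (Zset I K X A))
        = subtopology (prod_topology unit_interval (space_of (smash I X))) ({0..1} \<times> Zset I K X A)"
      by (simp add: subtopology_Times subtopology_subtopology)
    then show "continuous_map (prod_topology unit_interval (subtopology (space_of (smash I X)) (Zset I K X A))) (space_of (smash I Y)) H"
      using H by (simp add: continuous_map_from_subtopology)
    show "H \<in> topspace (prod_topology unit_interval (subtopology (space_of (smash I X)) (Zset I K X A))) \<rightarrow> Zset I K Y B"
      using HZ by auto
  qed
  moreover have "H (0, z) = smash_map I Y f z" "H (1, z) = smash_map I Y g z" for z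
  proof -
    have "(\<lambda>i\<in>I. F i (0, x i)) = (\<lambda>i\<in>I. f i (x i))" "(\<lambda>i\<in>I. F i (1, x i)) = (\<lambda>i\<in>I. g i (x i))" for x
      using F(2,3) by (auto intro!: restrict_ext)
    then show "H (0, z) = smash_map I Y f z" "H (1, z) = smash_map I Y g z"
      by (simp_all add: H_def smash_map_def cong: option.case_cong)
  qed
  moreover have "H (t, None) = None" for t
    by (simp add: H_def smash_map_def)
  ultimately show ?thesis
    unfolding pointed_homotopic_def homotopic_with_def by (intro exI[of _ H]) simp
qed

lemma smash_map_compose:
  assumes "\<And>i. i \<in> I \<Longrightarrow> g i (basept (Y i)) = basept (X i)"
  shows "smash_map I X g (smash_map I Y f z) = smash_map I X (\<lambda>i. g i \<circ> f i) z"
proof (cases z)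
  case (Some x)
  have *: "(\<lambda>i\<in>I. g i ((\<lambda>i\<in>I. f i (x i)) i)) = (\<lambda>i\<in>I. (g i \<circ> f i) (x i))" by auto
  show ?thesis
  proof (cases "(\<lambda>i\<in>I. f i (x i)) \<in> fat_wedge I Y")
    case True
    then obtain i where "i \<in> I" "f i (x i) = basept (Y i)" by (auto simp: fat_wedge_def)
    then have "(\<lambda>i\<in>I. (g i \<circ> f i) (x i)) \<in> fat_wedge I X"
      using assms by (auto simp: fat_wedge_def intro!: bexI[of _ i])
    then show ?thesis using True Some by (simp add: smash_map_def collapse_map_def)
  next
    case False
    then show ?thesis using Some * by (simp add: smash_map_def collapse_map_def)
  qed
qed (simp add: smash_map_def)

lemma smash_map_id:
  assumes "z \<in> points (smash I X)"
  shows "smash_map I X (\<lambda>i. id) z = z"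
proof -
  have "(\<lambda>i\<in>I. x i) = x" if "x \<in> (\<Pi>\<^sub>E i\<in>I. points (X i))" for x
    using that by (simp add: PiE_restrict)
  then show ?thesis
    using assms by (auto simp: points_smash smash_map_def collapse_map_def)
qed

lemma pointed_homotopic_eq:
  assumes "pointed_homotopic X Y f g" "\<And>x. x \<in> points X \<Longrightarrow> f x = f' x" "\<And>x. x \<in> points X \<Longrightarrow> g x = g' x"
    and "basept X \<in> points X"
  shows "pointed_homotopic X Y f' g'"
  using assms(1) unfolding pointed_homotopic_def
  by (rule homotopic_with_eq) (use assms in auto)

lemma pointed_map_Zhat:
  assumes "\<And>i. i \<in> I \<Longrightarrow> continuous_map (space_of (X i)) (space_of (Y i)) (h i) \<and> pair_preserving (X i) (A i) (Y i) (B i) (h i)"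
    and K: "K \<noteq> {}"
  shows "pointed_map (Zhat I K X A) (Zhat I K Y B) (smash_map I Y h)"
proof -
  have "pointed_homotopic (Zhat I K X A) (Zhat I K Y B) (smash_map I Y h) (smash_map I Y h)"
    by (intro pointed_homotopic_Zhat K) (simp add: assms(1))
  then show ?thesis
    by (simp add: pointed_homotopic_def pointed_map_def)
qed

lemma pointed_homotopic_Zhat_id:
  assumes "\<And>i. i \<in> I \<Longrightarrow> homotopic_with (pair_preserving (X i) (A i) (X i) (A i)) (space_of (X i)) (space_of (X i)) (k i \<circ> h i) id"
    and b: "\<And>i. i \<in> I \<Longrightarrow> k i (basept (Y i)) = basept (X i)" and K: "K \<noteq> {}"
  shows "pointed_homotopic (Zhat I K X A) (Zhat I K X A) (smash_map I X k \<circ> smash_map I Y h) id"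
proof (rule pointed_homotopic_eq[OF pointed_homotopic_Zhat[of I X A X A "\<lambda>i. k i \<circ> h i" "\<lambda>i. id" K, OF assms(1) K]])
  show "smash_map I X (\<lambda>i. k i \<circ> h i) z = (smash_map I X k \<circ> smash_map I Y h) z" for z
    using smash_map_compose[of I k Y X h z] b by simp
  show "smash_map I X (\<lambda>i. id) z = id z" if "z \<in> points (Zhat I K X A)" for z
    using smash_map_id[of z I X] Zset_subset[of I K X A] that by (auto simp: points_Zhat)
qed (simp_all add: points_Zhat None_in_Zset K)

lemma Zhat_homotopy_equivalence:
  assumes e: "\<And>i. i \<in> I \<Longrightarrow> pair_homotopy_equivalent (X i) (A i) (Y i) (B i)" and K: "K \<noteq> {}"
  shows "\<exists>f. pointed_homotopy_equivalence (Zhat I K X A) (Zhat I K Y B) f"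
proof -
  obtain f where f: "\<And>i. i \<in> I \<Longrightarrow> \<exists>g. continuous_map (space_of (X i)) (space_of (Y i)) (f i) \<and> pair_preserving (X i) (A i) (Y i) (B i) (f i) \<and>
     continuous_map (space_of (Y i)) (space_of (X i)) g \<and> pair_preserving (Y i) (B i) (X i) (A i) g \<and>
     homotopic_with (pair_preserving (X i) (A i) (X i) (A i)) (space_of (X i)) (space_of (X i)) (g \<circ> f i) id \<and>
     homotopic_with (pair_preserving (Y i) (B i) (Y i) (B i)) (space_of (Y i)) (space_of (Y i)) (f i \<circ> g) id"
    using e unfolding pair_homotopy_equivalent_def by metis
  then obtain g where fg: "\<And>i. i \<in> I \<Longrightarrow> continuous_map (space_of (X i)) (space_of (Y i)) (f i) \<and> pair_preserving (X i) (A i) (Y i) (B i) (f i) \<and>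
     continuous_map (space_of (Y i)) (space_of (X i)) (g i) \<and> pair_preserving (Y i) (B i) (X i) (A i) (g i) \<and>
     homotopic_with (pair_preserving (X i) (A i) (X i) (A i)) (space_of (X i)) (space_of (X i)) (g i \<circ> f i) id \<and>
     homotopic_with (pair_preserving (Y i) (B i) (Y i) (B i)) (space_of (Y i)) (space_of (Y i)) (f i \<circ> g i) id"
    by metis
  let ?X = "Zhat I K X A" and ?Y = "Zhat I K Y B"
  have b: "f i (basept (X i)) = basept (Y i)" "g i (basept (Y i)) = basept (X i)" if "i \<in> I" for i
    using fg[OF that] by (simp_all add: pair_preserving_def)
  show ?thesis
    unfolding pointed_homotopy_equivalence_def
  proof (intro exI[of _ "smash_map I Y f"] conjI exI[of _ "smash_map I X g"])
    show "pointed_map ?X ?Y (smash_map I Y f)" "pointed_map ?Y ?X (smash_map I X g)"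
      using fg by (intro pointed_map_Zhat K; simp)+
    show "pointed_homotopic ?X ?X (smash_map I X g \<circ> smash_map I Y f) id"
      using fg b by (intro pointed_homotopic_Zhat_id K) simp_all
    show "pointed_homotopic ?Y ?Y (smash_map I Y f \<circ> smash_map I X g) id"
      using fg b by (intro pointed_homotopic_Zhat_id K) simp_all
  qed
qed

section \<open>Joins\<close>

lemma join_map_simps [simp]:
  "join_map (x, y, 0) = Left_End x" "join_map (x, y, 1) = Right_End y"
  "0 < t \<Longrightarrow> t < 1 \<Longrightarrow> join_map (x, y, t) = Between x y t"
  by (simp_all add: join_map_def)

lemma topspace_join_topology: "topspace (join_topology X Y) = join_points X Y"
proof -
  have "{x \<in> topspace X. Left_End x \<in> join_points X Y} = topspace X"
    "{y \<in> topspace Y. Right_End y \<in> join_points X Y} = topspace Y"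
    "{z \<in> topspace (join_cylinder X Y). join_map z \<in> join_points X Y} = topspace (join_cylinder X Y)"
    by (auto simp: join_points_def)
  then have "openin (join_topology X Y) (join_points X Y)"
    by (simp add: openin_join_topology)
  then have "join_points X Y \<subseteq> topspace (join_topology X Y)"
    by (rule openin_subset)
  moreover have "topspace (join_topology X Y) \<subseteq> join_points X Y"
    using openin_topspace[of "join_topology X Y"] by (simp only: openin_join_topology)
  ultimately show ?thesis by (rule subset_antisym[rotated])
qed

lemma continuous_map_into_join:
  shows "continuous_map X (join_topology X Y) Left_End" and "continuous_map Y (join_topology X Y) Right_End"
    and "continuous_map (join_cylinder X Y) (join_topology X Y) join_map"
proof -
  show "continuous_map X (join_topology X Y) Left_End"
    unfolding continuous_map topspace_join_topology by (auto simp: join_points_def openin_join_topology)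
  show "continuous_map Y (join_topology X Y) Right_End"
    unfolding continuous_map topspace_join_topology by (auto simp: join_points_def openin_join_topology)
  show "continuous_map (join_cylinder X Y) (join_topology X Y) join_map"
    unfolding continuous_map topspace_join_topology by (auto simp: join_points_def openin_join_topology)
qed

lemma openin_joinI:
  assumes "U \<subseteq> join_points X Y" "openin X {x \<in> topspace X. Left_End x \<in> U}" "openin Y {y \<in> topspace Y. Right_End y \<in> U}"
    "openin (join_cylinder X Y) {z \<in> topspace (join_cylinder X Y). join_map z \<in> U}"
  shows "openin (join_topology X Y) U"
  using assms by (simp add: openin_join_topology)

lemma join_points_cases:
  assumes "p \<in> join_points X Y"
  obtains x where "x \<in> topspace X" "p = Left_End x" | y where "y \<in> topspace Y" "p = Right_End y"
    | z where "z \<in> topspace (join_cylinder X Y)" "p = join_map z"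
proof -
  consider "p \<in> Left_End ` topspace X" | "p \<in> Right_End ` topspace Y" | "p \<in> join_map ` topspace (join_cylinder X Y)"
    using assms unfolding join_points_def by auto
  then show thesis by cases (use that in auto)
qed

lemma k_space_join_cylinder:
  assumes "compact_space X" "Hausdorff_space X" "k_space Y"
  shows "k_space (join_cylinder X Y)"
  unfolding join_cylinder_def using assms unit_interval_facts
  by (intro k_space_prod_topology_left k_space_prod_topology_right compact_imp_locally_compact_space) auto

lemma openin_k_space_preimage:
  assumes "k_space A" "continuous_map A W q" "openin (kification W) U"
  shows "openin A {a \<in> topspace A. q a \<in> U}"
proof -
  have "continuous_map A (kification W) q"
    using assms(1,2) by (simp add: continuous_map_into_kification)
  then show ?thesis
    using assms(3) openin_continuous_map_preimage by blast
qed

text \<open>The topology of a join is determined by the two ends and the cylinder; the ends are listed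
  separately because the cylinder is empty if one of the spaces is. All three are k-spaces, so openness in
  a product can be tested on them.\<close>

lemma openin_kification_join_prod:
  assumes X: "compact_space X" "Hausdorff_space X" and Y: "k_space Y" and Z: "Hausdorff_space Z"
    and U: "U \<subseteq> join_points X Y \<times> topspace Z"
    and L: "openin (kification (prod_topology X Z)) {p \<in> topspace (prod_topology X Z). (Left_End (fst p), snd p) \<in> U}"
    and R: "openin (kification (prod_topology Y Z)) {p \<in> topspace (prod_topology Y Z). (Right_End (fst p), snd p) \<in> U}"
    and B: "openin (kification (prod_topology (join_cylinder X Y) Z))
              {p \<in> topspace (prod_topology (join_cylinder X Y) Z). (join_map (fst p), snd p) \<in> U}"
  shows "openin (kification (prod_topology (join_topology X Y) Z)) U"
proof (rule openin_kification_prod_if_compact_slices[OF Z])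
  show "U \<subseteq> topspace (join_topology X Y) \<times> topspace Z"
    using U by (simp add: topspace_join_topology)
  fix p assume p: "p \<in> topspace (join_topology X Y)"
  show "openin (kification Z) {z \<in> topspace Z. (p, z) \<in> U}"
  proof (rule join_points_cases[OF p[unfolded topspace_join_topology]])
    fix x assume "x \<in> topspace X" "p = Left_End x"
    then show ?thesis using openin_slice[OF L, of x] by simp
  next
    fix y assume "y \<in> topspace Y" "p = Right_End y"
    then show ?thesis using openin_slice[OF R, of y] by simp
  next
    fix c assume "c \<in> topspace (join_cylinder X Y)" "p = join_map c"
    then show ?thesis using openin_slice[OF B, of c] by simp
  qed
next
  fix N assume N: "compactin Z N"
  let ?V = "{p \<in> topspace (join_topology X Y). \<forall>z\<in>N. (p, z) \<in> U}"
  have NZ: "N \<subseteq> topspace Z" using N compactin_subset_topspace by blast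
  have kX: "k_space X" using X by (simp add: compact_imp_k_space)
  have jin: "Left_End x \<in> topspace (join_topology X Y)" if "x \<in> topspace X" for x
    using that by (simp add: topspace_join_topology join_points_def)
  have jin': "Right_End y \<in> topspace (join_topology X Y)" if "y \<in> topspace Y" for y
    using that by (simp add: topspace_join_topology join_points_def)
  have jin'': "join_map c \<in> topspace (join_topology X Y)" if "c \<in> topspace (join_cylinder X Y)" for c
    using that by (simp add: topspace_join_topology join_points_def)
  show "openin (join_topology X Y) ?V"
  proof (rule openin_joinI)
    show "?V \<subseteq> join_points X Y" by (auto simp: topspace_join_topology)
    have "{x \<in> topspace X. Left_End x \<in> ?V}
       = {x \<in> topspace X. \<forall>z\<in>N. (x, z) \<in> {p \<in> topspace (prod_topology X Z). (Left_End (fst p), snd p) \<in> U}}"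
      using jin NZ by auto
    then show "openin X {x \<in> topspace X. Left_End x \<in> ?V}"
      using compact_slices_openin[OF L kX N] by simp
    have "{y \<in> topspace Y. Right_End y \<in> ?V}
       = {y \<in> topspace Y. \<forall>z\<in>N. (y, z) \<in> {p \<in> topspace (prod_topology Y Z). (Right_End (fst p), snd p) \<in> U}}"
      using jin' NZ by auto
    then show "openin Y {y \<in> topspace Y. Right_End y \<in> ?V}"
      using compact_slices_openin[OF R Y N] by simp
    have "{c \<in> topspace (join_cylinder X Y). join_map c \<in> ?V}
       = {c \<in> topspace (join_cylinder X Y). \<forall>z\<in>N. (c, z) \<in> {p \<in> topspace (prod_topology (join_cylinder X Y) Z). (join_map (fst p), snd p) \<in> U}}"
      using jin'' NZ by auto
    then show "openin (join_cylinder X Y) {c \<in> topspace (join_cylinder X Y). join_map c \<in> ?V}"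
      using compact_slices_openin[OF B k_space_join_cylinder[OF X Y] N] by simp
  qed
qed

lemma continuous_map_from_kification_join_prod:
  assumes X: "compact_space X" "Hausdorff_space X" and Y: "k_space Y" and Z: "Hausdorff_space Z"
    and L: "continuous_map (kification (prod_topology X Z)) Q (\<lambda>p. f (Left_End (fst p), snd p))"
    and R: "continuous_map (kification (prod_topology Y Z)) Q (\<lambda>p. f (Right_End (fst p), snd p))"
    and B: "continuous_map (kification (prod_topology (join_cylinder X Y) Z)) Q (\<lambda>p. f (join_map (fst p), snd p))"
  shows "continuous_map (kification (prod_topology (join_topology X Y) Z)) Q f"
  unfolding continuous_map
proof (intro conjI allI impI)
  have "f (p, z) \<in> topspace Q" if p: "p \<in> join_points X Y" and z: "z \<in> topspace Z" for p z
  proof (rule join_points_cases[OF p])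
    fix x assume "x \<in> topspace X" "p = Left_End x"
    then show ?thesis
      using subsetD[OF continuous_map_image_subset_topspace[OF L] imageI[of "(x, z)"]] z by simp
  next
    fix y assume "y \<in> topspace Y" "p = Right_End y"
    then show ?thesis
      using subsetD[OF continuous_map_image_subset_topspace[OF R] imageI[of "(y, z)"]] z by simp
  next
    fix c assume "c \<in> topspace (join_cylinder X Y)" "p = join_map c"
    then show ?thesis
      using subsetD[OF continuous_map_image_subset_topspace[OF B] imageI[of "(c, z)"]] z by simp
  qed
  then show "f ` topspace (kification (prod_topology (join_topology X Y) Z)) \<subseteq> topspace Q"
    by (auto simp: topspace_join_topology)
  fix V assume V: "openin Q V"
  have jin: "x \<in> topspace X \<Longrightarrow> Left_End x \<in> join_points X Y" "y \<in> topspace Y \<Longrightarrow> Right_End y \<in> join_points X Y"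
    "c \<in> topspace (join_cylinder X Y) \<Longrightarrow> join_map c \<in> join_points X Y" for x y c
    by (auto simp: join_points_def)
  let ?U = "{p \<in> topspace (kification (prod_topology (join_topology X Y) Z)). f p \<in> V}"
  show "openin (kification (prod_topology (join_topology X Y) Z)) ?U"
  proof (rule openin_kification_join_prod[OF X Y Z])
    show "?U \<subseteq> join_points X Y \<times> topspace Z" by (auto simp: topspace_join_topology)
    show "openin (kification (prod_topology X Z)) {p \<in> topspace (prod_topology X Z). (Left_End (fst p), snd p) \<in> ?U}"
      using openin_continuous_map_preimage[OF L V]
      by (rule back_subst[where P = "openin _"]) (auto simp: topspace_join_topology jin)
    show "openin (kification (prod_topology Y Z)) {p \<in> topspace (prod_topology Y Z). (Right_End (fst p), snd p) \<in> ?U}"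
      using openin_continuous_map_preimage[OF R V]
      by (rule back_subst[where P = "openin _"]) (auto simp: topspace_join_topology jin)
    show "openin (kification (prod_topology (join_cylinder X Y) Z))
        {p \<in> topspace (prod_topology (join_cylinder X Y) Z). (join_map (fst p), snd p) \<in> ?U}"
      using openin_continuous_map_preimage[OF B V]
      by (rule back_subst[where P = "openin _"]) (auto simp: topspace_join_topology jin)
  qed
qed

lemma k_space_join:
  assumes X: "compact_space X" "Hausdorff_space X" and Y: "k_space Y"
  shows "k_space (join_topology X Y)"
proof -
  have "openin (join_topology X Y) U" if U: "openin (kification (join_topology X Y)) U" for U
  proof (rule openin_joinI)
    show "U \<subseteq> join_points X Y"
      using openin_subset[OF U] by (simp add: topspace_join_topology)
    show "openin X {x \<in> topspace X. Left_End x \<in> U}"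
      by (rule openin_k_space_preimage[OF compact_imp_k_space[OF X(1)] continuous_map_into_join(1) U])
    show "openin Y {y \<in> topspace Y. Right_End y \<in> U}"
      by (rule openin_k_space_preimage[OF Y continuous_map_into_join(2) U])
    show "openin (join_cylinder X Y) {z \<in> topspace (join_cylinder X Y). join_map z \<in> U}"
      by (rule openin_k_space_preimage[OF k_space_join_cylinder[OF assms] continuous_map_into_join(3) U])
  qed
  then have "kification (join_topology X Y) = join_topology X Y"
    unfolding topology_eq using openin_kification_finer by blast
  then show ?thesis
    by (simp add: kification_eq_self)
qed

lemma continuous_map_from_prod_join:
  assumes X: "compact_space X" "Hausdorff_space X" and Y: "k_space Y"
    and L: "continuous_map (prod_topology unit_interval X) Q (\<lambda>p. f (fst p, Left_End (snd p)))"
    and R: "continuous_map (prod_topology unit_interval Y) Q (\<lambda>p. f (fst p, Right_End (snd p)))"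
    and B: "continuous_map (prod_topology unit_interval (join_cylinder X Y)) Q (\<lambda>p. f (fst p, join_map (snd p)))"
  shows "continuous_map (prod_topology unit_interval (join_topology X Y)) Q f"
proof -
  have sw: "continuous_map (prod_topology S T) (prod_topology T S) (\<lambda>p. (snd p, fst p))" for S :: "'s topology" and T :: "'t topology"
    by (intro continuous_map_pairedI continuous_map_fst continuous_map_snd)
  have comp1: "continuous_map (prod_topology X unit_interval) Q (\<lambda>p. f (snd p, Left_End (fst p)))"
    using continuous_map_comp[OF sw[of X unit_interval] L] by simp
  have comp2: "continuous_map (prod_topology Y unit_interval) Q (\<lambda>p. f (snd p, Right_End (fst p)))"
    using continuous_map_comp[OF sw[of Y unit_interval] R] by simp
  have comp3: "continuous_map (prod_topology (join_cylinder X Y) unit_interval) Q (\<lambda>p. f (snd p, join_map (fst p)))"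
    using continuous_map_comp[OF sw[of "join_cylinder X Y" unit_interval] B] by simp
  have "continuous_map (kification (prod_topology (join_topology X Y) unit_interval)) Q (\<lambda>p. f (snd p, fst p))"
    by (rule continuous_map_from_kification_join_prod[OF X Y unit_interval_facts(2)];
        simp add: continuous_map_from_kification comp1 comp2 comp3)
  moreover have "k_space (prod_topology (join_topology X Y) unit_interval)"
    using k_space_join[OF X Y] unit_interval_facts by (simp add: k_space_prod_topology_right)
  ultimately have "continuous_map (prod_topology (join_topology X Y) unit_interval) Q (\<lambda>p. f (snd p, fst p))"
    by (simp only: kification_eq_self[THEN iffD2])
  from continuous_map_comp[OF sw this] show ?thesis by simp
qed

text \<open>The join of \<open>X\<close> with the base point of \<open>Y\<close>, a cone with apex the base point.\<close>

definition join_cone :: "'a topology \<Rightarrow> 'b pspace \<Rightarrow> ('a, 'b) join_point set" where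
  "join_cone X Y = insert (Right_End (basept Y)) (join_map ` (topspace X \<times> {basept Y} \<times> {0..1}))"

text \<open>The cones \<open>X * basept\<close> in all joins are contracted simultaneously. In the first half of the time
  \<open>Y\<close> is moved by \<open>k\<close>. In the second half, with parameter \<open>T\<close>, the end \<open>x\<close> of every segment slides along
  the segment from \<open>x\<close> to the base point, to the parameter \<open>T\<close>. The segment from \<open>x\<close> to \<open>y\<close> has to
  follow: starting from the end of \<open>y\<close>, it is mapped to the original segment up to the distance \<open>D\<close>, and
  then runs back to the parameter \<open>T\<close>. At the turning point either \<open>D < 1\<close>, and then \<open>k\<close> has moved \<open>y\<close>
  to the base point, or \<open>D = 1\<close> and the turning point is \<open>x\<close>; in both cases the way back can run
  towards the base point. The total length of the path is \<open>2 * D - 1 + T\<close>, and \<open>l\<close> is the length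
  that has been covered.\<close>

definition join_shrink_body :: "'b \<Rightarrow> ('b \<times> real \<Rightarrow> 'b) \<Rightarrow> ('b \<Rightarrow> real) \<Rightarrow> real \<times> 'a \<times> 'b \<times> real \<Rightarrow> ('a, 'b) join_point" where
  "join_shrink_body b k d = (\<lambda>(\<tau>, x, y, s).
     let T = max 0 (2 * \<tau> - 1); D = max (d y) (1 - T); l = (1 - s) * (2 * D - 1 + T)
     in if l \<le> D then join_map (x, k (y, min 1 (2 * \<tau>)), 1 - l) else join_map (x, b, 1 - 2 * D + l))"

definition join_shrink :: "'b \<Rightarrow> ('b \<times> real \<Rightarrow> 'b) \<Rightarrow> ('b \<Rightarrow> real) \<Rightarrow> real \<times> ('a, 'b) join_point \<Rightarrow> ('a, 'b) join_point" where
  "join_shrink b k d = (\<lambda>(\<tau>, p). case p of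
     Left_End x \<Rightarrow> join_map (x, b, max 0 (2 * \<tau> - 1))
   | Right_End y \<Rightarrow> Right_End (k (y, min 1 (2 * \<tau>)))
   | Between x y s \<Rightarrow> join_shrink_body b k d (\<tau>, x, y, s))"

locale contracting_base =
  fixes Y :: "'b pspace" and k d
  assumes k: "continuous_map (prod_topology (space_of Y) unit_interval) (space_of Y) k"
    and k0: "\<And>y. y \<in> points Y \<Longrightarrow> k (y, 0) = y"
    and kb: "\<And>t. t \<in> {0..1} \<Longrightarrow> k (basept Y, t) = basept Y"
    and d: "continuous_map (space_of Y) unit_interval d" and db: "d (basept Y) = 0"
    and d1: "\<And>y. y \<in> points Y \<Longrightarrow> d y < 1 \<Longrightarrow> k (y, 1) = basept Y"
    and base: "basept Y \<in> points Y"
begin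

abbreviation "b \<equiv> basept Y"

lemma d01: "y \<in> points Y \<Longrightarrow> 0 \<le> d y \<and> d y \<le> 1"
  using d by (simp add: continuous_map_into_unit_interval)

lemma shrink_numbers:
  assumes y: "y \<in> points Y" and t: "\<tau> \<in> {0..1}" and s: "s \<in> {0..1}"
    and T: "T = max 0 (2 * \<tau> - 1)" and D: "D = max (d y) (1 - T)" and l: "l = (1 - s) * (2 * D - 1 + T)"
  shows "0 \<le> T" "T \<le> 1" "0 \<le> D" "D \<le> 1" "1 - T \<le> D" "0 \<le> l" "l \<le> 2 * D - 1 + T"
    and "D < 1 \<Longrightarrow> k (y, min 1 (2 * \<tau>)) = b"
proof -
  show 1: "0 \<le> T" "T \<le> 1" using t by (auto simp: T)
  show 2: "0 \<le> D" "D \<le> 1" "1 - T \<le> D" using d01[OF y] 1 by (auto simp: D)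
  then have nn: "0 \<le> 2 * D - 1 + T" by linarith
  then show "0 \<le> l" using s by (simp add: l)
  show "l \<le> 2 * D - 1 + T" unfolding l using s nn by (simp add: mult_left_le_one_le)
  assume "D < 1"
  then have "d y < 1" "0 < T" by (auto simp: D)
  then have "min 1 (2 * \<tau>) = 1" by (auto simp: T)
  then show "k (y, min 1 (2 * \<tau>)) = b" using d1[OF y \<open>d y < 1\<close>] by simp
qed

lemma shrink_body_join_map:
  assumes y: "y \<in> points Y" and t: "\<tau> \<in> {0..1}" and s: "s \<in> {0..1}"
  shows "join_shrink_body b k d (\<tau>, x, y, s) = join_shrink b k d (\<tau>, join_map (x, y, s))"
proof -
  define T where "T = max 0 (2 * \<tau> - 1)"
  define D where "D = max (d y) (1 - T)"
  define l where "l = (1 - s) * (2 * D - 1 + T)"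
  note n = shrink_numbers[OF y t s T_def D_def l_def]
  have body: "join_shrink_body b k d (\<tau>, x, y, s)
      = (if l \<le> D then join_map (x, k (y, min 1 (2 * \<tau>)), 1 - l) else join_map (x, b, 1 - 2 * D + l))"
    by (simp add: join_shrink_body_def Let_def T_def D_def l_def)
  consider "s = 0" | "s = 1" | "0 < s" "s < 1" using s by fastforce
  then show ?thesis
  proof cases
    case 1
    then have l: "l = 2 * D - 1 + T" by (simp add: l_def)
    have R: "join_shrink b k d (\<tau>, join_map (x, y, s)) = join_map (x, b, T)"
      by (simp add: 1 join_shrink_def T_def)
    show ?thesis
    proof (cases "l \<le> D")
      case True
      then have DT: "D = 1 - T" using n l by linarith
      then have "1 - l = T" using l by simp
      moreover have "join_map (x, k (y, min 1 (2 * \<tau>)), T) = join_map (x, b, T)"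
        using n(1,8) DT by (cases "T = 0") auto
      ultimately show ?thesis unfolding body R using True by simp
    next
      case False
      then show ?thesis unfolding body R using l by simp
    qed
  next
    case 2
    then have "l = 0" by (simp add: l_def)
    then show ?thesis unfolding body using n(3) 2 by (simp add: join_shrink_def)
  next
    case 3
    then show ?thesis by (simp add: join_shrink_def)
  qed
qed

lemma continuous_map_join_shrink:
  assumes X: "compact_space X" "Hausdorff_space X" and Yk: "k_space (space_of Y)"
  shows "continuous_map (prod_topology unit_interval (join_topology X (space_of Y))) (join_topology X (space_of Y)) (join_shrink b k d)"
proof (rule continuous_map_from_prod_join[OF X Yk])
  let ?J = "join_topology X (space_of Y)" and ?cyl = "join_cylinder X (space_of Y)"
  have jm: "continuous_map Z ?J (\<lambda>z. join_map (u z, v z, w z))"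
    if "continuous_map Z X u" "continuous_map Z (space_of Y) v" "continuous_map Z unit_interval w"
    for Z :: "(real \<times> 'a \<times> 'b \<times> real) topology" and u v w
    by (rule continuous_map_comp[OF _ continuous_map_into_join(3)])
      (unfold join_cylinder_def, intro continuous_map_pairedI that)
  have fs: "continuous_map (prod_topology unit_interval Q) euclideanreal fst" for Q :: "'q topology"
    by (rule continuous_map_from_unit_interval[OF continuous_map_fst])
  have "continuous_map (prod_topology unit_interval X) ?cyl (\<lambda>p. (snd p, b, max 0 (2 * fst p - 1)))"
    unfolding join_cylinder_def
    by (intro continuous_map_pairedI continuous_map_snd)
      (auto simp: base continuous_map_into_unit_interval intro!: real_continuous_intros continuous_map_from_unit_interval[OF continuous_map_fst])
  from continuous_map_comp[OF this continuous_map_into_join(3)]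
  show "continuous_map (prod_topology unit_interval X) ?J (\<lambda>p. join_shrink b k d (fst p, Left_End (snd p)))"
    by (simp add: join_shrink_def)
  have "continuous_map (prod_topology unit_interval (space_of Y)) (prod_topology (space_of Y) unit_interval) (\<lambda>p. (snd p, min 1 (2 * fst p)))"
    by (intro continuous_map_pairedI continuous_map_snd)
      (auto simp: continuous_map_into_unit_interval intro!: real_continuous_intros continuous_map_from_unit_interval[OF continuous_map_fst])
  from continuous_map_comp[OF continuous_map_comp[OF this k] continuous_map_into_join(2)]
  show "continuous_map (prod_topology unit_interval (space_of Y)) ?J (\<lambda>p. join_shrink b k d (fst p, Right_End (snd p)))"
    by (simp add: join_shrink_def)
  let ?P = "prod_topology unit_interval ?cyl"
  define x y s T D l where
    "x = (\<lambda>p::real \<times> 'a \<times> 'b \<times> real. fst (snd p))" and "y = (\<lambda>p::real \<times> 'a \<times> 'b \<times> real. fst (snd (snd p)))" and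
    "s = (\<lambda>p::real \<times> 'a \<times> 'b \<times> real. snd (snd (snd p)))" and
    "T = (\<lambda>p::real \<times> 'a \<times> 'b \<times> real. max 0 (2 * fst p - 1))" and "D = (\<lambda>p. max (d (y p)) (1 - T p))" and
    "l = (\<lambda>p. (1 - s p) * (2 * D p - 1 + T p))"
  have cx: "continuous_map ?P X x" and cyy: "continuous_map ?P (space_of Y) y" and cs: "continuous_map ?P euclideanreal s"
    unfolding x_def y_def s_def join_cylinder_def
    by (rule continuous_map_fst_comp[OF continuous_map_snd],
        rule continuous_map_fst_comp[OF continuous_map_snd_comp[OF continuous_map_snd]],
        rule continuous_map_from_unit_interval[OF continuous_map_snd_comp[OF continuous_map_snd_comp[OF continuous_map_snd]]])
  have ct: "continuous_map ?P euclideanreal fst"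
    by (rule continuous_map_from_unit_interval[OF continuous_map_fst])
  have cT: "continuous_map ?P euclideanreal T"
    unfolding T_def by (auto intro!: real_continuous_intros ct)
  have cD: "continuous_map ?P euclideanreal D"
    unfolding D_def by (auto intro!: real_continuous_intros cT continuous_map_comp[OF cyy continuous_map_from_unit_interval[OF d]])
  have cl: "continuous_map ?P euclideanreal l"
    unfolding l_def by (auto intro!: real_continuous_intros cT cD cs)
  have pre: "y p \<in> points Y" "fst p \<in> {0..1}" "s p \<in> {0..1}" if "p \<in> topspace ?P" for p
    using that by (auto simp: y_def s_def join_cylinder_def)
  have eqs: "T p = max 0 (2 * fst p - 1)" "D p = max (d (y p)) (1 - T p)" "l p = (1 - s p) * (2 * D p - 1 + T p)" for p
    by (simp_all only: T_def D_def l_def)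
  note num = shrink_numbers[OF pre eqs]
  let ?f = "\<lambda>p. if l p \<le> D p then join_map (x p, k (y p, min 1 (2 * fst p)), 1 - l p) else join_map (x p, b, 1 - 2 * D p + l p)"
  have "continuous_map ?P ?J ?f"
  proof (rule continuous_map_if_le[OF cl cD])
    show "continuous_map (subtopology ?P {p. l p \<le> D p}) ?J (\<lambda>p. join_map (x p, k (y p, min 1 (2 * fst p)), 1 - l p))"
    proof (intro jm continuous_map_from_subtopology[OF cx] continuous_map_from_subtopology[OF continuous_map_comp[OF _ k]])
      show "continuous_map ?P (prod_topology (space_of Y) unit_interval) (\<lambda>p. (y p, min 1 (2 * fst p)))"
        by (intro continuous_map_pairedI cyy) (auto simp: continuous_map_into_unit_interval intro!: real_continuous_intros ct)
      show "continuous_map (subtopology ?P {p. l p \<le> D p}) unit_interval (\<lambda>p. 1 - l p)"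
        unfolding continuous_map_into_unit_interval
      proof (intro conjI ballI)
        show "continuous_map (subtopology ?P {p. l p \<le> D p}) euclideanreal (\<lambda>p. 1 - l p)"
          by (intro continuous_map_from_subtopology continuous_map_diff cl) simp
        fix p assume "p \<in> topspace (subtopology ?P {p. l p \<le> D p})"
        then have "p \<in> topspace ?P" "l p \<le> D p" by auto
        then show "0 \<le> 1 - l p" "1 - l p \<le> 1" using num(1-7)[of p] by auto
      qed
    qed
    show "continuous_map (subtopology ?P {p. D p \<le> l p}) ?J (\<lambda>p. join_map (x p, b, 1 - 2 * D p + l p))"
    proof (intro jm continuous_map_from_subtopology[OF cx])
      show "continuous_map (subtopology ?P {p. D p \<le> l p}) unit_interval (\<lambda>p. 1 - 2 * D p + l p)"
        unfolding continuous_map_into_unit_interval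
      proof (intro conjI ballI)
        show "continuous_map (subtopology ?P {p. D p \<le> l p}) euclideanreal (\<lambda>p. 1 - 2 * D p + l p)"
          by (rule continuous_map_from_subtopology) (auto intro!: real_continuous_intros cl cD)
        fix p assume "p \<in> topspace (subtopology ?P {p. D p \<le> l p})"
        then have "p \<in> topspace ?P" "D p \<le> l p" by auto
        then show "0 \<le> 1 - 2 * D p + l p" "1 - 2 * D p + l p \<le> 1" using num(1-7)[of p] by auto
      qed
    qed (use base in simp)
    fix p assume p: "p \<in> topspace ?P" "l p = D p"
    show "join_map (x p, k (y p, min 1 (2 * fst p)), 1 - l p) = join_map (x p, b, 1 - 2 * D p + l p)"
    proof (cases "D p < 1")
      case True
      then show ?thesis using num(8)[OF p(1) p(1) p(1)] p(2) by simp
    next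
      case False
      then have "D p = 1" using num(4)[OF p(1) p(1) p(1)] by simp
      then show ?thesis using p(2) by simp
    qed
  qed
  then show "continuous_map ?P ?J (\<lambda>p. join_shrink b k d (fst p, join_map (snd p)))"
  proof (rule continuous_map_eq)
    fix p assume p: "p \<in> topspace ?P"
    have "?f p = join_shrink_body b k d (fst p, x p, y p, s p)"
      by (simp add: join_shrink_body_def Let_def D_def T_def l_def)
    also have "\<dots> = join_shrink b k d (fst p, join_map (x p, y p, s p))"
      by (rule shrink_body_join_map[OF pre[OF p]])
    finally show "?f p = join_shrink b k d (fst p, join_map (snd p))"
      by (simp add: x_def y_def s_def)
  qed
qed

lemma join_shrink_0:
  assumes "p \<in> join_points X (space_of Y)"
  shows "join_shrink b k d (0, p) = p"
proof (rule join_points_cases[OF assms])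
  fix z assume z: "z \<in> topspace (join_cylinder X (space_of Y))" "p = join_map z"
  obtain x y s where xys: "z = (x, y, s)" by (cases z)
  then have y: "y \<in> points Y" "s \<in> {0..1}" using z by (auto simp: join_cylinder_def)
  have "join_shrink b k d (0, p) = join_shrink_body b k d (0, x, y, s)"
    using shrink_body_join_map[OF y(1) _ y(2), of 0 x] z(2) xys by simp
  also have "\<dots> = join_map (x, y, s)"
    using d01[OF y(1)] y k0[OF y(1)] by (simp add: join_shrink_body_def Let_def max_def)
  finally show ?thesis using z(2) xys by simp
qed (simp_all add: join_shrink_def k0)

lemma join_shrink_base: "t \<in> {0..1} \<Longrightarrow> join_shrink b k d (t, Right_End b) = Right_End b"
  by (simp add: join_shrink_def kb)

lemma join_shrink_cone:
  assumes t: "\<tau> \<in> {0..1}" and p: "p \<in> join_cone X Y"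
  shows "join_shrink b k d (\<tau>, p) \<in> join_cone X Y"
    and "\<tau> = 1 \<Longrightarrow> join_shrink b k d (\<tau>, p) = Right_End b"
proof -
  have "join_shrink b k d (\<tau>, p) \<in> join_cone X Y \<and> (\<tau> = 1 \<longrightarrow> join_shrink b k d (\<tau>, p) = Right_End b)"
  proof (cases "p = Right_End b")
    case True
    then show ?thesis using t by (simp add: join_cone_def join_shrink_base)
  next
    case False
    then obtain x s where x: "x \<in> topspace X" and s: "s \<in> {0..1}" and p: "p = join_map (x, b, s)"
      using p by (auto simp: join_cone_def)
    define T where "T = max 0 (2 * \<tau> - 1)"
    define D where "D = max (d b) (1 - T)"
    define l where "l = (1 - s) * (2 * D - 1 + T)"
    note n = shrink_numbers[OF base t s T_def D_def l_def]
    have kk: "k (b, min 1 (2 * \<tau>)) = b" using t by (intro kb) auto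
    have body: "join_shrink_body b k d (\<tau>, x, b, s)
        = (if l \<le> D then join_map (x, k (b, min 1 (2 * \<tau>)), 1 - l) else join_map (x, b, 1 - 2 * D + l))"
      by (simp add: join_shrink_body_def Let_def T_def D_def l_def)
    have e: "join_shrink b k d (\<tau>, p) = (if l \<le> D then join_map (x, b, 1 - l) else join_map (x, b, 1 - 2 * D + l))"
      unfolding p shrink_body_join_map[OF base t s, of x, symmetric] body kk ..
    have "1 - l \<in> {0..1}" if "l \<le> D" using n that by auto
    moreover have "1 - 2 * D + l \<in> {0..1}" if "\<not> l \<le> D" using n that by auto
    ultimately have "join_shrink b k d (\<tau>, p) \<in> join_cone X Y"
      unfolding e join_cone_def using x by auto
    moreover have "join_shrink b k d (\<tau>, p) = Right_End b" if "\<tau> = 1"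
    proof -
      have "D = 0" "l = 0" using that by (simp_all add: D_def T_def db l_def)
      then show ?thesis unfolding e by simp
    qed
    ultimately show ?thesis by blast
  qed
  then show "join_shrink b k d (\<tau>, p) \<in> join_cone X Y" "\<tau> = 1 \<Longrightarrow> join_shrink b k d (\<tau>, p) = Right_End b" by auto
qed

end

section \<open>Collapsing contractible fibres\<close>

text \<open>The homotopy \<open>H\<close> at time \<open>1\<close> factors through \<open>G\<close> and gives the inverse \<open>g\<close>. So \<open>g \<circ> G\<close> is homotopic
  to the identity by \<open>H\<close>, and \<open>G \<circ> g\<close> by the homotopy that \<open>H\<close> induces on \<open>Z\<close>, which is continuous
  because the product of \<open>G\<close> with the unit interval is a quotient map.\<close>

lemma collapse_fibre_homotopy_equivalence:
  assumes G: "quotient_map (space_of X) (space_of Z) G" and Gb: "G (basept X) = basept Z"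
    and base: "basept X \<in> points X"
    and inj: "\<And>x y. x \<in> points X \<Longrightarrow> y \<in> points X \<Longrightarrow> G x = G y \<Longrightarrow> G x \<noteq> basept Z \<Longrightarrow> x = y"
    and H: "continuous_map (prod_topology unit_interval (space_of X)) (space_of X) H"
    and H0: "\<And>x. x \<in> points X \<Longrightarrow> H (0, x) = x"
    and Hb: "\<And>t. t \<in> {0..1} \<Longrightarrow> H (t, basept X) = basept X"
    and HN: "\<And>t x. t \<in> {0..1} \<Longrightarrow> x \<in> points X \<Longrightarrow> G x = basept Z \<Longrightarrow> G (H (t, x)) = basept Z"
    and H1: "\<And>x. x \<in> points X \<Longrightarrow> G x = basept Z \<Longrightarrow> H (1, x) = basept X"
  shows "\<exists>f. pointed_homotopy_equivalence Z X f"
proof -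
  have Gc: "continuous_map (space_of X) (space_of Z) G" by (rule quotient_imp_continuous_map[OF G])
  have Gs: "G ` points X = points Z" using G by (simp add: quotient_map_def)
  have Zb: "basept Z \<in> points Z" using imageI[OF base, of G] Gs Gb by simp
  have H1c: "continuous_map (space_of X) (space_of X) (\<lambda>x. H (1, x))"
    by (intro continuous_map_comp[OF _ H] continuous_map_pairedI) auto
  obtain g where g: "continuous_map (space_of Z) (space_of X) g" and gG: "\<And>x. x \<in> points X \<Longrightarrow> g (G x) = H (1, x)"
  proof (rule quotient_map_lift_exists[OF G H1c])
    fix x y assume xy: "x \<in> points X" "y \<in> points X" "G x = G y"
    show "H (1, x) = H (1, y)"
    proof (cases "G x = basept Z")
      case True
      then show ?thesis using H1 xy by simp
    next
      case False
      then show ?thesis using inj[OF xy] by simp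
    qed
  qed blast
  let ?q = "\<lambda>(t::real, x). (t, G x)"
  have q: "quotient_map (prod_topology unit_interval (space_of X)) (prod_topology unit_interval (space_of Z)) ?q"
    using quotient_map_prod_right[OF unit_interval_facts(3) disjI1[OF unit_interval_facts(2)] G] .
  have GH: "continuous_map (prod_topology unit_interval (space_of X)) (space_of Z) (\<lambda>p. G (H p))"
    by (rule continuous_map_comp[OF H Gc])
  obtain H' where H': "continuous_map (prod_topology unit_interval (space_of Z)) (space_of Z) H'"
    and H'G: "\<And>p. p \<in> topspace (prod_topology unit_interval (space_of X)) \<Longrightarrow> H' (?q p) = G (H p)"
  proof (rule quotient_map_lift_exists[OF q GH])
    fix p p' assume p: "p \<in> topspace (prod_topology unit_interval (space_of X))"
      "p' \<in> topspace (prod_topology unit_interval (space_of X))" "?q p = ?q p'"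
    obtain t x t' x' where tx: "p = (t, x)" "p' = (t', x')" by (cases p, cases p')
    then have e: "t' = t" "G x = G x'" and x: "x \<in> points X" "x' \<in> points X" "t \<in> {0..1}" using p by auto
    show "G (H p) = G (H p')"
    proof (cases "G x = basept Z")
      case True
      then show ?thesis using HN x e tx by simp
    next
      case False
      then show ?thesis using inj[OF x(1,2) e(2)] e tx by simp
    qed
  qed blast
  have H't: "H' (t, G x) = G (H (t, x))" if "t \<in> {0..1}" "x \<in> points X" for t x
    using H'G[of "(t, x)"] that by simp
  have i01: "(0::real) \<in> {0..1}" "(1::real) \<in> {0..1}" by auto
  have "pointed_homotopic X X (g \<circ> G) id"
    unfolding pointed_homotopic_def
  proof (rule homotopic_with_symD, subst homotopic_with)
    show "(h (basept X) = basept X) = (k (basept X) = basept X)" if "\<And>x. x \<in> points X \<Longrightarrow> h x = k x" for h k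
      using that[OF base] by simp
    show "\<exists>h. continuous_map (prod_topology unit_interval (space_of X)) (space_of X) h \<and>
        (\<forall>x\<in>points X. h (0, x) = id x) \<and> (\<forall>x\<in>points X. h (1, x) = (g \<circ> G) x) \<and>
        (\<forall>t\<in>{0..1}. h (t, basept X) = basept X)"
      using H H0 Hb gG by (intro exI[of _ H]) simp
  qed
  moreover have "pointed_homotopic Z Z (G \<circ> g) id"
    unfolding pointed_homotopic_def
  proof (rule homotopic_with_symD, subst homotopic_with)
    show "(h (basept Z) = basept Z) = (k (basept Z) = basept Z)" if "\<And>x. x \<in> points Z \<Longrightarrow> h x = k x" for h k
      using that[OF Zb] by simp
    have "H' (0, z) = z \<and> H' (1, z) = G (g z)" if z: "z \<in> points Z" for z
    proof -
      obtain x where x: "x \<in> points X" "z = G x" using z unfolding Gs[symmetric] by (rule imageE)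
      then show ?thesis using H't[OF i01(1) x(1)] H't[OF i01(2) x(1)] H0 gG by simp
    qed
    moreover have "H' (t, basept Z) = basept Z" if "t \<in> {0..1}" for t
      using H't[OF that base] Hb[OF that] Gb by simp
    ultimately show "\<exists>h. continuous_map (prod_topology unit_interval (space_of Z)) (space_of Z) h \<and>
        (\<forall>x\<in>points Z. h (0, x) = id x) \<and> (\<forall>x\<in>points Z. h (1, x) = (G \<circ> g) x) \<and>
        (\<forall>t\<in>{0..1}. h (t, basept Z) = basept Z)"
      using H' by (intro exI[of _ H']) simp
  qed
  moreover have "pointed_map X Z G" using Gc Gb by (simp add: pointed_map_def)
  moreover have "pointed_map Z X g"
    using g gG[OF base] Hb[OF i01(2)] Gb by (simp add: pointed_map_def)
  ultimately show ?thesis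
    unfolding pointed_homotopy_equivalence_def by (intro exI conjI)
qed

section \<open>Wedges and binary smash products\<close>

definition wedge_base :: "'i set \<Rightarrow> ('i \<Rightarrow> 'a pspace) \<Rightarrow> ('i \<times> 'a) set" where
  "wedge_base J X = (\<lambda>j. (j, basept (X j))) ` J"

definition smash_base :: "'a pspace \<Rightarrow> 'b pspace \<Rightarrow> ('a \<times> 'b) set" where
  "smash_base X Y = {(x, y). x = basept X \<or> y = basept Y}"

lemma wedge_eq: "wedge J X = collapse (sum_topology (\<lambda>j. space_of (X j)) J) (wedge_base J X)"
  by (simp add: wedge_def wedge_base_def)

lemma smash2_eq: "smash2 X Y = collapse (kification (prod_topology (space_of X) (space_of Y))) (smash_base X Y)"
  by (simp add: smash2_def smash_base_def)

lemma basept_wedge [simp]: "basept (wedge J X) = None" and basept_smash2 [simp]: "basept (smash2 X' Y) = None"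
  by (simp_all add: wedge_eq smash2_eq)

lemma Some_in_wedge: "Some (j, x) \<in> points (wedge J X) \<longleftrightarrow> j \<in> J \<and> x \<in> points (X j) \<and> x \<noteq> basept (X j)"
  by (auto simp: wedge_eq points_collapse wedge_base_def topspace_sum_topology)

lemma Some_in_smash2: "Some (x, y) \<in> points (smash2 X Y) \<longleftrightarrow> x \<in> points X \<and> y \<in> points Y \<and> x \<noteq> basept X \<and> y \<noteq> basept Y"
  by (auto simp: smash2_eq points_collapse smash_base_def)

lemma None_in_wedge [simp]: "None \<in> points (wedge J X)" and None_in_smash2 [simp]: "None \<in> points (smash2 X' Y)"
  by (simp_all add: wedge_eq smash2_eq)

definition wedge_homotopy_map :: "'i set \<Rightarrow> ('i \<Rightarrow> 'b pspace) \<Rightarrow> ('i \<Rightarrow> real \<times> 'a \<Rightarrow> 'b) \<Rightarrow> real \<times> ('i \<times> 'a) option \<Rightarrow> ('i \<times> 'b) option" where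
  "wedge_homotopy_map J Y F = (\<lambda>(t, z). case z of None \<Rightarrow> None | Some (j, x) \<Rightarrow> collapse_map (wedge_base J Y) (j, F j (t, x)))"

definition smash2_homotopy_map :: "'b pspace \<Rightarrow> 'c pspace \<Rightarrow> (real \<times> 'a \<Rightarrow> 'b) \<Rightarrow> real \<times> ('a \<times> 'c) option \<Rightarrow> ('b \<times> 'c) option" where
  "smash2_homotopy_map X' Y F = (\<lambda>(t, z). case z of None \<Rightarrow> None | Some (x, y) \<Rightarrow> collapse_map (smash_base X' Y) (F (t, x), y))"

lemma continuous_map_wedge_homotopy:
  assumes F: "\<And>j. j \<in> J \<Longrightarrow> continuous_map (prod_topology unit_interval (space_of (X j))) (space_of (Y j)) (F j)"
    and b: "\<And>j t. j \<in> J \<Longrightarrow> t \<in> {0..1} \<Longrightarrow> F j (t, basept (X j)) = basept (Y j)"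
  shows "continuous_map (prod_topology unit_interval (space_of (wedge J X))) (space_of (wedge J Y)) (wedge_homotopy_map J Y F)"
proof -
  have "continuous_map (prod_topology unit_interval (space_of (wedge J X))) (space_of (wedge J Y))
     (\<lambda>(t, z). case z of None \<Rightarrow> None | Some p \<Rightarrow> (\<lambda>(t, j, x). collapse_map (wedge_base J Y) (j, F j (t, x))) (t, p))"
    unfolding wedge_eq[of J X]
  proof (rule continuous_map_case_prod_collapse)
    show "continuous_map (prod_topology unit_interval (sum_topology (\<lambda>j. space_of (X j)) J)) (space_of (wedge J Y))
       (\<lambda>(t, j, x). collapse_map (wedge_base J Y) (j, F j (t, x)))"
    proof (rule continuous_map_from_prod_sum)
      fix j assume j: "j \<in> J"
      from continuous_map_comp[OF continuous_map_comp[OF F[OF j] continuous_map_sum_inject[OF j, of "\<lambda>j. space_of (Y j)"]] continuous_map_collapse_map]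
      show "continuous_map (prod_topology unit_interval (space_of (X j))) (space_of (wedge J Y))
         (\<lambda>(t, x). case (t, j, x) of (t, j, x) \<Rightarrow> collapse_map (wedge_base J Y) (j, F j (t, x)))"
        by (simp add: wedge_eq case_prod_unfold)
    qed
  qed (auto simp: wedge_base_def collapse_map_def b)
  then show ?thesis
    by (rule continuous_map_eq) (auto simp: wedge_homotopy_map_def split: option.split)
qed

lemma continuous_map_smash2_homotopy:
  assumes F: "continuous_map (prod_topology unit_interval (space_of X)) (space_of X') F"
    and b: "\<And>t. t \<in> {0..1} \<Longrightarrow> F (t, basept X) = basept X'"
  shows "continuous_map (prod_topology unit_interval (space_of (smash2 X Y))) (space_of (smash2 X' Y)) (smash2_homotopy_map X' Y F)"
proof -
  let ?P = "kification (prod_topology (space_of X) (space_of Y))"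
  have k: "k_space (prod_topology unit_interval ?P)"
    by (intro k_space_prod_topology_left) (simp_all add: unit_interval_facts)
  have id': "continuous_map ?P (prod_topology (space_of X) (space_of Y)) (\<lambda>p. p)"
    by (rule continuous_map_from_kification) simp
  have "continuous_map (prod_topology unit_interval ?P) (space_of X') (\<lambda>p. F (fst p, fst (snd p)))"
    by (intro continuous_map_comp[OF _ F] continuous_map_pairedI continuous_map_fst
        continuous_map_fst_comp[OF continuous_map_comp[OF continuous_map_snd id']])
  moreover have "continuous_map (prod_topology unit_interval ?P) (space_of Y) (\<lambda>p. snd (snd p))"
    by (rule continuous_map_snd_comp[OF continuous_map_comp[OF continuous_map_snd id']])
  ultimately have "continuous_map (prod_topology unit_interval ?P) (kification (prod_topology (space_of X') (space_of Y))) (\<lambda>p. (F (fst p, fst (snd p)), snd (snd p)))"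
    using k by (simp add: continuous_map_into_kification continuous_map_pairedI)
  from continuous_map_comp[OF this continuous_map_collapse_map]
  have c: "continuous_map (prod_topology unit_interval ?P) (space_of (smash2 X' Y)) (\<lambda>p. collapse_map (smash_base X' Y) (F (fst p, fst (snd p)), snd (snd p)))"
    by (simp add: smash2_eq)
  have "continuous_map (prod_topology unit_interval (space_of (smash2 X Y))) (space_of (smash2 X' Y))
     (\<lambda>(t, z). case z of None \<Rightarrow> None | Some p \<Rightarrow> (\<lambda>p. collapse_map (smash_base X' Y) (F (fst p, fst (snd p)), snd (snd p))) (t, p))"
    unfolding smash2_eq[of X Y]
  proof (rule continuous_map_case_prod_collapse[OF c])
    fix t :: real and p assume "t \<in> {0..1}" "p \<in> smash_base X Y"
    then show "collapse_map (smash_base X' Y) (F (fst (t, p), fst (snd (t, p))), snd (snd (t, p))) = None"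
      using b by (auto simp: smash_base_def collapse_map_def)
  qed simp
  then show ?thesis
    by (rule continuous_map_eq) (auto simp: smash2_homotopy_map_def split: option.split)
qed

section \<open>Maps out of compactly generated products with a quotient\<close>

lemma openin_sum_topologyI:
  assumes "U \<subseteq> Sigma J (\<lambda>j. topspace (X j))" "\<And>j. j \<in> J \<Longrightarrow> openin (X j) {x \<in> topspace (X j). (j, x) \<in> U}"
  shows "openin (sum_topology X J) U"
  unfolding openin_sum_topology
proof (intro conjI ballI)
  show "U \<subseteq> Sigma J (topspace \<circ> X)" using assms(1) by (simp add: o_def)
  fix j assume "j \<in> J"
  moreover have "{x \<in> topspace (X j). (j, x) \<in> U} = {x. (j, x) \<in> U}" using assms(1) by auto
  ultimately show "openin (X j) {x. (j, x) \<in> U}" using assms(2) by metis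
qed

lemma k_space_sum:
  assumes "\<And>j. j \<in> J \<Longrightarrow> k_space (X j)"
  shows "k_space (sum_topology X J)"
proof -
  have "openin (sum_topology X J) U" if U: "openin (kification (sum_topology X J)) U" for U
  proof (rule openin_sum_topologyI)
    show "U \<subseteq> Sigma J (\<lambda>j. topspace (X j))"
      using openin_subset[OF U] by (simp add: topspace_sum_topology o_def)
    show "openin (X j) {x \<in> topspace (X j). (j, x) \<in> U}" if "j \<in> J" for j
      by (rule openin_k_space_preimage[OF assms[OF that] continuous_map_sum_inject[OF that] U])
  qed
  then have "kification (sum_topology X J) = sum_topology X J"
    unfolding topology_eq using openin_kification_finer by blast
  then show ?thesis by (simp add: kification_eq_self)
qed

lemma continuous_map_from_kification_sum_prod:
  assumes k: "\<And>j. j \<in> J \<Longrightarrow> k_space (X j)" and Z: "Hausdorff_space Z"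
    and f: "\<And>j. j \<in> J \<Longrightarrow> continuous_map (kification (prod_topology (X j) Z)) Q (\<lambda>p. f ((j, fst p), snd p))"
  shows "continuous_map (kification (prod_topology (sum_topology X J) Z)) Q f"
  unfolding continuous_map
proof (intro conjI allI impI)
  have im: "f ((j, x), z) \<in> topspace Q" if "j \<in> J" "x \<in> topspace (X j)" "z \<in> topspace Z" for j x z
    using subsetD[OF continuous_map_image_subset_topspace[OF f[OF that(1)]] imageI[of "(x, z)"]] that by simp
  then show "f ` topspace (kification (prod_topology (sum_topology X J) Z)) \<subseteq> topspace Q"
    by (auto simp: topspace_sum_topology)
  fix V assume V: "openin Q V"
  let ?U = "{p \<in> topspace (kification (prod_topology (sum_topology X J) Z)). f p \<in> V}"
  have pre: "openin (kification (prod_topology (X j) Z)) {p \<in> topspace (prod_topology (X j) Z). f ((j, fst p), snd p) \<in> V}" if "j \<in> J" for j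
    using openin_continuous_map_preimage[OF f[OF that] V] by simp
  show "openin (kification (prod_topology (sum_topology X J) Z)) ?U"
  proof (rule openin_kification_prod_if_compact_slices[OF Z])
    show "?U \<subseteq> topspace (sum_topology X J) \<times> topspace Z" by auto
    fix s assume s: "s \<in> topspace (sum_topology X J)"
    obtain j x where jx: "s = (j, x)" by (cases s)
    then have j: "j \<in> J" "x \<in> topspace (X j)" using s by (auto simp: topspace_sum_topology)
    have "{z \<in> topspace Z. (s, z) \<in> ?U} = {z \<in> topspace Z. (x, z) \<in> {p \<in> topspace (prod_topology (X j) Z). f ((j, fst p), snd p) \<in> V}}"
      using s j jx by auto
    then show "openin (kification Z) {z \<in> topspace Z. (s, z) \<in> ?U}"
      using openin_slice[OF pre[OF j(1)] j(2)] by simp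
  next
    fix N assume N: "compactin Z N"
    have NZ: "N \<subseteq> topspace Z" using N compactin_subset_topspace by blast
    show "openin (sum_topology X J) {s \<in> topspace (sum_topology X J). \<forall>z\<in>N. (s, z) \<in> ?U}"
    proof (rule openin_sum_topologyI)
      show "{s \<in> topspace (sum_topology X J). \<forall>z\<in>N. (s, z) \<in> ?U} \<subseteq> Sigma J (\<lambda>j. topspace (X j))"
        by (auto simp: topspace_sum_topology)
      fix j assume j: "j \<in> J"
      have "{x \<in> topspace (X j). (j, x) \<in> {s \<in> topspace (sum_topology X J). \<forall>z\<in>N. (s, z) \<in> ?U}}
          = {x \<in> topspace (X j). \<forall>z\<in>N. (x, z) \<in> {p \<in> topspace (prod_topology (X j) Z). f ((j, fst p), snd p) \<in> V}}"
        using j NZ by (auto simp: topspace_sum_topology)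
      then show "openin (X j) {x \<in> topspace (X j). (j, x) \<in> {s \<in> topspace (sum_topology X J). \<forall>z\<in>N. (s, z) \<in> ?U}}"
        using compact_slices_openin[OF pre[OF j] k[OF j] N] by simp
    qed
  qed
qed

lemma continuous_map_from_kification_collapse_prod:
  assumes k: "k_space X" and Z: "Hausdorff_space Z"
    and f: "continuous_map (kification (prod_topology X Z)) Q (\<lambda>p. f (collapse_map S (fst p), snd p))"
    and f0: "\<And>z. z \<in> topspace Z \<Longrightarrow> f (None, z) = q" and q: "q \<in> topspace Q"
  shows "continuous_map (kification (prod_topology (space_of (collapse X S)) Z)) Q f"
  unfolding continuous_map
proof (intro conjI allI impI)
  let ?C = "space_of (collapse X S)"
  have im: "f (collapse_map S x, z) \<in> topspace Q" if "x \<in> topspace X" "z \<in> topspace Z" for x z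
    using subsetD[OF continuous_map_image_subset_topspace[OF f] imageI[of "(x, z)"]] that by simp
  have C: "c \<in> topspace ?C \<Longrightarrow> c = None \<or> (\<exists>x\<in>topspace X. c = collapse_map S x)" for c
    by (auto simp: points_collapse collapse_map_def)
  show "f ` topspace (kification (prod_topology ?C Z)) \<subseteq> topspace Q"
  proof (intro image_subsetI)
    fix p assume p: "p \<in> topspace (kification (prod_topology ?C Z))"
    obtain c z where cz: "p = (c, z)" by (cases p)
    then have "z \<in> topspace Z" "c \<in> topspace ?C" using p by auto
    then show "f p \<in> topspace Q" using C[of c] im f0 q cz by auto
  qed
  fix V assume V: "openin Q V"
  let ?U = "{p \<in> topspace (kification (prod_topology ?C Z)). f p \<in> V}"
  let ?P = "{p \<in> topspace (prod_topology X Z). f (collapse_map S (fst p), snd p) \<in> V}"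
  have pre: "openin (kification (prod_topology X Z)) ?P"
    using openin_continuous_map_preimage[OF f V] by simp
  show "openin (kification (prod_topology ?C Z)) ?U"
  proof (rule openin_kification_prod_if_compact_slices[OF Z])
    show "?U \<subseteq> topspace ?C \<times> topspace Z" by auto
    fix c assume c: "c \<in> topspace ?C"
    then consider "c = None" | x where "x \<in> topspace X" "c = collapse_map S x" using C by blast
    then show "openin (kification Z) {z \<in> topspace Z. (c, z) \<in> ?U}"
    proof cases
      case 1
      then have "{z \<in> topspace Z. (c, z) \<in> ?U} = (if q \<in> V then topspace Z else {})"
        using f0 by auto
      then show ?thesis
        using openin_topspace[of "kification Z"] by simp
    next
      case (2 x)
      have "{z \<in> topspace Z. (c, z) \<in> ?U} = {z \<in> topspace Z. (x, z) \<in> ?P}"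
        using 2 c by auto
      then show ?thesis using openin_slice[OF pre 2(1)] by simp
    qed
  next
    fix N assume N: "compactin Z N"
    have NZ: "N \<subseteq> topspace Z" using N compactin_subset_topspace by blast
    show "openin ?C {c \<in> topspace ?C. \<forall>z\<in>N. (c, z) \<in> ?U}"
    proof (rule openin_collapseI)
      have "{x \<in> topspace X. collapse_map S x \<in> {c \<in> topspace ?C. \<forall>z\<in>N. (c, z) \<in> ?U}}
          = {x \<in> topspace X. \<forall>z\<in>N. (x, z) \<in> ?P}"
        using NZ collapse_map_in_points[of _ X S] by auto
      then show "openin X {x \<in> topspace X. collapse_map S x \<in> {c \<in> topspace ?C. \<forall>z\<in>N. (c, z) \<in> ?U}}"
        using compact_slices_openin[OF pre k N] by simp
    qed blast
  qed
qed

lemma Hausdorff_space_kification: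
  assumes "Hausdorff_space X" shows "Hausdorff_space (kification X)"
  unfolding Hausdorff_space_def topspace_kification
proof (intro allI impI, elim conjE)
  fix x y assume "x \<in> topspace X" "y \<in> topspace X" "x \<noteq> y"
  then obtain U W where "openin X U" "openin X W" "x \<in> U" "y \<in> W" "disjnt U W"
    using assms unfolding Hausdorff_space_def by meson
  then show "\<exists>U W. openin (kification X) U \<and> openin (kification X) W \<and> x \<in> U \<and> y \<in> W \<and> disjnt U W"
    by (intro exI[of _ U] exI[of _ W] conjI openin_kification_finer)
qed

text \<open>A point outside of the fat wedge is separated from it by the product of neighbourhoods of its
  coordinates that avoid neighbourhoods of the base points.\<close>

lemma Hausdorff_space_smash:
  assumes fin: "finite I" and H: "\<And>i. i \<in> I \<Longrightarrow> Hausdorff_space (space_of (X i))"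
    and b: "\<And>i. i \<in> I \<Longrightarrow> basept (X i) \<in> points (X i)"
  shows "Hausdorff_space (space_of (smash I X))"
  unfolding smash_eq
proof (rule Hausdorff_space_collapse)
  let ?P = "product_topology (\<lambda>i. space_of (X i)) I"
  show "Hausdorff_space (kification ?P)"
    using H by (intro Hausdorff_space_kification) (auto simp: Hausdorff_space_product_topology)
  fix x assume x: "x \<in> topspace (kification ?P) - fat_wedge I X"
  then have xP: "x \<in> (\<Pi>\<^sub>E i\<in>I. points (X i))" and xb: "\<And>i. i \<in> I \<Longrightarrow> x i \<noteq> basept (X i)"
    by (auto simp: fat_wedge_def)
  have "\<exists>U V. openin (space_of (X i)) U \<and> openin (space_of (X i)) V \<and> x i \<in> U \<and> basept (X i) \<in> V \<and> disjnt U V" if "i \<in> I" for i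
    using H[OF that] xb[OF that] b[OF that] xP that unfolding Hausdorff_space_def by (simp add: PiE_iff)
  then obtain U V where UV: "\<And>i. i \<in> I \<Longrightarrow> openin (space_of (X i)) (U i)" "\<And>i. i \<in> I \<Longrightarrow> openin (space_of (X i)) (V i)"
     "\<And>i. i \<in> I \<Longrightarrow> x i \<in> U i" "\<And>i. i \<in> I \<Longrightarrow> basept (X i) \<in> V i" "\<And>i. i \<in> I \<Longrightarrow> disjnt (U i) (V i)"
    by metis
  let ?U = "\<Pi>\<^sub>E i\<in>I. U i" and ?V = "\<Union>i\<in>I. {y \<in> topspace ?P. y i \<in> V i}"
  have "openin ?P ?U"
    using fin UV(1) by (simp add: openin_PiE)
  moreover have "openin ?P ?V"
  proof (rule openin_Union)
    fix S assume "S \<in> (\<lambda>i. {y \<in> topspace ?P. y i \<in> V i}) ` I"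
    then obtain i where i: "i \<in> I" "S = {y \<in> topspace ?P. y i \<in> V i}" by blast
    show "openin ?P S"
      unfolding i(2) by (rule openin_continuous_map_preimage[OF continuous_map_product_projection[OF i(1), of "\<lambda>i. space_of (X i)"] UV(2)[OF i(1)]])
  qed
  moreover have "x \<in> ?U" using UV(3) xP by (auto simp: PiE_iff)
  moreover have "fat_wedge I X \<inter> topspace (kification ?P) \<subseteq> ?V"
  proof
    fix y assume y: "y \<in> fat_wedge I X \<inter> topspace (kification ?P)"
    then obtain i where "i \<in> I" "y i = basept (X i)" by (auto simp: fat_wedge_def)
    then have "i \<in> I" "y \<in> {y \<in> topspace ?P. y i \<in> V i}" using y UV(4)[of i] by simp_all
    then show "y \<in> ?V" by (rule UN_I)
  qed
  moreover have "disjnt ?U ?V"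
    using UV(5) by (auto simp: disjnt_def PiE_iff)
  ultimately show "\<exists>U V. openin (kification ?P) U \<and> openin (kification ?P) V \<and> x \<in> U \<and> fat_wedge I X \<inter> topspace (kification ?P) \<subseteq> V \<and> disjnt U V"
    by (intro exI[of _ ?U] exI[of _ ?V] conjI openin_kification_finer)
qed

section \<open>Cones on geometric realizations\<close>

definition height :: "'v set \<Rightarrow> ('v \<Rightarrow> real) \<Rightarrow> real" where
  "height V t = Max (insert 0 (t ` V))"

text \<open>The cone on the realization of \<open>L\<close> as a subset of a cube: the apex is \<open>0\<close> and the base consists
  of the points with some coordinate equal to \<open>1\<close>.\<close>

definition cubical_cone :: "'v set set \<Rightarrow> ('v \<Rightarrow> real) topology" where
  "cubical_cone L = subtopology (powertop_real UNIV) {t. (\<forall>v. 0 \<le> t v \<and> t v \<le> 1) \<and> {v. t v \<noteq> 0} \<in> L}"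

text \<open>Polar coordinates in the cubical cone, with the maximum norm for the radius and the sum norm for the
  direction. The apex is sent to the end of \<open>y\<close> in the join, and the base to the realization.\<close>

definition cone_to_join :: "'v set \<Rightarrow> ('v \<Rightarrow> real) \<times> 'b \<Rightarrow> ('v \<Rightarrow> real, 'b) join_point" where
  "cone_to_join V = (\<lambda>(t, y). if height V t = 0 then Right_End y
      else join_map (\<lambda>v. t v / (\<Sum>u\<in>V. t u), y, 1 - height V t))"

text \<open>The inverse of the polar coordinates.\<close>

definition cone_point :: "'v set \<Rightarrow> ('v \<Rightarrow> real) \<times> real \<Rightarrow> 'v \<Rightarrow> real" where
  "cone_point V = (\<lambda>(l, s) v. (1 - s) * l v / height V l)"

lemma continuous_map_coordinate: "continuous_map (powertop_real UNIV) euclideanreal (\<lambda>x. x v)"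
  by (rule continuous_map_product_projection) simp

lemma topspace_realization:
  "topspace (geometric_realization L) = {x. (\<forall>v. 0 \<le> x v) \<and> {v. x v \<noteq> 0} \<in> L \<and> (\<Sum>v | x v \<noteq> 0. x v) = 1}"
  by (simp add: geometric_realization_def)

lemma topspace_cubical_cone:
  "topspace (cubical_cone L) = {t. (\<forall>v. 0 \<le> t v \<and> t v \<le> 1) \<and> {v. t v \<noteq> 0} \<in> L}"
  by (simp add: cubical_cone_def)

lemma height_props:
  assumes "finite V"
  shows "0 \<le> height V t" "v \<in> V \<Longrightarrow> t v \<le> height V t" "height V t = 0 \<or> (\<exists>v\<in>V. t v = height V t)"
proof -
  have f: "finite (insert 0 (t ` V))" using assms by simp
  show "0 \<le> height V t" unfolding height_def using f by (intro Max_ge) auto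
  show "t v \<le> height V t" if "v \<in> V" unfolding height_def using f that by (intro Max_ge) auto
  have "height V t \<in> insert 0 (t ` V)" unfolding height_def using f by (intro Max_in) auto
  then show "height V t = 0 \<or> (\<exists>v\<in>V. t v = height V t)" by auto
qed

lemma height_eqI:
  assumes "finite V" "0 \<le> c" "\<And>v. v \<in> V \<Longrightarrow> t v \<le> c" "c = 0 \<or> (\<exists>v\<in>V. t v = c)"
  shows "height V t = c"
  unfolding height_def using assms by (intro Max_eqI) auto

lemma continuous_map_height:
  assumes "finite V" "\<And>v. v \<in> V \<Longrightarrow> continuous_map X euclideanreal (\<lambda>x. t x v)"
  shows "continuous_map X euclideanreal (\<lambda>x. height V (t x))"
  using assms
proof (induction V rule: finite_induct)
  case empty
  then show ?case by (simp add: height_def)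
next
  case (insert v V)
  have "height (insert v V) s = max (s v) (height V s)" for s :: "'a \<Rightarrow> real"
    using insert.hyps by (simp add: height_def insert_commute[of 0])
  then show ?case
    using insert by (simp add: continuous_map_real_max)
qed

locale finite_complex =
  fixes V :: "'v set" and L :: "'v set set"
  assumes fin: "finite V" and sub: "\<And>\<rho>. \<rho> \<in> L \<Longrightarrow> \<rho> \<subseteq> V" and down: "\<And>\<rho> \<tau>. \<rho> \<in> L \<Longrightarrow> \<tau> \<subseteq> \<rho> \<Longrightarrow> \<tau> \<in> L"
begin

abbreviation "G \<equiv> geometric_realization L"

lemma realization_sum:
  assumes "x \<in> topspace G" shows "(\<Sum>v\<in>V. x v) = 1"
proof -
  have "{v. x v \<noteq> 0} \<subseteq> V" using assms sub by (auto simp: topspace_realization)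
  then have "(\<Sum>v\<in>V. x v) = (\<Sum>v | x v \<noteq> 0. x v)"
    using fin by (intro sum.mono_neutral_right) auto
  then show ?thesis using assms by (simp add: topspace_realization)
qed

lemma Hausdorff_realization: "Hausdorff_space G"
  unfolding geometric_realization_def by (intro Hausdorff_space_subtopology) (simp add: Hausdorff_space_product_topology)

lemma compact_realization: "compact_space G"
proof -
  let ?T = "powertop_real (UNIV :: 'v set)"
  have "compact_space (product_topology (\<lambda>_. top_of_set {0..1::real}) (UNIV :: 'v set))"
    by (simp add: compact_space_product_topology compact_space_subtopology)
  then have c: "compactin ?T (\<Pi>\<^sub>E i\<in>UNIV. {0..1::real})"
    by (simp add: compactin_PiE)
  let ?F = "\<lambda>\<rho>. {x. (\<forall>v. 0 \<le> x v) \<and> (\<forall>v. v \<notin> \<rho> \<longrightarrow> x v = 0) \<and> (\<Sum>v\<in>V. x v) = (1::real)}"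
  have coord: "continuous_map ?T euclideanreal (\<lambda>x. x v)" for v
    by (rule continuous_map_product_projection) simp
  have cl: "closedin ?T (?F \<rho>)" for \<rho>
  proof -
    have "?F \<rho> = (\<Inter>v. {x \<in> topspace ?T. x v \<in> (if v \<in> \<rho> then {0..} else {0})}) \<inter> {x \<in> topspace ?T. (\<Sum>v\<in>V. x v) \<in> {1}}"
      by (auto split: if_splits) (metis order_refl)
    moreover have "closedin ?T {x \<in> topspace ?T. x v \<in> (if v \<in> \<rho> then {0..} else {0})}" for v
      by (rule closedin_continuous_map_preimage[OF coord]) auto
    moreover have "closedin ?T {x \<in> topspace ?T. (\<Sum>v\<in>V. x v) \<in> {1}}"
      by (rule closedin_continuous_map_preimage[where Y = euclideanreal]) (auto intro: continuous_map_sum[OF fin] coord)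
    ultimately show ?thesis
      by (simp only:) (intro closedin_Int closedin_Inter, auto)
  qed
  have finL: "finite L"
    using finite_subset[of L "Pow V"] fin sub by auto
  have eq: "topspace G = (\<Union>\<rho>\<in>L. ?F \<rho>)"
  proof (intro equalityI subsetI)
    fix x assume x: "x \<in> topspace G"
    then show "x \<in> (\<Union>\<rho>\<in>L. ?F \<rho>)"
      using realization_sum[OF x] by (intro UN_I[of "{v. x v \<noteq> 0}"]) (auto simp: topspace_realization)
  next
    fix x assume "x \<in> (\<Union>\<rho>\<in>L. ?F \<rho>)"
    then obtain \<rho> where \<rho>: "\<rho> \<in> L" "x \<in> ?F \<rho>" by blast
    then have s: "{v. x v \<noteq> 0} \<subseteq> \<rho>" by auto
    moreover have "(\<Sum>v\<in>V. x v) = (\<Sum>v | x v \<noteq> 0. x v)"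
      using fin s sub[OF \<rho>(1)] by (intro sum.mono_neutral_right) auto
    ultimately show "x \<in> topspace G"
      using \<rho> down[OF \<rho>(1) s] by (auto simp: topspace_realization)
  qed
  have "closedin ?T (topspace G)"
    unfolding eq using finL cl by (intro closedin_Union) auto
  moreover have "topspace G \<subseteq> (\<Pi>\<^sub>E i\<in>UNIV. {0..1::real})"
  proof
    fix x assume x: "x \<in> topspace G"
    have nn: "0 \<le> x v" for v using x by (auto simp: topspace_realization)
    have "x v \<le> 1" for v
    proof (cases "v \<in> V")
      case True
      then have "x v \<le> (\<Sum>v\<in>V. x v)" using fin nn by (intro member_le_sum) auto
      then show ?thesis using realization_sum[OF x] by simp
    next
      case False
      then have "x v = 0" using x sub by (auto simp: topspace_realization)
      then show ?thesis by simp
    qed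
    then show "x \<in> (\<Pi>\<^sub>E i\<in>UNIV. {0..1::real})" using nn by auto
  qed
  ultimately have "compactin ?T (topspace G)"
    using closed_compactin[OF c] by blast
  then show ?thesis
    by (simp add: geometric_realization_def compact_space_subtopology)
qed

lemma height_realization:
  assumes x: "x \<in> topspace G" shows "0 < height V x" "\<exists>v\<in>V. x v = height V x \<and> x v \<noteq> 0"
proof -
  show p: "0 < height V x"
  proof (rule ccontr)
    assume "\<not> 0 < height V x"
    then have "height V x = 0" using height_props(1)[OF fin, of x] by linarith
    then have "x v = 0" if "v \<in> V" for v
      using height_props(2)[OF fin that, of x] x by (auto simp: topspace_realization intro: antisym)
    then show False using realization_sum[OF x] by simp
  qed
  then show "\<exists>v\<in>V. x v = height V x \<and> x v \<noteq> 0"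
    using height_props(3)[OF fin, of x] by auto
qed

lemma cone_point_props:
  assumes l: "l \<in> topspace G" and s: "s \<in> {0..1}" and e: "{} \<in> L"
  shows "cone_point V (l, s) \<in> topspace (cubical_cone L)" and "height V (cone_point V (l, s)) = 1 - s"
    and "s \<noteq> 1 \<Longrightarrow> cone_to_join V (cone_point V (l, s), y) = join_map (l, y, s)"
    and "v \<in> V \<Longrightarrow> s \<noteq> 0 \<Longrightarrow> cone_point V (l, s) v < 1"
proof -
  have nn: "0 \<le> l v" for v using l by (auto simp: topspace_realization)
  have l0: "l v = 0" if "v \<notin> V" for v using l sub that by (auto simp: topspace_realization)
  note hp = height_realization(1)[OF l]
  have le: "l v \<le> height V l" for v
    using height_props(2)[OF fin, of v l] l0[of v] hp by (cases "v \<in> V") auto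
  have bnd: "0 \<le> cone_point V (l, s) v" "cone_point V (l, s) v \<le> 1 - s" for v
  proof -
    show "0 \<le> cone_point V (l, s) v" using nn[of v] s hp by (simp add: cone_point_def)
    have "l v / height V l \<le> 1" using le[of v] hp by simp
    then have "(1 - s) * (l v / height V l) \<le> (1 - s) * 1" using s by (intro mult_left_mono) auto
    then show "cone_point V (l, s) v \<le> 1 - s" by (simp add: cone_point_def)
  qed
  have "{v. cone_point V (l, s) v \<noteq> 0} \<in> L"
    by (rule down[of "{v. l v \<noteq> 0}"]) (use l in \<open>auto simp: topspace_realization cone_point_def\<close>)
  moreover have "cone_point V (l, s) v \<le> 1" for v
  proof -
    have "0 \<le> s" using s by simp
    then show ?thesis using bnd(2)[of v] by linarith
  qed
  ultimately show "cone_point V (l, s) \<in> topspace (cubical_cone L)"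
    using bnd(1) by (simp add: topspace_cubical_cone)
  obtain v where v: "v \<in> V" "l v = height V l" using height_realization(2)[OF l] by blast
  show h: "height V (cone_point V (l, s)) = 1 - s"
  proof (rule height_eqI[OF fin])
    show "0 \<le> 1 - s" using s by simp
    show "cone_point V (l, s) u \<le> 1 - s" for u by (rule bnd)
    show "1 - s = 0 \<or> (\<exists>v\<in>V. cone_point V (l, s) v = 1 - s)"
      using v hp by (intro disjI2 bexI[of _ v]) (simp_all add: cone_point_def)
  qed
  show "cone_to_join V (cone_point V (l, s), y) = join_map (l, y, s)" if "s \<noteq> 1"
  proof -
    have "(\<Sum>u\<in>V. cone_point V (l, s) u) = (\<Sum>u\<in>V. l u) * ((1 - s) / height V l)"
      unfolding sum_distrib_right by (simp add: cone_point_def mult.commute)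
    then have sm: "(\<Sum>u\<in>V. cone_point V (l, s) u) = (1 - s) / height V l"
      using realization_sum[OF l] by simp
    have "(\<lambda>v. cone_point V (l, s) v / (\<Sum>u\<in>V. cone_point V (l, s) u)) = l"
      unfolding sm using that hp by (auto simp: cone_point_def field_simps)
    then show ?thesis
      using that h by (simp add: cone_to_join_def)
  qed
  show "cone_point V (l, s) v < 1" if "s \<noteq> 0" for v
    using bnd(2)[of v] s that by simp
qed

lemma continuous_map_cone_point:
  "continuous_map (prod_topology G unit_interval) euclideanreal (\<lambda>p. cone_point V p v)"
proof -
  have c: "continuous_map (prod_topology G unit_interval) euclideanreal (\<lambda>p. fst p u)" for u
    unfolding geometric_realization_def
    by (rule continuous_map_comp[OF continuous_map_fst continuous_map_from_subtopology[OF continuous_map_coordinate]])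
  have "continuous_map (prod_topology G unit_interval) euclideanreal (\<lambda>p. (1 - snd p) * fst p v / height V (fst p))"
  proof (intro continuous_map_real_divide continuous_map_real_mult c continuous_map_height[OF fin])
    show "continuous_map (prod_topology G unit_interval) euclideanreal (\<lambda>p. 1 - snd p)"
      by (auto intro!: real_continuous_intros continuous_map_from_unit_interval[OF continuous_map_snd])
    show "height V (fst p) \<noteq> 0" if "p \<in> topspace (prod_topology G unit_interval)" for p
    proof -
      have "fst p \<in> topspace G" using that by auto
      then show ?thesis using height_realization(1)[of "fst p"] by simp
    qed
  qed
  then show ?thesis by (simp add: cone_point_def case_prod_unfold)
qed

lemma cubical_cone_normalize:
  assumes t: "t \<in> topspace (cubical_cone L)" and h: "height V t \<noteq> 0"
  defines "n \<equiv> \<lambda>v. t v / (\<Sum>u\<in>V. t u)"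
  shows "n \<in> topspace G" and "cone_point V (n, 1 - height V t) = t" and "0 < (\<Sum>u\<in>V. t u)"
proof -
  have nn: "0 \<le> t v" for v using t by (auto simp: topspace_cubical_cone)
  have tV: "{v. t v \<noteq> 0} \<subseteq> V" using t sub by (auto simp: topspace_cubical_cone)
  obtain v where v: "v \<in> V" "t v = height V t" using height_props(3)[OF fin, of t] h by blast
  have hp: "0 < height V t" using h height_props(1)[OF fin, of t] by simp
  have "t v \<le> (\<Sum>u\<in>V. t u)" using fin v nn by (intro member_le_sum) auto
  then show sp: "0 < (\<Sum>u\<in>V. t u)" using v hp by simp
  have supp: "{v. n v \<noteq> 0} = {v. t v \<noteq> 0}" using sp by (auto simp: n_def)
  have "(\<Sum>v | t v \<noteq> 0. t v) = (\<Sum>v\<in>V. t v)" using fin tV by (intro sum.mono_neutral_left) auto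
  then have "(\<Sum>v | n v \<noteq> 0. n v) = 1"
    unfolding supp n_def using sp by (simp add: sum_divide_distrib[symmetric])
  then show n: "n \<in> topspace G"
    unfolding topspace_realization using supp t nn sp by (auto simp: topspace_cubical_cone n_def)
  have "height V n = height V t / (\<Sum>u\<in>V. t u)"
  proof (rule height_eqI[OF fin])
    show "0 \<le> height V t / (\<Sum>u\<in>V. t u)" using hp sp by simp
    show "n u \<le> height V t / (\<Sum>u\<in>V. t u)" if "u \<in> V" for u
      using height_props(2)[OF fin that, of t] sp by (simp add: n_def divide_right_mono)
    show "height V t / (\<Sum>u\<in>V. t u) = 0 \<or> (\<exists>v\<in>V. n v = height V t / (\<Sum>u\<in>V. t u))"
      using v by (auto simp: n_def)
  qed
  then show "cone_point V (n, 1 - height V t) = t"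
    using hp sp by (auto simp: cone_point_def n_def)
qed

text \<open>Only the apex needs an argument. Compactness of the realization gives, for an open set of the join
  containing the end of \<open>y\<close>, a neighbourhood that is uniform in the direction.\<close>

lemma continuous_map_cone_to_join:
  "continuous_map (prod_topology (cubical_cone L) Y) (join_topology G Y) (cone_to_join V)"
proof -
  let ?T = "cubical_cone L" and ?J = "join_topology G Y" and ?f = "cone_to_join V"
  let ?P = "prod_topology ?T Y"
  have ct: "continuous_map ?T euclideanreal (\<lambda>t. t v)" for v
    unfolding cubical_cone_def by (rule continuous_map_from_subtopology[OF continuous_map_coordinate])
  have ch: "continuous_map ?T euclideanreal (height V)"
    using continuous_map_height[OF fin, of ?T "\<lambda>t. t"] ct by simp
  have h01: "0 \<le> height V t" "height V t \<le> 1" if "t \<in> topspace ?T" for t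
  proof -
    show "0 \<le> height V t" by (rule height_props(1)[OF fin])
    have "t v \<le> 1" for v using that by (auto simp: topspace_cubical_cone)
    then show "height V t \<le> 1"
      using height_props(3)[OF fin, of t] by (metis zero_le_one)
  qed
  \<comment> \<open>away from the apex the map factors through the cylinder of the join\<close>
  let ?S = "{t \<in> topspace ?T. height V t \<in> - {0}}"
  have oS: "openin ?T ?S"
    by (rule openin_continuous_map_preimage[OF ch]) auto
  let ?Q = "subtopology ?P (?S \<times> topspace Y)"
  have cfst: "continuous_map ?Q ?T fst" by (rule continuous_map_subtopology_fst)
  have "continuous_map ?Q (join_cylinder G Y) (\<lambda>p. (\<lambda>v. fst p v / (\<Sum>u\<in>V. fst p u), snd p, 1 - height V (fst p)))"
    unfolding join_cylinder_def
  proof (intro continuous_map_pairedI continuous_map_subtopology_snd)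
    show "continuous_map ?Q G (\<lambda>p v. fst p v / (\<Sum>u\<in>V. fst p u))"
      unfolding geometric_realization_def continuous_map_in_subtopology continuous_map_componentwise_UNIV
    proof (intro conjI allI)
      fix v
      show "continuous_map ?Q euclideanreal (\<lambda>p. fst p v / (\<Sum>u\<in>V. fst p u))"
      proof (intro continuous_map_real_divide continuous_map_sum[OF fin] continuous_map_comp[OF cfst ct])
        show "(\<Sum>u\<in>V. fst p u) \<noteq> 0" if "p \<in> topspace ?Q" for p
          using that cubical_cone_normalize(3)[of "fst p"] by auto
      qed
    next
      have "(\<lambda>v. fst p v / (\<Sum>u\<in>V. fst p u)) \<in> topspace G" if "p \<in> topspace ?Q" for p
        using that cubical_cone_normalize(1)[of "fst p"] by auto
      then show "(\<lambda>p v. fst p v / (\<Sum>u\<in>V. fst p u)) \<in> topspace ?Q \<rightarrow>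
          {x. (\<forall>v. 0 \<le> x v) \<and> {v. x v \<noteq> 0} \<in> L \<and> (\<Sum>v | x v \<noteq> 0. x v) = 1}"
        unfolding topspace_realization by blast
    qed
    have "continuous_map ?T unit_interval (\<lambda>t. 1 - height V t)"
      using h01 by (auto simp: continuous_map_into_unit_interval intro!: real_continuous_intros ch)
    then show "continuous_map ?Q unit_interval (\<lambda>p. 1 - height V (fst p))"
      by (rule continuous_map_comp[OF cfst])
  qed
  from continuous_map_comp[OF this continuous_map_into_join(3)]
  have cQ: "continuous_map ?Q ?J ?f"
    by (rule continuous_map_eq) (auto simp: cone_to_join_def)
  show ?thesis
    unfolding continuous_map
  proof (intro conjI allI impI)
    have "?f p \<in> topspace ?J" if p: "p \<in> topspace ?P" for p
    proof (cases "height V (fst p) = 0")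
      case True
      then show ?thesis using p by (auto simp: cone_to_join_def topspace_join_topology join_points_def)
    next
      case False
      then have "p \<in> topspace ?Q" using p by auto
      then show ?thesis using continuous_map_image_subset_topspace[OF cQ] by blast
    qed
    then show "?f ` topspace ?P \<subseteq> topspace ?J" by blast
    fix U assume U: "openin ?J U"
    let ?W = "{p \<in> topspace ?P. ?f p \<in> U}"
    show "openin ?P ?W"
    proof (subst openin_subopen, intro ballI)
      fix p assume p: "p \<in> ?W"
      show "\<exists>T. openin ?P T \<and> p \<in> T \<and> T \<subseteq> ?W"
      proof (cases "height V (fst p) = 0")
        case False
        have "openin ?Q {p \<in> topspace ?Q. ?f p \<in> U}"
          by (rule openin_continuous_map_preimage[OF cQ U])
        moreover have "openin ?P (?S \<times> topspace Y)"
          using oS by (simp add: openin_prod_Times_iff)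
        ultimately have "openin ?P {p \<in> topspace ?Q. ?f p \<in> U}"
          using openin_trans_full by blast
        then show ?thesis using p False by (intro exI[of _ "{p \<in> topspace ?Q. ?f p \<in> U}"]) auto
      next
        case True
        obtain t y where ty: "p = (t, y)" by (cases p)
        then have t: "t \<in> topspace ?T" "height V t = 0" and y: "y \<in> topspace Y" and yU: "Right_End y \<in> U"
          using p True by (auto simp: cone_to_join_def)
        let ?C = "{z \<in> topspace (join_cylinder G Y). join_map z \<in> U}"
        have oC: "openin (prod_topology G (prod_topology Y unit_interval)) ?C"
          using U unfolding openin_join_topology join_cylinder_def by blast
        have oR: "openin Y {y \<in> topspace Y. Right_End y \<in> U}"
          using U unfolding openin_join_topology by blast
        have c1: "compactin G (topspace G)" using compact_realization by (simp add: compact_space_def)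
        have c2: "compactin (prod_topology Y unit_interval) {(y, 1)}" using y by simp
        have sb: "topspace G \<times> {(y, 1)} \<subseteq> ?C" using y yU by (auto simp: join_cylinder_def)
        obtain U1 U2 where U12: "openin G U1" "openin (prod_topology Y unit_interval) U2" "topspace G \<subseteq> U1" "{(y, 1)} \<subseteq> U2" "U1 \<times> U2 \<subseteq> ?C"
          using Wallace_theorem_prod_topology[OF c1 c2 oC sb] by blast
        obtain Y1 I1 where YI: "openin Y Y1" "openin unit_interval I1" "y \<in> Y1" "1 \<in> I1" "Y1 \<times> I1 \<subseteq> U2"
          using U12(2,4) unfolding openin_prod_topology_alt by (metis insert_subset)
        have ci: "continuous_map ?T unit_interval (\<lambda>t. 1 - height V t)"
          using h01 by (auto simp: continuous_map_into_unit_interval intro!: real_continuous_intros ch)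
        let ?N = "{t \<in> topspace ?T. 1 - height V t \<in> I1} \<times> (Y1 \<inter> {y \<in> topspace Y. Right_End y \<in> U})"
        have "openin ?P ?N"
          using openin_continuous_map_preimage[OF ci YI(2)] openin_Int[OF YI(1) oR] by (simp add: openin_prod_Times_iff)
        moreover have "p \<in> ?N" using ty t y yU YI by auto
        moreover have "?N \<subseteq> ?W"
        proof
          fix q assume q: "q \<in> ?N"
          obtain t' y' where q': "q = (t', y')" by (cases q)
          have t': "t' \<in> topspace ?T" "1 - height V t' \<in> I1" "y' \<in> Y1" "y' \<in> topspace Y" "Right_End y' \<in> U"
            using q q' by auto
          have "?f q \<in> U"
          proof (cases "height V t' = 0")
            case True
            then show ?thesis using t' q' by (simp add: cone_to_join_def)
          next
            case False
            have "(\<lambda>v. t' v / (\<Sum>u\<in>V. t' u)) \<in> U1"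
              using cubical_cone_normalize(1)[OF t'(1) False] U12(3) by blast
            moreover have "(y', 1 - height V t') \<in> U2" using YI(5) t' by blast
            ultimately have "(\<lambda>v. t' v / (\<Sum>u\<in>V. t' u), y', 1 - height V t') \<in> ?C"
              using U12(5) by blast
            then show ?thesis using False q' by (simp add: cone_to_join_def)
          qed
          then show "q \<in> ?W" using q' t' by simp
        qed
        ultimately show ?thesis by blast
      qed
    qed
  qed
qed

end

section \<open>The wedge of joins maps to the model\<close>

lemma cone_piece_injections:
  fixes B C :: "'a pspace"
  shows "continuous_map (space_of B) (space_of (cone_wedge B C E)) (\<lambda>x. collapse_map (cone_base B C) (0, x, 0))"
    and "continuous_map (space_of C) (space_of (cone_wedge B C E)) (\<lambda>x. collapse_map (cone_base B C) (1, x, 0))"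
    and "continuous_map (prod_topology (subtopology (space_of C) E) unit_interval) (space_of (cone_wedge B C E))
           (\<lambda>p. collapse_map (cone_base B C) (2, p))"
proof -
  have inj: "continuous_map (cone_piece B C E n) (space_of (cone_wedge B C E)) (\<lambda>p. collapse_map (cone_base B C) (n, p))"
    if "n \<in> {0, 1, 2}" for n
    using continuous_map_comp[OF continuous_map_sum_inject[OF that, of "cone_piece B C E"] continuous_map_collapse_map[of _ "cone_base B C"]]
    by (simp add: cone_wedge_def cone_sum_def)
  have "continuous_map (space_of B) (cone_piece B C E 0) (\<lambda>x. (x, 0))"
    by (simp add: cone_piece_def continuous_map_pairedI)
  from continuous_map_comp[OF this inj[of 0]]
  show "continuous_map (space_of B) (space_of (cone_wedge B C E)) (\<lambda>x. collapse_map (cone_base B C) (0, x, 0))" by simp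
  have "continuous_map (space_of C) (cone_piece B C E 1) (\<lambda>x. (x, 0))"
    by (simp add: cone_piece_def continuous_map_pairedI)
  from continuous_map_comp[OF this inj[of 1]]
  show "continuous_map (space_of C) (space_of (cone_wedge B C E)) (\<lambda>x. collapse_map (cone_base B C) (1, x, 0))" by simp
  have "cone_piece B C E 2 = prod_topology (subtopology (space_of C) E) unit_interval"
    by (simp add: cone_piece_def)
  then show "continuous_map (prod_topology (subtopology (space_of C) E) unit_interval) (space_of (cone_wedge B C E))
           (\<lambda>p. collapse_map (cone_base B C) (2, p))"
    using inj[of 2] by simp
qed

lemma basept_cone_wedge [simp]: "basept (cone_wedge B C E) = None"
  by (simp add: cone_wedge_def)

locale wedge_decomposition =
  fixes V :: "'v set" and K :: "'v set set" and B C :: "'v \<Rightarrow> 'a pspace" and E :: "'v \<Rightarrow> 'a set"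
    and R h k d
  assumes fin: "finite V" and K: "simplicial_complex_on V K"
    and data: "\<And>i. i \<in> V \<Longrightarrow> null_pair_data (C i) (E i) (R i) (h i) (k i) (d i)"
    and HB: "\<And>i. i \<in> V \<Longrightarrow> Hausdorff_space (space_of (B i))"
    and kB: "\<And>i. i \<in> V \<Longrightarrow> k_space (space_of (B i))"
    and bB: "\<And>i. i \<in> V \<Longrightarrow> basept (B i) \<in> points (B i)"
begin

abbreviation "Kf I \<equiv> full_subcomplex K I"
abbreviation "lk I \<sigma> \<equiv> link \<sigma> (Kf I)"
abbreviation "Lk I \<sigma> \<equiv> geometric_realization (lk I \<sigma>)"
abbreviation "W \<sigma> i \<equiv> if i \<in> \<sigma> then C i else subpspace (C i) (E i)"
abbreviation "D I \<sigma> \<equiv> Dhat I C E \<sigma>"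
abbreviation "Jn I \<sigma> \<equiv> join (Lk I \<sigma>) (D I \<sigma>)"
abbreviation "Wd I \<equiv> wedge (Kf I) (Jn I)"
abbreviation "Bh I \<equiv> Zhat (V - I) (Kf (V - I)) B (\<lambda>i. points (B i))"
abbreviation "Sm I \<equiv> smash2 (Wd I) (Bh I)"
abbreviation "joins_wedge \<equiv> wedge (Pow V) Sm"
abbreviation "M i \<equiv> cone_wedge (B i) (C i) (E i)"
abbreviation "MA i \<equiv> cone_wedge_sub (B i) (C i) (E i)"
abbreviation "PW I \<sigma> \<equiv> kification (product_topology (\<lambda>i. space_of (W \<sigma> i)) I)"
abbreviation "PB I \<equiv> kification (product_topology (\<lambda>i. space_of (B i)) (V - I))"

lemma Kempty: "{} \<in> K" and Ksub: "\<sigma> \<in> K \<Longrightarrow> \<sigma> \<subseteq> V" and Kdown: "\<sigma> \<in> K \<Longrightarrow> \<tau> \<subseteq> \<sigma> \<Longrightarrow> \<tau> \<in> K"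
  using K unfolding simplicial_complex_on_def by auto

lemma Kf_iff: "\<sigma> \<in> Kf I \<longleftrightarrow> \<sigma> \<in> K \<and> \<sigma> \<subseteq> I"
  by (simp add: full_subcomplex_def)

lemma lk_iff: "\<tau> \<in> lk I \<sigma> \<longleftrightarrow> \<tau> \<in> K \<and> \<tau> \<subseteq> I \<and> \<tau> \<inter> \<sigma> = {} \<and> \<tau> \<union> \<sigma> \<in> K \<and> \<sigma> \<subseteq> I"
  by (auto simp: link_def Kf_iff)

lemma finite_complex_lk: "finite_complex V (lk I \<sigma>)"
proof
  show "finite V" by (rule fin)
  show "\<rho> \<subseteq> V" if "\<rho> \<in> lk I \<sigma>" for \<rho> using that Ksub by (auto simp: lk_iff)
  show "\<tau> \<in> lk I \<sigma>" if "\<rho> \<in> lk I \<sigma>" "\<tau> \<subseteq> \<rho>" for \<rho> \<tau>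
    using that Kdown[of \<rho> \<tau>] Kdown[of "\<rho> \<union> \<sigma>" "\<tau> \<union> \<sigma>"] unfolding lk_iff by blast
qed

lemma lk_empty: "\<sigma> \<in> Kf I \<Longrightarrow> {} \<in> lk I \<sigma>"
  using Kempty by (simp add: lk_iff Kf_iff)

lemma C_facts:
  assumes "i \<in> V"
  shows "Hausdorff_space (space_of (C i))" "k_space (space_of (C i))" "closedin (space_of (C i)) (E i)"
    "basept (C i) \<in> E i" "E i \<subseteq> points (C i)" "basept (C i) \<in> points (C i)"
    "continuous_map (prod_topology (space_of (C i)) unit_interval) (space_of (C i)) (k i)"
    "\<And>x. x \<in> points (C i) \<Longrightarrow> k i (x, 0) = x" "\<And>t. t \<in> {0..1} \<Longrightarrow> k i (basept (C i), t) = basept (C i)"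
    "\<And>x t. x \<in> E i \<Longrightarrow> t \<in> {0..1} \<Longrightarrow> k i (x, t) \<in> E i"
    "continuous_map (space_of (C i)) unit_interval (d i)" "d i (basept (C i)) = 0"
    "\<And>x. x \<in> points (C i) \<Longrightarrow> d i x < 1 \<Longrightarrow> k i (x, 1) = basept (C i)"
proof -
  note dd = data[OF assms, unfolded null_pair_data_def]
  show cl: "closedin (space_of (C i)) (E i)" using dd by (simp only: simp_thms)
  then show "E i \<subseteq> points (C i)" by (rule closedin_subset)
  moreover show "basept (C i) \<in> E i" using dd by (simp only: simp_thms)
  ultimately show "basept (C i) \<in> points (C i)" by blast
qed (use data[OF assms, unfolded null_pair_data_def] in \<open>simp_all only: simp_thms ball_simps\<close>)

lemma points_W: "points (W \<sigma> i) = (if i \<in> \<sigma> then points (C i) else points (C i) \<inter> E i)" "basept (W \<sigma> i) = basept (C i)"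
  by (simp_all add: subpspace_def)

lemma space_W: "space_of (W \<sigma> i) = (if i \<in> \<sigma> then space_of (C i) else subtopology (space_of (C i)) (E i))"
  by (simp add: subpspace_def)

lemma W_facts:
  assumes "i \<in> V"
  shows "Hausdorff_space (space_of (W \<sigma> i))" "basept (W \<sigma> i) \<in> points (W \<sigma> i)"
    "continuous_map (space_of (W \<sigma> i)) (space_of (C i)) (\<lambda>x. x)"
  unfolding space_W points_W using C_facts[OF assms]
  by (simp_all add: Hausdorff_space_subtopology continuous_map_from_subtopology)

text \<open>For pairs \<open>(B, B)\<close> the polyhedral smash product is the smash product, already for \<open>\<sigma> = {}\<close>.\<close>

lemma Bh_eq:
  assumes "I \<subseteq> V" shows "Bh I = smash (V - I) B"
proof -
  have "{} \<in> Kf (V - I)" using Kempty by (simp add: Kf_iff)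
  then have "Zset (V - I) (Kf (V - I)) B (\<lambda>i. points (B i)) = points (smash (V - I) B)"
  proof (intro equalityI Zset_subset subsetI)
    fix z assume z: "z \<in> points (smash (V - I) B)"
    show "z \<in> Zset (V - I) (Kf (V - I)) B (\<lambda>i. points (B i))"
    proof (cases z)
      case None
      then show ?thesis using \<open>{} \<in> Kf (V - I)\<close> None_in_Zset[of "Kf (V - I)"] by blast
    next
      case (Some x)
      then have "x \<in> (\<Pi>\<^sub>E i\<in>V - I. points (B i))" "x \<notin> fat_wedge (V - I) B"
        using z by (auto simp: points_smash)
      then show ?thesis
        unfolding Some Some_in_Zset using \<open>{} \<in> Kf (V - I)\<close>
        by (intro conjI bexI[of _ "{}"]) (auto simp: fat_wedge_def PiE_iff)
    qed
  qed
  then show ?thesis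
    by (simp add: Zhat_eq subpspace_def prod_eq_iff)
qed

lemma Bh_Hausdorff: "I \<subseteq> V \<Longrightarrow> Hausdorff_space (space_of (Bh I))"
  unfolding Bh_eq using fin HB bB by (intro Hausdorff_space_smash) auto

lemma D_eq: "D I \<sigma> = smash I (W \<sigma>)"
  by (simp add: Dhat_def)

lemma k_space_D: "k_space (space_of (D I \<sigma>))"
  unfolding D_eq smash_eq by (rule k_space_collapse[OF k_space_kification])

lemma D_Hausdorff_PW:
  assumes "I \<subseteq> V" shows "Hausdorff_space (PW I \<sigma>)"
proof (rule Hausdorff_space_kification)
  have "Hausdorff_space (space_of (W \<sigma> i))" if "i \<in> I" for i
    using W_facts(1) assms that by blast
  then show "Hausdorff_space (product_topology (\<lambda>i. space_of (W \<sigma> i)) I)"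
    unfolding Hausdorff_space_product_topology by blast
qed

definition model_tuple :: "'v set \<Rightarrow> 'v set \<Rightarrow> ('v \<Rightarrow> 'a) \<Rightarrow> ('v \<Rightarrow> 'a) \<Rightarrow> ('v \<Rightarrow> real) \<Rightarrow> 'v \<Rightarrow> (nat \<times> 'a \<times> real) option" where
  "model_tuple I \<sigma> w b t = (\<lambda>i\<in>V. collapse_map (cone_base (B i) (C i))
      (if i \<notin> I then (0, b i, 0) else if i \<in> \<sigma> then (1, w i, 0) else (2, w i, t i)))"

definition model_point :: "'v set \<Rightarrow> 'v set \<Rightarrow> ('v \<Rightarrow> real) \<Rightarrow> ('v \<Rightarrow> 'a) option \<Rightarrow> ('v \<Rightarrow> 'a) option \<Rightarrow> ('v \<Rightarrow> (nat \<times> 'a \<times> real) option) option" where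
  "model_point I \<sigma> t w' b' = (case w' of None \<Rightarrow> None | Some w \<Rightarrow> (case b' of None \<Rightarrow> None | Some b \<Rightarrow>
      collapse_map (fat_wedge V M) (model_tuple I \<sigma> w b t)))"

lemma model_point_simps [simp]: "model_point I \<sigma> t None b' = None" "model_point I \<sigma> t w' None = None"
  "model_point I \<sigma> t (Some w) (Some b) = collapse_map (fat_wedge V M) (model_tuple I \<sigma> w b t)"
  by (auto simp: model_point_def split: option.split)

lemma model_tuple_base:
  assumes "I \<subseteq> V" and "w \<in> fat_wedge I (W \<sigma>) \<or> b \<in> fat_wedge (V - I) B \<or> (\<exists>i\<in>I - \<sigma>. t i = 1)"
  shows "collapse_map (fat_wedge V M) (model_tuple I \<sigma> w b t) = None"
proof -
  consider i where "i \<in> I" "w i = basept (C i)" | i where "i \<in> V - I" "b i = basept (B i)" | i where "i \<in> I - \<sigma>" "t i = 1"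
    using assms(2) unfolding fat_wedge_def points_W(2) by blast
  then obtain i where "i \<in> V" "model_tuple I \<sigma> w b t i = None"
  proof cases
    case (1 i)
    then show ?thesis using assms(1) that[of i] by (auto simp: model_tuple_def collapse_map_def cone_base_def)
  next
    case (2 i)
    then show ?thesis using that[of i] by (auto simp: model_tuple_def collapse_map_def cone_base_def)
  next
    case (3 i)
    then show ?thesis using assms(1) that[of i] by (auto simp: model_tuple_def collapse_map_def cone_base_def)
  qed
  then have "model_tuple I \<sigma> w b t \<in> fat_wedge V M"
    by (auto simp: fat_wedge_def intro!: bexI[of _ i])
  then show ?thesis by (simp add: collapse_map_def)
qed

lemma model_point_collapse:
  assumes "I \<subseteq> V"
  shows "model_point I \<sigma> t (collapse_map (fat_wedge I (W \<sigma>)) w) (collapse_map (fat_wedge (V - I) B) b)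
    = collapse_map (fat_wedge V M) (model_tuple I \<sigma> w b t)"
proof (cases "w \<in> fat_wedge I (W \<sigma>) \<or> b \<in> fat_wedge (V - I) B")
  case True
  then have "model_point I \<sigma> t (collapse_map (fat_wedge I (W \<sigma>)) w) (collapse_map (fat_wedge (V - I) B) b) = None"
    by (elim disjE) (simp_all add: collapse_map_def)
  moreover have "collapse_map (fat_wedge V M) (model_tuple I \<sigma> w b t) = None"
    using True by (intro model_tuple_base[OF assms]) blast
  ultimately show ?thesis by simp
next
  case False
  then show ?thesis by (simp add: collapse_map_def)
qed

lemma continuous_map_model_tuple:
  assumes I: "I \<subseteq> V" and \<tau>: "\<And>i. i \<in> I - \<sigma> \<Longrightarrow> continuous_map P unit_interval (\<lambda>p. \<tau> p i)"
  shows "continuous_map (prod_topology (PB I) (prod_topology (PW I \<sigma>) P)) (product_topology (\<lambda>i. space_of (M i)) V)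
     (\<lambda>x. model_tuple I \<sigma> (fst (snd x)) (fst x) (\<tau> (snd (snd x))))"
  unfolding continuous_map_componentwise
proof (intro conjI ballI)
  let ?X = "prod_topology (PB I) (prod_topology (PW I \<sigma>) P)"
  show "(\<lambda>x. model_tuple I \<sigma> (fst (snd x)) (fst x) (\<tau> (snd (snd x)))) ` topspace ?X \<subseteq> extensional V"
    by (auto simp: model_tuple_def)
  fix i assume i: "i \<in> V"
  have cb: "continuous_map ?X (space_of (B i)) (\<lambda>x. fst x i)" if "i \<notin> I"
    using that i by (intro continuous_map_comp[OF continuous_map_fst] continuous_map_from_kification continuous_map_product_projection) simp
  have cw: "continuous_map ?X (space_of (W \<sigma> i)) (\<lambda>x. fst (snd x) i)" if "i \<in> I"
    using that by (intro continuous_map_comp[OF continuous_map_fst_comp[OF continuous_map_snd]] continuous_map_from_kification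
        continuous_map_product_projection[of i I "\<lambda>i. space_of (W \<sigma> i)"])
  consider "i \<notin> I" | "i \<in> I" "i \<in> \<sigma>" | "i \<in> I" "i \<notin> \<sigma>" by blast
  then show "continuous_map ?X (space_of (M i)) (\<lambda>x. model_tuple I \<sigma> (fst (snd x)) (fst x) (\<tau> (snd (snd x))) i)"
  proof cases
    case 1
    then show ?thesis using continuous_map_comp[OF cb cone_piece_injections(1), of "C i" "E i"] i by (simp add: model_tuple_def)
  next
    case 2
    then have "continuous_map ?X (space_of (C i)) (\<lambda>x. fst (snd x) i)" using cw by simp
    from continuous_map_comp[OF this cone_piece_injections(2), of "B i" "E i"] 2 i show ?thesis by (simp add: model_tuple_def)
  next
    case 3
    then have "continuous_map ?X (subtopology (space_of (C i)) (E i)) (\<lambda>x. fst (snd x) i)"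
      using cw by (simp add: subpspace_def)
    moreover have "continuous_map ?X unit_interval (\<lambda>x. \<tau> (snd (snd x)) i)"
      using 3 \<tau> by (intro continuous_map_comp[OF continuous_map_snd_comp[OF continuous_map_snd]]) simp
    ultimately have "continuous_map ?X (prod_topology (subtopology (space_of (C i)) (E i)) unit_interval) (\<lambda>x. (fst (snd x) i, \<tau> (snd (snd x)) i))"
      by (rule continuous_map_pairedI)
    from continuous_map_comp[OF this cone_piece_injections(3), of "B i"] 3 i show ?thesis by (simp add: model_tuple_def)
  qed
qed

text \<open>Two applications of the principle that products with a quotient map are quotient maps: collapse
  the fat wedge in the coordinates \<open>b\<close>, and then that in the coordinates \<open>w\<close>.\<close>

lemma continuous_map_model_point:
  assumes I: "I \<subseteq> V" and P: "Hausdorff_space P"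
    and \<tau>: "\<And>i. i \<in> I - \<sigma> \<Longrightarrow> continuous_map P unit_interval (\<lambda>p. \<tau> p i)"
  shows "continuous_map (kification (prod_topology (space_of (D I \<sigma>)) (prod_topology (space_of (Bh I)) P))) (space_of (smash V M))
     (\<lambda>x. model_point I \<sigma> (\<tau> (snd (snd x))) (fst x) (fst (snd x)))"
proof -
  let ?Z = "space_of (smash V M)"
  have "continuous_map (kification (prod_topology (PB I) (prod_topology (PW I \<sigma>) P))) ?Z
     (\<lambda>x. collapse_map (fat_wedge V M) (model_tuple I \<sigma> (fst (snd x)) (fst x) (\<tau> (snd (snd x)))))"
    unfolding smash_eq[of V M]
    by (rule continuous_map_comp[OF continuous_map_kification_functor[OF continuous_map_model_tuple[OF I \<tau>]] continuous_map_collapse_map])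
  then have c3: "continuous_map (kification (prod_topology (PB I) (prod_topology (PW I \<sigma>) P))) ?Z
     (\<lambda>x. model_point I \<sigma> (\<tau> (snd (snd x))) (collapse_map (fat_wedge I (W \<sigma>)) (fst (snd x))) (collapse_map (fat_wedge (V - I) B) (fst x)))"
    by (simp only: model_point_collapse[OF I])
  have bz: "None \<in> topspace ?Z" by (simp add: smash_eq)
  have c2: "continuous_map (kification (prod_topology (space_of (Bh I)) (prod_topology (PW I \<sigma>) P))) ?Z
     (\<lambda>x. model_point I \<sigma> (\<tau> (snd (snd x))) (collapse_map (fat_wedge I (W \<sigma>)) (fst (snd x))) (fst x))"
    unfolding Bh_eq[OF I] smash_eq[of "V - I" B]
  proof (rule continuous_map_from_kification_collapse_prod[where q = None])
    show "Hausdorff_space (prod_topology (PW I \<sigma>) P)"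
      using D_Hausdorff_PW[OF I] P by (simp add: Hausdorff_space_prod_topology)
  qed (use c3 bz in simp_all)
  let ?re = "\<lambda>x. (fst (snd x), fst x, snd (snd x))"
  have "continuous_map (prod_topology (PW I \<sigma>) (prod_topology (space_of (Bh I)) P)) (prod_topology (space_of (Bh I)) (prod_topology (PW I \<sigma>) P)) ?re"
    by (intro continuous_map_pairedI continuous_map_fst continuous_map_fst_comp[OF continuous_map_snd] continuous_map_snd_comp[OF continuous_map_snd])
  from continuous_map_comp[OF continuous_map_kification_functor[OF this] c2]
  have c1: "continuous_map (kification (prod_topology (PW I \<sigma>) (prod_topology (space_of (Bh I)) P))) ?Z
     (\<lambda>x. model_point I \<sigma> (\<tau> (snd (snd x))) (collapse_map (fat_wedge I (W \<sigma>)) (fst x)) (fst (snd x)))"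
    by simp
  show ?thesis
    unfolding D_eq smash_eq[of I "W \<sigma>"]
  proof (rule continuous_map_from_kification_collapse_prod[where q = None])
    show "Hausdorff_space (prod_topology (space_of (Bh I)) P)"
      using Bh_Hausdorff[OF I] P by (simp add: Hausdorff_space_prod_topology)
  qed (use c1 bz in simp_all)
qed

text \<open>On the end \<open>|lk|\<close> of the join some height is \<open>1\<close>, so the whole end goes to the base point; on
  the other end all heights vanish.\<close>

definition join_to_model :: "'v set \<Rightarrow> 'v set \<Rightarrow> ('v \<Rightarrow> real, ('v \<Rightarrow> 'a) option) join_point \<Rightarrow> ('v \<Rightarrow> 'a) option \<Rightarrow> ('v \<Rightarrow> (nat \<times> 'a \<times> real) option) option" where
  "join_to_model I \<sigma> j b' = (case j of Left_End l \<Rightarrow> None | Right_End w' \<Rightarrow> model_point I \<sigma> (\<lambda>_. 0) w' b'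
     | Between l w' s \<Rightarrow> model_point I \<sigma> (cone_point V (l, s)) w' b')"

definition wedge_to_model where "wedge_to_model I z b' = (case z of None \<Rightarrow> None | Some (\<sigma>, j) \<Rightarrow> join_to_model I \<sigma> j b')"

definition smash_to_model where "smash_to_model I z = (case z of None \<Rightarrow> None | Some (wp, b') \<Rightarrow> wedge_to_model I wp b')"

definition to_model :: "('v set \<times> (('v set \<times> ('v \<Rightarrow> real, ('v \<Rightarrow> 'a) option) join_point) option \<times> ('v \<Rightarrow> 'a) option) option) option
    \<Rightarrow> ('v \<Rightarrow> (nat \<times> 'a \<times> real) option) option" where
  "to_model z = (case z of None \<Rightarrow> None | Some (I, q) \<Rightarrow> smash_to_model I q)"

lemma join_to_model_None [simp]: "join_to_model I \<sigma> j None = None" "join_to_model I \<sigma> (Right_End None) b' = None"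
  by (auto simp: join_to_model_def split: join_point.split)

lemma join_to_model_join_map:
  assumes I: "I \<subseteq> V" and l: "l \<in> topspace (Lk I \<sigma>)" and s: "s \<in> {0..1}"
  shows "join_to_model I \<sigma> (join_map (l, w', s)) b' = model_point I \<sigma> (cone_point V (l, s)) w' b'"
proof -
  consider "s = 0" | "s = 1" | "0 < s" "s < 1" using s by fastforce
  then show ?thesis
  proof cases
    case 1
    interpret finite_complex V "lk I \<sigma>" by (rule finite_complex_lk)
    obtain v where v: "v \<in> V" "l v = height V l" "l v \<noteq> 0" using height_realization(2)[OF l] by blast
    then have "v \<in> {v. l v \<noteq> 0}" by simp
    then have vI: "v \<in> I - \<sigma>" using l unfolding topspace_realization lk_iff by blast
    have "cone_point V (l, s) v = 1" using v 1 by (simp add: cone_point_def)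
    then have "model_point I \<sigma> (cone_point V (l, s)) w' b' = None"
      using model_tuple_base[OF I, of _ \<sigma> _ "cone_point V (l, s)"] vI by (auto simp: model_point_def split: option.split)
    then show ?thesis using 1 by (simp add: join_to_model_def)
  next
    case 2
    then have "cone_point V (l, s) = (\<lambda>_. 0)" by (simp add: cone_point_def)
    then show ?thesis using 2 by (simp add: join_to_model_def)
  next
    case 3
    then show ?thesis by (simp add: join_to_model_def)
  qed
qed

lemma join_eq: "space_of (Jn I \<sigma>) = join_topology (Lk I \<sigma>) (space_of (D I \<sigma>))" "basept (Jn I \<sigma>) = Right_End None"
  by (simp_all add: join_def D_eq smash_eq)

lemma None_model: "None \<in> points (smash V M)"
  by (simp add: smash_eq)

lemma continuous_map_join_to_model:
  assumes I: "I \<subseteq> V" and \<sigma>: "\<sigma> \<in> Kf I"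
  shows "continuous_map (kification (prod_topology (space_of (Jn I \<sigma>)) (space_of (Bh I)))) (space_of (smash V M)) (\<lambda>x. join_to_model I \<sigma> (fst x) (snd x))"
  unfolding join_eq
proof (rule continuous_map_from_kification_join_prod)
  interpret finite_complex V "lk I \<sigma>" by (rule finite_complex_lk)
  let ?Z = "space_of (smash V M)" and ?D = "space_of (D I \<sigma>)" and ?B = "space_of (Bh I)"
  show "compact_space (Lk I \<sigma>)" "Hausdorff_space (Lk I \<sigma>)"
    by (rule compact_realization, rule Hausdorff_realization)
  show "k_space ?D" by (rule k_space_D)
  show "Hausdorff_space ?B" by (rule Bh_Hausdorff[OF I])
  show "continuous_map (kification (prod_topology (Lk I \<sigma>) ?B)) ?Z (\<lambda>p. join_to_model I \<sigma> (fst (Left_End (fst p), snd p)) (snd (Left_End (fst p), snd p)))"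
    by (simp add: join_to_model_def None_model)
  have "continuous_map (prod_topology ?D ?B) (prod_topology ?D (prod_topology ?B unit_interval)) (\<lambda>x. (fst x, snd x, 0))"
    by (intro continuous_map_pairedI continuous_map_fst continuous_map_snd) simp
  from continuous_map_comp[OF continuous_map_kification_functor[OF this] continuous_map_model_point[OF I unit_interval_facts(2), where \<tau> = "\<lambda>_ _. 0"]]
  show "continuous_map (kification (prod_topology ?D ?B)) ?Z (\<lambda>p. join_to_model I \<sigma> (fst (Right_End (fst p), snd p)) (snd (Right_End (fst p), snd p)))"
    by (simp add: join_to_model_def)
  let ?P = "prod_topology (Lk I \<sigma>) unit_interval"
  have P: "Hausdorff_space ?P"
    using Hausdorff_realization unit_interval_facts by (simp add: Hausdorff_space_prod_topology)
  have c: "continuous_map ?P unit_interval (\<lambda>p. cone_point V p i)" for i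
    unfolding continuous_map_into_unit_interval
  proof (intro conjI ballI continuous_map_cone_point)
    fix p assume "p \<in> topspace ?P"
    then have "cone_point V p \<in> topspace (cubical_cone (lk I \<sigma>))"
      using cone_point_props(1)[OF _ _ lk_empty[OF \<sigma>], of "fst p" "snd p"] by auto
    then show "0 \<le> cone_point V p i" "cone_point V p i \<le> 1" by (auto simp: topspace_cubical_cone)
  qed
  let ?X = "prod_topology (join_cylinder (Lk I \<sigma>) ?D) ?B"
  have "continuous_map ?X (prod_topology ?D (prod_topology ?B ?P))
     (\<lambda>x. (fst (snd (fst x)), snd x, fst (fst x), snd (snd (fst x))))"
    unfolding join_cylinder_def
    by (intro continuous_map_pairedI continuous_map_snd continuous_map_fst_comp[OF continuous_map_fst]
        continuous_map_fst_comp[OF continuous_map_snd_comp[OF continuous_map_fst]] continuous_map_snd_comp[OF continuous_map_snd_comp[OF continuous_map_fst]])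
  from continuous_map_comp[OF continuous_map_kification_functor[OF this] continuous_map_model_point[OF I P c]]
  have "continuous_map (kification ?X) ?Z
     (\<lambda>x. model_point I \<sigma> (cone_point V (fst (fst x), snd (snd (fst x)))) (fst (snd (fst x))) (snd x))"
    by simp
  then show "continuous_map (kification ?X) ?Z (\<lambda>p. join_to_model I \<sigma> (fst (join_map (fst p), snd p)) (snd (join_map (fst p), snd p)))"
  proof (rule continuous_map_eq)
    fix x assume "x \<in> topspace (kification ?X)"
    then have "fst (fst x) \<in> topspace (Lk I \<sigma>)" "snd (snd (fst x)) \<in> {0..1}"
      by (auto simp: join_cylinder_def)
    from join_to_model_join_map[OF I this, of "fst (snd (fst x))" "snd x"]
    show "model_point I \<sigma> (cone_point V (fst (fst x), snd (snd (fst x)))) (fst (snd (fst x))) (snd x)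
        = join_to_model I \<sigma> (fst (join_map (fst x), snd x)) (snd (join_map (fst x), snd x))"
      by simp
  qed
qed

lemma continuous_map_wedge_to_model:
  assumes I: "I \<subseteq> V"
  shows "continuous_map (kification (prod_topology (space_of (Wd I)) (space_of (Bh I)))) (space_of (smash V M)) (\<lambda>x. wedge_to_model I (fst x) (snd x))"
  unfolding wedge_eq
proof (rule continuous_map_from_kification_collapse_prod[where q = None])
  have kJ: "k_space (space_of (Jn I \<sigma>))" for \<sigma>
  proof -
    interpret finite_complex V "lk I \<sigma>" by (rule finite_complex_lk)
    show ?thesis unfolding join_eq by (intro k_space_join compact_realization Hausdorff_realization k_space_D)
  qed
  show "k_space (sum_topology (\<lambda>\<sigma>. space_of (Jn I \<sigma>)) (Kf I))" by (rule k_space_sum[OF kJ])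
  show "Hausdorff_space (space_of (Bh I))" by (rule Bh_Hausdorff[OF I])
  show "continuous_map (kification (prod_topology (sum_topology (\<lambda>\<sigma>. space_of (Jn I \<sigma>)) (Kf I)) (space_of (Bh I)))) (space_of (smash V M))
     (\<lambda>p. wedge_to_model I (fst (collapse_map (wedge_base (Kf I) (Jn I)) (fst p), snd p)) (snd (collapse_map (wedge_base (Kf I) (Jn I)) (fst p), snd p)))"
  proof (rule continuous_map_from_kification_sum_prod[OF kJ Bh_Hausdorff[OF I]])
    fix \<sigma> assume \<sigma>: "\<sigma> \<in> Kf I"
    have "wedge_to_model I (collapse_map (wedge_base (Kf I) (Jn I)) (\<sigma>, j)) b' = join_to_model I \<sigma> j b'" for j b'
      by (auto simp: wedge_to_model_def collapse_map_def wedge_base_def join_eq)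
    then show "continuous_map (kification (prod_topology (space_of (Jn I \<sigma>)) (space_of (Bh I)))) (space_of (smash V M))
       (\<lambda>p. wedge_to_model I (fst (collapse_map (wedge_base (Kf I) (Jn I)) (fst ((\<sigma>, fst p), snd p)), snd ((\<sigma>, fst p), snd p)))
          (snd (collapse_map (wedge_base (Kf I) (Jn I)) (fst ((\<sigma>, fst p), snd p)), snd ((\<sigma>, fst p), snd p))))"
      using continuous_map_join_to_model[OF I \<sigma>] by simp
  qed
qed (simp_all add: wedge_to_model_def None_model)

lemma wedge_to_model_None [simp]: "wedge_to_model I None b' = None" "wedge_to_model I wp None = None"
  by (auto simp: wedge_to_model_def split: option.split)

lemma continuous_map_to_model: "continuous_map (space_of joins_wedge) (space_of (smash V M)) to_model"
proof -
  have smash_to_model: "continuous_map (space_of (Sm I)) (space_of (smash V M)) (smash_to_model I)" if "I \<subseteq> V" for I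
  proof -
    have "continuous_map (space_of (Sm I)) (space_of (smash V M)) (case_option None (\<lambda>x. wedge_to_model I (fst x) (snd x)))"
      unfolding smash2_eq
      by (rule continuous_map_case_collapse[OF continuous_map_wedge_to_model[OF that]]) (auto simp: smash_base_def None_model Bh_eq[OF that] smash_eq[of "V - I"])
    then show ?thesis by (rule continuous_map_eq) (auto simp: smash_to_model_def split: option.split)
  qed
  have "continuous_map (space_of joins_wedge) (space_of (smash V M)) (case_option None (\<lambda>x. smash_to_model (fst x) (snd x)))"
    unfolding wedge_eq[of "Pow V"]
  proof (rule continuous_map_case_collapse)
    show "continuous_map (sum_topology (\<lambda>I. space_of (Sm I)) (Pow V)) (space_of (smash V M)) (\<lambda>x. smash_to_model (fst x) (snd x))"
      using smash_to_model by (intro continuous_map_from_sum) auto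
  qed (auto simp: wedge_base_def smash_to_model_def None_model)
  then show ?thesis by (rule continuous_map_eq) (auto simp: to_model_def split: option.split)
qed

end

lemma Some_in_collapse: "Some x \<in> points (collapse X S) \<longleftrightarrow> x \<in> topspace X \<and> x \<notin> S"
  by (auto simp: points_collapse)

context wedge_decomposition
begin

lemma Some_in_D: "Some w \<in> points (D I \<sigma>) \<longleftrightarrow> w \<in> (\<Pi>\<^sub>E i\<in>I. points (W \<sigma> i)) \<and> w \<notin> fat_wedge I (W \<sigma>)"
  unfolding D_eq smash_eq Some_in_collapse by simp

lemma Some_in_Bh: "I \<subseteq> V \<Longrightarrow> Some b \<in> points (Bh I) \<longleftrightarrow> b \<in> (\<Pi>\<^sub>E i\<in>V - I. points (B i)) \<and> b \<notin> fat_wedge (V - I) B"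
  unfolding Bh_eq smash_eq Some_in_collapse by simp

lemma Knonempty: "K \<noteq> {}"
  using Kempty by blast

text \<open>The simplex witnessing membership is the union of \<open>\<sigma>\<close> and the support of the heights; it is in \<open>K\<close> by
  the definition of the link.\<close>

lemma model_tuple_in_model:
  assumes I: "I \<subseteq> V" and \<sigma>: "\<sigma> \<in> Kf I" and w: "w \<in> (\<Pi>\<^sub>E i\<in>I. points (W \<sigma> i))" and b: "b \<in> (\<Pi>\<^sub>E i\<in>V - I. points (B i))"
    and t: "t \<in> topspace (cubical_cone (lk I \<sigma>))"
  shows "collapse_map (fat_wedge V M) (model_tuple I \<sigma> w b t) \<in> Zset V K M MA"
proof (cases "model_tuple I \<sigma> w b t \<in> fat_wedge V M")
  case True
  then show ?thesis by (simp add: collapse_map_def None_in_Zset[OF Knonempty])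
next
  case False
  have t01: "0 \<le> t i" "t i \<le> 1" for i using t by (auto simp: topspace_cubical_cone)
  have supp: "{i. t i \<noteq> 0} \<union> \<sigma> \<in> K" using t by (auto simp: topspace_cubical_cone lk_iff)
  have nb: "model_tuple I \<sigma> w b t i \<noteq> None" if "i \<in> V" for i
    using False that by (auto simp: fat_wedge_def)
  have "model_tuple I \<sigma> w b t i \<in> points (M i)" if i: "i \<in> V" for i
  proof -
    note inj = continuous_map_image_subset_topspace[OF cone_piece_injections(1)[where B = "B i" and C = "C i" and E = "E i"]]
      continuous_map_image_subset_topspace[OF cone_piece_injections(2)[where B = "B i" and C = "C i" and E = "E i"]]
      continuous_map_image_subset_topspace[OF cone_piece_injections(3)[where B = "B i" and C = "C i" and E = "E i"]]
    consider "i \<notin> I" | "i \<in> I" "i \<in> \<sigma>" | "i \<in> I" "i \<notin> \<sigma>" by blast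
    then show ?thesis
    proof cases
      case 1
      then have "b i \<in> points (B i)" using b i by (auto simp: PiE_iff)
      then show ?thesis using subsetD[OF inj(1) imageI[of "b i"]] 1 i by (simp add: model_tuple_def)
    next
      case 2
      then have "w i \<in> points (C i)" using w by (auto simp: PiE_iff)
      then show ?thesis using subsetD[OF inj(2) imageI[of "w i"]] 2 i by (simp add: model_tuple_def)
    next
      case 3
      then have "w i \<in> points (W \<sigma> i)" using w by (auto simp: PiE_iff)
      then have "(w i, t i) \<in> topspace (prod_topology (subtopology (space_of (C i)) (E i)) unit_interval)"
        using 3 t01[of i] by (simp add: subpspace_def)
      then show ?thesis using subsetD[OF inj(3) imageI[of "(w i, t i)"]] 3 i by (simp add: model_tuple_def)
    qed
  qed
  then have P: "model_tuple I \<sigma> w b t \<in> (\<Pi>\<^sub>E i\<in>V. points (M i))"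
    by (auto simp: PiE_iff model_tuple_def)
  have "model_tuple I \<sigma> w b t i \<in> MA i" if "i \<in> V - ({i. t i \<noteq> 0} \<union> \<sigma>)" for i
  proof -
    have "model_tuple I \<sigma> w b t i \<in> points (M i)" using P that by (auto simp: PiE_iff)
    then show ?thesis
      using that by (auto simp: cone_wedge_sub_def model_tuple_def collapse_map_def split: if_splits)
  qed
  then have "Some (model_tuple I \<sigma> w b t) \<in> Zset V K M MA"
    unfolding Some_in_Zset using P nb supp by (intro conjI bexI[of _ "{i. t i \<noteq> 0} \<union> \<sigma>"]) auto
  then show ?thesis using False by (simp add: collapse_map_def)
qed

lemma zero_in_cone: "\<sigma> \<in> Kf I \<Longrightarrow> (\<lambda>_. 0) \<in> topspace (cubical_cone (lk I \<sigma>))"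
  using lk_empty by (simp add: topspace_cubical_cone)

lemma model_point_in_model:
  assumes I: "I \<subseteq> V" and \<sigma>: "\<sigma> \<in> Kf I" and w: "w' \<in> points (D I \<sigma>)" and b: "b' \<in> points (Bh I)"
    and t: "t \<in> topspace (cubical_cone (lk I \<sigma>))"
  shows "model_point I \<sigma> t w' b' \<in> Zset V K M MA"
proof (cases "w' = None \<or> b' = None")
  case True
  then show ?thesis by (auto simp: None_in_Zset[OF Knonempty])
next
  case False
  then obtain w b where wb: "w' = Some w" "b' = Some b" by auto
  then show ?thesis
    using model_tuple_in_model[OF I \<sigma> _ _ t] w b unfolding wb Some_in_D Some_in_Bh[OF I] by simp
qed

lemma joins_wedge_cases:
  assumes "z \<in> points joins_wedge"
  obtains "z = None" | I \<sigma> j b where "z = Some (I, Some (Some (\<sigma>, j), Some b))" "I \<subseteq> V" "\<sigma> \<in> Kf I"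
    "j \<in> join_points (Lk I \<sigma>) (space_of (D I \<sigma>))" "j \<noteq> Right_End None" "Some b \<in> points (Bh I)"
proof (cases z)
  case None
  then show thesis using that(1) by blast
next
  case (Some p)
  obtain I q where p: "p = (I, q)" by (cases p)
  then have q: "I \<subseteq> V" "q \<in> points (Sm I)" "q \<noteq> None"
    using assms unfolding Some p Some_in_wedge by (auto simp: smash2_eq)
  then obtain wp b' where q': "q = Some (wp, b')" by auto
  then have wb: "wp \<in> points (Wd I)" "b' \<in> points (Bh I)" "wp \<noteq> None" "b' \<noteq> None"
    using q(2) unfolding q' Some_in_smash2 by simp_all
  then obtain \<sigma> j b where sj: "wp = Some (\<sigma>, j)" "b' = Some b" by auto
  then have "\<sigma> \<in> Kf I" "j \<in> points (Jn I \<sigma>)" "j \<noteq> basept (Jn I \<sigma>)"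
    using wb(1) unfolding sj Some_in_wedge by simp_all
  then show thesis
    using that(2)[of I \<sigma> j b] q(1) wb(2) sj p q' Some by (simp add: join_eq topspace_join_topology)
qed

lemma join_point_forms:
  assumes "j \<in> join_points (Lk I \<sigma>) (space_of (D I \<sigma>))"
  obtains l where "j = Left_End l" "l \<in> topspace (Lk I \<sigma>)" | w' where "j = Right_End w'" "w' \<in> points (D I \<sigma>)"
    | l w' s where "j = Between l w' s" "j = join_map (l, w', s)" "l \<in> topspace (Lk I \<sigma>)" "w' \<in> points (D I \<sigma>)" "0 < s" "s < 1"
proof (rule join_points_cases[OF assms])
  fix c assume c: "c \<in> topspace (join_cylinder (Lk I \<sigma>) (space_of (D I \<sigma>)))" "j = join_map c"
  obtain l w' s where cc: "c = (l, w', s)" by (cases c)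
  then have in': "l \<in> topspace (Lk I \<sigma>)" "w' \<in> points (D I \<sigma>)" "s \<in> {0..1}" using c(1) by (auto simp: join_cylinder_def)
  consider "s = 0" | "s = 1" | "0 < s" "s < 1" using in'(3) by fastforce
  then show thesis
  proof cases
    case 1 then show thesis using that(1) c cc in' by simp
  next
    case 2 then show thesis using that(2) c cc in' by simp
  next
    case 3 then show thesis using that(3) c cc in' by simp
  qed
qed (use that in auto)

lemma join_to_model_in_model:
  assumes I: "I \<subseteq> V" and \<sigma>: "\<sigma> \<in> Kf I" and j: "j \<in> join_points (Lk I \<sigma>) (space_of (D I \<sigma>))" and b: "b' \<in> points (Bh I)"
  shows "join_to_model I \<sigma> j b' \<in> Zset V K M MA"
proof (rule join_point_forms[OF j])
  fix l assume "j = Left_End l"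
  then show ?thesis by (simp add: join_to_model_def None_in_Zset[OF Knonempty])
next
  fix w' assume "j = Right_End w'" "w' \<in> points (D I \<sigma>)"
  then show ?thesis using model_point_in_model[OF I \<sigma> _ b zero_in_cone[OF \<sigma>]] by (simp add: join_to_model_def)
next
  fix l w' s assume *: "j = Between l w' s" "l \<in> topspace (Lk I \<sigma>)" "w' \<in> points (D I \<sigma>)" "0 < s" "s < 1"
  have "cone_point V (l, s) \<in> topspace (cubical_cone (lk I \<sigma>))"
    using finite_complex.cone_point_props(1)[OF finite_complex_lk *(2) _ lk_empty[OF \<sigma>], of s] * by simp
  from model_point_in_model[OF I \<sigma> *(3) b this] show ?thesis using * by (simp add: join_to_model_def)
qed

lemma to_model_simps [simp]:
  "to_model None = None" "to_model (Some (I, Some (Some (\<sigma>, j), b'))) = join_to_model I \<sigma> j b'"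
  by (simp_all add: to_model_def smash_to_model_def wedge_to_model_def)

lemma to_model_in_Zset:
  assumes "z \<in> points joins_wedge" shows "to_model z \<in> Zset V K M MA"
  by (rule joins_wedge_cases[OF assms]) (simp_all add: None_in_Zset[OF Knonempty] join_to_model_in_model)

text \<open>Off the fibre over the base point, a point of the wedge can be read off from the tuple it is mapped to.\<close>

definition tags :: "('v \<Rightarrow> (nat \<times> 'a \<times> real) option) \<Rightarrow> (nat \<Rightarrow> bool) \<Rightarrow> 'v set" where
  "tags x Q = {i \<in> V. Q (fst (the (x i)))}"

definition coords :: "'v set \<Rightarrow> ('v \<Rightarrow> (nat \<times> 'a \<times> real) option) \<Rightarrow> 'v \<Rightarrow> 'a" where
  "coords J x = (\<lambda>i\<in>J. fst (snd (the (x i))))"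

definition heights :: "'v set \<Rightarrow> ('v \<Rightarrow> (nat \<times> 'a \<times> real) option) \<Rightarrow> 'v \<Rightarrow> real" where
  "heights J x = (\<lambda>i. if i \<in> J then snd (snd (the (x i))) else 0)"

definition from_model_tuple where
  "from_model_tuple I \<sigma> x = collapse_map (wedge_base (Pow V) Sm) (I, collapse_map (smash_base (Wd I) (Bh I))
     (collapse_map (wedge_base (Kf I) (Jn I)) (\<sigma>, cone_to_join V (heights (I - \<sigma>) x, collapse_map (fat_wedge I (W \<sigma>)) (coords I x))),
      collapse_map (fat_wedge (V - I) B) (coords (V - I) x)))"

lemma model_tuple_nonbase:
  assumes I: "I \<subseteq> V" and w: "w \<notin> fat_wedge I (W \<sigma>)" and b: "b \<notin> fat_wedge (V - I) B" and t: "\<And>i. i \<in> I - \<sigma> \<Longrightarrow> t i \<noteq> 1"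
  shows "i \<in> V \<Longrightarrow> model_tuple I \<sigma> w b t i = Some (if i \<notin> I then (0, b i, 0) else if i \<in> \<sigma> then (1, w i, 0) else (2, w i, t i))"
    and "model_tuple I \<sigma> w b t \<notin> fat_wedge V M"
proof -
  have wb: "w i \<noteq> basept (C i)" if "i \<in> I" for i using w that unfolding fat_wedge_def points_W(2) by blast
  have bb: "b i \<noteq> basept (B i)" if "i \<in> V - I" for i using b that unfolding fat_wedge_def by blast
  show *: "model_tuple I \<sigma> w b t i = Some (if i \<notin> I then (0, b i, 0) else if i \<in> \<sigma> then (1, w i, 0) else (2, w i, t i))"
    if "i \<in> V" for i
    using that wb[of i] bb[of i] t[of i] by (auto simp: model_tuple_def collapse_map_def cone_base_def)
  then show "model_tuple I \<sigma> w b t \<notin> fat_wedge V M"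
    by (auto simp: fat_wedge_def)
qed

text \<open>Outside of the cone over the base point the join is described by cone coordinates, and all heights are
  less than \<open>1\<close>, so that no entry of the tuple is a base point.\<close>

lemma join_to_model_nonbase:
  assumes I: "I \<subseteq> V" and \<sigma>: "\<sigma> \<in> Kf I" and j: "j \<in> join_points (Lk I \<sigma>) (space_of (D I \<sigma>))"
    and nc: "j \<notin> join_cone (Lk I \<sigma>) (D I \<sigma>)" and b: "Some b \<in> points (Bh I)"
  obtains w t where "Some w \<in> points (D I \<sigma>)" "t \<in> topspace (cubical_cone (lk I \<sigma>))" "\<forall>i\<in>V. t i \<noteq> 1"
    "j = cone_to_join V (t, Some w)" "join_to_model I \<sigma> j (Some b) = Some (model_tuple I \<sigma> w b t)"
proof -
  interpret finite_complex V "lk I \<sigma>" by (rule finite_complex_lk)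
  have bD: "basept (D I \<sigma>) = None" by (simp add: D_eq smash_eq)
  have bf: "b \<notin> fat_wedge (V - I) B" using b unfolding Some_in_Bh[OF I] by blast
  have zc: "join_map (l, None, s) \<in> join_cone (Lk I \<sigma>) (D I \<sigma>)" if "l \<in> topspace (Lk I \<sigma>)" "s \<in> {0..1}" for l s
    unfolding join_cone_def bD using that by (intro insertI2 imageI) simp
  show thesis
  proof (rule join_point_forms[OF j])
    fix l assume l: "j = Left_End l" "l \<in> topspace (Lk I \<sigma>)"
    have "join_map (l, None, 0) \<in> join_cone (Lk I \<sigma>) (D I \<sigma>)" by (rule zc[OF l(2)]) simp
    then show thesis using nc l(1) by simp
  next
    fix w' assume w': "j = Right_End w'" "w' \<in> points (D I \<sigma>)"
    then have "w' \<noteq> None" using nc by (auto simp: join_cone_def bD)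
    then obtain w where w: "w' = Some w" by auto
    then have wf: "w \<notin> fat_wedge I (W \<sigma>)" using w'(2) unfolding w Some_in_D by blast
    have "height V (\<lambda>_. 0) = 0" by (rule height_eqI[OF fin]) auto
    then have "j = cone_to_join V (\<lambda>_. 0, Some w)" using w' w by (simp add: cone_to_join_def)
    moreover have "join_to_model I \<sigma> j (Some b) = Some (model_tuple I \<sigma> w b (\<lambda>_. 0))"
      using model_tuple_nonbase(2)[OF I wf bf, of "\<lambda>_. 0"] w w'(1) by (simp add: join_to_model_def collapse_map_def)
    ultimately show thesis
      using that[of w "\<lambda>_. 0"] w' w zero_in_cone[OF \<sigma>] by simp
  next
    fix l w' s assume *: "j = Between l w' s" "j = join_map (l, w', s)" "l \<in> topspace (Lk I \<sigma>)" "w' \<in> points (D I \<sigma>)" "0 < s" "s < 1"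
    have "w' \<noteq> None"
    proof
      assume "w' = None"
      then show False using zc[OF *(3), of s] * nc by simp
    qed
    then obtain w where w: "w' = Some w" by auto
    then have wf: "w \<notin> fat_wedge I (W \<sigma>)" using *(4) unfolding w Some_in_D by blast
    let ?t = "cone_point V (l, s)"
    note cp = cone_point_props[OF *(3) _ lk_empty[OF \<sigma>], of s]
    have t1: "?t i \<noteq> 1" if "i \<in> V" for i
      using cp(4)[OF _ that] * by simp
    then have "\<And>i. i \<in> I - \<sigma> \<Longrightarrow> ?t i \<noteq> 1" using I by blast
    then have "join_to_model I \<sigma> j (Some b) = Some (model_tuple I \<sigma> w b ?t)"
      using model_tuple_nonbase(2)[OF I wf bf, of ?t] w *(1) by (simp add: join_to_model_def collapse_map_def)
    moreover have "j = cone_to_join V (?t, Some w)"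
      using cp(3)[of "Some w"] * w by simp
    moreover have "?t \<in> topspace (cubical_cone (lk I \<sigma>))" using cp(1) * by simp
    ultimately show thesis using that[of w ?t] *(4) w t1 by simp
  qed
qed

lemma join_to_model_join_cone:
  assumes I: "I \<subseteq> V" and "j \<in> join_cone (Lk I \<sigma>) (D I \<sigma>)"
  shows "join_to_model I \<sigma> j b' = None"
proof -
  have bD: "basept (D I \<sigma>) = None" by (simp add: D_eq smash_eq)
  show ?thesis
  proof (cases "j = Right_End None")
    case False
    then obtain l s where "l \<in> topspace (Lk I \<sigma>)" "s \<in> {0..1}" "j = join_map (l, None, s)"
      using assms(2) by (auto simp: join_cone_def bD)
    then show ?thesis using join_to_model_join_map[OF I] by simp
  qed simp
qed

text \<open>The index sets \<open>I\<close> and \<open>\<sigma>\<close> are recovered from the tags of the entries.\<close>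

lemma from_model_tuple_to_model:
  assumes z: "z \<in> points joins_wedge" and x: "to_model z = Some x"
  shows "from_model_tuple (tags x (\<lambda>n. n \<noteq> 0)) (tags x (\<lambda>n. n = 1)) x = z"
proof (rule joins_wedge_cases[OF z])
  assume "z = None" then show ?thesis using x by simp
next
  fix I \<sigma> j b assume *: "z = Some (I, Some (Some (\<sigma>, j), Some b))" "I \<subseteq> V" "\<sigma> \<in> Kf I"
    "j \<in> join_points (Lk I \<sigma>) (space_of (D I \<sigma>))" "j \<noteq> Right_End None" "Some b \<in> points (Bh I)"
  have nc: "j \<notin> join_cone (Lk I \<sigma>) (D I \<sigma>)"
    using join_to_model_join_cone[OF *(2), of j \<sigma> "Some b"] x *(1) by auto
  obtain w t where wt: "Some w \<in> points (D I \<sigma>)" "t \<in> topspace (cubical_cone (lk I \<sigma>))" "\<forall>i\<in>V. t i \<noteq> 1"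
    "j = cone_to_join V (t, Some w)" "join_to_model I \<sigma> j (Some b) = Some (model_tuple I \<sigma> w b t)"
    using join_to_model_nonbase[OF *(2,3,4) nc *(6)] .
  have xt: "x = model_tuple I \<sigma> w b t" using x *(1) wt(5) by simp
  have w: "w \<in> (\<Pi>\<^sub>E i\<in>I. points (W \<sigma> i))" "w \<notin> fat_wedge I (W \<sigma>)" using wt(1) unfolding Some_in_D by blast+
  have b: "b \<in> (\<Pi>\<^sub>E i\<in>V - I. points (B i))" "b \<notin> fat_wedge (V - I) B" using *(6) unfolding Some_in_Bh[OF *(2)] by blast+
  have \<sigma>I: "\<sigma> \<subseteq> I" using *(3) by (simp add: Kf_iff)
  have xi: "x i = Some (if i \<notin> I then (0, b i, 0) else if i \<in> \<sigma> then (1, w i, 0) else (2, w i, t i))" if "i \<in> V" for i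
    unfolding xt using model_tuple_nonbase(1)[OF *(2) w(2) b(2)] wt(3) *(2) that by blast
  have I: "tags x (\<lambda>n. n \<noteq> 0) = I"
    using *(2) xi by (auto simp: tags_def split: if_splits)
  have S: "tags x (\<lambda>n. n = 1) = \<sigma>"
  proof (rule set_eqI)
    fix i
    have "\<sigma> \<subseteq> V" using \<sigma>I *(2) by (rule subset_trans)
    then show "i \<in> tags x (\<lambda>n. n = 1) \<longleftrightarrow> i \<in> \<sigma>"
      using \<sigma>I xi[of i] by (cases "i \<in> V") (auto simp: tags_def)
  qed
  have cw: "coords I x = w"
  proof
    fix i show "coords I x i = w i"
      using *(2) xi[of i] w(1) by (auto simp: coords_def PiE_iff extensional_def split: if_splits)
  qed
  have cb: "coords (V - I) x = b"
  proof
    fix i show "coords (V - I) x i = b i"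
      using xi[of i] b(1) by (auto simp: coords_def PiE_iff extensional_def split: if_splits)
  qed
  have supp: "{i. t i \<noteq> 0} \<subseteq> I - \<sigma>" using wt(2) unfolding topspace_cubical_cone lk_iff by blast
  have h: "heights (I - \<sigma>) x = t"
  proof
    fix i show "heights (I - \<sigma>) x i = t i"
      using *(2) xi[of i] supp by (auto simp: heights_def)
  qed
  have b1: "(\<sigma>, j) \<notin> wedge_base (Kf I) (Jn I)"
    using *(5) by (auto simp: wedge_base_def join_eq)
  have b2: "(Some (\<sigma>, j), Some b) \<notin> smash_base (Wd I) (Bh I)"
    by (simp add: smash_base_def)
  have b3: "(I, Some (Some (\<sigma>, j), Some b)) \<notin> wedge_base (Pow V) Sm"
    by (auto simp: wedge_base_def)
  show "from_model_tuple (tags x (\<lambda>n. n \<noteq> 0)) (tags x (\<lambda>n. n = 1)) x = z"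
    unfolding I S from_model_tuple_def cw cb h *(1) using w(2) b(2) b1 b2 b3 wt(4) by (simp add: collapse_map_def)
qed

lemma to_model_inj:
  assumes "z \<in> points joins_wedge" "z' \<in> points joins_wedge" "to_model z = to_model z'" "to_model z \<noteq> None"
  shows "z = z'"
  using from_model_tuple_to_model[OF assms(1)] from_model_tuple_to_model[OF assms(2)] assms(3,4) by (metis option.exhaust)

lemma join_to_model_cone_to_join:
  assumes I: "I \<subseteq> V" and t: "t \<in> topspace (cubical_cone (lk I \<sigma>))"
  shows "join_to_model I \<sigma> (cone_to_join V (t, w')) b' = model_point I \<sigma> t w' b'"
proof -
  interpret finite_complex V "lk I \<sigma>" by (rule finite_complex_lk)
  have t01: "0 \<le> t v" "t v \<le> 1" for v using t by (auto simp: topspace_cubical_cone)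
  have off: "t v = 0" if "v \<notin> V" for v
    using t that sub by (auto simp: topspace_cubical_cone)
  show ?thesis
  proof (cases "height V t = 0")
    case True
    then have "t v = 0" for v
      using height_props(2)[OF fin, of v t] off[of v] t01(1)[of v] by (cases "v \<in> V") auto
    then have "t = (\<lambda>_. 0)" by auto
    then show ?thesis using True by (simp add: cone_to_join_def join_to_model_def)
  next
    case False
    note n = cubical_cone_normalize[OF t False]
    have "1 - height V t \<in> {0..1}"
      using height_props(1,3)[OF fin, of t] t01(2) by (auto) (metis)
    from join_to_model_join_map[OF I n(1) this] show ?thesis
      using False n(2) by (simp add: cone_to_join_def)
  qed
qed

lemma to_model_from_model_tuple:
  assumes I: "I \<subseteq> V" and \<sigma>: "\<sigma> \<in> Kf I" and t: "heights (I - \<sigma>) x \<in> topspace (cubical_cone (lk I \<sigma>))"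
  shows "to_model (from_model_tuple I \<sigma> x) = collapse_map (fat_wedge V M) (model_tuple I \<sigma> (coords I x) (coords (V - I) x) (heights (I - \<sigma>) x))"
proof -
  have 1: "to_model (collapse_map (wedge_base (Pow V) Sm) (I, q)) = smash_to_model I q" for q
    by (auto simp: to_model_def collapse_map_def wedge_base_def smash_to_model_def)
  have 2: "smash_to_model I (collapse_map (smash_base (Wd I) (Bh I)) (wp, b')) = wedge_to_model I wp b'" for wp b'
    by (auto simp: smash_to_model_def collapse_map_def smash_base_def)
  have 3: "wedge_to_model I (collapse_map (wedge_base (Kf I) (Jn I)) (\<sigma>, j)) b' = join_to_model I \<sigma> j b'" for j b'
    by (auto simp: wedge_to_model_def collapse_map_def wedge_base_def join_eq)
  show ?thesis
    unfolding from_model_tuple_def 1 2 3 join_to_model_cone_to_join[OF I t] model_point_collapse[OF I] ..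
qed

section \<open>Shrinking the cones over the base points of the joins\<close>

definition contraction_D :: "'v set \<Rightarrow> 'v set \<Rightarrow> ('v \<Rightarrow> 'a) option \<times> real \<Rightarrow> ('v \<Rightarrow> 'a) option" where
  "contraction_D I \<sigma> = (\<lambda>(z, t). smash_map I (W \<sigma>) (\<lambda>i x. k i (x, t)) z)"

text \<open>The product vanishes at the base point of the smash product, and it is less than \<open>1\<close> only if some
  factor is, in which case that coordinate, and hence the point, is contracted to the base point.\<close>

definition depth_D :: "'v set \<Rightarrow> ('v \<Rightarrow> 'a) option \<Rightarrow> real" where
  "depth_D I z = (case z of None \<Rightarrow> 0 | Some w \<Rightarrow> (\<Prod>i\<in>I. d i (w i)))"

lemma contracting_base_D:
  assumes I: "I \<subseteq> V"
  shows "contracting_base (D I \<sigma>) (contraction_D I \<sigma>) (depth_D I)"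
proof
  have fI: "finite I" using I fin finite_subset by blast
  note CV = C_facts[OF subsetD[OF I]]
  show bD: "basept (D I \<sigma>) \<in> points (D I \<sigma>)" by (simp add: D_eq smash_eq)
  have cW: "continuous_map (prod_topology unit_interval (space_of (W \<sigma> i))) (space_of (W \<sigma> i)) (\<lambda>p. k i (snd p, fst p))" if i: "i \<in> I" for i
  proof -
    have 1: "continuous_map (prod_topology unit_interval (space_of (W \<sigma> i))) (space_of (C i)) (\<lambda>p. k i (snd p, fst p))"
    proof (intro continuous_map_comp[OF _ CV(7)[OF i]] continuous_map_pairedI continuous_map_fst)
      have cc: "continuous_map (space_of (W \<sigma> i)) (space_of (C i)) (\<lambda>x. x)" using W_facts(3) I i by blast
      show "continuous_map (prod_topology unit_interval (space_of (W \<sigma> i))) (space_of (C i)) snd"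
        by (rule continuous_map_comp[OF continuous_map_snd cc])
    qed
    show ?thesis
    proof (cases "i \<in> \<sigma>")
      case True
      then show ?thesis using 1 by simp
    next
      case False
      then show ?thesis using 1 CV(10)[OF i] by (auto simp: subpspace_def continuous_map_in_subtopology)
    qed
  qed
  have cs: "continuous_map (prod_topology unit_interval (space_of (smash I (W \<sigma>)))) (space_of (smash I (W \<sigma>)))
     (\<lambda>(t, z). smash_map I (W \<sigma>) (\<lambda>i x. (\<lambda>p. k i (snd p, fst p)) (t, x)) z)"
  proof (rule continuous_map_smash_homotopy)
    show "(\<lambda>p. k i (snd p, fst p)) (t, basept (W \<sigma> i)) = basept (W \<sigma> i)" if "i \<in> I" "t \<in> {0..1}" for i t
      using CV(9)[OF that] unfolding points_W(2) by simp
  qed (rule cW)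
  have "continuous_map (prod_topology (space_of (D I \<sigma>)) unit_interval) (prod_topology unit_interval (space_of (D I \<sigma>))) (\<lambda>p. (snd p, fst p))"
    by (intro continuous_map_pairedI continuous_map_fst continuous_map_snd)
  from continuous_map_comp[OF this cs[folded D_eq]]
  show "continuous_map (prod_topology (space_of (D I \<sigma>)) unit_interval) (space_of (D I \<sigma>)) (contraction_D I \<sigma>)"
    by (simp add: contraction_D_def case_prod_unfold)
  have form: "z = None \<or> (\<exists>w. z = Some w \<and> w \<in> (\<Pi>\<^sub>E i\<in>I. points (W \<sigma> i)) \<and> w \<notin> fat_wedge I (W \<sigma>))" if "z \<in> points (D I \<sigma>)" for z
    using that Some_in_D by (cases z) auto
  have wC: "w i \<in> points (C i)" if "w \<in> (\<Pi>\<^sub>E i\<in>I. points (W \<sigma> i))" "i \<in> I" for w i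
  proof -
    have "w i \<in> points (W \<sigma> i)" using that by (auto simp: PiE_iff)
    then show ?thesis unfolding points_W by (auto split: if_splits)
  qed
  show "contraction_D I \<sigma> (z, 0) = z" if zD: "z \<in> points (D I \<sigma>)" for z
  proof -
    consider "z = None" | w where "z = Some w" "w \<in> (\<Pi>\<^sub>E i\<in>I. points (W \<sigma> i))" "w \<notin> fat_wedge I (W \<sigma>)" using form[OF zD] by blast
    then show ?thesis
    proof cases
      case (2 w)
      have "(\<lambda>i\<in>I. k i (w i, 0)) = w"
      proof
        fix i show "(\<lambda>i\<in>I. k i (w i, 0)) i = w i"
          using CV(8) wC[OF 2(2)] 2(2) by (cases "i \<in> I") (auto simp: PiE_iff extensional_def)
      qed
      then show ?thesis using 2 by (simp add: contraction_D_def smash_map_def collapse_map_def)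
    qed (simp add: contraction_D_def smash_map_def)
  qed
  show "contraction_D I \<sigma> (basept (D I \<sigma>), t) = basept (D I \<sigma>)" for t
    by (simp add: D_eq smash_eq contraction_D_def smash_map_def)
  show "depth_D I (basept (D I \<sigma>)) = 0"
    by (simp add: D_eq smash_eq depth_D_def)
  have dc: "continuous_map (space_of (W \<sigma> i)) euclideanreal (d i)" if "i \<in> I" for i
    using continuous_map_comp[OF W_facts(3)[OF subsetD[OF I that]] continuous_map_from_unit_interval[OF CV(11)[OF that]]] .
  have d01: "0 \<le> d i (w i) \<and> d i (w i) \<le> 1" if "w \<in> (\<Pi>\<^sub>E i\<in>I. points (W \<sigma> i))" "i \<in> I" for w i
    using CV(11)[OF that(2)] wC[OF that] by (simp add: continuous_map_into_unit_interval)
  have "continuous_map (space_of (D I \<sigma>)) euclideanreal (case_option 0 (\<lambda>w. \<Prod>i\<in>I. d i (w i)))"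
    unfolding D_eq smash_eq
  proof (rule continuous_map_case_collapse)
    show "continuous_map (PW I \<sigma>) euclideanreal (\<lambda>w. \<Prod>i\<in>I. d i (w i))"
    proof (intro continuous_map_prod[OF fI])
      fix i assume i: "i \<in> I"
      show "continuous_map (PW I \<sigma>) euclideanreal (\<lambda>w. d i (w i))"
        by (rule continuous_map_comp[OF continuous_map_from_kification[OF continuous_map_product_projection[OF i, of "\<lambda>i. space_of (W \<sigma> i)"]] dc[OF i]])
    qed
    show "(\<Prod>i\<in>I. d i (w i)) = 0" if w: "w \<in> fat_wedge I (W \<sigma>)" for w
    proof -
      obtain i where "i \<in> I" "w i = basept (C i)" using w unfolding fat_wedge_def points_W(2) by blast
      then show ?thesis using CV(12)[of i] fI by (intro prod_zero bexI[of _ i]) auto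
    qed
  qed simp
  then have cd: "continuous_map (space_of (D I \<sigma>)) euclideanreal (depth_D I)"
    by (rule continuous_map_eq) (auto simp: depth_D_def split: option.split)
  show "continuous_map (space_of (D I \<sigma>)) unit_interval (depth_D I)"
    unfolding continuous_map_into_unit_interval
  proof (intro conjI ballI cd)
    fix z assume "z \<in> points (D I \<sigma>)"
    from form[OF this] show "0 \<le> depth_D I z" "depth_D I z \<le> 1"
      using d01 by (auto simp: depth_D_def intro!: prod_nonneg prod_le_1)
  qed
  show "contraction_D I \<sigma> (z, 1) = basept (D I \<sigma>)" if z: "z \<in> points (D I \<sigma>)" "depth_D I z < 1" for z
  proof -
    consider "z = None" | w where "z = Some w" "w \<in> (\<Pi>\<^sub>E i\<in>I. points (W \<sigma> i))" using form[OF z(1)] by blast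
    then show ?thesis
    proof cases
      case (2 w)
      have "\<exists>i\<in>I. d i (w i) < 1"
      proof (rule ccontr)
        assume "\<not> (\<exists>i\<in>I. d i (w i) < 1)"
        then have "d i (w i) = 1" if "i \<in> I" for i using d01[OF 2(2) that] that by force
        then show False using z(2) 2(1) by (simp add: depth_D_def)
      qed
      then obtain i where i: "i \<in> I" "d i (w i) < 1" by blast
      then have "k i (w i, 1) = basept (W \<sigma> i)"
        using CV(13)[OF i(1) wC[OF 2(2) i(1)]] unfolding points_W(2) by simp
      then have "(\<lambda>i\<in>I. k i (w i, 1)) \<in> fat_wedge I (W \<sigma>)"
        using i(1) unfolding fat_wedge_def by (intro CollectI bexI[of _ i]) (simp_all only: restrict_apply if_True)
      then show ?thesis using 2 by (simp add: contraction_D_def smash_map_def collapse_map_def D_eq smash_eq)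
    qed (simp add: contraction_D_def smash_map_def D_eq smash_eq)
  qed
qed

definition shrink where
  "shrink = wedge_homotopy_map (Pow V) Sm (\<lambda>I. smash2_homotopy_map (Wd I) (Bh I)
     (wedge_homotopy_map (Kf I) (Jn I) (\<lambda>\<sigma>. join_shrink None (contraction_D I \<sigma>) (depth_D I))))"

lemma bD: "basept (D I \<sigma>) = None"
  by (simp add: D_eq smash_eq)

lemma continuous_map_shrink: "continuous_map (prod_topology unit_interval (space_of joins_wedge)) (space_of joins_wedge) shrink"
  unfolding shrink_def
proof (intro continuous_map_wedge_homotopy continuous_map_smash2_homotopy)
  fix I \<sigma> assume I: "I \<in> Pow V" and \<sigma>: "\<sigma> \<in> Kf I"
  interpret finite_complex V "lk I \<sigma>" by (rule finite_complex_lk)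
  interpret contracting_base "D I \<sigma>" "contraction_D I \<sigma>" "depth_D I" by (rule contracting_base_D) (use I in simp)
  show "continuous_map (prod_topology unit_interval (space_of (Jn I \<sigma>))) (space_of (Jn I \<sigma>)) (join_shrink None (contraction_D I \<sigma>) (depth_D I))"
    unfolding join_eq using continuous_map_join_shrink[OF compact_realization Hausdorff_realization k_space_D] by (simp add: bD)
  show "join_shrink None (contraction_D I \<sigma>) (depth_D I) (t, basept (Jn I \<sigma>)) = basept (Jn I \<sigma>)" if "t \<in> {0..1}" for t
    unfolding join_eq using join_shrink_base[OF that] by (simp add: bD)
qed (simp_all add: wedge_homotopy_map_def smash2_homotopy_map_def)

lemma shrink_None: "shrink (t, None) = None"
  by (simp add: shrink_def wedge_homotopy_map_def)

lemma shrink_Some: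
  "shrink (t, Some (I, Some (Some (\<sigma>, j), Some b))) = collapse_map (wedge_base (Pow V) Sm) (I, collapse_map (smash_base (Wd I) (Bh I))
     (collapse_map (wedge_base (Kf I) (Jn I)) (\<sigma>, join_shrink None (contraction_D I \<sigma>) (depth_D I) (t, j)), Some b))"
  by (simp add: shrink_def wedge_homotopy_map_def smash2_homotopy_map_def)

text \<open>The fibre of \<open>to_model\<close> over the base point consists of the base point and the cones over the
  base points of the joins, and these are what \<open>join_shrink\<close> preserves and contracts.\<close>

lemma shrink_props:
  assumes z: "z \<in> points joins_wedge"
  shows "shrink (0, z) = z"
    and "t \<in> {0..1} \<Longrightarrow> to_model z = None \<Longrightarrow> to_model (shrink (t, z)) = None"
    and "to_model z = None \<Longrightarrow> shrink (1, z) = None"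
proof -
  have "shrink (0, z) = z \<and> (\<forall>t\<in>{0..1}. to_model z = None \<longrightarrow> to_model (shrink (t, z)) = None) \<and> (to_model z = None \<longrightarrow> shrink (1, z) = None)"
  proof (rule joins_wedge_cases[OF z])
    assume "z = None" then show ?thesis by (simp add: shrink_None)
  next
    fix I \<sigma> j b assume *: "z = Some (I, Some (Some (\<sigma>, j), Some b))" "I \<subseteq> V" "\<sigma> \<in> Kf I"
      "j \<in> join_points (Lk I \<sigma>) (space_of (D I \<sigma>))" "j \<noteq> Right_End None" "Some b \<in> points (Bh I)"
    interpret contracting_base "D I \<sigma>" "contraction_D I \<sigma>" "depth_D I" by (rule contracting_base_D[OF *(2)])
    let ?s = "\<lambda>t. join_shrink None (contraction_D I \<sigma>) (depth_D I) (t, j)"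
    have b1: "(\<sigma>, j) \<notin> wedge_base (Kf I) (Jn I)"
      using *(5) by (auto simp: wedge_base_def join_eq)
    have b2: "(Some (\<sigma>, j), Some b) \<notin> smash_base (Wd I) (Bh I)" by (simp add: smash_base_def)
    have b3: "(I, Some (Some (\<sigma>, j), Some b)) \<notin> wedge_base (Pow V) Sm" by (auto simp: wedge_base_def)
    have "?s 0 = j" using join_shrink_0[OF *(4)] by (simp add: bD)
    then have 0: "shrink (0, z) = z"
      unfolding *(1) shrink_Some using b1 b2 b3 by (simp add: collapse_map_def)
    have tm: "to_model (shrink (t, z)) = join_to_model I \<sigma> (?s t) (Some b)" for t
    proof -
      have 1: "to_model (collapse_map (wedge_base (Pow V) Sm) (I, q)) = smash_to_model I q" for q
        by (auto simp: to_model_def collapse_map_def wedge_base_def smash_to_model_def)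
      have 2: "smash_to_model I (collapse_map (smash_base (Wd I) (Bh I)) (wp, b')) = wedge_to_model I wp b'" for wp b'
        by (auto simp: smash_to_model_def collapse_map_def smash_base_def)
      have 3: "wedge_to_model I (collapse_map (wedge_base (Kf I) (Jn I)) (\<sigma>, j)) b' = join_to_model I \<sigma> j b'" for j b'
        by (auto simp: wedge_to_model_def collapse_map_def wedge_base_def join_eq)
      show ?thesis unfolding *(1) shrink_Some 1 2 3 ..
    qed
    have cone: "j \<in> join_cone (Lk I \<sigma>) (D I \<sigma>)" if "to_model z = None"
    proof (rule ccontr)
      assume nc: "j \<notin> join_cone (Lk I \<sigma>) (D I \<sigma>)"
      obtain w t where "Some w \<in> points (D I \<sigma>)" "t \<in> topspace (cubical_cone (lk I \<sigma>))" "\<forall>i\<in>V. t i \<noteq> 1"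
        "j = cone_to_join V (t, Some w)" "join_to_model I \<sigma> j (Some b) = Some (model_tuple I \<sigma> w b t)"
        using join_to_model_nonbase[OF *(2,3,4) nc *(6)] .
      then show False using that *(1) by simp
    qed
    have "to_model (shrink (t, z)) = None" if "t \<in> {0..1}" "to_model z = None" for t
      unfolding tm using join_to_model_join_cone[OF *(2) join_shrink_cone(1)[OF that(1) cone[OF that(2)]]] by (simp add: bD)
    moreover have "shrink (1, z) = None" if "to_model z = None"
    proof -
      have "?s 1 = Right_End None" using join_shrink_cone(2)[OF _ cone[OF that], of 1] by (simp add: bD)
      then have "(\<sigma>, ?s 1) \<in> wedge_base (Kf I) (Jn I)" using *(3) by (auto simp: wedge_base_def join_eq)
      then have e1: "collapse_map (wedge_base (Kf I) (Jn I)) (\<sigma>, ?s 1) = None" by (simp add: collapse_map_def)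
      have e2: "collapse_map (smash_base (Wd I) (Bh I)) (None, Some b) = None" by (simp add: collapse_map_def smash_base_def)
      have "(I, None) \<in> wedge_base (Pow V) Sm" using *(2) by (auto simp: wedge_base_def)
      then show ?thesis unfolding *(1) shrink_Some e1 e2 by (simp add: collapse_map_def)
    qed
    ultimately show ?thesis using 0 by blast
  qed
  then show "shrink (0, z) = z" "t \<in> {0..1} \<Longrightarrow> to_model z = None \<Longrightarrow> to_model (shrink (t, z)) = None"
    "to_model z = None \<Longrightarrow> shrink (1, z) = None" by auto
qed

end

section \<open>The model is a quotient of the wedge of joins\<close>

lemma Hausdorff_space_sum:
  assumes "\<And>j. j \<in> J \<Longrightarrow> Hausdorff_space (X j)"
  shows "Hausdorff_space (sum_topology X J)"
  unfolding Hausdorff_space_def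
proof (intro allI impI, elim conjE)
  fix p q assume pq: "p \<in> topspace (sum_topology X J)" "q \<in> topspace (sum_topology X J)" "p \<noteq> q"
  obtain i x j y where ij: "p = (i, x)" "q = (j, y)" by (cases p, cases q)
  then have in': "i \<in> J" "x \<in> topspace (X i)" "j \<in> J" "y \<in> topspace (X j)"
    using pq by (auto simp: topspace_sum_topology)
  have op: "openin (sum_topology X J) ({i} \<times> U)" if "i \<in> J" "openin (X i) U" for i U
  proof (rule openin_sum_topologyI)
    show "{i} \<times> U \<subseteq> Sigma J (\<lambda>j. topspace (X j))" using that openin_subset[OF that(2)] by auto
    show "openin (X l) {x \<in> topspace (X l). (l, x) \<in> {i} \<times> U}" for l
    proof (cases "l = i")
      case True
      then have "{x \<in> topspace (X l). (l, x) \<in> {i} \<times> U} = U" using openin_subset[OF that(2)] by auto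
      then show ?thesis using that True by simp
    qed simp
  qed
  show "\<exists>U W. openin (sum_topology X J) U \<and> openin (sum_topology X J) W \<and> p \<in> U \<and> q \<in> W \<and> disjnt U W"
  proof (cases "i = j")
    case False
    show ?thesis
      by (intro exI[of _ "{i} \<times> topspace (X i)"] exI[of _ "{j} \<times> topspace (X j)"] conjI op)
        (use in' ij False in \<open>auto simp: disjnt_def\<close>)
  next
    case True
    then have "x \<noteq> y" using pq(3) ij by simp
    then obtain U W where "openin (X i) U" "openin (X i) W" "x \<in> U" "y \<in> W" "disjnt U W"
      using assms[OF in'(1)] in' True unfolding Hausdorff_space_def by meson
    then show ?thesis
      by (intro exI[of _ "{i} \<times> U"] exI[of _ "{j} \<times> W"] conjI op)
        (use in' ij True in \<open>auto simp: disjnt_def\<close>)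
  qed
qed

lemma Hausdorff_space_cone_piece:
  assumes "Hausdorff_space (space_of B)" "Hausdorff_space (space_of C)"
  shows "Hausdorff_space (cone_piece B C E n)"
proof -
  have "Hausdorff_space (if n = 0 then space_of B else if n = 1 then space_of C else subtopology (space_of C) E)"
    using assms by (simp add: Hausdorff_space_subtopology)
  moreover have "Hausdorff_space (top_of_set (if n = 2 then {0..1::real} else {0}))"
    by (simp add: Hausdorff_space_subtopology)
  ultimately show ?thesis
    unfolding cone_piece_def Hausdorff_space_prod_topology by blast
qed

lemma k_space_cone_piece:
  assumes "k_space (space_of B)" "k_space (space_of C)" "closedin (space_of C) E"
  shows "k_space (cone_piece B C E n)"
proof -
  have "compact_space (top_of_set (if n = 2 then {0..1::real} else {0}))"
    by (simp add: compact_space_subtopology)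
  moreover have "k_space (if n = 0 then space_of B else if n = 1 then space_of C else subtopology (space_of C) E)"
    using assms by (simp add: k_space_closed_subtopology)
  ultimately show ?thesis
    unfolding cone_piece_def
    by (intro k_space_prod_topology_right compact_imp_locally_compact_space) (auto simp: Hausdorff_space_subtopology)
qed

text \<open>A point off the base point is separated from the base points of the summands by its position in \<open>B\<close>
  or \<open>C\<close>, and from the apex of the cone by its height.\<close>

lemma Hausdorff_space_cone_wedge:
  assumes HB: "Hausdorff_space (space_of B)" and HC: "Hausdorff_space (space_of C)"
    and bB: "basept B \<in> points B" and bC: "basept C \<in> points C"
  shows "Hausdorff_space (space_of (cone_wedge B C E))"
  unfolding cone_wedge_def
proof (rule Hausdorff_space_collapse)
  let ?S = "cone_sum B C E" and ?b = "cone_base B C"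
  show "Hausdorff_space ?S"
    unfolding cone_sum_def by (intro Hausdorff_space_sum Hausdorff_space_cone_piece HB HC)
  fix p assume p: "p \<in> topspace ?S - ?b"
  obtain n x t where nx: "p = (n, x, t)" by (cases p)
  then have n: "n \<in> {0, 1, 2}" and xt: "(x, t) \<in> topspace (cone_piece B C E n)" and xb: "x \<noteq> basept (if n = 0 then B else C)" and t1: "\<not> (n = 2 \<and> t = 1)"
    using p by (auto simp: cone_sum_def topspace_sum_topology cone_base_def)
  let ?Y = "if n = 0 then B else C"
  have "Hausdorff_space (space_of ?Y)" "x \<in> points ?Y" "basept ?Y \<in> points ?Y"
    using HB HC bB bC xt by (auto simp: cone_piece_def split: if_splits)
  then obtain U W where UW: "openin (space_of ?Y) U" "openin (space_of ?Y) W" "x \<in> U" "basept ?Y \<in> W" "disjnt U W"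
    using xb unfolding Hausdorff_space_def by meson
  let ?c = "(1 + t) / 2"
  let ?U = "{q \<in> topspace ?S. fst q = n \<and> fst (snd q) \<in> U \<and> (n = 2 \<longrightarrow> snd (snd q) < ?c)}"
  let ?W = "{q \<in> topspace ?S. fst q = n \<longrightarrow> fst (snd q) \<in> W \<or> (n = 2 \<and> snd (snd q) > ?c)}"
  have cf: "continuous_map (cone_piece B C E n) (space_of ?Y) fst"
    unfolding cone_piece_def by (auto intro: continuous_map_fst continuous_map_into_fulltopology[OF continuous_map_fst])
  have cs: "continuous_map (cone_piece B C E n) euclideanreal snd"
    unfolding cone_piece_def by (rule continuous_map_into_fulltopology[OF continuous_map_snd])
  let ?pU = "{r \<in> topspace (cone_piece B C E n). fst r \<in> U} \<inter> (if n = 2 then {r \<in> topspace (cone_piece B C E n). snd r \<in> {..<?c}} else topspace (cone_piece B C E n))"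
  let ?pW = "{r \<in> topspace (cone_piece B C E n). fst r \<in> W} \<union> (if n = 2 then {r \<in> topspace (cone_piece B C E n). snd r \<in> {?c<..}} else {})"
  have opU: "openin (cone_piece B C E n) ?pU"
  proof (intro openin_Int openin_continuous_map_preimage[OF cf UW(1)])
    have "openin (cone_piece B C E n) {r \<in> topspace (cone_piece B C E n). snd r \<in> {..<?c}}"
      by (rule openin_continuous_map_preimage[OF cs]) simp
    then show "openin (cone_piece B C E n) (if n = 2 then {r \<in> topspace (cone_piece B C E n). snd r \<in> {..<?c}} else topspace (cone_piece B C E n))"
      by (cases "n = 2"; simp only: if_True if_False openin_topspace refl)
  qed
  have opW: "openin (cone_piece B C E n) ?pW"
  proof (intro openin_Un openin_continuous_map_preimage[OF cf UW(2)])
    have "openin (cone_piece B C E n) {r \<in> topspace (cone_piece B C E n). snd r \<in> {?c<..}}"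
      by (rule openin_continuous_map_preimage[OF cs]) simp
    then show "openin (cone_piece B C E n) (if n = 2 then {r \<in> topspace (cone_piece B C E n). snd r \<in> {?c<..}} else {})"
      by (cases "n = 2"; simp only: if_True if_False openin_empty refl)
  qed
  have "openin ?S ?U"
    unfolding cone_sum_def
  proof (rule openin_sum_topologyI)
    fix l :: nat assume "l \<in> {0, 1, 2}"
    then have "{r \<in> topspace (cone_piece B C E l). (l, r) \<in> {q \<in> topspace (sum_topology (cone_piece B C E) {0, 1, 2}). fst q = n \<and> fst (snd q) \<in> U \<and> (n = 2 \<longrightarrow> snd (snd q) < ?c)}}
        = (if l = n then ?pU else {})"
      by (auto simp: topspace_sum_topology)
    then show "openin (cone_piece B C E l) {r \<in> topspace (cone_piece B C E l). (l, r) \<in> {q \<in> topspace (sum_topology (cone_piece B C E) {0, 1, 2}). fst q = n \<and> fst (snd q) \<in> U \<and> (n = 2 \<longrightarrow> snd (snd q) < ?c)}}"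
      using opU by simp
  qed (auto simp: topspace_sum_topology)
  moreover have "openin ?S ?W"
    unfolding cone_sum_def
  proof (rule openin_sum_topologyI)
    fix l :: nat assume "l \<in> {0, 1, 2}"
    then have "{r \<in> topspace (cone_piece B C E l). (l, r) \<in> {q \<in> topspace (sum_topology (cone_piece B C E) {0, 1, 2}). fst q = n \<longrightarrow> fst (snd q) \<in> W \<or> (n = 2 \<and> snd (snd q) > ?c)}}
        = (if l = n then ?pW else topspace (cone_piece B C E l))"
      by (auto simp: topspace_sum_topology)
    then show "openin (cone_piece B C E l) {r \<in> topspace (cone_piece B C E l). (l, r) \<in> {q \<in> topspace (sum_topology (cone_piece B C E) {0, 1, 2}). fst q = n \<longrightarrow> fst (snd q) \<in> W \<or> (n = 2 \<and> snd (snd q) > ?c)}}"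
      using opW by simp
  qed (auto simp: topspace_sum_topology)
  moreover have "p \<in> ?U"
    using p nx UW(3) t1 xt by (auto simp: cone_piece_def)
  moreover have "?b \<inter> topspace ?S \<subseteq> ?W"
  proof
    fix q assume q: "q \<in> ?b \<inter> topspace ?S"
    show "q \<in> ?W"
    proof (cases "n = 2")
      case True
      then have "t < 1" using t1 xt by (auto simp: cone_piece_def)
      then show ?thesis using q True UW(4) by (auto simp: cone_base_def)
    next
      case False
      then show ?thesis using q UW(4) by (auto simp: cone_base_def)
    qed
  qed
  moreover have "disjnt ?U ?W"
    using UW(5) by (auto simp: disjnt_def)
  ultimately show "\<exists>U W. openin ?S U \<and> openin ?S W \<and> p \<in> U \<and> ?b \<inter> topspace ?S \<subseteq> W \<and> disjnt U W"
    by (intro exI[of _ ?U] exI[of _ ?W] conjI)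
qed

context wedge_decomposition
begin

text \<open>The models are quotients of the sums \<open>S i\<close>, on which tag, position and height are continuous; \<open>Mo i\<close>
  is the sum with a disjoint base point.\<close>

abbreviation "S i \<equiv> cone_sum (B i) (C i) (E i)"
abbreviation "Mo i \<equiv> space_of (collapse (S i) {})"
abbreviation "PMo \<equiv> kification (product_topology Mo V)"
abbreviation "PM \<equiv> kification (product_topology (\<lambda>i. space_of (M i)) V)"

lemma S_facts:
  assumes "i \<in> V"
  shows "k_space (S i)" "Hausdorff_space (Mo i)" "k_space (Mo i)" "Hausdorff_space (space_of (M i))"
proof -
  note c = C_facts[OF assms]
  show kS: "k_space (S i)"
    unfolding cone_sum_def by (intro k_space_sum k_space_cone_piece kB assms c)
  show "k_space (Mo i)" by (rule k_space_collapse[OF kS])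
  have HS: "Hausdorff_space (S i)"
    unfolding cone_sum_def by (intro Hausdorff_space_sum Hausdorff_space_cone_piece HB assms c)
  show "Hausdorff_space (Mo i)"
  proof (rule Hausdorff_space_collapse[OF HS])
    fix x assume "x \<in> topspace (S i) - {}"
    then show "\<exists>U W. openin (S i) U \<and> openin (S i) W \<and> x \<in> U \<and> {} \<inter> topspace (S i) \<subseteq> W \<and> disjnt U W"
      by (intro exI[of _ "topspace (S i)"] exI[of _ "{}"]) (auto simp: disjnt_def)
  qed
  show "Hausdorff_space (space_of (M i))"
    by (rule Hausdorff_space_cone_wedge[OF HB[OF assms] c(1) bB[OF assms] c(6)])
qed

definition proj :: "('v \<Rightarrow> (nat \<times> 'a \<times> real) option) \<Rightarrow> 'v \<Rightarrow> (nat \<times> 'a \<times> real) option" where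
  "proj x = (\<lambda>i\<in>V. collapse_lift (cone_base (B i) (C i)) id (x i))"

lemma quotient_map_proj: "quotient_map PMo PM proj"
proof -
  have eq: "proj = (\<lambda>x. \<lambda>i\<in>V. collapse_lift (cone_base (B i) (C i)) id (x i))"
    by (simp add: proj_def[abs_def])
  have q: "quotient_map (Mo i) (space_of (M i)) (collapse_lift (cone_base (B i) (C i)) id)" for i
    unfolding cone_wedge_def by (rule quotient_map_collapse_from_disjoint_base)
  show ?thesis
    unfolding eq by (intro quotient_map_kification_product fin q S_facts)
qed

definition tag :: "'v set \<Rightarrow> 'v set \<Rightarrow> 'v \<Rightarrow> nat" where
  "tag I \<sigma> i = (if i \<notin> I then 0 else if i \<in> \<sigma> then 1 else 2)"

text \<open>The points whose factors have prescribed tags and whose cone heights are supported in \<open>\<rho>\<close>.\<close>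

definition cell :: "'v set \<Rightarrow> 'v set \<Rightarrow> 'v set \<Rightarrow> ('v \<Rightarrow> (nat \<times> 'a \<times> real) option) set" where
  "cell I \<sigma> \<rho> = {x \<in> topspace PMo. \<forall>i\<in>V. x i \<in> Some ` {p \<in> topspace (S i). fst p = tag I \<sigma> i \<and> (i \<notin> \<rho> \<longrightarrow> snd (snd p) = 0)}}"

lemma continuous_map_from_S:
  assumes "continuous_map (space_of (B i)) Z (\<lambda>x. f (0, x, 0))" "continuous_map (space_of (C i)) Z (\<lambda>x. f (1, x, 0))"
    "continuous_map (prod_topology (subtopology (space_of (C i)) (E i)) unit_interval) Z (\<lambda>p. f (2, p))"
  shows "continuous_map (S i) Z f"
  unfolding cone_sum_def
proof (rule continuous_map_from_sum)
  fix n :: nat assume "n \<in> {0, 1, 2}"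
  then consider "n = 0" | "n = 1" | "n = 2" by auto
  then show "continuous_map (cone_piece (B i) (C i) (E i) n) Z (\<lambda>x. f (n, x))"
  proof cases
    case 1
    have "continuous_map (prod_topology (space_of (B i)) (top_of_set {0::real})) Z (\<lambda>x. f (0, x))"
      by (rule continuous_map_eq[OF continuous_map_comp[OF continuous_map_fst assms(1)]]) auto
    then show ?thesis using 1 by (simp add: cone_piece_def)
  next
    case 2
    have "continuous_map (prod_topology (space_of (C i)) (top_of_set {0::real})) Z (\<lambda>x. f (1, x))"
      by (rule continuous_map_eq[OF continuous_map_comp[OF continuous_map_fst assms(2)]]) auto
    then show ?thesis using 2 by (simp add: cone_piece_def)
  next
    case 3
    then show ?thesis using assms(3) by (simp add: cone_piece_def)
  qed
qed

lemma S_coordinates: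
  shows "continuous_map (S i) euclideanreal (\<lambda>p. real (fst p))" and "continuous_map (S i) euclideanreal (\<lambda>p. snd (snd p))"
  by (rule continuous_map_from_S;
      simp add: continuous_map_from_unit_interval[OF continuous_map_snd])+

lemma closedin_cell: "closedin PMo (cell I \<sigma> \<rho>)"
proof -
  let ?F = "\<lambda>i. {p \<in> topspace (S i). fst p = tag I \<sigma> i \<and> (i \<notin> \<rho> \<longrightarrow> snd (snd p) = 0)}"
  have "closedin (S i) (?F i)" for i
  proof -
    have "?F i = {p \<in> topspace (S i). real (fst p) \<in> {real (tag I \<sigma> i)}} \<inter> {p \<in> topspace (S i). snd (snd p) \<in> (if i \<in> \<rho> then UNIV else {0})}"
      by auto
    moreover have "closedin (S i) \<dots>"
      by (intro closedin_Int closedin_continuous_map_preimage[OF S_coordinates(1)] closedin_continuous_map_preimage[OF S_coordinates(2)]) auto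
    ultimately show ?thesis by simp
  qed
  moreover have "{p \<in> topspace (S i). collapse_map {} p \<in> Some ` ?F i} = ?F i" for i
    by (auto simp: collapse_map_def)
  ultimately have Fc: "closedin (Mo i) (Some ` ?F i)" for i
    unfolding closedin_collapse points_collapse by auto
  have "cell I \<sigma> \<rho> = topspace PMo \<inter> (\<Inter>i\<in>V. {x \<in> topspace PMo. x i \<in> Some ` ?F i})"
    by (auto simp: cell_def)
  moreover have "closedin PMo (topspace PMo \<inter> (\<Inter>i\<in>V. {x \<in> topspace PMo. x i \<in> Some ` ?F i}))"
  proof (cases "V = {}")
    case False
    have "closedin PMo {x \<in> topspace PMo. x i \<in> Some ` ?F i}" if "i \<in> V" for i
    by (rule closedin_continuous_map_preimage[OF continuous_map_from_kification[OF continuous_map_product_projection[OF that, of Mo]] Fc])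
    then show ?thesis by (intro closedin_Int closedin_topspace closedin_INT[OF False])
  qed (simp only: INT_empty Int_UNIV_right closedin_topspace)
  ultimately show ?thesis by (simp only:)
qed

lemma cell_D:
  assumes x: "x \<in> cell I \<sigma> \<rho>" and i: "i \<in> V"
  shows "\<exists>y t. x i = Some (tag I \<sigma> i, y, t) \<and> (tag I \<sigma> i, y, t) \<in> topspace (S i) \<and> (i \<notin> \<rho> \<longrightarrow> t = 0)"
proof -
  obtain p where p: "x i = Some p" "p \<in> topspace (S i)" "fst p = tag I \<sigma> i" "i \<notin> \<rho> \<longrightarrow> snd (snd p) = 0"
    using assms unfolding cell_def by blast
  then show ?thesis by (intro exI[of _ "fst (snd p)"] exI[of _ "snd (snd p)"]) (cases p, simp)
qed

lemma in_S: "(n, y, t) \<in> topspace (S i) \<longleftrightarrow> n = 0 \<and> y \<in> points (B i) \<and> t = 0 \<or> n = 1 \<and> y \<in> points (C i) \<and> t = 0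
    \<or> n = 2 \<and> y \<in> points (C i) \<inter> E i \<and> t \<in> {0..1}"
  by (auto simp: cone_sum_def topspace_sum_topology cone_piece_def)

text \<open>On a cell the coordinates of the tuple, and with them the point of the join, depend continuously on
  the tuple. A coordinate is extended to the whole sum by the base point to see this; the heights are in the
  cubical cone on the link because their support is contained in \<open>\<rho>\<close>.\<close>

lemma continuous_map_from_model_tuple:
  assumes I: "I \<subseteq> V" and \<sigma>: "\<sigma> \<in> Kf I" and \<rho>: "\<rho> \<in> lk I \<sigma>"
  shows "continuous_map (subtopology PMo (cell I \<sigma> \<rho>)) (space_of joins_wedge) (from_model_tuple I \<sigma>)"
    and "\<And>x. x \<in> cell I \<sigma> \<rho> \<Longrightarrow> to_model (from_model_tuple I \<sigma> x) = collapse_map (fat_wedge V M) (proj x)"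
proof -
  interpret finite_complex V "lk I \<sigma>" by (rule finite_complex_lk)
  have \<sigma>I: "\<sigma> \<subseteq> I" using \<sigma> by (simp add: Kf_iff)
  let ?T = "subtopology PMo (cell I \<sigma> \<rho>)"
  have cT: "topspace ?T = cell I \<sigma> \<rho>" by (rule topspace_subtopology_subset[OF closedin_subset[OF closedin_cell]])
  have pr: "continuous_map ?T (Mo i) (\<lambda>x. x i)" if "i \<in> V" for i
    by (rule continuous_map_from_subtopology[OF continuous_map_from_kification[OF continuous_map_product_projection[OF that, of Mo]]])
  have prk: "continuous_map PMo (Mo i) (\<lambda>x. x i)" if "i \<in> V" for i
    by (rule continuous_map_from_kification[OF continuous_map_product_projection[OF that, of Mo]])
  have ext: "continuous_map (Mo i) Z (case_option z0 (\<lambda>p. if fst p = n then fst (snd p) else z0))"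
    if z0: "z0 \<in> topspace Z" and c: "n = 0 \<Longrightarrow> continuous_map (space_of (B i)) Z (\<lambda>x. x)"
       "n = 1 \<Longrightarrow> continuous_map (space_of (C i)) Z (\<lambda>x. x)"
       "n = 2 \<Longrightarrow> continuous_map (subtopology (space_of (C i)) (E i)) Z (\<lambda>x. x)" for i n z0 and Z :: "'a topology"
  proof (rule continuous_map_case_collapse)
    show "continuous_map (S i) Z (\<lambda>p. if fst p = n then fst (snd p) else z0)"
    proof (rule continuous_map_from_S)
      show "continuous_map (space_of (B i)) Z (\<lambda>x. if fst (0::nat, x, 0::real) = n then fst (snd (0::nat, x, 0::real)) else z0)"
        using c(1) z0 by (cases "n = 0") simp_all
      show "continuous_map (space_of (C i)) Z (\<lambda>x. if fst (1::nat, x, 0::real) = n then fst (snd (1::nat, x, 0::real)) else z0)"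
        using c(2) z0 by (cases "n = 1") simp_all
      show "continuous_map (prod_topology (subtopology (space_of (C i)) (E i)) unit_interval) Z (\<lambda>p. if fst (2::nat, p) = n then fst (snd (2::nat, p)) else z0)"
        using continuous_map_comp[OF continuous_map_fst c(3)] z0 by (cases "n = 2") simp_all
    qed
  qed (use z0 in simp_all)
  have cw: "continuous_map ?T (PW I \<sigma>) (coords I)"
  proof -
    let ?u = "\<lambda>i. case_option (basept (C i)) (\<lambda>p. if fst p = tag I \<sigma> i then fst (snd p) else basept (C i))"
    have u: "continuous_map (Mo i) (space_of (W \<sigma> i)) (?u i)" if i: "i \<in> I" for i
    proof (rule ext)
      show "basept (C i) \<in> points (W \<sigma> i)" using W_facts(2)[of i \<sigma>] i I unfolding points_W(2) by blast
    qed (use i in \<open>auto simp: tag_def subpspace_def\<close>)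
    have "continuous_map (product_topology Mo V) (product_topology (\<lambda>i. space_of (W \<sigma> i)) I) (\<lambda>x. \<lambda>i\<in>I. ?u i (x i))"
      unfolding continuous_map_componentwise
    proof (intro conjI ballI)
      fix i assume i: "i \<in> I"
      then have "i \<in> V" using I by blast
      from continuous_map_comp[OF continuous_map_product_projection[OF this, of Mo] u[OF i]] i
      show "continuous_map (product_topology Mo V) (space_of (W \<sigma> i)) (\<lambda>x. (\<lambda>i\<in>I. ?u i (x i)) i)" by simp
    qed auto
    from continuous_map_from_subtopology[OF continuous_map_kification_functor[OF this], of "cell I \<sigma> \<rho>"]
    show ?thesis
    proof (rule continuous_map_eq)
      fix x assume "x \<in> topspace ?T"
      then have x: "x \<in> cell I \<sigma> \<rho>" using cT by blast
      show "(\<lambda>i\<in>I. ?u i (x i)) = coords I x"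
        unfolding coords_def
      proof (rule restrict_ext)
        fix i assume "i \<in> I"
        then have "i \<in> V" using I by blast
        then obtain y t where "x i = Some (tag I \<sigma> i, y, t)" using cell_D[OF x] by blast
        then show "?u i (x i) = fst (snd (the (x i)))" by simp
      qed
    qed
  qed
  have cb: "continuous_map ?T (PB I) (coords (V - I))"
  proof -
    let ?u = "\<lambda>i. case_option (basept (B i)) (\<lambda>p. if fst p = tag I \<sigma> i then fst (snd p) else basept (B i))"
    have u: "continuous_map (Mo i) (space_of (B i)) (?u i)" if i: "i \<in> V - I" for i
      by (rule ext) (use i bB in \<open>auto simp: tag_def\<close>)
    have "continuous_map (product_topology Mo V) (product_topology (\<lambda>i. space_of (B i)) (V - I)) (\<lambda>x. \<lambda>i\<in>V - I. ?u i (x i))"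
      unfolding continuous_map_componentwise
    proof (intro conjI ballI)
      fix i assume i: "i \<in> V - I"
      then have "i \<in> V" by blast
      from continuous_map_comp[OF continuous_map_product_projection[OF this, of Mo] u[OF i]] i
      show "continuous_map (product_topology Mo V) (space_of (B i)) (\<lambda>x. (\<lambda>i\<in>V - I. ?u i (x i)) i)" by simp
    qed auto
    from continuous_map_from_subtopology[OF continuous_map_kification_functor[OF this], of "cell I \<sigma> \<rho>"]
    show ?thesis
    proof (rule continuous_map_eq)
      fix x assume "x \<in> topspace ?T"
      then have x: "x \<in> cell I \<sigma> \<rho>" using cT by blast
      show "(\<lambda>i\<in>V - I. ?u i (x i)) = coords (V - I) x"
        unfolding coords_def
      proof (rule restrict_ext)
        fix i assume "i \<in> V - I"
        then have "i \<in> V" by blast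
        then obtain y t where "x i = Some (tag I \<sigma> i, y, t)" using cell_D[OF x] by blast
        then show "?u i (x i) = fst (snd (the (x i)))" by simp
      qed
    qed
  qed
  have heights_cone: "heights (I - \<sigma>) x \<in> topspace (cubical_cone (lk I \<sigma>))" if x: "x \<in> cell I \<sigma> \<rho>" for x
  proof -
    have *: "0 \<le> heights (I - \<sigma>) x i \<and> heights (I - \<sigma>) x i \<le> 1 \<and> (heights (I - \<sigma>) x i \<noteq> 0 \<longrightarrow> i \<in> \<rho>)" for i
    proof (cases "i \<in> I - \<sigma>")
      case True
      then have "i \<in> V" using I by blast
      then obtain y t where "x i = Some (tag I \<sigma> i, y, t)" "(tag I \<sigma> i, y, t) \<in> topspace (S i)" "i \<notin> \<rho> \<longrightarrow> t = 0"
        using cell_D[OF x] by blast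
      moreover have tag2: "tag I \<sigma> i = 2" using True by (simp add: tag_def)
      ultimately show ?thesis using True unfolding tag2 in_S by (auto simp: heights_def)
    qed (auto simp: heights_def)
    then have "{i. heights (I - \<sigma>) x i \<noteq> 0} \<subseteq> \<rho>" by blast
    then have "{i. heights (I - \<sigma>) x i \<noteq> 0} \<in> lk I \<sigma>" by (rule down[OF \<rho>])
    then show ?thesis using * by (simp add: topspace_cubical_cone)
  qed
  have ch: "continuous_map ?T (cubical_cone (lk I \<sigma>)) (heights (I - \<sigma>))"
    unfolding cubical_cone_def continuous_map_in_subtopology continuous_map_componentwise_UNIV
  proof (intro conjI allI)
    fix i
    show "continuous_map ?T euclideanreal (\<lambda>x. heights (I - \<sigma>) x i)"
    proof (cases "i \<in> I - \<sigma>")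
      case True
      then have iV: "i \<in> V" using I by blast
      have "continuous_map (Mo i) euclideanreal (case_option 0 (\<lambda>p. snd (snd p)))"
        by (rule continuous_map_case_collapse[OF S_coordinates(2)]) auto
      from continuous_map_comp[OF pr[OF iV] this] show ?thesis
      proof (rule continuous_map_eq)
        fix x assume "x \<in> topspace ?T"
        then have x: "x \<in> cell I \<sigma> \<rho>" using cT by blast
        obtain y t where "x i = Some (tag I \<sigma> i, y, t)" using cell_D[OF x iV] by blast
        then show "case_option 0 (\<lambda>p. snd (snd p)) (x i) = heights (I - \<sigma>) x i" using True by (simp add: heights_def)
      qed
    qed (auto simp: heights_def)
  next
    show "heights (I - \<sigma>) \<in> topspace ?T \<rightarrow> {t. (\<forall>v. 0 \<le> t v \<and> t v \<le> 1) \<and> {v. t v \<noteq> 0} \<in> lk I \<sigma>}"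
      using heights_cone cT unfolding topspace_cubical_cone by blast
  qed
  have c1: "continuous_map ?T (space_of (D I \<sigma>)) (\<lambda>x. collapse_map (fat_wedge I (W \<sigma>)) (coords I x))"
    unfolding D_eq smash_eq by (rule continuous_map_comp[OF cw continuous_map_collapse_map])
  have c2: "continuous_map ?T (space_of (Jn I \<sigma>)) (\<lambda>x. cone_to_join V (heights (I - \<sigma>) x, collapse_map (fat_wedge I (W \<sigma>)) (coords I x)))"
    unfolding join_eq by (rule continuous_map_comp[OF continuous_map_pairedI[OF ch c1] continuous_map_cone_to_join])
  have c3: "continuous_map ?T (space_of (Wd I)) (\<lambda>x. collapse_map (wedge_base (Kf I) (Jn I)) (\<sigma>, cone_to_join V (heights (I - \<sigma>) x, collapse_map (fat_wedge I (W \<sigma>)) (coords I x))))"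
    unfolding wedge_eq
    by (rule continuous_map_comp[OF continuous_map_comp[OF c2 continuous_map_sum_inject[OF \<sigma>, of "\<lambda>\<sigma>. space_of (Jn I \<sigma>)"]] continuous_map_collapse_map])
  have c4: "continuous_map ?T (space_of (Bh I)) (\<lambda>x. collapse_map (fat_wedge (V - I) B) (coords (V - I) x))"
    unfolding Bh_eq[OF I] smash_eq by (rule continuous_map_comp[OF cb continuous_map_collapse_map])
  have kT: "k_space ?T" by (rule k_space_closed_subtopology[OF k_space_kification closedin_cell])
  have c5: "continuous_map ?T (kification (prod_topology (space_of (Wd I)) (space_of (Bh I))))
     (\<lambda>x. (collapse_map (wedge_base (Kf I) (Jn I)) (\<sigma>, cone_to_join V (heights (I - \<sigma>) x, collapse_map (fat_wedge I (W \<sigma>)) (coords I x))),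
        collapse_map (fat_wedge (V - I) B) (coords (V - I) x)))"
    using kT continuous_map_pairedI[OF c3 c4] by (simp add: continuous_map_into_kification)
  from continuous_map_comp[OF c5 continuous_map_collapse_map[of _ "smash_base (Wd I) (Bh I)"]]
  have c6: "continuous_map ?T (space_of (Sm I)) (\<lambda>x. collapse_map (smash_base (Wd I) (Bh I)) (collapse_map (wedge_base (Kf I) (Jn I)) (\<sigma>, cone_to_join V (heights (I - \<sigma>) x, collapse_map (fat_wedge I (W \<sigma>)) (coords I x))),
        collapse_map (fat_wedge (V - I) B) (coords (V - I) x)))"
    by (simp only: smash2_eq)
  have "I \<in> Pow V" using I by simp
  from continuous_map_comp[OF continuous_map_comp[OF c6 continuous_map_sum_inject[OF this, of "\<lambda>I. space_of (Sm I)"]] continuous_map_collapse_map[of _ "wedge_base (Pow V) Sm"]]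
  show "continuous_map ?T (space_of joins_wedge) (from_model_tuple I \<sigma>)"
    unfolding wedge_eq[of "Pow V"] from_model_tuple_def[abs_def] .
  show "to_model (from_model_tuple I \<sigma> x) = collapse_map (fat_wedge V M) (proj x)" if x: "x \<in> cell I \<sigma> \<rho>" for x
  proof -
    have "model_tuple I \<sigma> (coords I x) (coords (V - I) x) (heights (I - \<sigma>) x) = proj x"
      unfolding model_tuple_def proj_def
    proof (rule restrict_ext)
      fix i assume i: "i \<in> V"
      obtain y t where yt: "x i = Some (tag I \<sigma> i, y, t)" "(tag I \<sigma> i, y, t) \<in> topspace (S i)"
        using cell_D[OF x i] by blast
      then show "collapse_map (cone_base (B i) (C i)) (if i \<notin> I then (0, coords (V - I) x i, 0) else if i \<in> \<sigma> then (1, coords I x i, 0)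
            else (2, coords I x i, heights (I - \<sigma>) x i)) = collapse_lift (cone_base (B i) (C i)) id (x i)"
        using i unfolding in_S by (auto simp: coords_def heights_def tag_def)
    qed
    then show ?thesis using to_model_from_model_tuple[OF I \<sigma> heights_cone[OF x]] by simp
  qed
qed

text \<open>\<open>I\<close>, \<open>\<sigma>\<close> and \<open>\<rho>\<close> are the sets of indices with tag \<open>1\<close> or \<open>2\<close>, with tag \<open>1\<close>, and with positive
  height. Membership in the block of a simplex \<open>\<kappa>\<close> forces \<open>\<sigma> \<union> \<rho> \<subseteq> \<kappa>\<close>.\<close>

lemma cell_exists:
  assumes x: "x \<in> topspace PMo" and y: "collapse_map (fat_wedge V M) (proj x) = Some y" "Some y \<in> Zset V K M MA"
  obtains I \<sigma> \<rho> where "I \<subseteq> V" "\<sigma> \<in> Kf I" "\<rho> \<in> lk I \<sigma>" "x \<in> cell I \<sigma> \<rho>"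
proof -
  have yp: "y = proj x" "proj x \<notin> fat_wedge V M" using y(1) by (auto simp: collapse_map_def split: if_splits)
  have nb: "collapse_lift (cone_base (B i) (C i)) id (x i) \<noteq> None" if "i \<in> V" for i
    using yp(2) that by (auto simp: fat_wedge_def proj_def)
  have xi: "\<exists>p. x i = Some p \<and> p \<in> topspace (S i) \<and> y i = Some p" if i: "i \<in> V" for i
  proof -
    obtain p where p: "x i = Some p" using nb[OF i] by (cases "x i") auto
    have "x i \<in> topspace (Mo i)" using x i by (auto simp: PiE_iff)
    then have "p \<in> topspace (S i)" unfolding p Some_in_collapse by blast
    moreover have "y i = Some p" using nb[OF i] p i yp(1) by (auto simp: proj_def collapse_map_def split: if_splits)
    ultimately show ?thesis using p by blast
  qed
  then obtain p where p: "\<And>i. i \<in> V \<Longrightarrow> x i = Some (p i)" "\<And>i. i \<in> V \<Longrightarrow> p i \<in> topspace (S i)" "\<And>i. i \<in> V \<Longrightarrow> y i = Some (p i)"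
    by metis
  obtain \<kappa> where \<kappa>: "\<kappa> \<in> K" "\<And>i. i \<in> V - \<kappa> \<Longrightarrow> y i \<in> MA i"
    using y(2) unfolding Some_in_Zset by blast
  have out: "fst (p i) \<noteq> 1 \<and> snd (snd (p i)) = 0" if "i \<in> V - \<kappa>" for i
  proof -
    obtain n z t where nz: "p i = (n, z, t)" by (cases "p i")
    then show ?thesis using \<kappa>(2)[OF that] p(3)[of i] that by (simp add: cone_wedge_sub_def)
  qed
  define I where "I = {i \<in> V. fst (p i) \<noteq> 0}"
  define \<sigma> where "\<sigma> = {i \<in> V. fst (p i) = 1}"
  define \<rho> where "\<rho> = {i \<in> V. fst (p i) = 2 \<and> snd (snd (p i)) \<noteq> 0}"
  have form: "fst (p i) = 0 \<and> snd (snd (p i)) = 0 \<or> fst (p i) = 1 \<and> snd (snd (p i)) = 0 \<or> fst (p i) = 2" if "i \<in> V" for i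
  proof -
    obtain n z t where nz: "p i = (n, z, t)" by (cases "p i")
    then show ?thesis using p(2)[OF that] unfolding nz in_S by auto
  qed
  have sub: "\<sigma> \<union> \<rho> \<subseteq> \<kappa>" using out by (auto simp: \<sigma>_def \<rho>_def)
  have "I \<subseteq> V" by (auto simp: I_def)
  moreover have "\<sigma> \<subseteq> I" "\<rho> \<subseteq> I" "\<rho> \<inter> \<sigma> = {}" by (auto simp: I_def \<sigma>_def \<rho>_def)
  moreover have "\<sigma> \<in> K" "\<rho> \<in> K" "\<rho> \<union> \<sigma> \<in> K"
    using Kdown[OF \<kappa>(1)] sub by auto
  ultimately have Is: "I \<subseteq> V" "\<sigma> \<in> Kf I" "\<rho> \<in> lk I \<sigma>" by (simp_all add: Kf_iff lk_iff)
  have "x i \<in> Some ` {p \<in> topspace (S i). fst p = tag I \<sigma> i \<and> (i \<notin> \<rho> \<longrightarrow> snd (snd p) = 0)}" if i: "i \<in> V" for i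
  proof (rule image_eqI)
    show "x i = Some (p i)" by (rule p(1)[OF i])
    show "p i \<in> {p \<in> topspace (S i). fst p = tag I \<sigma> i \<and> (i \<notin> \<rho> \<longrightarrow> snd (snd p) = 0)}"
      using p(2)[OF i] form[OF i] i by (auto simp: tag_def I_def \<sigma>_def \<rho>_def)
  qed
  then have "x \<in> cell I \<sigma> \<rho>" using x by (simp add: cell_def)
  then show thesis using that Is by blast
qed

text \<open>Let \<open>Z\<close> have a closed preimage in the wedge of joins. The preimage of \<open>Z\<close> in the product of the
  sums \<open>S i\<close> is the union of its intersections with the finitely many cells, each of which is the preimage
  of a closed set under a continuous map, and, if the base point belongs to \<open>Z\<close>, of the preimage of
  the fat wedge. As the product of the
  \<open>S i\<close> with disjoint base points maps to the product of the models by a quotient map, \<open>Z\<close> is closed.\<close>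

lemma quotient_map_to_model: "quotient_map (space_of joins_wedge) (space_of (Zhat V K M MA)) to_model"
proof -
  have pts: "topspace (space_of (Zhat V K M MA)) = Zset V K M MA" by (rule points_Zhat)
  have bz: "None \<in> Zset V K M MA" by (rule None_in_Zset[OF Knonempty])
  have PMo_proj: "proj x \<in> topspace PM" if "x \<in> topspace PMo" for x
    using continuous_map_image_subset_topspace[OF quotient_imp_continuous_map[OF quotient_map_proj]] that by blast
  have cont: "continuous_map (space_of joins_wedge) (space_of (Zhat V K M MA)) to_model"
    unfolding space_Zhat continuous_map_in_subtopology using continuous_map_to_model to_model_in_Zset by auto
  have surj: "to_model ` points joins_wedge = Zset V K M MA"
  proof (intro equalityI subsetI)
    fix y assume "y \<in> to_model ` points joins_wedge" then show "y \<in> Zset V K M MA" using to_model_in_Zset by blast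
  next
    fix y' assume y': "y' \<in> Zset V K M MA"
    show "y' \<in> to_model ` points joins_wedge"
    proof (cases y')
      case None
      then show ?thesis by (intro image_eqI[of _ _ None]) simp_all
    next
      case (Some y)
      have "Some y \<in> points (smash V M)" using y' Some Zset_subset by blast
      then have y: "y \<in> topspace PM" "y \<notin> fat_wedge V M" unfolding smash_eq Some_in_collapse by blast+
      obtain x where x: "x \<in> topspace PMo" "y = proj x"
        using y(1) quotient_map_proj unfolding quotient_map_def by blast
      then have cx: "collapse_map (fat_wedge V M) (proj x) = Some y" using y(2) by (simp add: collapse_map_def)
      obtain I \<sigma> \<rho> where c: "I \<subseteq> V" "\<sigma> \<in> Kf I" "\<rho> \<in> lk I \<sigma>" "x \<in> cell I \<sigma> \<rho>"
        using cell_exists[OF x(1) cx] y' Some by blast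
      have "x \<in> topspace (subtopology PMo (cell I \<sigma> \<rho>))" using x(1) c(4) by simp
      then have "from_model_tuple I \<sigma> x \<in> points joins_wedge"
        using continuous_map_image_subset_topspace[OF continuous_map_from_model_tuple(1)[OF c(1,2,3)]] by blast
      moreover have "to_model (from_model_tuple I \<sigma> x) = y'"
        using continuous_map_from_model_tuple(2)[OF c] cx Some by simp
      ultimately show ?thesis by blast
    qed
  qed
  have closed: "closedin (space_of (Zhat V K M MA)) Z"
    if Z: "Z \<subseteq> Zset V K M MA" and cl: "closedin (space_of joins_wedge) {z \<in> points joins_wedge. to_model z \<in> Z}" for Z
  proof -
    let ?r = "\<lambda>x. collapse_map (fat_wedge V M) (proj x)"
    let ?G = "{z \<in> points joins_wedge. to_model z \<in> Z}"
    let ?N = "if None \<in> Z then (\<Union>i\<in>V. {x \<in> topspace PMo. collapse_lift (cone_base (B i) (C i)) id (x i) \<in> {None}}) else {}"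
    let ?idx = "{(I, \<sigma>, \<rho>). I \<subseteq> V \<and> \<sigma> \<in> Kf I \<and> \<rho> \<in> lk I \<sigma>}"
    let ?P = "\<lambda>(I, \<sigma>, \<rho>). {x \<in> topspace (subtopology PMo (cell I \<sigma> \<rho>)). from_model_tuple I \<sigma> x \<in> ?G}"
    have "finite (Pow V \<times> Pow V \<times> Pow V)" using fin by simp
    then have fidx: "finite ?idx"
      by (rule rev_finite_subset) (use Ksub in \<open>auto simp: Kf_iff lk_iff\<close>)
    have eq: "{x \<in> topspace PMo. ?r x \<in> Z} = ?N \<union> (\<Union>a\<in>?idx. ?P a)"
    proof (intro equalityI subsetI)
      fix x assume "x \<in> {x \<in> topspace PMo. ?r x \<in> Z}"
      then have x: "x \<in> topspace PMo" "?r x \<in> Z" by auto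
      show "x \<in> ?N \<union> (\<Union>a\<in>?idx. ?P a)"
      proof (cases "?r x")
        case None
        then obtain i where "i \<in> V" "collapse_lift (cone_base (B i) (C i)) id (x i) = None"
          by (auto simp: collapse_map_def fat_wedge_def proj_def split: if_splits)
        then show ?thesis using x None by auto
      next
        case (Some y)
        have "Some y \<in> Zset V K M MA" using Some x(2) Z by auto
        then obtain I \<sigma> \<rho> where c: "I \<subseteq> V" "\<sigma> \<in> Kf I" "\<rho> \<in> lk I \<sigma>" "x \<in> cell I \<sigma> \<rho>"
          using cell_exists[OF x(1) Some] by blast
        have xT: "x \<in> topspace (subtopology PMo (cell I \<sigma> \<rho>))" using x(1) c(4) by simp
        then have "from_model_tuple I \<sigma> x \<in> points joins_wedge"
          using continuous_map_image_subset_topspace[OF continuous_map_from_model_tuple(1)[OF c(1,2,3)]] by blast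
        then have "from_model_tuple I \<sigma> x \<in> ?G"
          using continuous_map_from_model_tuple(2)[OF c] x(2) by simp
        then have "x \<in> ?P (I, \<sigma>, \<rho>)" using xT by simp
        moreover have "(I, \<sigma>, \<rho>) \<in> ?idx" using c by simp
        ultimately show ?thesis by blast
      qed
    next
      fix x assume "x \<in> ?N \<union> (\<Union>a\<in>?idx. ?P a)"
      then consider i where "None \<in> Z" "i \<in> V" "x \<in> topspace PMo" "collapse_lift (cone_base (B i) (C i)) id (x i) = None"
        | I \<sigma> \<rho> where "I \<subseteq> V" "\<sigma> \<in> Kf I" "\<rho> \<in> lk I \<sigma>" "x \<in> ?P (I, \<sigma>, \<rho>)"
        by (auto split: if_splits)
      then show "x \<in> {x \<in> topspace PMo. ?r x \<in> Z}"
      proof cases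
        case (1 i)
        then have "proj x \<in> fat_wedge V M" by (auto simp: fat_wedge_def proj_def intro!: bexI[of _ i])
        then show ?thesis using 1 by (simp add: collapse_map_def)
      next
        case (2 I \<sigma> \<rho>)
        then have "x \<in> cell I \<sigma> \<rho>" "x \<in> topspace PMo" "to_model (from_model_tuple I \<sigma> x) \<in> Z" by auto
        then show ?thesis using continuous_map_from_model_tuple(2)[OF 2(1-3)] by simp
      qed
    qed
    have cN: "closedin PMo ?N"
    proof (cases "None \<in> Z")
      case True
      have "closedin PMo {x \<in> topspace PMo. collapse_lift (cone_base (B i) (C i)) id (x i) \<in> {None}}" if i: "i \<in> V" for i
      proof (rule closedin_continuous_map_preimage)
        have "continuous_map (Mo i) (space_of (M i)) (collapse_lift (cone_base (B i) (C i)) id)"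
          unfolding cone_wedge_def by (rule quotient_imp_continuous_map[OF quotient_map_collapse_from_disjoint_base])
        from continuous_map_comp[OF continuous_map_from_kification[OF continuous_map_product_projection[OF i, of Mo]] this]
        show "continuous_map PMo (space_of (M i)) (\<lambda>x. collapse_lift (cone_base (B i) (C i)) id (x i))" .
        show "closedin (space_of (M i)) {None}"
          using S_facts(4)[OF i] by (intro closedin_Hausdorff_singleton) (simp_all add: cone_wedge_def)
      qed
      then show ?thesis using True fin by (simp only: if_True) (intro closedin_Union, auto)
    qed simp
    have cP: "closedin PMo (?P a)" if "a \<in> ?idx" for a
    proof -
      obtain I \<sigma> \<rho> where a: "a = (I, \<sigma>, \<rho>)" by (cases a)
      then have c: "I \<subseteq> V" "\<sigma> \<in> Kf I" "\<rho> \<in> lk I \<sigma>" using that by auto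
      have "closedin (subtopology PMo (cell I \<sigma> \<rho>)) {x \<in> topspace (subtopology PMo (cell I \<sigma> \<rho>)). from_model_tuple I \<sigma> x \<in> ?G}"
        by (rule closedin_continuous_map_preimage[OF continuous_map_from_model_tuple(1)[OF c] cl])
      then have "closedin PMo {x \<in> topspace (subtopology PMo (cell I \<sigma> \<rho>)). from_model_tuple I \<sigma> x \<in> ?G}"
        by (rule closedin_trans_full[OF _ closedin_cell])
      then show ?thesis unfolding a by simp
    qed
    have "closedin PMo {x \<in> topspace PMo. ?r x \<in> Z}"
      unfolding eq
    proof (intro closedin_Un cN closedin_Union)
      show "finite (?P ` ?idx)" using fidx by simp
      show "closedin PMo T" if "T \<in> ?P ` ?idx" for T using that cP by blast
    qed
    moreover have "{x \<in> topspace PMo. ?r x \<in> Z} = {x \<in> topspace PMo. proj x \<in> {y \<in> topspace PM. collapse_map (fat_wedge V M) y \<in> Z}}"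
      using PMo_proj by blast
    ultimately have cl': "closedin PMo {x \<in> topspace PMo. proj x \<in> {y \<in> topspace PM. collapse_map (fat_wedge V M) y \<in> Z}}"
      by (simp only:)
    have "\<forall>U\<subseteq>topspace PM. closedin PMo {x \<in> topspace PMo. proj x \<in> U} = closedin PM U"
      using quotient_map_proj unfolding quotient_map_closedin by (rule conjunct2)
    from this[rule_format, of "{y \<in> topspace PM. collapse_map (fat_wedge V M) y \<in> Z}", OF Collect_restrict] cl'
    have "closedin PM {y \<in> topspace PM. collapse_map (fat_wedge V M) y \<in> Z}"
      by (rule iffD1)
    with subset_trans[OF Z Zset_subset] have "closedin (space_of (smash V M)) Z"
      unfolding smash_eq closedin_collapse by (rule conjI)
    then show ?thesis
      unfolding space_Zhat using Z by (rule closedin_subset_topspace)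
  qed
  show ?thesis
    unfolding quotient_map_closedin pts
  proof (intro conjI allI impI iffI surj)
    fix Z assume "Z \<subseteq> Zset V K M MA"
    show "closedin (space_of (Zhat V K M MA)) Z" if "closedin (space_of joins_wedge) {z \<in> points joins_wedge. to_model z \<in> Z}"
      by (rule closed[OF \<open>Z \<subseteq> _\<close> that])
    show "closedin (space_of joins_wedge) {z \<in> points joins_wedge. to_model z \<in> Z}" if "closedin (space_of (Zhat V K M MA)) Z"
      by (rule closedin_continuous_map_preimage[OF cont that])
  qed
qed

lemma model_homotopy_equivalence: "\<exists>f. pointed_homotopy_equivalence (Zhat V K M MA) joins_wedge f"
proof (rule collapse_fibre_homotopy_equivalence[OF quotient_map_to_model])
  show "continuous_map (prod_topology unit_interval (space_of joins_wedge)) (space_of joins_wedge) shrink"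
    by (rule continuous_map_shrink)
  show "x = y" if "x \<in> points joins_wedge" "y \<in> points joins_wedge" "to_model x = to_model y" "to_model x \<noteq> basept (Zhat V K M MA)" for x y
    using to_model_inj[OF that(1-3)] that(4) by simp
qed (simp_all add: shrink_None shrink_props)

end

section \<open>The homotopy equivalence\<close>

lemma pointed_homotopy_equivalence_trans:
  assumes f: "pointed_homotopy_equivalence X Y f" and f': "pointed_homotopy_equivalence Y Z f'"
  shows "pointed_homotopy_equivalence X Z (f' \<circ> f)"
proof -
  have comp: "pointed_map P R (b \<circ> a)" if "pointed_map P Q a" "pointed_map Q R b"
    for P :: "'p pspace" and Q :: "'q pspace" and R :: "'r pspace" and a b
    using that unfolding pointed_map_def by (auto intro: continuous_map_compose)
  have mid: "pointed_homotopic P P (g \<circ> g' \<circ> (a' \<circ> a)) id"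
    if a: "pointed_map P Q a" and g: "pointed_map Q P g" and ga: "pointed_homotopic P P (g \<circ> a) id"
      and ga': "pointed_homotopic Q Q (g' \<circ> a') id"
    for P :: "'p pspace" and Q :: "'q pspace" and a :: "'p \<Rightarrow> 'q" and g and a' :: "'q \<Rightarrow> 'r" and g'
  proof -
    have h1: "homotopic_with (\<lambda>h. h (basept P) = basept Q) (space_of P) (space_of Q) ((g' \<circ> a') \<circ> a) (id \<circ> a)"
    proof (rule homotopic_with_compose_continuous_map_right)
      show "homotopic_with (\<lambda>h. h (basept Q) = basept Q) (space_of Q) (space_of Q) (g' \<circ> a') id"
        using ga' unfolding pointed_homotopic_def .
      show "continuous_map (space_of P) (space_of Q) a" using a by (simp add: pointed_map_def)
      show "(j \<circ> a) (basept P) = basept Q" if "j (basept Q) = basept Q" for j using a that by (simp add: pointed_map_def)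
    qed
    have "homotopic_with (\<lambda>h. h (basept P) = basept P) (space_of P) (space_of P) (g \<circ> ((g' \<circ> a') \<circ> a)) (g \<circ> (id \<circ> a))"
    proof (rule homotopic_with_compose_continuous_map_left[OF h1])
      show "continuous_map (space_of Q) (space_of P) g" using g by (simp add: pointed_map_def)
      show "(g \<circ> j) (basept P) = basept P" if "j (basept P) = basept Q" for j using g that by (simp add: pointed_map_def)
    qed
    then have "homotopic_with (\<lambda>h. h (basept P) = basept P) (space_of P) (space_of P) (g \<circ> g' \<circ> (a' \<circ> a)) (g \<circ> a)"
      by (simp only: o_assoc id_comp comp_id)
    then show ?thesis
      using ga unfolding pointed_homotopic_def by (rule homotopic_with_trans)
  qed
  obtain g where g: "pointed_map X Y f" "pointed_map Y X g" "pointed_homotopic X X (g \<circ> f) id" "pointed_homotopic Y Y (f \<circ> g) id"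
    using f unfolding pointed_homotopy_equivalence_def by blast
  obtain g' where g': "pointed_map Y Z f'" "pointed_map Z Y g'" "pointed_homotopic Y Y (g' \<circ> f') id" "pointed_homotopic Z Z (f' \<circ> g') id"
    using f' unfolding pointed_homotopy_equivalence_def by blast
  show ?thesis
    unfolding pointed_homotopy_equivalence_def
    by (intro conjI exI[of _ "g \<circ> g'"] comp[OF g(1) g'(1)] comp[OF g'(2) g(2)] mid[OF g(1,2,3) g'(3)] mid[OF g'(2,1,4) g(4)])
qed

lemma pointed_cw_complex_facts:
  assumes "pointed_cw_complex X"
  shows "Hausdorff_space (space_of X)" and "k_space (space_of X)" and "basept X \<in> points X"
proof -
  obtain \<Phi> where "cw_structure (space_of X) \<Phi>" "basept X \<in> points X"
    using assms unfolding pointed_cw_complex_def pointed_cw_pair_def by blast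
  then show "Hausdorff_space (space_of X)" "k_space (space_of X)" "basept X \<in> points X"
    by (auto intro: cw_structureD(1) k_space_cw)
qed

theorem corollary2p5:
  fixes m :: nat
    and K :: "nat set set"
    and B C :: "nat \<Rightarrow> 'a pspace"
    and E :: "nat \<Rightarrow> 'a set"
    and U :: "nat \<Rightarrow> (bool \<times> 'a) option pspace"
    and V :: "nat \<Rightarrow> (bool \<times> 'a) option set"
  assumes K: "simplicial_complex_on {1..m} K"
    and B: "\<And>i. i \<in> {1..m} \<Longrightarrow> pointed_cw_complex (B i)"
    and CE: "\<And>i. i \<in> {1..m} \<Longrightarrow> pointed_cw_pair (C i) (E i)"
    and null: "\<And>i. i \<in> {1..m} \<Longrightarrow> null_homotopic_inclusion (C i) (E i)"
    and U: "\<And>i. i \<in> {1..m} \<Longrightarrow> U i = wedge2 (B i) (C i)"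
    and V: "\<And>i. i \<in> {1..m} \<Longrightarrow> V i = points (wedge2 (B i) (subpspace (C i) (E i)))"
  shows "\<exists>f. pointed_homotopy_equivalence
     (Zhat {1..m} K U V)
     (wedge (Pow {1..m}) (\<lambda>I.
        smash2
          (wedge (full_subcomplex K I) (\<lambda>\<sigma>.
             join (geometric_realization (link \<sigma> (full_subcomplex K I))) (Dhat I C E \<sigma>)))
          (Zhat ({1..m} - I) (full_subcomplex K ({1..m} - I)) B (\<lambda>i. points (B i)))))
     f"
proof -
  obtain R where "\<forall>i\<in>{1..m}. \<exists>h k d. null_pair_data (C i) (E i) (R i) h k d"
    using bchoice[of "{1..m}" "\<lambda>i R. \<exists>h k d. null_pair_data (C i) (E i) R h k d"] pointed_cw_pair_null_pair_data[OF CE null] by blast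
  then obtain h where "\<forall>i\<in>{1..m}. \<exists>k d. null_pair_data (C i) (E i) (R i) (h i) k d"
    using bchoice[of "{1..m}" "\<lambda>i h. \<exists>k d. null_pair_data (C i) (E i) (R i) h k d"] by blast
  then obtain k where "\<forall>i\<in>{1..m}. \<exists>d. null_pair_data (C i) (E i) (R i) (h i) (k i) d"
    using bchoice[of "{1..m}" "\<lambda>i k. \<exists>d. null_pair_data (C i) (E i) (R i) (h i) k d"] by blast
  then obtain d where deformation: "\<forall>i\<in>{1..m}. null_pair_data (C i) (E i) (R i) (h i) (k i) (d i)"
    using bchoice[of "{1..m}" "\<lambda>i d. null_pair_data (C i) (E i) (R i) (h i) (k i) d"] by blast
  interpret wedge_decomposition "{1..m}" K B C E R h k d
    by (rule wedge_decomposition.intro) (fact finite_atLeastAtMost K bspec[OF deformation] pointed_cw_complex_facts[OF B])+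
  have "pair_homotopy_equivalent (U i) (V i) (M i) (MA i)" if i: "i \<in> {1..m}" for i
  proof -
    interpret cone_model "B i" "C i" "E i" "R i" "h i" "k i" "d i"
      by (rule cone_model.intro) (fact bspec[OF deformation i] bB[OF i])+
    show ?thesis unfolding U[OF i] V[OF i] by (rule pair_homotopy_equivalent_cone_wedge)
  qed
  from Zhat_homotopy_equivalence[OF this Knonempty]
  obtain f where f: "pointed_homotopy_equivalence (Zhat {1..m} K U V) (Zhat {1..m} K M MA) f" ..
  from model_homotopy_equivalence
  obtain f' where f': "pointed_homotopy_equivalence (Zhat {1..m} K M MA) joins_wedge f'" ..
  show ?thesis by (rule exI, rule pointed_homotopy_equivalence_trans[OF f f'])
qed

end
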